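(* Let $d\in\mathbb{N}$ and $1\le p<q<\infty$. Then there is a constant $C>0$ (independent of $m$) such that for all $m\in\mathbb{N}$ with $m\ge2$: (i) $\varrho_m\big(S^{1/p}_{p,1}B([0,1]^d),L_q([0,1]^d)\big)\le C\,m^{-1/q}\,(\log^{d-1}m)^{2/q}$, and (ii) $\varrho_m\big(S^{1}_{1,\infty}F([0,1]^d),L_q([0,1]^d)\big)\le C\,m^{-1/q}\,(\log^{d-1}m)^{2/q}$.
   Context: Notation: $\mathbb{N}=\{1,2,\dots\}$, $\mathbb{N}_0=\mathbb{N}\cup\{0\}$, $a_+=\max\{a,0\}$, $|x|_1=\sum_i|x_i|$; $\log^{d-1}m=(\log m)^{d-1}$. Function spaces. Let $\mathcal{F}$ be the Fourier transform on $\mathbb{R}^d$, $\mathcal{F}f(\xi)=(2\pi)^{-d/2}\int_{\mathbb{R}^d}f(x)e^{-i\xi\cdot x}dx$. Fix a system $\varphi=\{\varphi_n\}_{n=0}^\infty\subset C_0^\infty(\mathbb{R})$ with (i) $\operatorname{supp}\varphi_0\subset\{|x|\le 2\}$; (ii) $\operatorname{supp}\varphi_n\subset\{2^{n-1}\le|x|\le 2^{n+1}\}$ for $n\ge1$; (iii) for every $\ell\in\mathbb{N}_0$, $\sup_{x,n}2^{n\ell}|D^\ell\varphi_n(x)|<\infty$; (iv) $\sum_{n=0}^\infty\varphi_n(x)=1$ for all $x\in\mathbb{R}$. For $f\in L_1(\mathbb{R}^d)$ and $\ell\in\mathbb{N}_0^d$ put $f_\ell=\mathcal{F}^{-1}[\varphi_{\ell_1}(\xi_1)\cdots\varphi_{\ell_d}(\xi_d)\mathcal{F}f(\xi)]$.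 For $0<p,q\le\infty$ and $r>(1/p-1)_+$, $S^r_{p,q}B(\mathbb{R}^d)$ is the set of all $f\in L_1(\mathbb{R}^d)$ with $\|f|S^r_{p,q}B(\mathbb{R}^d)\|=\big(\sum_{j\in\mathbb{N}_0^d}2^{|j|_1rq}\|f_j\|_p^q\big)^{1/q}<\infty$ (usual modification for $q=\infty$). For $0<p<\infty$, $S^r_{p,q}F(\mathbb{R}^d)$ is the set of all $f\in L_1(\mathbb{R}^d)$ with $\|f|S^r_{p,q}F(\mathbb{R}^d)\|=\big\|\big(\sum_{j\in\mathbb{N}_0^d}2^{|j|_1rq}|f_j(x)|^q\big)^{1/q}\big\|_p<\infty$ (with $\sup_j2^{|j|_1r}|f_j(x)|$ inside the $L_p$-norm if $q=\infty$). For $A\in\{B,F\}$, $S^r_{p,q}A([0,1]^d)$ consists of all $f\in L_1([0,1]^d)$ that are restrictions to $[0,1]^d$ of some $g\in S^r_{p,q}A(\mathbb{R}^d)$, with $\|f|S^r_{p,q}A([0,1]^d)\|$ the infimum of $\|g|S^r_{p,q}A(\mathbb{R}^d)\|$ over all such $g$. Elements of $S^{1/p}_{p,1}B([0,1]^d)$ and $S^1_{1,\infty}F([0,1]^d)$ are identified with their continuous representatives. Sampling widths. For a space $Y$ of continuous functions on $[0,1]^d$ with norm $\|\cdot|Y\|$, $$\varrho_m(Y,L_q([0,1]^d))=\inf_{\substack{X_m\subset[0,1]^d,\ |X_m|=m\\ \psi:\mathbb{C}^m\to L_q([0,1]^d)}}\ \sup_{\|f|Y\|\le1}\|f-\psi(f(X_m))\|_{L_q([0,1]^d)},$$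 where $f(X_m)\in\mathbb{C}^m$ is the vector of values of $f$ at the points of $X_m$ and $\psi$ ranges over arbitrary (not necessarily linear) maps. *)

theory Defs
  imports "HOL-Analysis.Analysis" "HOL-Probability.Essential_Supremum"
begin

text \<open>
  Functions on \<open>\<real>\<^sup>d\<close> are complex-valued functions on \<^typ>\<open>real^'d\<close>, with \<open>d = CARD('d)\<close>.
  Elements of \<open>L\<^sub>p\<close> are represented by Borel functions, not by equivalence classes; all norms
  below only depend on the class.  Norms take values in \<^typ>\<open>ennreal\<close>, the value \<open>\<infinity>\<close> meaning
  that the norm is not finite.
\<close>

section \<open>\<open>L\<^sub>p\<close> and \<open>\<ell>\<^sub>q\<close> (quasi-)norms\<close>

text \<open>The power \<open>x\<^sup>a\<close> on \<open>[0, \<infinity>]\<close>; only used for \<open>a > 0\<close>.\<close>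

definition enn_powr :: "ennreal \<Rightarrow> real \<Rightarrow> ennreal" where
  "enn_powr x a = (if x = \<infinity> then \<infinity> else ennreal (enn2real x powr a))"

definition Lp_enn :: "'a measure \<Rightarrow> ennreal \<Rightarrow> ('a \<Rightarrow> ennreal) \<Rightarrow> ennreal" where
  "Lp_enn M p u = (if p = \<infinity> then esssup M u
     else enn_powr (\<integral>\<^sup>+x. enn_powr (u x) (enn2real p) \<partial>M) (1 / enn2real p))"

definition Lp_norm :: "'a measure \<Rightarrow> ennreal \<Rightarrow> ('a \<Rightarrow> complex) \<Rightarrow> ennreal" where
  "Lp_norm M p f = Lp_enn M p (\<lambda>x. ennreal (norm (f x)))"

definition Lp_space :: "'a measure \<Rightarrow> ennreal \<Rightarrow> ('a \<Rightarrow> complex) set" where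
  "Lp_space M p = {f \<in> borel_measurable M. Lp_norm M p f < \<infinity>}"

definition lq_norm :: "ennreal \<Rightarrow> ('i \<Rightarrow> ennreal) \<Rightarrow> ennreal" where
  "lq_norm q a = (if q = \<infinity> then (SUP i. a i)
     else enn_powr (\<Sum>\<^sub>\<infinity>i. enn_powr (a i) (enn2real q)) (1 / enn2real q))"

section \<open>Dyadic frequency decomposition\<close>

definition fourier :: "(real^'d \<Rightarrow> complex) \<Rightarrow> real^'d \<Rightarrow> complex" where
  "fourier f \<xi> = of_real ((2 * pi) powr (- real CARD('d) / 2)) *
     (\<integral>x. f x * exp (- \<i> * of_real (\<xi> \<bullet> x)) \<partial>lborel)"

definition inverse_fourier :: "(real^'d \<Rightarrow> complex) \<Rightarrow> real^'d \<Rightarrow> complex" where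
  "inverse_fourier g x = of_real ((2 * pi) powr (- real CARD('d) / 2)) *
     (\<integral>\<xi>. g \<xi> * exp (\<i> * of_real (\<xi> \<bullet> x)) \<partial>lborel)"

definition tsupp :: "(real \<Rightarrow> complex) \<Rightarrow> real set" where
  "tsupp f = closure {x. f x \<noteq> 0}"

definition nth_vderiv :: "nat \<Rightarrow> (real \<Rightarrow> complex) \<Rightarrow> real \<Rightarrow> complex" where
  "nth_vderiv l = (\<lambda>g x. vector_derivative g (at x)) ^^ l"

definition test_function :: "(real \<Rightarrow> complex) \<Rightarrow> bool" where
  "test_function f \<longleftrightarrow>
     (\<forall>l x. nth_vderiv l f differentiable at x) \<and> compact (tsupp f)"

definition dyadic_system :: "(nat \<Rightarrow> real \<Rightarrow> complex) \<Rightarrow> bool" where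
  "dyadic_system \<phi> \<longleftrightarrow>
     (\<forall>n. test_function (\<phi> n)) \<and>
     tsupp (\<phi> 0) \<subseteq> {x. \<bar>x\<bar> \<le> 2} \<and>
     (\<forall>n\<ge>1. tsupp (\<phi> n) \<subseteq> {x. 2 ^ (n - 1) \<le> \<bar>x\<bar> \<and> \<bar>x\<bar> \<le> 2 ^ (n + 1)}) \<and>
     (\<forall>l. \<exists>B. \<forall>n x. 2 ^ (n * l) * norm (nth_vderiv l (\<phi> n) x) \<le> B) \<and>
     (\<forall>x. (\<lambda>n. \<phi> n x) sums 1)"

text \<open>
  For integrable \<open>f\<close>, the product of the multiplier with \<open>fourier f\<close> is continuous with compact
  support, so the inverse transform is given pointwise by an absolutely convergent integral.
\<close>

definition freq_block ::
    "(nat \<Rightarrow> real \<Rightarrow> complex) \<Rightarrow> nat^'d \<Rightarrow> (real^'d \<Rightarrow> complex) \<Rightarrow> real^'d \<Rightarrow> complex" where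
  "freq_block \<phi> j f = inverse_fourier (\<lambda>\<xi>. (\<Prod>i\<in>UNIV. \<phi> (j $ i) (\<xi> $ i)) * fourier f \<xi>)"

section \<open>Spaces of dominating mixed smoothness\<close>

definition dyadic_weight :: "real \<Rightarrow> nat^'d \<Rightarrow> ennreal" where
  "dyadic_weight r j = ennreal (2 powr (real (\<Sum>i\<in>UNIV. j $ i) * r))"

text \<open>
  The parameters are meant to satisfy \<open>0 < p, q \<le> \<infinity>\<close> and \<open>r > max (1/p - 1) 0\<close>, and \<open>p < \<infinity>\<close> for
  the \<open>F\<close>-scale.  The weighted \<open>\<ell>\<^sub>q\<close>-norms are written with the weight \<open>2\<^bsup>|j| r\<^esup>\<close> inside the \<open>q\<close>-th
  power.
\<close>

definition SB_norm ::
    "(nat \<Rightarrow> real \<Rightarrow> complex) \<Rightarrow> real \<Rightarrow> ennreal \<Rightarrow> ennreal \<Rightarrow> (real^'d \<Rightarrow> complex) \<Rightarrow> ennreal" where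
  "SB_norm \<phi> r p q f =
     lq_norm q (\<lambda>j. dyadic_weight r j * Lp_norm lborel p (freq_block \<phi> j f))"

definition SF_norm ::
    "(nat \<Rightarrow> real \<Rightarrow> complex) \<Rightarrow> real \<Rightarrow> ennreal \<Rightarrow> ennreal \<Rightarrow> (real^'d \<Rightarrow> complex) \<Rightarrow> ennreal" where
  "SF_norm \<phi> r p q f =
     Lp_enn lborel p
       (\<lambda>x. lq_norm q (\<lambda>j. dyadic_weight r j * ennreal (norm (freq_block \<phi> j f x))))"

definition space_of_norm :: "((real^'d \<Rightarrow> complex) \<Rightarrow> ennreal) \<Rightarrow> (real^'d \<Rightarrow> complex) set" where
  "space_of_norm N = {f. integrable lborel f \<and> N f < \<infinity>}"

definition unit_cube :: "(real^'d) set" where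
  "unit_cube = {x. \<forall>i. 0 \<le> x $ i \<and> x $ i \<le> 1}"

definition cube_measure :: "(real^'d) measure" where
  "cube_measure = restrict_space lborel unit_cube"

text \<open>
  Functions on the cube are represented by functions on \<^typ>\<open>real^'d\<close> whose values outside the
  cube are irrelevant; restriction is understood almost everywhere.
\<close>

definition extensions ::
    "((real^'d \<Rightarrow> complex) \<Rightarrow> ennreal) \<Rightarrow> (real^'d \<Rightarrow> complex) \<Rightarrow> (real^'d \<Rightarrow> complex) set" where
  "extensions N f = {g \<in> space_of_norm N. AE x in cube_measure. f x = g x}"

definition cube_norm ::
    "((real^'d \<Rightarrow> complex) \<Rightarrow> ennreal) \<Rightarrow> (real^'d \<Rightarrow> complex) \<Rightarrow> ennreal" where
  "cube_norm N f = (INF g\<in>extensions N f. N g)"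

definition cube_space :: "((real^'d \<Rightarrow> complex) \<Rightarrow> ennreal) \<Rightarrow> (real^'d \<Rightarrow> complex) set" where
  "cube_space N = {f. integrable cube_measure f \<and> extensions N f \<noteq> {}}"

text \<open>The continuous representatives of the elements of \<^term>\<open>cube_space N\<close>.\<close>

definition cont_cube_space :: "((real^'d \<Rightarrow> complex) \<Rightarrow> ennreal) \<Rightarrow> (real^'d \<Rightarrow> complex) set" where
  "cont_cube_space N = {f \<in> cube_space N. continuous_on unit_cube f}"

section \<open>Sampling widths\<close>

text \<open>
  A set of \<open>m\<close> sampling points is given as a distinct list \<open>X\<close> of length \<open>m\<close>, and \<open>\<complex>\<^sup>m\<close> as the
  complex lists of length \<open>m\<close>, so that \<open>f(X)\<close> is \<^term>\<open>map f X\<close>.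
\<close>

definition sampling_width ::
    "(real^'d \<Rightarrow> complex) set \<Rightarrow> ((real^'d \<Rightarrow> complex) \<Rightarrow> ennreal) \<Rightarrow> ennreal \<Rightarrow> nat \<Rightarrow> ennreal" where
  "sampling_width Y N q m =
     (INF (X, \<psi>) \<in> {(X :: (real^'d) list, \<psi> :: complex list \<Rightarrow> real^'d \<Rightarrow> complex).
           length X = m \<and> distinct X \<and> set X \<subseteq> unit_cube \<and>
           (\<forall>v. length v = m \<longrightarrow> \<psi> v \<in> Lp_space cube_measure q)}.
        SUP f\<in>{f \<in> Y. N f \<le> 1}. Lp_norm cube_measure q (\<lambda>x. f x - \<psi> (map f X) x))"

end

theory Submission
  imports Defs "HOL-Probability.Probability"
begin

text \<open>
  A continuous function \<open>h\<close> on the cube is the sum over \<open>k \<in> \<nat>\<^sub>0\<^sup>d\<close> of its tensor dyadic differences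
  \<open>\<Delta>\<^sub>k h\<close>, built from the values of \<open>h\<close> at the lower corners of dyadic cells; \<open>\<Delta>\<^sub>k h\<close> is constant on
  dyadic boxes of side lengths \<open>2\<^bsup>-k\<^esup>\<close>.  If \<open>h\<close> vanishes on the sparse grid of level \<open>n\<close>, only the levels
  \<open>|k|\<^sub>1 > n\<close> survive.  Hence any element of the unit ball that interpolates the samples of \<open>f\<close> on the
  sparse grid is a good approximation of \<open>f\<close>, as soon as
  \<open>\<parallel>\<Delta>\<^sub>k f\<parallel>\<^sub>u\<^sup>u \<le> K 2\<^bsup>-|k|\<^esup>\<close> for some \<open>u\<close> slightly smaller than \<open>q\<close>: by cell-constancy the levels are
  almost orthogonal and the \<open>L\<^sub>q\<close>-norm to the power \<open>q\<close> of the tail is of order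
  \<open>\<Sum>\<^bsub>|k| > n\<^esub> 2\<^bsup>-|k|\<^esup> \<approx> n\<^bsup>d-1\<^esup> 2\<^bsup>-n\<^esup>\<close>, while the grid has about \<open>n\<^bsup>d-1\<^esup> 2\<^bsup>n\<^esup>\<close> points.

  The bound on \<open>\<Delta>\<^sub>k f\<close> is obtained one coordinate at a time from the frequency blocks \<open>f\<^sub>j\<close>, each reproduced
  by a kernel with integrable decay at scale \<open>2\<^bsup>-j\<^esup>\<close>.  Schur's test and Minkowski's inequality settle
  the \<open>B\<close>-case with exponent \<open>p\<close>, and cell-constancy raises the exponent to \<open>u\<close>.  In the \<open>F\<close>-case
  a Jawerth-type argument exchanges \<open>L\<^sub>1\<close> integrability of the supremum of the weighted blocks for
  summability of their \<open>L\<^sub>u\<close>-norms.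
\<close>


section \<open>Iterated integrals\<close>

text \<open>At the critical smoothness there is no decay between frequency and mesh to spare.
  Sampling a block of frequency 2^j at mesh 2^-k costs a factor 2^(j-k) in the u-th power of its L_u
  norm, whether j is below or above k, and weights 2^(j/u), summed over j to the first power, are
  just what pays for it. Decay has to come from elsewhere: functions constant on cells of different
  shapes hardly interact. A second obstacle is that f is tied to blocks only through an integrable
  extension, almost everywhere on the cube, while samples are point values. So the estimates are
  proved for finite box sums of blocks and all their translates, uniformly in both. Averages of the
  translates over a small box converge at every point. Boxes that extend upwards from a lower corner
  of a dyadic cell stay in the cube, where f is continuous; this is why lower corners are sampled.
  The power of log m is doubled because n^(d-1) enters once through the tail and once more when 2^-n
  is expressed by the number m of points.\<close>

definition vupd :: "real^'d \<Rightarrow> 'd \<Rightarrow> real \<Rightarrow> real^'d" where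
  "vupd x s t = (\<chi> i. if i = s then t else x $ i)"

lemma vupd_nth [simp]: "vupd x s t $ i = (if i = s then t else x $ i)"
  by (simp add: vupd_def)

lemma vupd_same [simp]: "vupd (vupd x s t) s t' = vupd x s t'"
  by (simp add: vec_eq_iff)

lemma vupd_commute: "s \<noteq> r \<Longrightarrow> vupd (vupd x s t) r t' = vupd (vupd x r t') s t"
  by (simp add: vec_eq_iff)

lemma vupd_triv [simp]: "vupd x s (x $ s) = x"
  by (simp add: vec_eq_iff)

lemma vupd_alt: "vupd x s t = x + (t - x $ s) *\<^sub>R axis s 1"
  by (simp add: vec_eq_iff axis_def)

lemma measurable_nth [measurable]:
  "f \<in> borel_measurable M \<Longrightarrow> (\<lambda>w. (f w :: real^'d) $ i) \<in> borel_measurable M"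
  unfolding cart_eq_inner_axis by (intro borel_measurable_inner borel_measurable_const)

lemma measurable_vupd [measurable]:
  assumes [measurable]: "f \<in> borel_measurable M" "g \<in> borel_measurable M"
  shows "(\<lambda>w. vupd (f w) s (g w)) \<in> borel_measurable M"
  unfolding vupd_alt by measurable

text \<open>The coordinate that is integrated out remains an argument, on which the result no longer
  depends. All functions thus live on one space, and integrals in different coordinates, against
  different measures, can be applied in any order.\<close>

definition coord_int :: "real measure \<Rightarrow> 'd \<Rightarrow> (real^'d \<Rightarrow> ennreal) \<Rightarrow> real^'d \<Rightarrow> ennreal" where
  "coord_int N s F x = (\<integral>\<^sup>+t. F (vupd x s t) \<partial>N)"

definition iter_int :: "real measure \<Rightarrow> 'd list \<Rightarrow> (real^'d \<Rightarrow> ennreal) \<Rightarrow> real^'d \<Rightarrow> ennreal" where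
  "iter_int N ss F = foldr (coord_int N) ss F"

lemma iter_int_Nil [simp]: "iter_int N [] F = F"
  and iter_int_Cons [simp]: "iter_int N (s # ss) F = coord_int N s (iter_int N ss F)"
  by (simp_all add: iter_int_def)

definition sf_borel :: "real measure \<Rightarrow> bool" where
  "sf_borel N \<longleftrightarrow> sigma_finite_measure N \<and> sets N = sets borel"

lemma sf_borelD: "sf_borel N \<Longrightarrow> sigma_finite_measure N" "sf_borel N \<Longrightarrow> sets N = sets borel"
  by (auto simp: sf_borel_def)

lemma coord_int_measurable [measurable (raw)]:
  assumes N: "sf_borel N" and [measurable]: "F \<in> borel_measurable borel"
  shows "coord_int N s F \<in> borel_measurable borel"
proof -
  interpret sigma_finite_measure N using N by (rule sf_borelD)
  note [measurable_cong] = sf_borelD(2)[OF N]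
  show ?thesis unfolding coord_int_def by measurable
qed

lemma iter_int_measurable:
  assumes N: "sf_borel N" and "F \<in> borel_measurable borel"
  shows "iter_int N ss F \<in> borel_measurable borel"
  by (induction ss) (auto intro!: coord_int_measurable assms)

lemma coord_int_commute:
  assumes N: "sf_borel N" and N': "sf_borel N'" and [measurable]: "F \<in> borel_measurable borel"
    and "s \<noteq> r"
  shows "coord_int N s (coord_int N' r F) = coord_int N' r (coord_int N s F)"
proof
  fix x
  interpret A: sigma_finite_measure N using N by (rule sf_borelD)
  interpret B: sigma_finite_measure N' using N' by (rule sf_borelD)
  interpret P: pair_sigma_finite N N' ..
  note [measurable_cong] = sf_borelD(2)[OF N] sf_borelD(2)[OF N']
  have "(\<integral>\<^sup>+t. \<integral>\<^sup>+t'. F (vupd (vupd x s t) r t') \<partial>N' \<partial>N) =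
        (\<integral>\<^sup>+t'. \<integral>\<^sup>+t. F (vupd (vupd x s t) r t') \<partial>N \<partial>N')"
    by (rule P.Fubini'[symmetric]) measurable
  then show "coord_int N s (coord_int N' r F) x = coord_int N' r (coord_int N s F) x"
    unfolding coord_int_def using \<open>s \<noteq> r\<close> by (simp add: vupd_commute)
qed

text \<open>The two measures differ on purpose: in the middle of an argument some coordinates are
  integrated over the unit interval, while another one is integrated over the whole line or against
  a kernel.\<close>

lemma coord_iter_commute:
  assumes N: "sf_borel N" and N': "sf_borel N'" and F: "F \<in> borel_measurable borel"
    and "s \<notin> set ss"
  shows "coord_int N' s (iter_int N ss F) = iter_int N ss (coord_int N' s F)"
  using \<open>s \<notin> set ss\<close>
proof (induction ss)
  case (Cons r ss)
  then show ?case
    using coord_int_commute[OF N' N iter_int_measurable[OF N F], of s r] by simp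
qed simp

lemma coord_int_mono: "(\<And>y. F y \<le> G y) \<Longrightarrow> coord_int N s F x \<le> coord_int N s G x"
  unfolding coord_int_def by (intro nn_integral_mono) auto

lemma iter_int_mono: "(\<And>y. F y \<le> G y) \<Longrightarrow> iter_int N ss F x \<le> iter_int N ss G x"
  by (induction ss arbitrary: x) (auto intro!: coord_int_mono)

lemma coord_int_cmult:
  assumes N: "sf_borel N" and [measurable]: "F \<in> borel_measurable borel"
  shows "coord_int N s (\<lambda>x. c * F x) = (\<lambda>x. c * coord_int N s F x)"
proof -
  note [measurable_cong] = sf_borelD(2)[OF N]
  show ?thesis unfolding coord_int_def by (intro ext nn_integral_cmult) measurable
qed

lemma iter_int_cmult:
  assumes N: "sf_borel N" and F: "F \<in> borel_measurable borel"
  shows "iter_int N ss (\<lambda>x. c * F x) = (\<lambda>x. c * iter_int N ss F x)"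
  by (induction ss) (auto simp: coord_int_cmult[OF N iter_int_measurable[OF N F]])

lemma coord_int_add:
  assumes N: "sf_borel N" and [measurable]: "F \<in> borel_measurable borel" "G \<in> borel_measurable borel"
  shows "coord_int N s (\<lambda>x. F x + G x) = (\<lambda>x. coord_int N s F x + coord_int N s G x)"
proof -
  note [measurable_cong] = sf_borelD(2)[OF N]
  show ?thesis unfolding coord_int_def by (intro ext nn_integral_add) measurable
qed

lemma iter_int_add:
  assumes N: "sf_borel N" and F: "F \<in> borel_measurable borel" "G \<in> borel_measurable borel"
  shows "iter_int N ss (\<lambda>x. F x + G x) = (\<lambda>x. iter_int N ss F x + iter_int N ss G x)"
  by (induction ss) (auto simp: coord_int_add[OF N iter_int_measurable iter_int_measurable, OF N F(1) N F(2)])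

lemma iter_int_sum:
  assumes N: "sf_borel N" and F: "\<And>i. i \<in> I \<Longrightarrow> F i \<in> borel_measurable borel" and "finite I"
  shows "iter_int N ss (\<lambda>x. \<Sum>i\<in>I. F i x) = (\<lambda>x. \<Sum>i\<in>I. iter_int N ss (F i) x)"
  using \<open>finite I\<close> F
proof (induction I)
  case empty
  have "iter_int N ss (\<lambda>x. 0) = (\<lambda>x. 0)"
    by (induction ss) (auto simp: coord_int_def)
  then show ?case by simp
next
  case (insert i I)
  then show ?case by (simp add: iter_int_add[OF N])
qed

lemma iter_int_vupd:
  assumes "s \<notin> set ss"
  shows "iter_int N ss F (vupd x s t) = iter_int N ss (\<lambda>y. F (vupd y s t)) x"
  using assms
proof (induction ss arbitrary: x)
  case (Cons r ss)
  then show ?case by (simp add: coord_int_def vupd_commute[of s r])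
qed simp

lemma iter_int_mult_indep:
  assumes N: "sf_borel N" and F: "F \<in> borel_measurable borel"
    and c: "\<And>r x t. r \<in> set ss \<Longrightarrow> c (vupd x r t) = c x"
  shows "iter_int N ss (\<lambda>x. c x * F x) = (\<lambda>x. c x * iter_int N ss F x)"
  using c
proof (induction ss)
  case (Cons r ss)
  note [measurable_cong] = sf_borelD(2)[OF N]
  have [measurable]: "iter_int N ss F \<in> borel_measurable borel" by (rule iter_int_measurable[OF N F])
  show ?case
    using Cons unfolding coord_int_def iter_int_Cons
    by (auto simp: fun_eq_iff coord_int_def intro!: nn_integral_cmult)
qed simp

section \<open>Lebesgue measure on the space and on the half-open cube through iterated
  integrals\<close>

lemma measurable_vec_lambda [measurable]:
  "vec_lambda \<in> borel_measurable (Pi\<^sub>M (UNIV::'d::finite set) (\<lambda>_. lborel :: real measure))"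
proof (subst borel_measurable_euclidean_space, intro ballI)
  fix b :: "real^'d" assume "b \<in> Basis"
  then obtain i where b: "b = axis i 1" by (auto simp: Basis_vec_def)
  show "(\<lambda>x. vec_lambda x \<bullet> b) \<in> borel_measurable (Pi\<^sub>M UNIV (\<lambda>_. lborel :: real measure))"
    unfolding b by (simp add: inner_axis)
qed

lemma prod_Basis_vec: "(\<Prod>b\<in>(Basis::(real^'d) set). g b) = (\<Prod>i\<in>UNIV. g (axis i 1))"
proof -
  have "(Basis::(real^'d) set) = (\<lambda>i. axis i 1) ` UNIV" by (auto simp: Basis_vec_def)
  moreover have "inj (\<lambda>i::'d. axis i (1::real))" by (auto simp: inj_on_def axis_eq_axis)
  ultimately show ?thesis using prod.reindex[of "\<lambda>i::'d. axis i (1::real)" UNIV g] by (simp only: o_def)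
qed

text \<open>By uniqueness of Lebesgue measure it is enough that the image measure gives every box
  the product of its side lengths.\<close>

lemma lborel_eq_PiM:
  "(lborel :: (real^'d) measure) = distr (Pi\<^sub>M UNIV (\<lambda>_. lborel)) borel vec_lambda"
proof (rule lborel_eqI)
  fix l u :: "real^'d"
  assume le: "\<And>b. b \<in> Basis \<Longrightarrow> l \<bullet> b \<le> u \<bullet> b"
  interpret product_sigma_finite "\<lambda>_::'d. lborel :: real measure" ..
  have le': "l $ i \<le> u $ i" for i using le[of "axis i 1"] by (auto simp: Basis_vec_def inner_axis)
  have "emeasure (distr (Pi\<^sub>M UNIV (\<lambda>_. lborel)) borel vec_lambda) (box l u) =
        emeasure (Pi\<^sub>M UNIV (\<lambda>_. lborel)) (Pi\<^sub>E UNIV (\<lambda>i. {l $ i<..<u $ i}))"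
    by (subst emeasure_distr) (auto simp: space_PiM box_def Basis_vec_def inner_axis intro!: arg_cong2[where f=emeasure])
  also have "\<dots> = (\<Prod>i\<in>UNIV. ennreal (u $ i - l $ i))"
    by (subst emeasure_PiM) (auto simp: le')
  finally show "emeasure (distr (Pi\<^sub>M UNIV (\<lambda>_. lborel)) borel vec_lambda) (box l u) =
     ennreal (\<Prod>b\<in>Basis. (u - l) \<bullet> b)"
    by (simp add: prod_Basis_vec inner_axis prod_ennreal le')
qed simp

text \<open>Induction on the list splits one factor off the product measure; coordinates outside the
  list stay frozen at those of \<open>x\<close>.\<close>

lemma iter_int_eq_PiM:
  assumes N: "sf_borel N" and [measurable]: "F \<in> borel_measurable borel" and "distinct ss"
  shows "iter_int N ss F x =
    (\<integral>\<^sup>+\<omega>. F (\<chi> i. if i \<in> set ss then \<omega> i else x $ i) \<partial>Pi\<^sub>M (set ss) (\<lambda>_. N))"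
  using \<open>distinct ss\<close>
proof (induction ss arbitrary: x)
  case Nil
  interpret S: sigma_finite_measure N using N by (rule sf_borelD)
  interpret product_sigma_finite "\<lambda>_::'a. N" ..
  show ?case by (simp add: PiM_empty nn_integral_count_space_finite)
next
  case (Cons s ss)
  interpret S: sigma_finite_measure N using N by (rule sf_borelD)
  interpret product_sigma_finite "\<lambda>_::'a. N" ..
  note [measurable_cong] = sf_borelD(2)[OF N]
  have m0: "(\<lambda>\<omega>. \<chi> i. if i \<in> insert s (set ss) then \<omega> i else x $ i) \<in> borel_measurable (Pi\<^sub>M (insert s (set ss)) (\<lambda>_. N))"
  proof (subst borel_measurable_euclidean_space, intro ballI)
    fix b :: "real^'a" assume "b \<in> Basis"
    then obtain j where b: "b = axis j 1" by (auto simp: Basis_vec_def)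
    show "(\<lambda>\<omega>. (\<chi> i. if i \<in> insert s (set ss) then \<omega> i else x $ i) \<bullet> b) \<in> borel_measurable (Pi\<^sub>M (insert s (set ss)) (\<lambda>_. N))"
      unfolding b by (cases "j \<in> insert s (set ss)") (auto simp: inner_axis)
  qed
  note m = measurable_compose[OF m0 assms(2)]
  have "(\<integral>\<^sup>+\<omega>. F (\<chi> i. if i \<in> insert s (set ss) then \<omega> i else x $ i) \<partial>Pi\<^sub>M (insert s (set ss)) (\<lambda>_. N)) =
    (\<integral>\<^sup>+y. \<integral>\<^sup>+\<omega>. F (\<chi> i. if i \<in> insert s (set ss) then (fun_upd \<omega> s y) i else x $ i) \<partial>Pi\<^sub>M (set ss) (\<lambda>_. N) \<partial>N)"
    using Cons.prems m by (subst product_nn_integral_insert_rev) auto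
  also have "\<dots> = (\<integral>\<^sup>+y. iter_int N ss F (vupd x s y) \<partial>N)"
    using Cons by (auto intro!: nn_integral_cong arg_cong[where f=F] simp: vec_eq_iff)
  finally show ?case by (simp add: coord_int_def)
qed

lemma sf_borel_lborel [simp]: "sf_borel lborel"
  by (simp add: sf_borel_def lborel.sigma_finite_measure_axioms)

lemma nn_integral_iter_int:
  assumes [measurable]: "F \<in> borel_measurable borel" and "distinct ss" "set ss = UNIV"
  shows "(\<integral>\<^sup>+x. F x \<partial>lborel) = iter_int lborel ss F (x :: real^'d)"
  by (subst lborel_eq_PiM, subst nn_integral_distr)
     (use assms in \<open>simp_all add: iter_int_eq_PiM\<close>)

text \<open>Lebesgue measure on [0,1), encoded as a density on the line so that its sigma-algebra is
  still that of \<open>borel\<close>, as \<open>sf_borel\<close> demands.\<close>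

definition unit_int :: "real measure" where
  "unit_int = density lborel (indicator {0..<1})"

lemma sf_borel_density:
  assumes [measurable]: "g \<in> borel_measurable borel" and "\<And>x. g x \<noteq> \<infinity>"
  shows "sf_borel (density lborel g)"
  using assms by (auto simp: sf_borel_def sigma_finite_measure.sigma_finite_iff_density_finite[OF lborel.sigma_finite_measure_axioms])

lemma sf_borel_unit_int [simp]: "sf_borel unit_int"
  unfolding unit_int_def by (intro sf_borel_density) (auto simp: indicator_def)

lemma sets_unit_int [simp, measurable_cong]: "sets unit_int = sets borel"
  by (simp add: unit_int_def)

lemma nn_unit_int:
  "F \<in> borel_measurable borel \<Longrightarrow> (\<integral>\<^sup>+t. F t \<partial>unit_int) = (\<integral>\<^sup>+t. indicator {0..<1} t * F t \<partial>lborel)"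
  unfolding unit_int_def by (rule nn_integral_density) auto

lemma coord_unit_int:
  assumes [measurable]: "F \<in> borel_measurable borel"
  shows "coord_int unit_int s F x = (\<integral>\<^sup>+t. indicator {0..<1} t * F (vupd x s t) \<partial>lborel)"
  unfolding coord_int_def unit_int_def by (subst nn_integral_density) auto

lemma iter_unit_int:
  assumes F[measurable]: "F \<in> borel_measurable borel" and "distinct ss"
  shows "iter_int unit_int ss F = iter_int lborel ss (\<lambda>x. (\<Prod>s\<in>set ss. indicator {0..<1} (x $ s)) * F x)"
  using \<open>distinct ss\<close>
proof (induction ss)
  case (Cons s ss)
  have [measurable]: "iter_int unit_int ss F \<in> borel_measurable borel"
    by (rule iter_int_measurable) auto
  have m[measurable]: "(\<lambda>x. (\<Prod>s\<in>set ss. indicator {0..<1} (x $ s)) * F x) \<in> borel_measurable borel"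
    by measurable
  have ind: "iter_int lborel ss (\<lambda>x. indicator {0..<1} (x $ s) * ((\<Prod>s\<in>set ss. indicator {0..<1} (x $ s)) * F x)) =
    (\<lambda>x. indicator {0..<1} (x $ s) * iter_int lborel ss (\<lambda>x. (\<Prod>s\<in>set ss. indicator {0..<1} (x $ s)) * F x) x)"
    using Cons.prems by (intro iter_int_mult_indep) auto
  show ?case
  proof
    fix x
    have "iter_int unit_int (s # ss) F x = (\<integral>\<^sup>+t. indicator {0..<1} t * iter_int unit_int ss F (vupd x s t) \<partial>lborel)"
      by (simp add: coord_unit_int)
    also have "\<dots> = coord_int lborel s (\<lambda>x. indicator {0..<1} (x $ s) * iter_int lborel ss (\<lambda>x. (\<Prod>s\<in>set ss. indicator {0..<1} (x $ s)) * F x) x) x"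
      using Cons by (simp add: coord_int_def)
    also have "\<dots> = coord_int lborel s (iter_int lborel ss (\<lambda>x. indicator {0..<1} (x $ s) * ((\<Prod>s\<in>set ss. indicator {0..<1} (x $ s)) * F x))) x"
      by (simp add: ind)
    finally show "iter_int unit_int (s # ss) F x = iter_int lborel (s # ss) (\<lambda>x. (\<Prod>s\<in>set (s # ss). indicator {0..<1} (x $ s)) * F x) x"
      using Cons.prems by (simp add: mult.assoc)
  qed
qed simp

text \<open>Half-open, hence a disjoint union of dyadic cells on every level. It differs from the
  closed cube by a null set.\<close>

definition half_cube :: "(real^'d) set" where
  "half_cube = {x. \<forall>i. 0 \<le> x $ i \<and> x $ i < 1}"

lemma half_cube_sets [measurable]: "half_cube \<in> sets borel"
proof -
  have "{x\<in>space borel. \<forall>i\<in>UNIV. 0 \<le> (x::real^'d) $ i \<and> x $ i < 1} \<in> sets borel"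
    by measurable
  then show ?thesis by (simp add: half_cube_def)
qed

lemma prod_indicator_half_cube:
  "(\<Prod>s\<in>UNIV. indicator {0..<1} (x $ s)) = (indicator half_cube (x::real^'d) :: ennreal)"
  by (auto simp: half_cube_def indicator_def)

lemma nn_integral_half_cube:
  assumes [measurable]: "F \<in> borel_measurable borel" and "distinct ss" "set ss = UNIV"
  shows "(\<integral>\<^sup>+x\<in>half_cube. F x \<partial>lborel) = iter_int unit_int ss F (x :: real^'d)"
  unfolding iter_unit_int[OF assms(1,2)]
  by (subst nn_integral_iter_int[symmetric])
     (use assms in \<open>simp_all add: prod_indicator_half_cube mult.commute\<close>)

section \<open>Convexity inequalities\<close>

text \<open>The tangent of the convex function \<open>t powr u\<close> at \<open>c\<close> lies
  below its graph; Young's inequality gives this without derivatives. It is the common source of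
  \<open>jensen_powr\<close> and \<open>powr_sum_weighted\<close>.\<close>

lemma powr_tangent:
  fixes f c u :: real
  assumes "0 \<le> f" "0 \<le> c" "1 \<le> u"
  shows "u * c powr (u - 1) * f \<le> f powr u + (u - 1) * c powr u"
proof (cases "f = 0 \<or> c = 0")
  case False
  then have pos: "f > 0" "c > 0" using assms by auto
  have "(f powr u) powr (1/u) * (c powr u) powr ((u - 1)/u) \<le> (1/u) * f powr u + ((u-1)/u) * c powr u"
    using pos assms by (intro Youngs_inequality_0) (auto simp: field_simps)
  moreover have "u * ((u - 1) / u) = u - 1" using assms by simp
  ultimately have "f * c powr (u - 1) \<le> (1/u) * f powr u + ((u-1)/u) * c powr u"
    using pos assms by (simp add: powr_powr)
  then have "u * (f * c powr (u - 1)) \<le> u * ((1/u) * f powr u + ((u-1)/u) * c powr u)"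
    using assms by (intro mult_left_mono) auto
  also have "\<dots> = f powr u + (u - 1) * c powr u"
    using assms by (simp add: distrib_left)
  finally show ?thesis by (simp add: ac_simps)
qed (use assms in auto)

text \<open>Jensen's inequality for a complex weight whose mass is only bounded by \<open>A\<close>.
  The tangent inequality at \<open>c = Y / A\<close>, the mean with respect to this bound, is
  integrated against the modulus of the weight; boundedness of \<open>F\<close> makes all integrals
  finite.\<close>

lemma jensen_powr:
  fixes F w :: "'a \<Rightarrow> complex"
  assumes [measurable]: "F \<in> borel_measurable M" and w: "integrable M w"
    and A: "(\<integral>x. norm (w x) \<partial>M) \<le> A" "A > 0" and B: "\<And>x. norm (F x) \<le> B" and u: "1 \<le> u"
  shows "ennreal (norm (\<integral>x. F x * w x \<partial>M) powr u)
    \<le> ennreal (A powr (u - 1)) * (\<integral>\<^sup>+x. ennreal (norm (F x) powr u) * ennreal (norm (w x)) \<partial>M)"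
proof -
  have [measurable]: "w \<in> borel_measurable M" using w by auto
  have B0: "B \<ge> 0" using B[of undefined] norm_ge_zero order_trans by blast
  have i1: "integrable M (\<lambda>x. norm (F x) * norm (w x))"
    by (rule Bochner_Integration.integrable_bound[where f="\<lambda>x. B * norm (w x)"])
       (use w B B0 in \<open>auto intro!: mult_right_mono AE_I2\<close>)
  have i2: "integrable M (\<lambda>x. norm (F x) powr u * norm (w x))"
    by (rule Bochner_Integration.integrable_bound[where f="\<lambda>x. B powr u * norm (w x)"])
       (use w B B0 u in \<open>auto intro!: mult_right_mono AE_I2 powr_mono2\<close>)
  define Y where "Y = (\<integral>x. norm (F x) * norm (w x) \<partial>M)"
  define Z where "Z = (\<integral>x. norm (F x) powr u * norm (w x) \<partial>M)"
  have Y0: "Y \<ge> 0" unfolding Y_def by (intro integral_nonneg_AE) auto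
  have Z0: "Z \<ge> 0" unfolding Z_def by (intro integral_nonneg_AE) auto
  define c where "c = Y / A"
  have c0: "c \<ge> 0" using Y0 A by (simp add: c_def)
  have "(\<integral>x. u * c powr (u - 1) * (norm (F x) * norm (w x)) \<partial>M)
      \<le> (\<integral>x. norm (F x) powr u * norm (w x) + (u - 1) * c powr u * norm (w x) \<partial>M)"
  proof (intro integral_mono)
    fix x
    show "u * c powr (u - 1) * (norm (F x) * norm (w x)) \<le> norm (F x) powr u * norm (w x) + (u - 1) * c powr u * norm (w x)"
      using mult_right_mono[OF powr_tangent[of "norm (F x)" c u], of "norm (w x)"] c0 u
      by (simp add: algebra_simps)
  qed (use i1 i2 w in auto)
  then have "u * c powr (u - 1) * Y \<le> Z + (u - 1) * c powr u * (\<integral>x. norm (w x) \<partial>M)"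
    using i1 i2 w by (simp add: Y_def Z_def)
  also have "\<dots> \<le> Z + (u - 1) * c powr u * A"
    using A u by (intro add_left_mono mult_left_mono) auto
  finally have *: "u * c powr (u - 1) * Y \<le> Z + (u - 1) * c powr u * A" .
  have cA: "c powr (u - 1) * Y = c powr u * A"
  proof (cases "c = 0")
    case False
    then have "c powr u = c powr (u - 1) * c" using c0 by (simp add: powr_diff)
    then show ?thesis using A by (simp add: c_def)
  qed simp
  have "u * (c powr u * A) \<le> Z + (u - 1) * (c powr u * A)" using * by (simp only: cA mult.assoc)
  then have "c powr u * A \<le> Z" by (simp add: left_diff_distrib)
  moreover have "c powr u * A = Y powr u * A powr (1 - u)"
    using A Y0 by (simp add: c_def powr_divide powr_diff)
  ultimately have "Y powr u * A powr (1 - u) * A powr (u - 1) \<le> Z * A powr (u - 1)"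
    by (intro mult_right_mono) auto
  moreover have "A powr (1 - u) * A powr (u - 1) = 1"
    using A by (simp flip: powr_add)
  ultimately have YZ: "Y powr u \<le> A powr (u - 1) * Z"
    by (simp add: mult.assoc mult.commute[of Z])
  have "norm (\<integral>x. F x * w x \<partial>M) \<le> Y"
    unfolding Y_def by (rule order_trans[OF integral_norm_bound]) (simp add: norm_mult)
  then have "norm (\<integral>x. F x * w x \<partial>M) powr u \<le> A powr (u - 1) * Z"
    using u YZ by (intro order_trans[OF _ YZ] powr_mono2) auto
  moreover have "(\<integral>\<^sup>+x. ennreal (norm (F x) powr u) * ennreal (norm (w x)) \<partial>M) = ennreal Z"
    unfolding Z_def by (subst nn_integral_eq_integral[OF i2, symmetric]) (auto simp: ennreal_mult)
  ultimately show ?thesis using Z0 by (simp flip: ennreal_mult)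
qed

text \<open>Convexity with weights \<open>t i\<close> applied to the values
  \<open>z i / t i\<close>. The weights are left free: normalized norms will give Minkowski's
  inequality, exponentials in the distance of levels will give the almost orthogonality.\<close>

lemma powr_sum_weighted:
  fixes z t :: "'i \<Rightarrow> real"
  assumes "finite I" and z: "\<And>i. i \<in> I \<Longrightarrow> z i \<ge> 0" and t: "\<And>i. i \<in> I \<Longrightarrow> t i > 0"
    and st: "sum t I \<le> 1" and u: "1 \<le> u"
  shows "(\<Sum>i\<in>I. z i) powr u \<le> (\<Sum>i\<in>I. t i powr (1 - u) * z i powr u)"
proof -
  define S where "S = sum z I"
  have S0: "S \<ge> 0" unfolding S_def using z by (intro sum_nonneg) auto
  have "u * S powr (u - 1) * z i \<le> t i powr (1 - u) * z i powr u + (u - 1) * t i * S powr u" if "i \<in> I" for i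
  proof -
    have "t i * (u * S powr (u - 1) * (z i / t i)) \<le> t i * ((z i / t i) powr u + (u - 1) * S powr u)"
      using t[OF that] z[OF that] S0 u by (intro mult_left_mono powr_tangent) auto
    moreover have "t i * (z i / t i) powr u = t i powr (1 - u) * z i powr u"
      using t[OF that] z[OF that] by (simp add: powr_divide powr_diff)
    ultimately show ?thesis using t[OF that] by (simp add: algebra_simps)
  qed
  then have "(\<Sum>i\<in>I. u * S powr (u - 1) * z i) \<le> (\<Sum>i\<in>I. t i powr (1 - u) * z i powr u + (u - 1) * t i * S powr u)"
    by (rule sum_mono)
  then have "u * S powr (u - 1) * S \<le> (\<Sum>i\<in>I. t i powr (1 - u) * z i powr u) + (u - 1) * sum t I * S powr u"
    by (simp add: S_def sum.distrib sum_distrib_left sum_distrib_right mult.assoc)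
  also have "\<dots> \<le> (\<Sum>i\<in>I. t i powr (1 - u) * z i powr u) + (u - 1) * 1 * S powr u"
    using st u by (intro add_left_mono mult_right_mono mult_left_mono) auto
  finally have "u * S powr (u - 1) * S \<le> (\<Sum>i\<in>I. t i powr (1 - u) * z i powr u) + (u - 1) * S powr u" by simp
  moreover have "S powr (u - 1) * S = S powr u"
    using S0 by (cases "S = 0") (auto simp: powr_diff)
  ultimately have "u * S powr u \<le> (\<Sum>i\<in>I. t i powr (1 - u) * z i powr u) + (u - 1) * S powr u"
    by (simp only: mult.assoc)
  then show ?thesis by (simp add: S_def[symmetric] left_diff_distrib)
qed

lemma powr_add_le:
  fixes x y u :: real
  assumes "0 \<le> x" "0 \<le> y" "1 \<le> u"
  shows "(x + y) powr u \<le> 2 powr (u - 1) * (x powr u + y powr u)"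
proof -
  have "(\<Sum>i::bool\<in>UNIV. if i then x else y) powr u
      \<le> (\<Sum>i::bool\<in>UNIV. (1/2) powr (1 - u) * (if i then x else y) powr u)"
    by (rule powr_sum_weighted) (use assms in \<open>auto simp: UNIV_bool\<close>)
  moreover have "(1/2::real) powr (1 - u) = 2 powr (u - 1)"
    by (simp add: powr_divide powr_diff)
  ultimately show ?thesis by (simp add: UNIV_bool algebra_simps)
qed

section \<open>Iterated dyadic differences\<close>

text \<open>The left end of the dyadic cell of length 2^-a that contains \<open>t\<close>. Left ends
  of a level are also left ends on every finer level, so the grids are nested.\<close>

definition dyad :: "nat \<Rightarrow> real \<Rightarrow> real" where
  "dyad a t = of_int \<lfloor>2 ^ a * t\<rfloor> / 2 ^ a"

text \<open>Level 0 has no predecessor and is the sampled function itself, so that the levels up to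
  \<open>M\<close> telescope to sampling at mesh 2^-M.\<close>

definition dif :: "'d \<Rightarrow> nat \<Rightarrow> (real^'d \<Rightarrow> complex) \<Rightarrow> real^'d \<Rightarrow> complex" where
  "dif s a h x = h (vupd x s (dyad a (x $ s)))
     - (if a = 0 then 0 else h (vupd x s (dyad (a - 1) (x $ s))))"

fun difs :: "('d \<Rightarrow> nat) \<Rightarrow> 'd list \<Rightarrow> (real^'d \<Rightarrow> complex) \<Rightarrow> real^'d \<Rightarrow> complex" where
  "difs k [] h = h"
| "difs k (s # ss) h = dif s (k s) (difs k ss h)"

lemma dyad_measurable [measurable]: "dyad a \<in> borel_measurable borel"
  unfolding dyad_def[abs_def] by measurable

lemma dif_measurable [measurable (raw)]:
  assumes [measurable]: "h \<in> borel_measurable borel"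
  shows "dif s a h \<in> borel_measurable borel"
  unfolding dif_def[abs_def] by (cases "a = 0") simp_all

lemma difs_measurable:
  assumes "h \<in> borel_measurable borel"
  shows "difs k ss h \<in> borel_measurable borel"
  by (induction ss) (auto intro: assms dif_measurable)

lemma dif_bounded:
  assumes "\<And>x. norm (h x) \<le> B"
  shows "norm (dif s a h x) \<le> 2 * B"
proof -
  have "B \<ge> 0" using assms[of x] norm_ge_zero[of "h x"] by linarith
  then show ?thesis
    using norm_triangle_ineq4[of "h (vupd x s (dyad a (x $ s)))" "h (vupd x s (dyad (a - 1) (x $ s)))"]
      assms[of "vupd x s (dyad a (x $ s))"] assms[of "vupd x s (dyad (a - 1) (x $ s))"]
    by (cases "a = 0") (simp_all add: dif_def)
qed

lemma dif_sum: "dif s a (\<lambda>x. \<Sum>i\<in>I. f i x) x = (\<Sum>i\<in>I. dif s a (f i) x)"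
  by (simp add: dif_def sum_subtractf)

lemma difs_sum: "difs k ss (\<lambda>x. \<Sum>i\<in>I. f i x) = (\<lambda>x. \<Sum>i\<in>I. difs k ss (f i) x)"
proof (induction ss)
  case (Cons s ss)
  show ?case by (rule ext) (simp add: Cons dif_sum)
qed simp

section \<open>Functions reproduced by a kernel in one coordinate\<close>

text \<open>What the one-coordinate estimates require of a reproducing kernel of scale 2^-a.
  \<open>L a\<close> plays the role of the derivative of \<open>P a\<close>; absolute continuity is
  stated through the bound on increments, so that no derivative is ever taken here.\<close>

locale kernels =
  fixes P L :: "nat \<Rightarrow> real \<Rightarrow> complex" and A :: real
  assumes P_meas [measurable]: "P a \<in> borel_measurable borel"
    and L_meas [measurable]: "L a \<in> borel_measurable borel"
    and A_pos: "A > 0"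
    and P_L1: "(\<integral>\<^sup>+x. ennreal (norm (P a x)) \<partial>lborel) \<le> ennreal A"
    and P_sup: "norm (P a x) \<le> A * 2 ^ a"
    and L_L1: "(\<integral>\<^sup>+x. ennreal (norm (L a x)) \<partial>lborel) \<le> ennreal (A * 2 ^ a)"
    and P_diff: "x \<le> y \<Longrightarrow> ennreal (norm (P a y - P a x)) \<le> (\<integral>\<^sup>+t. indicator {x..<y} t * ennreal (norm (L a t)) \<partial>lborel)"
begin

text \<open>Convolution with \<open>P a\<close> in the coordinate \<open>s\<close> alone reproduces
  \<open>F\<close>. Stated for a single coordinate, the property survives sampling and summation in
  all the others; the bound on \<open>F\<close> makes the convolution absolutely convergent.\<close>

definition rep :: "nat \<Rightarrow> 'd \<Rightarrow> (real^'d \<Rightarrow> complex) \<Rightarrow> bool" where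
  "rep a s F \<longleftrightarrow> F \<in> borel_measurable borel \<and> (\<exists>B. \<forall>x. norm (F x) \<le> B) \<and>
     (\<forall>x. F x = (\<integral>y. F (vupd x s y) * P a (x $ s - y) \<partial>lborel))"

lemma nn_P_shift: "(\<integral>\<^sup>+y. ennreal (norm (P a (t - y))) \<partial>lborel) \<le> ennreal A"
  using P_L1[of a] nn_integral_real_affine[of "\<lambda>x. ennreal (norm (P a x))" "-1" t] by simp

lemma P_shift_integrable: "integrable lborel (\<lambda>y. P a (t - y))"
  using nn_P_shift[of a t] by (auto simp: integrable_iff_bounded intro: le_less_trans)

text \<open>The increment of \<open>P a\<close> is at most the integral of the modulus of
  \<open>L a\<close> over the interval in between. After exchanging the integrals each
  \<open>t\<close> is counted for shifts \<open>z\<close> in a set of length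
  \<open>y - y'\<close>.\<close>

lemma P_shift_diff:
  assumes "y' \<le> y"
  shows "(\<integral>\<^sup>+z. ennreal (norm (P a (y - z) - P a (y' - z))) \<partial>lborel) \<le> ennreal (A * 2 ^ a * (y - y'))"
proof -
  have "(\<integral>\<^sup>+z. ennreal (norm (P a (y - z) - P a (y' - z))) \<partial>lborel)
     \<le> (\<integral>\<^sup>+z. \<integral>\<^sup>+t. indicator {y'..<y} (t + z) * ennreal (norm (L a t)) \<partial>lborel \<partial>lborel)"
  proof (intro nn_integral_mono)
    fix z
    have "(\<lambda>t. indicator {y' - z..<y - z} t * ennreal (norm (L a t))) = (\<lambda>t. indicator {y'..<y} (t + z) * ennreal (norm (L a t)))"
      by (auto simp: indicator_def fun_eq_iff)
    then show "ennreal (norm (P a (y - z) - P a (y' - z))) \<le> (\<integral>\<^sup>+t. indicator {y'..<y} (t + z) * ennreal (norm (L a t)) \<partial>lborel)"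
      using P_diff[of "y' - z" "y - z" a] assms by simp
  qed
  also have "\<dots> = (\<integral>\<^sup>+t. \<integral>\<^sup>+z. indicator {y'..<y} (t + z) * ennreal (norm (L a t)) \<partial>lborel \<partial>lborel)"
    by (rule lborel_pair.Fubini') measurable
  also have "\<dots> = (\<integral>\<^sup>+t. ennreal (y - y') * ennreal (norm (L a t)) \<partial>lborel)"
  proof (intro nn_integral_cong)
    fix t
    have "(\<integral>\<^sup>+z. indicator {y'..<y} (t + z) * ennreal (norm (L a t)) \<partial>lborel) = (\<integral>\<^sup>+z. indicator {y' - t..<y - t} z \<partial>lborel) * ennreal (norm (L a t))"
      by (subst nn_integral_multc[symmetric]) (auto intro!: nn_integral_cong simp: indicator_def)
    then show "(\<integral>\<^sup>+z. indicator {y'..<y} (t + z) * ennreal (norm (L a t)) \<partial>lborel) = ennreal (y - y') * ennreal (norm (L a t))"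
      using assms by simp
  qed
  also have "\<dots> = ennreal (y - y') * (\<integral>\<^sup>+t. ennreal (norm (L a t)) \<partial>lborel)"
    by (rule nn_integral_cmult) measurable
  also have "\<dots> \<le> ennreal (y - y') * ennreal (A * 2 ^ a)"
    by (intro mult_left_mono L_L1) auto
  finally show ?thesis using assms A_pos by (simp add: ennreal_mult' [symmetric] ac_simps)
qed

text \<open>The left ends of the cells of \<open>t\<close> on the levels \<open>k - 1\<close> and
  \<open>k\<close> differ only when \<open>t\<close> lies in the right half of its parent cell, and
  the interval between them is then the left half. So \<open>t\<close> is confined to the cell
  directly after that of \<open>z\<close>, a set of measure 2^-k.\<close>

lemma dyad_interval:
  assumes "k > 0" "dyad (k - 1) t \<le> z" "z < dyad k t"
  shows "\<lfloor>2 ^ k * t\<rfloor> = \<lfloor>2 ^ k * z\<rfloor> + 1"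
proof -
  obtain l where k: "k = Suc l" using assms(1) by (cases k) auto
  have a: "of_int \<lfloor>2 ^ l * t\<rfloor> \<le> 2 ^ l * z" and b: "2 ^ k * z < of_int \<lfloor>2 ^ k * t\<rfloor>"
    using assms unfolding dyad_def k by (auto simp: field_simps)
  have "of_int (2 * \<lfloor>2 ^ l * t\<rfloor>) \<le> 2 ^ k * z" using a by (simp add: k)
  then have "2 * \<lfloor>2 ^ l * t\<rfloor> \<le> \<lfloor>2 ^ k * z\<rfloor>" by linarith
  moreover have "\<lfloor>2 ^ k * t\<rfloor> \<le> 2 * \<lfloor>2 ^ l * t\<rfloor> + 1" by (simp add: k) linarith
  moreover have "\<lfloor>2 ^ k * z\<rfloor> < \<lfloor>2 ^ k * t\<rfloor>" using b by linarith
  ultimately show ?thesis by linarith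
qed

text \<open>The kernel through which \<open>dif\<close> acts on a function reproduced by
  \<open>P a\<close>.\<close>

definition dif_ker :: "nat \<Rightarrow> nat \<Rightarrow> real \<Rightarrow> real \<Rightarrow> complex" where
  "dif_ker a k t y = P a (dyad k t - y) - (if k = 0 then 0 else P a (dyad (k - 1) t - y))"

lemma dif_ker_measurable [measurable]:
  assumes [measurable]: "f \<in> borel_measurable M" "g \<in> borel_measurable M"
  shows "(\<lambda>w. dif_ker a k (f w) (g w)) \<in> borel_measurable M"
  unfolding dif_ker_def by (cases "k = 0") simp_all

lemma dif_ker_L1: "(\<integral>\<^sup>+y. ennreal (norm (dif_ker a k t y)) \<partial>lborel) \<le> ennreal (2 * A)"
proof -
  have "(\<integral>\<^sup>+y. ennreal (norm (dif_ker a k t y)) \<partial>lborel)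
    \<le> (\<integral>\<^sup>+y. ennreal (norm (P a (dyad k t - y))) + ennreal (norm (P a (dyad (k - 1) t - y))) \<partial>lborel)"
    unfolding dif_ker_def
    by (intro nn_integral_mono) (auto simp: norm_triangle_ineq4 simp flip: ennreal_plus)
  also have "\<dots> \<le> ennreal A + ennreal A"
    by (subst nn_integral_add) (auto intro!: add_mono nn_P_shift)
  finally show ?thesis using A_pos by (simp flip: ennreal_plus)
qed

text \<open>The difference of two values of \<open>P a\<close> is bounded by the integral of the
  modulus of \<open>L a\<close> over the interval between two cell corners. With the integrals
  exchanged, \<open>dyad_interval\<close> leaves for each \<open>z\<close> a single cell of
  \<open>t\<close>, of length 2^-k, and the total variation A 2^a remains. On level 0 there is no
  difference, and the supremum bound of \<open>P a\<close> takes its place.\<close>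

lemma dif_ker_variation:
  "(\<integral>\<^sup>+t. ennreal (norm (dif_ker a k t y)) \<partial>unit_int) \<le> ennreal (A * 2 ^ a / 2 ^ k)"
proof (cases "k = 0")
  case True
  have "(\<integral>\<^sup>+t. ennreal (norm (dif_ker a k t y)) \<partial>unit_int) = (\<integral>\<^sup>+t. indicator {0..<1} t * ennreal (norm (dif_ker a k t y)) \<partial>lborel)"
    by (rule nn_unit_int) measurable
  also have "\<dots> \<le> (\<integral>\<^sup>+t. indicator {0..<1::real} t * ennreal (A * 2 ^ a) \<partial>lborel)"
    using True P_sup by (intro nn_integral_mono mult_left_mono ennreal_leI) (auto simp: dif_ker_def)
  also have "\<dots> = ennreal (A * 2 ^ a)"
    by (subst nn_integral_multc) auto
  finally show ?thesis using True by simp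
next
  case False
  have "(\<integral>\<^sup>+t. ennreal (norm (dif_ker a k t y)) \<partial>unit_int) = (\<integral>\<^sup>+t. indicator {0..<1} t * ennreal (norm (dif_ker a k t y)) \<partial>lborel)"
    by (rule nn_unit_int) measurable
  also have "\<dots> \<le> (\<integral>\<^sup>+t. \<integral>\<^sup>+z. indicator {t::real. \<lfloor>2 ^ k * t\<rfloor> = \<lfloor>2 ^ k * (z + y)\<rfloor> + 1} t * ennreal (norm (L a z)) \<partial>lborel \<partial>lborel)"
  proof (intro nn_integral_mono)
    fix t
    have le: "dyad (k - 1) t \<le> dyad k t"
    proof -
      obtain l where k: "k = Suc l" using False by (cases k) auto
      have "2 * \<lfloor>2 ^ l * t\<rfloor> \<le> \<lfloor>2 ^ k * t\<rfloor>" by (simp add: k) linarith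
      then have "real_of_int (2 * \<lfloor>2 ^ l * t\<rfloor>) \<le> real_of_int \<lfloor>2 ^ k * t\<rfloor>" by linarith
      then show ?thesis unfolding dyad_def k by (simp add: field_simps)
    qed
    have "indicator {0..<1} t * ennreal (norm (dif_ker a k t y)) \<le> 1 * ennreal (norm (dif_ker a k t y))"
      by (intro mult_right_mono) (auto simp: indicator_def)
    also have "\<dots> = ennreal (norm (P a (dyad k t - y) - P a (dyad (k - 1) t - y)))"
      using False by (simp add: dif_ker_def)
    also have "\<dots> \<le> (\<integral>\<^sup>+z. indicator {dyad (k - 1) t - y..<dyad k t - y} z * ennreal (norm (L a z)) \<partial>lborel)"
      using le by (intro P_diff) auto
    also have "\<dots> \<le> (\<integral>\<^sup>+z. indicator {t::real. \<lfloor>2 ^ k * t\<rfloor> = \<lfloor>2 ^ k * (z + y)\<rfloor> + 1} t * ennreal (norm (L a z)) \<partial>lborel)"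
      using dyad_interval[of k t] False
      by (intro nn_integral_mono mult_right_mono) (auto simp: indicator_def)
    finally show "indicator {0..<1} t * ennreal (norm (dif_ker a k t y)) \<le> (\<integral>\<^sup>+z. indicator {t::real. \<lfloor>2 ^ k * t\<rfloor> = \<lfloor>2 ^ k * (z + y)\<rfloor> + 1} t * ennreal (norm (L a z)) \<partial>lborel)" .
  qed
  also have "\<dots> = (\<integral>\<^sup>+z. \<integral>\<^sup>+t. indicator {t::real. \<lfloor>2 ^ k * t\<rfloor> = \<lfloor>2 ^ k * (z + y)\<rfloor> + 1} t * ennreal (norm (L a z)) \<partial>lborel \<partial>lborel)"
    by (rule lborel_pair.Fubini') measurable
  also have "\<dots> = (\<integral>\<^sup>+z. ennreal (1 / 2 ^ k) * ennreal (norm (L a z)) \<partial>lborel)"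
  proof (intro nn_integral_cong)
    fix z
    let ?n = "\<lfloor>2 ^ k * (z + y)\<rfloor> + 1"
    have "{t::real. \<lfloor>2 ^ k * t\<rfloor> = ?n} = {?n / 2 ^ k ..< (?n + 1) / 2 ^ k}"
      by (auto simp: floor_eq_iff field_simps)
    moreover have "(of_int ?n + 1) / 2 ^ k = of_int ?n / 2 ^ k + 1 / (2 ^ k :: real)"
      by (simp only: add_divide_distrib)
    ultimately have "emeasure lborel {t::real. \<lfloor>2 ^ k * t\<rfloor> = ?n} = ennreal (1 / 2 ^ k)"
      by (simp only: emeasure_lborel_Ico le_add_same_cancel1) simp
    then show "(\<integral>\<^sup>+t. indicator {t::real. \<lfloor>2 ^ k * t\<rfloor> = ?n} t * ennreal (norm (L a z)) \<partial>lborel) = ennreal (1 / 2 ^ k) * ennreal (norm (L a z))"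
      by (simp add: nn_integral_multc)
  qed
  also have "\<dots> = ennreal (1 / 2 ^ k) * (\<integral>\<^sup>+t. ennreal (norm (L a t)) \<partial>lborel)"
    by (rule nn_integral_cmult) measurable
  also have "\<dots> \<le> ennreal (1 / 2 ^ k) * ennreal (A * 2 ^ a)"
    by (intro mult_left_mono L_L1) auto
  finally show ?thesis using A_pos by (simp add: ennreal_mult' [symmetric])
qed

lemma rep_measurable: "rep a s F \<Longrightarrow> F \<in> borel_measurable borel"
  by (simp add: rep_def)

lemma rep_bounded: "rep a s F \<Longrightarrow> \<exists>B>0. \<forall>x. norm (F x) \<le> B"
proof -
  assume "rep a s F"
  then obtain B where "\<And>x. norm (F x) \<le> B" unfolding rep_def by blast
  then have "\<forall>x. norm (F x) \<le> max B 1" by (intro allI max.coboundedI1)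
  then show ?thesis by (intro exI[of _ "max B 1"] conjI) auto
qed

lemma rep_integrable:
  assumes "rep a s F"
  shows "integrable lborel (\<lambda>y. F (vupd x s y) * P a (t - y))"
proof -
  obtain B where B: "B > 0" "\<And>x. norm (F x) \<le> B" using rep_bounded[OF assms] by auto
  have [measurable]: "F \<in> borel_measurable borel" using assms by (rule rep_measurable)
  show ?thesis
    by (rule Bochner_Integration.integrable_bound[where f="\<lambda>y. B * norm (P a (t - y))"])
       (use P_shift_integrable B in \<open>auto simp: norm_mult abs_of_pos intro!: mult_right_mono AE_I2\<close>)
qed

lemma rep_eq: "rep a s F \<Longrightarrow> F (vupd x s t) = (\<integral>y. F (vupd x s y) * P a (t - y) \<partial>lborel)"
proof -
  assume "rep a s F"
  then have "F (vupd x s t) = (\<integral>y. F (vupd (vupd x s t) s y) * P a (vupd x s t $ s - y) \<partial>lborel)"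
    unfolding rep_def by blast
  then show ?thesis by simp
qed

lemma rep_diff:
  assumes F: "rep a s F"
  shows "F (vupd x s t) - F (vupd x s t') = (\<integral>y. F (vupd x s y) * (P a (t - y) - P a (t' - y)) \<partial>lborel)"
  unfolding right_diff_distrib
  by (subst Bochner_Integration.integral_diff[OF rep_integrable[OF F] rep_integrable[OF F]])
     (simp only: rep_eq[OF F, symmetric])

lemma rep_sum:
  assumes "finite I" "\<And>i. i \<in> I \<Longrightarrow> rep a s (F i)"
  shows "rep a s (\<lambda>x. \<Sum>i\<in>I. F i x)"
  unfolding rep_def
proof (intro conjI allI)
  show "(\<lambda>x. \<Sum>i\<in>I. F i x) \<in> borel_measurable borel"
    using assms rep_measurable by (intro borel_measurable_sum) auto
  have "\<forall>i\<in>I. \<exists>b. \<forall>x. norm (F i x) \<le> b" using assms(2) rep_bounded by blast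
  then obtain B where "\<And>i x. i \<in> I \<Longrightarrow> norm (F i x) \<le> B i" by (auto simp: bchoice_iff)
  then have "norm (\<Sum>i\<in>I. F i x) \<le> sum B I" for x by (intro sum_norm_le) auto
  then show "\<exists>B. \<forall>x. norm (\<Sum>i\<in>I. F i x) \<le> B" by auto
  fix x
  have "F i x = (\<integral>y. F i (vupd x s y) * P a (x $ s - y) \<partial>lborel)" if "i \<in> I" for i
    using rep_eq[OF assms(2)[OF that], of x "x $ s"] by simp
  then show "(\<Sum>i\<in>I. F i x) = (\<integral>y. (\<Sum>i\<in>I. F i (vupd x s y)) * P a (x $ s - y) \<partial>lborel)"
    by (simp add: sum_distrib_right assms(2) rep_integrable)
qed

lemma rep_dif:
  assumes F: "rep a s F" and "r \<noteq> s"
  shows "rep a s (dif r k F)"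
  unfolding rep_def
proof (intro conjI allI)
  show "dif r k F \<in> borel_measurable borel" using rep_measurable[OF F] by (rule dif_measurable)
  show "\<exists>B. \<forall>x. norm (dif r k F x) \<le> B"
  proof -
    obtain B where "\<And>x. norm (F x) \<le> B" using rep_bounded[OF F] by auto
    then show ?thesis using dif_bounded[of F B r k] by auto
  qed
  fix x
  have "F (vupd x r t) = (\<integral>y. F (vupd (vupd x s y) r t) * P a (x $ s - y) \<partial>lborel)" for t
  proof -
    have "vupd (vupd x r t) s (x $ s) = vupd x r t" using \<open>r \<noteq> s\<close> by (simp add: vec_eq_iff)
    moreover have "vupd (vupd x r t) s y = vupd (vupd x s y) r t" for y
      using \<open>r \<noteq> s\<close> by (rule vupd_commute)
    ultimately show ?thesis using rep_eq[OF F, of "vupd x r t" "x $ s"] by simp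
  qed
  moreover have "integrable lborel (\<lambda>y. F (vupd (vupd x s y) r t) * P a (x $ s - y))" for t
    using rep_integrable[OF F, of "vupd x r t" "x $ s"] unfolding vupd_commute[OF \<open>r \<noteq> s\<close>] .
  ultimately show "dif r k F x = (\<integral>y. dif r k F (vupd x s y) * P a (x $ s - y) \<partial>lborel)"
    unfolding dif_def using \<open>r \<noteq> s\<close> by (simp add: left_diff_distrib)
qed

lemma rep_difs: "rep a s F \<Longrightarrow> s \<notin> set ss \<Longrightarrow> rep a s (difs k ss F)"
  by (induction ss) (auto intro: rep_dif)

text \<open>The row bound \<open>2 * A\<close> of the difference kernel enters through Jensen's
  inequality, the last factor \<open>A\<close> through the columns.\<close>

definition Cs :: "real \<Rightarrow> real" where "Cs u = (2 * A) powr (u - 1) * A"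

lemma Cs_pos: "Cs u > 0" using A_pos by (simp add: Cs_def)

text \<open>Schur's test: the columns of the difference kernel are controlled by the total variation
  of \<^term>\<open>P a\<close>, whatever the mesh is.\<close>

lemma schur_dif:
  assumes F: "rep a s F" and u: "1 \<le> u"
  shows "coord_int unit_int s (\<lambda>x. ennreal (norm (dif s k F x) powr u)) x
    \<le> ennreal (Cs u * 2 ^ a / 2 ^ k) * coord_int lborel s (\<lambda>x. ennreal (norm (F x) powr u)) x"
proof -
  have [measurable]: "F \<in> borel_measurable borel" using F by (rule rep_measurable)
  obtain B where B: "\<And>x. norm (F x) \<le> B" using rep_bounded[OF F] by auto
  have ki: "integrable lborel (dif_ker a k t)" for t
    using dif_ker_L1[of a k t] by (auto simp: integrable_iff_bounded intro: le_less_trans)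
  have kn: "(\<integral>y. norm (dif_ker a k t y) \<partial>lborel) \<le> 2 * A" for t
    using dif_ker_L1[of a k t] A_pos by (subst (asm) nn_integral_eq_integral) (use ki in \<open>auto simp: ennreal_le_iff\<close>)
  have "dif s k F (vupd x s t) = (\<integral>y. F (vupd x s y) * dif_ker a k t y \<partial>lborel)" for t
    unfolding dif_def dif_ker_def
    by (cases "k = 0") (simp_all add: rep_diff[OF F] flip: rep_eq[OF F])
  then have "ennreal (norm (dif s k F (vupd x s t)) powr u)
     \<le> ennreal ((2 * A) powr (u - 1)) * (\<integral>\<^sup>+y. ennreal (norm (F (vupd x s y)) powr u) * ennreal (norm (dif_ker a k t y)) \<partial>lborel)" for t
    using jensen_powr[of "\<lambda>y. F (vupd x s y)" lborel "dif_ker a k t" "2 * A" B u] ki kn A_pos B u by simp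
  then have "coord_int unit_int s (\<lambda>x. ennreal (norm (dif s k F x) powr u)) x
    \<le> (\<integral>\<^sup>+t. ennreal ((2 * A) powr (u - 1)) * (\<integral>\<^sup>+y. ennreal (norm (F (vupd x s y)) powr u) * ennreal (norm (dif_ker a k t y)) \<partial>lborel) \<partial>unit_int)"
    unfolding coord_int_def by (intro nn_integral_mono) auto
  also have "\<dots> = ennreal ((2 * A) powr (u - 1)) * (\<integral>\<^sup>+t. \<integral>\<^sup>+y. ennreal (norm (F (vupd x s y)) powr u) * ennreal (norm (dif_ker a k t y)) \<partial>lborel \<partial>unit_int)"
    by (intro nn_integral_cmult) measurable
  also have "(\<integral>\<^sup>+t. \<integral>\<^sup>+y. ennreal (norm (F (vupd x s y)) powr u) * ennreal (norm (dif_ker a k t y)) \<partial>lborel \<partial>unit_int)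
     = (\<integral>\<^sup>+y. \<integral>\<^sup>+t. ennreal (norm (F (vupd x s y)) powr u) * ennreal (norm (dif_ker a k t y)) \<partial>unit_int \<partial>lborel)"
  proof -
    interpret U: sigma_finite_measure unit_int by (rule sf_borelD) simp
    interpret pair_sigma_finite unit_int "lborel :: real measure" ..
    show ?thesis by (rule Fubini'[symmetric]) measurable
  qed
  also have "\<dots> = (\<integral>\<^sup>+y. ennreal (norm (F (vupd x s y)) powr u) * (\<integral>\<^sup>+t. ennreal (norm (dif_ker a k t y)) \<partial>unit_int) \<partial>lborel)"
    by (intro nn_integral_cong nn_integral_cmult) measurable
  also have "\<dots> \<le> (\<integral>\<^sup>+y. ennreal (norm (F (vupd x s y)) powr u) * ennreal (A * 2 ^ a / 2 ^ k) \<partial>lborel)"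
    by (intro nn_integral_mono mult_left_mono dif_ker_variation) auto
  also have "\<dots> = ennreal (A * 2 ^ a / 2 ^ k) * coord_int lborel s (\<lambda>x. ennreal (norm (F x) powr u)) x"
    unfolding coord_int_def by (subst nn_integral_cmult[symmetric]) (auto simp: mult.commute)
  finally have "coord_int unit_int s (\<lambda>x. ennreal (norm (dif s k F x) powr u)) x
    \<le> ennreal ((2 * A) powr (u - 1)) * (ennreal (A * 2 ^ a / 2 ^ k) * coord_int lborel s (\<lambda>x. ennreal (norm (F x) powr u)) x)"
    by (auto simp: mult_left_mono)
  also have "\<dots> = ennreal (Cs u * 2 ^ a / 2 ^ k) * coord_int lborel s (\<lambda>x. ennreal (norm (F x) powr u)) x"
    using A_pos by (simp add: Cs_def mult.assoc[symmetric] flip: ennreal_mult)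
  finally show ?thesis .
qed

text \<open>Jensen's inequality for the difference of two shifted kernels, whose mass is at most
  \<open>c\<close>. The kernel is recast as a density in the coordinate \<open>s\<close>, because in
  this form it commutes with integrations in the other coordinates.\<close>

lemma rep_shift:
  assumes F: "rep a s F" and u: "1 \<le> u" and "y \<noteq> y'"
  defines "c \<equiv> A * 2 ^ a * \<bar>y - y'\<bar>"
  shows "ennreal (norm (F (vupd x s y) - F (vupd x s y')) powr u) \<le>
    ennreal (c powr (u - 1)) * coord_int (density lborel (\<lambda>z. ennreal (norm (P a (y - z) - P a (y' - z))))) s
      (\<lambda>x. ennreal (norm (F x) powr u)) x"
    and "(\<integral>\<^sup>+z. ennreal (norm (P a (y - z) - P a (y' - z))) \<partial>lborel) \<le> ennreal c"
proof -
  have [measurable]: "F \<in> borel_measurable borel" using F by (rule rep_measurable)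
  obtain B where B: "\<And>x. norm (F x) \<le> B" using rep_bounded[OF F] by auto
  show le: "(\<integral>\<^sup>+z. ennreal (norm (P a (y - z) - P a (y' - z))) \<partial>lborel) \<le> ennreal c"
    using P_shift_diff[of y' y a] P_shift_diff[of y y' a]
    by (cases "y' \<le> y") (auto simp: c_def norm_minus_commute abs_if)
  have c: "c > 0" using A_pos \<open>y \<noteq> y'\<close> by (simp add: c_def)
  have ki: "integrable lborel (\<lambda>z. P a (y - z) - P a (y' - z))"
    using le by (auto simp: integrable_iff_bounded intro: le_less_trans)
  have kn: "(\<integral>z. norm (P a (y - z) - P a (y' - z)) \<partial>lborel) \<le> c"
    using le c by (subst (asm) nn_integral_eq_integral) (use ki in \<open>auto simp: ennreal_le_iff\<close>)
  have "F (vupd x s y) - F (vupd x s y') = (\<integral>z. F (vupd x s z) * (P a (y - z) - P a (y' - z)) \<partial>lborel)"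
    by (rule rep_diff[OF F])
  then show "ennreal (norm (F (vupd x s y) - F (vupd x s y')) powr u) \<le>
    ennreal (c powr (u - 1)) * coord_int (density lborel (\<lambda>z. ennreal (norm (P a (y - z) - P a (y' - z))))) s
      (\<lambda>x. ennreal (norm (F x) powr u)) x"
    using jensen_powr[of "\<lambda>z. F (vupd x s z)" lborel "\<lambda>z. P a (y - z) - P a (y' - z)" c B u] ki kn c B u
    unfolding coord_int_def by (subst nn_integral_density) (auto simp: mult.commute)
qed

end

section \<open>A one-dimensional Jawerth embedding\<close>

lemma two_powr_neg_less_1: "\<theta> > 0 \<Longrightarrow> (2::real) powr (- \<theta>) < 1"
  using powr_less_mono[of "- \<theta>" 0 "2::real"] by simp

text \<open>A geometric sum is controlled by its first term, and for the least index in
  \<open>I\<close> the hypothesis gives that term the size \<open>z powr \<theta>\<close>.\<close>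

lemma sum_dyadic_powr_le:
  fixes \<theta> z :: real
  assumes "finite I" "\<theta> > 0" "\<And>a. a \<in> I \<Longrightarrow> 1 / 2 ^ a \<le> z"
  shows "(\<Sum>a\<in>I. 2 powr (- real a * \<theta>)) \<le> z powr \<theta> / (1 - 2 powr (- \<theta>))"
proof (cases "I = {}")
  case True
  have "(2::real) powr (- \<theta>) \<le> 1" using two_powr_neg_less_1[OF assms(2)] by simp
  then show ?thesis using True by (simp add: zero_le_divide_iff)
next
  case False
  define r where "r = (2::real) powr (- \<theta>)"
  have r: "0 < r" "r < 1" unfolding r_def using assms(2) by (auto simp: powr_less_one)
  have eq: "2 powr (- real a * \<theta>) = r ^ a" for a
    unfolding r_def by (simp add: powr_realpow[symmetric] powr_powr mult.commute)
  define m where "m = Min I"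
  have m: "m \<in> I" "\<And>a. a \<in> I \<Longrightarrow> m \<le> a" using assms(1) False by (auto simp: m_def)
  have "(\<Sum>a\<in>I. r ^ a) = (\<Sum>a\<in>(\<lambda>a. a - m) ` I. r ^ (a + m))"
    using m(2) by (subst sum.reindex) (auto simp: inj_on_def o_def dest!: m(2) dest: le_add_diff_inverse)
  also have "\<dots> = r ^ m * (\<Sum>a\<in>(\<lambda>a. a - m) ` I. r ^ a)"
    by (simp add: power_add sum_distrib_left mult.commute)
  also have "\<dots> \<le> r ^ m * (1 / (1 - r))"
  proof (intro mult_left_mono)
    have "summable (\<lambda>n. r ^ n)" using r by (auto intro: summable_geometric)
    then have "(\<Sum>a\<in>(\<lambda>a. a - m) ` I. r ^ a) \<le> (\<Sum>n. r ^ n)"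
      using r assms(1) by (intro sum_le_suminf) auto
    then show "(\<Sum>a\<in>(\<lambda>a. a - m) ` I. r ^ a) \<le> 1 / (1 - r)"
      using r by (simp add: suminf_geometric)
  qed (use r in auto)
  also have "r ^ m = (1 / 2 ^ m) powr \<theta>"
    unfolding eq[symmetric] by (simp add: powr_divide powr_realpow[symmetric] powr_powr powr_minus_divide)
  also have "\<dots> * (1 / (1 - r)) \<le> z powr \<theta> * (1 / (1 - r))"
    using assms(2) assms(3)[OF m(1)] r by (intro mult_right_mono powr_mono2) auto
  finally show ?thesis unfolding eq by (simp add: r_def)
qed

lemma nn_integral_int_shift:
  "(\<integral>\<^sup>+b. f (b + c) \<partial>count_space (UNIV :: int set)) = (\<integral>\<^sup>+b. f b \<partial>count_space UNIV)"
  by (rule nn_integral_bij_count_space) (auto intro!: bij_betwI[of _ _ _ "\<lambda>b. b - c"])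

text \<open>A geometric series descending from the largest power of 2 below \<open>w\<close>.
  Integrated over a variable, it is the dyadic form of the layer cake formula.\<close>

lemma dyadic_levels_le:
  fixes w :: ennreal
  shows "(\<integral>\<^sup>+b. ennreal (2 powr real_of_int b) * indicator {b. ennreal (2 powr b) < w} b \<partial>count_space UNIV) \<le> 2 * w"
proof (cases w)
  case (real r)
  show ?thesis
  proof (cases "r = 0")
    case True
    then show ?thesis using real by (simp add: indicator_def)
  next
    case False
    then have r: "r > 0" using real by simp
    define n where "n = \<lceil>log 2 r\<rceil>"
    have iff: "ennreal (2 powr b) < w \<longleftrightarrow> b < n" for b :: int
    proof -
      have "ennreal (2 powr b) < w \<longleftrightarrow> 2 powr b < r" using real by (simp add: ennreal_less_iff)
      also have "\<dots> \<longleftrightarrow> real_of_int b < log 2 r" using r by (simp add: less_log_iff)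
      also have "\<dots> \<longleftrightarrow> b < n" by (simp add: n_def less_ceiling_iff)
      finally show ?thesis .
    qed
    have "(\<integral>\<^sup>+b. ennreal (2 powr real_of_int b) * indicator {b. ennreal (2 powr b) < w} b \<partial>count_space UNIV)
       = (\<integral>\<^sup>+b. ennreal (2 powr real_of_int b) \<partial>count_space {..<n})"
      by (subst nn_integral_count_space_indicator) (auto simp: iff indicator_def intro!: nn_integral_cong)
    also have "\<dots> = (\<integral>\<^sup>+i. ennreal (2 powr real_of_int (n - 1 - int i)) \<partial>count_space UNIV)"
      by (rule nn_integral_bij_count_space[symmetric])
         (auto intro!: bij_betwI[of _ _ _ "\<lambda>b. nat (n - 1 - b)"])
    also have "\<dots> = (\<Sum>i. ennreal (2 powr real_of_int (n - 1 - int i)))"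
      by (rule nn_integral_count_space_nat)
    also have "(\<lambda>i. ennreal (2 powr real_of_int (n - 1 - int i))) = (\<lambda>i. ennreal (2 powr (real_of_int n - 1) * (1/2) ^ i))"
      by (auto simp: fun_eq_iff powr_diff powr_realpow power_divide)
    also have "(\<Sum>i. ennreal (2 powr (real_of_int n - 1) * (1/2) ^ i)) = ennreal (2 powr (real_of_int n - 1) * 2)"
      using sums_mult[OF geometric_sums[of "1/2::real"], of "2 powr (real_of_int n - 1)"]
      by (intro suminf_ennreal_eq) auto
    also have "\<dots> \<le> ennreal (2 * r)"
    proof (intro ennreal_leI)
      have "real_of_int (n - 1) \<le> log 2 r" unfolding n_def by linarith
      then have "2 powr (real_of_int n - 1) \<le> r" using r by (simp add: le_log_iff)
      then show "2 powr (real_of_int n - 1) * 2 \<le> 2 * r" by simp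
    qed
    finally show ?thesis using real by (simp add: ennreal_mult)
  qed
qed simp

text \<open>16 is 8 from comparing the heights \<open>b + 1\<close> and \<open>b - 2\<close>, times
  2 from \<open>dyadic_levels_le\<close>; \<open>4 * A\<close> is the reciprocal of the length of
  the flat interval at scale 1; the denominator belongs to the geometric sum over the
  levels.\<close>

definition CJ :: "real \<Rightarrow> real \<Rightarrow> real" where
  "CJ A u = 16 * (4 * A) powr (1 - 1 / u) / (1 - 2 powr (- (1 - 1 / u)))"

lemma CJ_pos: "A > 0 \<Longrightarrow> u > 1 \<Longrightarrow> CJ A u > 0"
  unfolding CJ_def by (auto intro!: divide_pos_pos simp: powr_less_one field_simps)

text \<open>Here \<^term>\<open>v a\<close> is the \<open>u\<close>-th power of the function of interest.  The hypothesis \<open>flat\<close> says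
  that near a point where it is large this function stays large on an interval of length comparable
  to \<open>2\<^bsup>-a\<^esup>\<close>.\<close>

lemma jawerth_scalar:
  fixes v :: "nat \<Rightarrow> real \<Rightarrow> ennreal" and g :: "real \<Rightarrow> ennreal" and A u c :: real
  assumes vm [measurable]: "\<And>a. v a \<in> borel_measurable borel" and gm [measurable]: "g \<in> borel_measurable borel"
    and A: "A > 0" and u: "u > 1"
    and flat: "\<And>a m y y'. m \<ge> 0 \<Longrightarrow> (\<And>z. v a z \<le> ennreal (m powr u)) \<Longrightarrow>
        ennreal ((m / 2) powr u) \<le> v a y \<Longrightarrow> \<bar>y' - y\<bar> \<le> 1 / (8 * A * 2 ^ a) \<Longrightarrow> ennreal ((m / 4) powr u) \<le> v a y'"
    and dom: "\<And>a t y. t > 0 \<Longrightarrow> ennreal (t powr u) < v a y \<Longrightarrow> ennreal (2 ^ a * t) < g y"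
    and bnd: "\<And>a. \<exists>B. \<forall>y. v a y \<le> ennreal B"
    and int: "(\<integral>\<^sup>+y. g y \<partial>lborel) \<le> ennreal c" and c: "c \<ge> 0"
  shows "\<exists>X. (\<forall>a. X a \<ge> 0) \<and> (\<forall>a\<le>M. (\<integral>\<^sup>+y. v a y \<partial>lborel) \<le> ennreal (X a powr u)) \<and>
     (\<Sum>a\<le>M. 2 powr (real a / u) * X a) \<le> CJ A u * c"
proof -
  \<comment> \<open>The supremum of the function whose u-th power is \<open>v a\<close>.\<close>
  define m where "m a = enn2real (SUP y. v a y) powr (1 / u)" for a
  have m0: "m a \<ge> 0" for a by (simp add: m_def)
  have mu: "ennreal (m a powr u) = (SUP y. v a y)" for a
  proof -
    obtain B where B: "\<And>y. v a y \<le> ennreal B" using bnd[of a] by auto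
    have "(SUP y. v a y) \<le> ennreal B" by (intro SUP_least B)
    then have "(SUP y. v a y) < top" using ennreal_less_top le_less_trans by blast
    then show ?thesis using u by (simp add: m_def powr_powr)
  qed
  have v_le: "v a y \<le> ennreal (m a powr u)" for a y
    unfolding mu by (intro SUP_upper) auto
  \<comment> \<open>The distribution function of \<open>g\<close> at dyadic heights; the whole proof
    compares the blocks with it.\<close>
  define \<mu> where "\<mu> b = emeasure lborel {y. ennreal (2 powr real_of_int b) < g y}" for b
  have \<mu>_sum: "(\<integral>\<^sup>+b. ennreal (2 powr real_of_int b) * \<mu> b \<partial>count_space UNIV) \<le> ennreal (2 * c)"
  proof -
    have "(\<integral>\<^sup>+b. ennreal (2 powr real_of_int b) * \<mu> b \<partial>count_space UNIV)
      = (\<integral>\<^sup>+b. \<integral>\<^sup>+y. ennreal (2 powr real_of_int b) * indicator {y. ennreal (2 powr real_of_int b) < g y} y \<partial>lborel \<partial>count_space UNIV)"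
      unfolding \<mu>_def by (intro nn_integral_cong) (simp add: nn_integral_cmult_indicator)
    also have "\<dots> = (\<integral>\<^sup>+y. \<integral>\<^sup>+b. ennreal (2 powr real_of_int b) * indicator {y. ennreal (2 powr real_of_int b) < g y} y \<partial>count_space UNIV \<partial>lborel)"
      by (intro nn_integral_count_space_nn_integral[symmetric]) auto
    also have "\<dots> \<le> (\<integral>\<^sup>+y. 2 * g y \<partial>lborel)"
      using dyadic_levels_le by (intro nn_integral_mono) (simp add: indicator_def)
    also have "\<dots> \<le> 2 * ennreal c" using int by (simp add: nn_integral_cmult mult_left_mono)
    finally show ?thesis using c by (simp add: ennreal_mult)
  qed
  have \<mu>_fin: "\<mu> b < top" for b
  proof -
    have "ennreal (2 powr real_of_int b) * \<mu> b \<le> ennreal (2 * c)"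
      by (rule order_trans[OF nn_integral_ge_point \<mu>_sum]) simp
    then have "ennreal (2 powr real_of_int b) * \<mu> b < top" using ennreal_less_top le_less_trans by blast
    then show ?thesis by (auto simp: ennreal_mult_less_top)
  qed
  define r where "r b = enn2real (\<mu> b)" for b
  have \<mu>_eq: "\<mu> b = ennreal (r b)" and r0: "r b \<ge> 0" for b
    using \<mu>_fin[of b] by (auto simp: r_def)
  have r_mono: "r b \<le> r b'" if "b' \<le> b" for b b'
  proof -
    have "2 powr real_of_int b' \<le> 2 powr real_of_int b" using that by simp
    then have "\<mu> b \<le> \<mu> b'" unfolding \<mu>_def
      by (intro emeasure_mono subsetI CollectI) (erule CollectE, erule le_less_trans[OF ennreal_leI], simp_all)
    then show ?thesis using r0[of b'] by (simp add: \<mu>_eq)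
  qed
  \<comment> \<open>A bound for the L_u norm of the part of the block with values between 2^b and
    2^(b+1): by \<open>dom\<close>, \<open>g\<close> exceeds 2^(a+b) there. The cutoff at the
    supremum \<open>m a\<close> is essential, since it is what restricts the levels contributing at
    a given height of \<open>g\<close>.\<close>
  define x where "x a b = (if 2 powr real_of_int b < m a then 2 powr (real_of_int b + 1) * r (int a + b) powr (1 / u) else 0)" for a b
  have x0: "x a b \<ge> 0" for a b by (simp add: x_def)
  have xu: "ennreal (2 powr ((real_of_int b + 1) * u)) * emeasure lborel {y. ennreal (2 powr (real_of_int b * u)) < v a y} \<le> ennreal (x a b powr u)" for a b
  proof (cases "2 powr real_of_int b < m a")
    case True
    have "{y. ennreal (2 powr (real_of_int b * u)) < v a y} \<subseteq> {y. ennreal (2 powr real_of_int (int a + b)) < g y}"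
      using dom[of "2 powr real_of_int b" a] by (auto simp: powr_powr powr_add powr_realpow)
    then have "emeasure lborel {y. ennreal (2 powr (real_of_int b * u)) < v a y} \<le> \<mu> (int a + b)"
      unfolding \<mu>_def by (intro emeasure_mono) auto
    then have "ennreal (2 powr ((real_of_int b + 1) * u)) * emeasure lborel {y. ennreal (2 powr (real_of_int b * u)) < v a y} \<le> ennreal (2 powr ((real_of_int b + 1) * u)) * ennreal (r (int a + b))"
      by (intro mult_left_mono) (auto simp: \<mu>_eq)
    also have "\<dots> = ennreal (x a b powr u)"
      using True u r0 by (simp add: x_def powr_mult powr_powr ennreal_mult')
    finally show ?thesis .
  next
    case False
    then have "m a powr u \<le> 2 powr (real_of_int b * u)"
      using m0 u powr_mono2[of u "m a" "2 powr real_of_int b"] by (simp add: powr_powr)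
    then have "{y. ennreal (2 powr (real_of_int b * u)) < v a y} = {}"
      using v_le[of a] by (auto simp: not_less intro: order_trans ennreal_leI)
    then show ?thesis by simp
  qed
  have vint: "(\<integral>\<^sup>+y. v a y \<partial>lborel) \<le> (\<integral>\<^sup>+b. ennreal (x a b powr u) \<partial>count_space UNIV)" for a
  proof -
    have "v a y \<le> (\<integral>\<^sup>+b. ennreal (2 powr ((real_of_int b + 1) * u)) * indicator {y. ennreal (2 powr (real_of_int b * u)) < v a y} y \<partial>count_space UNIV)" for y
    proof (cases "v a y = 0")
      case False
      have "v a y < top" using v_le[of a y] ennreal_less_top le_less_trans by blast
      then obtain w where w: "v a y = ennreal w" "w \<ge> 0" by (cases "v a y") auto
      then have w0: "w > 0" using False by (cases "w = 0") auto
      \<comment> \<open>The ceiling minus 1 makes the lower inequality strict, as the level sets are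
        defined by a strict inequality.\<close>
      define b where "b = \<lceil>log 2 w / u\<rceil> - 1"
      have "real_of_int b < log 2 w / u" "log 2 w / u \<le> real_of_int b + 1" unfolding b_def by linarith+
      then have "real_of_int b * u < log 2 w" "log 2 w \<le> (real_of_int b + 1) * u" using u by (auto simp: field_simps)
      then have "2 powr (real_of_int b * u) < w" "w \<le> 2 powr ((real_of_int b + 1) * u)"
        using w0 by (auto simp: less_log_iff log_le_iff)
      then have "v a y \<le> ennreal (2 powr ((real_of_int b + 1) * u)) * indicator {y. ennreal (2 powr (real_of_int b * u)) < v a y} y"
        using w by (simp add: ennreal_leI ennreal_less_iff)
      also have "\<dots> \<le> (\<integral>\<^sup>+b. ennreal (2 powr ((real_of_int b + 1) * u)) * indicator {y. ennreal (2 powr (real_of_int b * u)) < v a y} y \<partial>count_space UNIV)"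
        by (rule nn_integral_ge_point) simp
      finally show ?thesis .
    qed simp
    then have "(\<integral>\<^sup>+y. v a y \<partial>lborel) \<le> (\<integral>\<^sup>+y. \<integral>\<^sup>+b. ennreal (2 powr ((real_of_int b + 1) * u)) * indicator {y. ennreal (2 powr (real_of_int b * u)) < v a y} y \<partial>count_space UNIV \<partial>lborel)"
      by (intro nn_integral_mono) auto
    also have "\<dots> = (\<integral>\<^sup>+b. \<integral>\<^sup>+y. ennreal (2 powr ((real_of_int b + 1) * u)) * indicator {y. ennreal (2 powr (real_of_int b * u)) < v a y} y \<partial>lborel \<partial>count_space UNIV)"
      by (intro nn_integral_count_space_nn_integral) auto
    also have "\<dots> \<le> (\<integral>\<^sup>+b. ennreal (x a b powr u) \<partial>count_space UNIV)"
      using xu by (intro nn_integral_mono) (simp add: nn_integral_cmult_indicator)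
    finally show ?thesis .
  qed
  define S where "S a = (\<integral>\<^sup>+b. ennreal (x a b) \<partial>count_space UNIV)" for a
  define \<theta> where "\<theta> = 1 - 1 / u"
  have \<theta>: "\<theta> > 0" using u by (simp add: \<theta>_def)
  define K where "K = (4 * A) powr \<theta> / (1 - 2 powr (- \<theta>))"
  have K0: "K \<ge> 0" unfolding K_def using two_powr_neg_less_1[OF \<theta>] by (intro divide_nonneg_nonneg) auto
  \<comment> \<open>If the block of level \<open>a\<close> exceeds 2^(b-a) somewhere, flatness keeps
    it above a quarter of its supremum on an interval of length 1/(4 A 2^a), where
    \<open>dom\<close> forces \<open>g\<close> above 2^(b-2). So the measure of that set of
    \<open>g\<close> is at least a multiple of 2^-a, and only levels with 2^-a small enough
    occur.\<close>
  have low: "1 / 2 ^ a \<le> 4 * A * r (b - 2)" if "2 powr real_of_int (b - int a) < m a" for a b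
  proof -
    have mp: "m a > 0" using that by (rule less_trans[rotated]) simp
    have "(m a / 2) powr u < m a powr u" using mp u by (intro powr_less_mono2) auto
    then have "ennreal ((m a / 2) powr u) < (SUP y. v a y)" unfolding mu[symmetric] by (simp add: ennreal_less_iff)
    then obtain y where y: "ennreal ((m a / 2) powr u) < v a y" by (auto simp: less_SUP_iff)
    define h where "h = 1 / (8 * A * 2 ^ a)"
    have h: "h > 0" using A by (simp add: h_def)
    have "{y - h..y + h} \<subseteq> {y. ennreal (2 powr real_of_int (b - 2)) < g y}"
    proof
      fix y' assume "y' \<in> {y - h..y + h}"
      then have "\<bar>y' - y\<bar> \<le> h" by (auto simp: abs_if)
      then have 1: "ennreal ((m a / 4) powr u) \<le> v a y'"
        using flat[of "m a" a y y'] m0 v_le y by (auto simp: h_def)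
      define t where "t = 2 powr real_of_int (b - int a) / 4"
      have t: "t > 0" by (simp add: t_def)
      have "t powr u < (m a / 4) powr u" using that t u by (intro powr_less_mono2) (auto simp: t_def)
      then have "ennreal (t powr u) < v a y'" using 1 by (intro less_le_trans[OF _ 1]) (simp add: ennreal_less_iff)
      then have "ennreal (2 ^ a * t) < g y'" using dom t by blast
      moreover have "2 ^ a * t = 2 powr real_of_int (b - 2)"
        by (simp add: t_def powr_diff powr_realpow)
      ultimately show "y' \<in> {y. ennreal (2 powr real_of_int (b - 2)) < g y}" by simp
    qed
    then have "emeasure lborel {y - h..y + h} \<le> \<mu> (b - 2)"
      unfolding \<mu>_def by (intro emeasure_mono) auto
    then have "2 * h \<le> r (b - 2)" using h r0 by (simp add: \<mu>_eq)
    then show ?thesis using A by (simp add: h_def field_simps)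
  qed
  have Sle: "(\<Sum>a\<le>M. ennreal (2 powr (real a / u)) * S a) \<le> ennreal (CJ A u * c)"
  proof -
    \<comment> \<open>The shift by \<open>a\<close> makes \<open>b\<close> the height of
      \<open>g\<close> instead of that of the block. The levels can then be summed at a fixed
      height.\<close>
    have "ennreal (2 powr (real a / u)) * S a = (\<integral>\<^sup>+b. ennreal (2 powr (real a / u) * x a (b - int a)) \<partial>count_space UNIV)" for a
    proof -
      have "S a = (\<integral>\<^sup>+b. ennreal (x a (b - int a)) \<partial>count_space UNIV)"
        unfolding S_def using nn_integral_int_shift[of "\<lambda>b. ennreal (x a b)" "- int a"] by simp
      then show ?thesis using x0 by (simp add: ennreal_mult nn_integral_cmult)
    qed
    then have "(\<Sum>a\<le>M. ennreal (2 powr (real a / u)) * S a) = (\<integral>\<^sup>+b. (\<Sum>a\<le>M. ennreal (2 powr (real a / u) * x a (b - int a))) \<partial>count_space UNIV)"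
      by (simp add: nn_integral_sum)
    also have "\<dots> \<le> (\<integral>\<^sup>+b. ennreal (8 * K) * (ennreal (2 powr real_of_int (b + - 2)) * \<mu> (b + - 2)) \<partial>count_space UNIV)"
    proof (intro nn_integral_mono)
      fix b
      define I where "I = {a\<in>{..M}. 2 powr real_of_int (b - int a) < m a}"
      have "(\<Sum>a\<le>M. 2 powr (real a / u) * x a (b - int a)) = (\<Sum>a\<in>I. 2 powr (real a / u) * x a (b - int a))"
        unfolding I_def by (rule sum.mono_neutral_right) (auto simp: x_def)
      also have "\<dots> = (\<Sum>a\<in>I. 2 powr (real_of_int b + 1) * r b powr (1/u) * 2 powr (- real a * \<theta>))"
      proof (intro sum.cong refl)
        fix a assume "a \<in> I"
        then have "x a (b - int a) = 2 powr (real_of_int b - real a + 1) * r b powr (1/u)"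
          by (simp add: x_def I_def)
        moreover have "2 powr (real a / u) * 2 powr (real_of_int b - real a + 1) = 2 powr (real_of_int b + 1) * 2 powr (- real a * \<theta>)"
          by (simp add: \<theta>_def flip: powr_add) (simp add: algebra_simps)
        ultimately show "2 powr (real a / u) * x a (b - int a) = 2 powr (real_of_int b + 1) * r b powr (1/u) * 2 powr (- real a * \<theta>)"
          by (simp add: ac_simps)
      qed
      also have "\<dots> = 2 powr (real_of_int b + 1) * r b powr (1/u) * (\<Sum>a\<in>I. 2 powr (- real a * \<theta>))"
        by (simp add: sum_distrib_left)
      \<comment> \<open>By \<open>low\<close> the geometric sum is at most a multiple of a power
        \<theta> of the distribution function. Together with the power 1/u already present this is
        its first power, which is summable over the heights because \<open>g\<close> is
        integrable.\<close>
      also have "\<dots> \<le> 2 powr (real_of_int b + 1) * r (b - 2) powr (1/u) * ((4 * A * r (b - 2)) powr \<theta> / (1 - 2 powr (- \<theta>)))"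
      proof -
        have "(\<Sum>a\<in>I. 2 powr (- real a * \<theta>)) \<le> (4 * A * r (b - 2)) powr \<theta> / (1 - 2 powr (- \<theta>))"
          by (rule sum_dyadic_powr_le) (use \<theta> low in \<open>auto simp: I_def\<close>)
        moreover have "r b powr (1/u) \<le> r (b - 2) powr (1/u)"
          using u r0 r_mono[of "b - 2" b] by (intro powr_mono2) auto
        ultimately show ?thesis
          by (intro mult_mono mult_nonneg_nonneg sum_nonneg) auto
      qed
      also have "\<dots> = 2 powr (real_of_int b + 1) * K * (r (b - 2) powr (1/u) * r (b - 2) powr \<theta>)"
        using A r0 by (simp add: K_def powr_mult)
      also have "r (b - 2) powr (1/u) * r (b - 2) powr \<theta> = r (b - 2)"
        using r0[of "b - 2"] by (simp add: \<theta>_def flip: powr_add)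
      also have "2 powr (real_of_int b + 1) * K * r (b - 2) = 8 * K * (2 powr real_of_int (b + -2) * r (b + -2))"
        by (simp add: powr_add powr_diff)
      finally have "(\<Sum>a\<le>M. 2 powr (real a / u) * x a (b - int a)) \<le> 8 * K * (2 powr real_of_int (b + -2) * r (b + -2))" .
      then have "ennreal (\<Sum>a\<le>M. 2 powr (real a / u) * x a (b - int a)) \<le> ennreal (8 * K * (2 powr real_of_int (b + -2) * r (b + -2)))"
        by (rule ennreal_leI)
      then show "(\<Sum>a\<le>M. ennreal (2 powr (real a / u) * x a (b - int a))) \<le> ennreal (8 * K) * (ennreal (2 powr real_of_int (b + - 2)) * \<mu> (b + - 2))"
        using K0 r0 x0 by (simp add: \<mu>_eq sum_ennreal ennreal_mult del: sum_ennreal) (simp add: sum_ennreal[symmetric] ennreal_mult)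
    qed
    also have "\<dots> = ennreal (8 * K) * (\<integral>\<^sup>+b. (ennreal (2 powr real_of_int (b + - 2)) * \<mu> (b + - 2)) \<partial>count_space UNIV)"
      by (rule nn_integral_cmult) simp
    also have "(\<integral>\<^sup>+b. (ennreal (2 powr real_of_int (b + - 2)) * \<mu> (b + - 2)) \<partial>count_space UNIV) = (\<integral>\<^sup>+b. (ennreal (2 powr real_of_int b) * \<mu> b) \<partial>count_space UNIV)"
      by (rule nn_integral_int_shift)
    also have "ennreal (8 * K) * \<dots> \<le> ennreal (8 * K) * ennreal (2 * c)"
      by (intro mult_left_mono \<mu>_sum) auto
    also have "\<dots> = ennreal (CJ A u * c)"
    proof -
      have "8 * K * (2 * c) = CJ A u * c" by (simp add: CJ_def K_def \<theta>_def)
      moreover have "ennreal (8 * K) * ennreal (2 * c) = ennreal (8 * K * (2 * c))"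
        using K0 c by (intro ennreal_mult[symmetric]) auto
      ultimately show ?thesis by (simp only:)
    qed
    finally show ?thesis .
  qed
  define X where "X a = (if a \<le> M then enn2real (S a) else 0)" for a
  have S_fin: "S a = ennreal (X a)" if "a \<le> M" for a
  proof -
    have "ennreal (2 powr (real a / u)) * S a \<le> (\<Sum>a\<le>M. ennreal (2 powr (real a / u)) * S a)"
      using that by (intro member_le_sum) auto
    then have "ennreal (2 powr (real a / u)) * S a < top" using Sle ennreal_less_top le_less_trans by (metis order_trans)
    then have "S a < top" by (auto simp: ennreal_mult_less_top)
    then show ?thesis using that by (simp add: X_def)
  qed
  have X0: "X a \<ge> 0" for a by (simp add: X_def)
  show ?thesis
  proof (intro exI[of _ X] conjI allI impI)
    show "X a \<ge> 0" for a by (rule X0)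
    have "ennreal (\<Sum>a\<le>M. 2 powr (real a / u) * X a) = (\<Sum>a\<le>M. ennreal (2 powr (real a / u)) * S a)"
      using X0 by (subst sum_ennreal[symmetric]) (auto simp: S_fin ennreal_mult intro!: sum.cong)
    with Sle have "ennreal (\<Sum>a\<le>M. 2 powr (real a / u) * X a) \<le> ennreal (CJ A u * c)" by simp
    moreover have "0 \<le> CJ A u * c" using CJ_pos[OF A u] c by simp
    ultimately show "(\<Sum>a\<le>M. 2 powr (real a / u) * X a) \<le> CJ A u * c"
      by (simp only: ennreal_le_iff)
    fix a assume a: "a \<le> M"
    have "x a b \<le> X a" for b
    proof -
      have "ennreal (x a b) \<le> S a" unfolding S_def by (rule nn_integral_ge_point) simp
      then show ?thesis using a X0 by (simp add: S_fin)
    qed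
    \<comment> \<open>No \<open>x a b\<close> exceeds the sum \<open>X a\<close>, so the l_u norm
      over the heights is at most the l_1 norm.\<close>
    then have "x a b powr u \<le> X a powr (u - 1) * x a b" for b
    proof -
      have "x a b powr u = x a b powr (u - 1) * x a b"
        using x0[of a b] by (cases "x a b = 0") (auto simp: powr_diff)
      also have "\<dots> \<le> X a powr (u - 1) * x a b"
        using \<open>\<And>b. x a b \<le> X a\<close>[of b] x0 u by (intro mult_right_mono powr_mono2) auto
      finally show ?thesis .
    qed
    then have "(\<integral>\<^sup>+b. ennreal (x a b powr u) \<partial>count_space UNIV) \<le> (\<integral>\<^sup>+b. ennreal (X a powr (u - 1)) * ennreal (x a b) \<partial>count_space UNIV)"
      using x0 by (intro nn_integral_mono) (simp add: ennreal_leI flip: ennreal_mult)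
    also have "\<dots> = ennreal (X a powr (u - 1)) * S a"
      unfolding S_def by (rule nn_integral_cmult) simp
    also have "\<dots> = ennreal (X a powr u)"
      using X0[of a] a by (cases "X a = 0") (auto simp: S_fin powr_diff simp flip: ennreal_mult)
    finally show "(\<integral>\<^sup>+y. v a y \<partial>lborel) \<le> ennreal (X a powr u)"
      using vint[of a] by (rule order_trans[rotated])
  qed
qed

section \<open>Estimates carried through all coordinates\<close>

lemma iter_unit_int_const: "iter_int unit_int ss (\<lambda>_. c) = (\<lambda>_. c)"
proof (induction ss)
  case (Cons s ss)
  have "emeasure unit_int UNIV = 1"
    unfolding unit_int_def by (simp add: emeasure_density)
  then have "(\<integral>\<^sup>+t. c \<partial>unit_int) = c"
    by (simp add: unit_int_def)
  then show ?case by (simp add: Cons coord_int_def fun_eq_iff)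
qed simp

text \<open>The triangle inequality in L_u, by convexity with weights proportional to the bounds
  \<open>Y i\<close>. These may vanish, so each is raised by \<open>e > 0\<close>, and
  \<open>e\<close> tends to 0 at the end.\<close>

lemma minkowski_iter:
  fixes w :: "'i \<Rightarrow> real^'d \<Rightarrow> complex"
  assumes N: "sf_borel N" and "finite I" and w: "\<And>i. i \<in> I \<Longrightarrow> w i \<in> borel_measurable borel"
    and Y: "\<And>i. i \<in> I \<Longrightarrow> Y i \<ge> 0" and u: "u \<ge> 1" and l: "l \<ge> 0"
    and le: "\<And>i. i \<in> I \<Longrightarrow> iter_int N ss (\<lambda>x. ennreal (norm (w i x) powr u)) x \<le> ennreal (Y i powr u * l)"
  shows "iter_int N ss (\<lambda>x. ennreal (norm (\<Sum>i\<in>I. w i x) powr u)) x \<le> ennreal ((\<Sum>i\<in>I. Y i) powr u * l)"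
proof (cases "I = {}")
  case True
  have "iter_int N ss (\<lambda>x. 0 :: ennreal) = (\<lambda>x. 0)" by (induction ss) (auto simp: coord_int_def)
  then show ?thesis using True by simp
next
  case False
  define n where "n = real (card I)"
  have *: "iter_int N ss (\<lambda>x. ennreal (norm (\<Sum>i\<in>I. w i x) powr u)) x \<le> ennreal (((\<Sum>i\<in>I. Y i) + n * e) powr u * l)"
    if e: "e > 0" for e
  proof -
    define Z where "Z i = Y i + e" for i
    have Z: "Z i > 0" if "i \<in> I" for i using Y[OF that] e by (simp add: Z_def)
    define S where "S = sum Z I"
    have S: "S > 0" unfolding S_def using Z False \<open>finite I\<close> by (intro sum_pos) auto
    have "norm (\<Sum>i\<in>I. w i x) powr u \<le> (\<Sum>i\<in>I. (Z i / S) powr (1 - u) * norm (w i x) powr u)" for x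
    proof -
      have "norm (\<Sum>i\<in>I. w i x) powr u \<le> (\<Sum>i\<in>I. norm (w i x)) powr u"
        using u by (intro powr_mono2 norm_sum) auto
      also have "\<dots> \<le> (\<Sum>i\<in>I. (Z i / S) powr (1 - u) * norm (w i x) powr u)"
        using \<open>finite I\<close> u Z S by (intro powr_sum_weighted) (auto simp: S_def simp flip: sum_divide_distrib)
      finally show ?thesis .
    qed
    then have "iter_int N ss (\<lambda>x. ennreal (norm (\<Sum>i\<in>I. w i x) powr u)) x
      \<le> iter_int N ss (\<lambda>x. \<Sum>i\<in>I. ennreal ((Z i / S) powr (1 - u)) * ennreal (norm (w i x) powr u)) x"
      by (intro iter_int_mono) (simp add: ennreal_leI flip: ennreal_mult)
    also have "\<dots> = (\<Sum>i\<in>I. ennreal ((Z i / S) powr (1 - u)) * iter_int N ss (\<lambda>x. ennreal (norm (w i x) powr u)) x)"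
      using w by (subst iter_int_sum[OF N _ \<open>finite I\<close>]) (auto intro!: sum.cong simp: iter_int_cmult[OF N])
    also have "\<dots> \<le> (\<Sum>i\<in>I. ennreal ((Z i / S) powr (1 - u)) * ennreal (Z i powr u * l))"
    proof (intro sum_mono mult_left_mono)
      fix i assume i: "i \<in> I"
      have "Y i powr u * l \<le> Z i powr u * l"
        using u Y[OF i] e l by (intro mult_right_mono powr_mono2) (auto simp: Z_def)
      then show "iter_int N ss (\<lambda>x. ennreal (norm (w i x) powr u)) x \<le> ennreal (Z i powr u * l)"
        using le[OF i] ennreal_leI order_trans by blast
    qed simp
    also have "\<dots> = ennreal (\<Sum>i\<in>I. (Z i / S) powr (1 - u) * (Z i powr u * l))"
      using l by (subst sum_ennreal[symmetric]) (auto simp: ennreal_mult intro!: sum.cong)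
    also have "(\<Sum>i\<in>I. (Z i / S) powr (1 - u) * (Z i powr u * l)) = (\<Sum>i\<in>I. Z i * (S powr (u - 1) * l))"
    proof (intro sum.cong refl)
      fix i assume i: "i \<in> I"
      have "(Z i / S) powr (1 - u) = Z i powr (1 - u) * S powr (u - 1)"
        using Z[OF i] S by (simp add: powr_divide powr_diff)
      moreover have "Z i powr (1 - u) * Z i powr u = Z i"
        using Z[OF i] by (simp flip: powr_add)
      ultimately show "(Z i / S) powr (1 - u) * (Z i powr u * l) = Z i * (S powr (u - 1) * l)"
        by (metis (no_types, opaque_lifting) mult.assoc mult.commute)
    qed
    also have "\<dots> = S * (S powr (u - 1) * l)"
      by (simp only: S_def sum_distrib_right)
    also have "\<dots> = S powr u * l"
      using S by (simp add: powr_diff)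
    also have "S = (\<Sum>i\<in>I. Y i) + n * e"
      by (simp add: S_def Z_def sum.distrib n_def)
    finally show ?thesis .
  qed
  have Y0: "0 \<le> (\<Sum>i\<in>I. Y i)" using Y by (intro sum_nonneg) auto
  have n0: "n \<ge> 0" by (simp add: n_def)
  have "((\<lambda>e. ((\<Sum>i\<in>I. Y i) + n * e) powr u * l) \<longlongrightarrow> ((\<Sum>i\<in>I. Y i) + n * 0) powr u * l) (at_right 0)"
  proof (intro tendsto_mult tendsto_powr' tendsto_add tendsto_const tendsto_ident_at disjI2 conjI)
    show "\<forall>\<^sub>F e in at_right 0. 0 \<le> (\<Sum>i\<in>I. Y i) + n * e"
      using Y0 n0 by (auto simp: eventually_at intro!: exI[of _ 1])
  qed (use u in auto)
  then have "((\<lambda>e. ennreal (((\<Sum>i\<in>I. Y i) + n * e) powr u * l)) \<longlongrightarrow> ennreal ((\<Sum>i\<in>I. Y i) powr u * l)) (at_right 0)"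
    by (auto dest: tendsto_ennrealI)
  then show ?thesis
    by (rule tendsto_lowerbound) (use * in \<open>auto simp: eventually_at intro!: exI[of _ 1]\<close>)
qed

text \<open>The recursion over the list follows that of \<open>difs\<close> and
  \<open>iter_int\<close>, so that an induction can treat the frequency sum, the difference and the
  integral of one coordinate together.\<close>

fun partial_box_sum :: "nat \<Rightarrow> 'd list \<Rightarrow> (('d \<Rightarrow> nat) \<Rightarrow> real^'d \<Rightarrow> complex) \<Rightarrow> ('d \<Rightarrow> nat) \<Rightarrow> real^'d \<Rightarrow> complex" where
  "partial_box_sum M [] f j = f j"
| "partial_box_sum M (s # ss) f j = (\<lambda>x. \<Sum>a\<le>M. partial_box_sum M ss f (fun_upd j s a) x)"

context kernels
begin

text \<open>Schur's test in one coordinate after the other: differences in the remaining coordinates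
  preserve \<open>rep\<close>, and the integrals commute. This is the estimate of a single block in
  the \<open>B\<close>-case.\<close>

lemma difs_bound:
  assumes u: "1 \<le> u" and "distinct ss" and "\<And>s. s \<in> set ss \<Longrightarrow> rep (j s) s f"
    and fm: "f \<in> borel_measurable borel"
  shows "iter_int unit_int ss (\<lambda>x. ennreal (norm (difs k ss f x) powr u)) x
    \<le> ennreal (\<Prod>s\<in>set ss. Cs u * 2 ^ j s / 2 ^ k s) * iter_int lborel ss (\<lambda>x. ennreal (norm (f x) powr u)) x"
  using assms(2,3)
proof (induction ss arbitrary: x)
  case (Cons s ss)
  note [measurable] = fm difs_measurable[OF fm]
  have F: "rep (j s) s (difs k ss f)" using Cons.prems by (intro rep_difs) auto
  let ?C = "Cs u * 2 ^ j s / 2 ^ k s"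
  let ?D = "\<Prod>s\<in>set ss. Cs u * 2 ^ j s / 2 ^ k s"
  have C0: "?C \<ge> 0" "?D \<ge> 0" using Cs_pos[of u] by (auto intro!: prod_nonneg)
  have "iter_int unit_int (s # ss) (\<lambda>x. ennreal (norm (difs k (s # ss) f x) powr u)) x
    = iter_int unit_int ss (coord_int unit_int s (\<lambda>x. ennreal (norm (dif s (k s) (difs k ss f) x) powr u))) x"
    using Cons.prems by (simp add: coord_iter_commute)
  also have "\<dots> \<le> iter_int unit_int ss (\<lambda>x. ennreal ?C * coord_int lborel s (\<lambda>x. ennreal (norm (difs k ss f x) powr u)) x) x"
    by (intro iter_int_mono schur_dif F u)
  also have "\<dots> = ennreal ?C * iter_int unit_int ss (coord_int lborel s (\<lambda>x. ennreal (norm (difs k ss f x) powr u))) x"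
    by (subst iter_int_cmult) (auto intro!: coord_int_measurable)
  also have "\<dots> = ennreal ?C * coord_int lborel s (iter_int unit_int ss (\<lambda>x. ennreal (norm (difs k ss f x) powr u))) x"
    using Cons.prems by (simp add: coord_iter_commute)
  also have "\<dots> \<le> ennreal ?C * coord_int lborel s (\<lambda>x. ennreal ?D * iter_int lborel ss (\<lambda>x. ennreal (norm (f x) powr u)) x) x"
    using Cons by (intro mult_left_mono coord_int_mono) auto
  also have "\<dots> = ennreal ?C * (ennreal ?D * iter_int lborel (s # ss) (\<lambda>x. ennreal (norm (f x) powr u)) x)"
    by (subst coord_int_cmult) (auto intro!: iter_int_measurable)
  also have "\<dots> = ennreal (\<Prod>s\<in>set (s # ss). Cs u * 2 ^ j s / 2 ^ k s) * iter_int lborel (s # ss) (\<lambda>x. ennreal (norm (f x) powr u)) x"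
    using C0 Cons.prems by (simp add: mult.assoc[symmetric] ennreal_mult del: times_divide_eq_left)
  finally show ?case .
qed simp

text \<open>The coordinate \<open>s\<close> is not summed over, so all terms have the frequency
  \<open>j s\<close> in it and share one reproducing kernel.\<close>

lemma rep_partial_box_sum:
  "(\<And>j s. rep (j s) s (f j)) \<Longrightarrow> s \<notin> set ss \<Longrightarrow> rep (j s) s (partial_box_sum M ss f j)"
proof (induction ss arbitrary: j)
  case (Cons r ss)
  have "rep (j s) s (partial_box_sum M ss f (fun_upd j r a))" for a
  proof -
    have "rep (fun_upd j r a s) s (partial_box_sum M ss f (fun_upd j r a))"
      by (rule Cons.IH) (use Cons.prems in auto)
    moreover have "fun_upd j r a s = j s" using Cons.prems by auto
    ultimately show ?thesis by (simp only:)
  qed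
  then show ?case by (auto intro!: rep_sum)
qed simp

lemma partial_box_sum_measurable:
  "(\<And>j. f j \<in> borel_measurable borel) \<Longrightarrow> partial_box_sum M ss f j \<in> borel_measurable borel"
  by (induction ss arbitrary: j) auto

text \<open>A Bernstein inequality for slices: regarded as elements of L_u in the coordinates
  \<open>ss\<close>, the slices of \<open>F\<close> at \<open>y\<close> and \<open>y'\<close> differ
  by at most A 2^a |y - y'| times the largest slice norm, which is the u-th root of
  \<open>W\<close>.\<close>

lemma iter_shift_bound:
  assumes F: "rep a s F" and s: "s \<notin> set ss" and u: "1 \<le> u"
    and W: "\<And>z. iter_int unit_int ss (\<lambda>x. ennreal (norm (F x) powr u)) (vupd x s z) \<le> ennreal W" "W \<ge> 0"
  shows "iter_int unit_int ss (\<lambda>x. ennreal (norm (F (vupd x s y) - F (vupd x s y')) powr u)) x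
     \<le> ennreal ((A * 2 ^ a * \<bar>y - y'\<bar>) powr u * W)"
proof (cases "y = y'")
  case True
  then show ?thesis by (simp add: iter_unit_int_const)
next
  case False
  have [measurable]: "F \<in> borel_measurable borel" using F by (rule rep_measurable)
  define c where "c = A * 2 ^ a * \<bar>y - y'\<bar>"
  have c: "c > 0" using A_pos False by (simp add: c_def)
  define N where "N = density lborel (\<lambda>z. ennreal (norm (P a (y - z) - P a (y' - z))))"
  have N: "sf_borel N" unfolding N_def by (intro sf_borel_density) auto
  have NU: "emeasure N UNIV \<le> ennreal c"
    using rep_shift(2)[OF F u False] by (simp add: N_def emeasure_density c_def)
  have "iter_int unit_int ss (\<lambda>x. ennreal (norm (F (vupd x s y) - F (vupd x s y')) powr u)) x
    \<le> iter_int unit_int ss (\<lambda>x. ennreal (c powr (u - 1)) * coord_int N s (\<lambda>x. ennreal (norm (F x) powr u)) x) x"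
    unfolding N_def c_def by (intro iter_int_mono rep_shift(1) F u False)
  also have "\<dots> = ennreal (c powr (u - 1)) * coord_int N s (iter_int unit_int ss (\<lambda>x. ennreal (norm (F x) powr u))) x"
    using N s by (subst iter_int_cmult) (auto intro!: coord_int_measurable simp: coord_iter_commute)
  also have "\<dots> \<le> ennreal (c powr (u - 1)) * (\<integral>\<^sup>+z. ennreal W \<partial>N)"
    unfolding coord_int_def by (intro mult_left_mono nn_integral_mono W) auto
  also have "\<dots> = ennreal (c powr (u - 1)) * (ennreal W * emeasure N UNIV)"
    using sf_borelD(2)[OF N] by (simp add: N_def)
  also have "\<dots> \<le> ennreal (c powr (u - 1)) * (ennreal W * ennreal c)"
    by (intro mult_left_mono NU) auto
  also have "\<dots> = ennreal (c powr u * W)"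
    using c W by (simp add: powr_diff flip: ennreal_mult)
  finally show ?thesis by (simp add: c_def)
qed

text \<open>Over the distance 1/(8 A 2^a) the slice norm changes by at most an eighth of its upper
  bound. Half of that bound therefore leaves at least a quarter; the loss in adding u-th powers fits
  into the gap. This supplies the hypothesis \<open>flat\<close> of
  \<open>jawerth_scalar\<close>.\<close>

lemma iter_flat:
  assumes F: "rep a s F" and s: "s \<notin> set ss" and u: "1 < u"
    and W: "\<And>z. iter_int unit_int ss (\<lambda>x. ennreal (norm (F x) powr u)) (vupd x s z) \<le> ennreal W" "W \<ge> 0"
    and y: "ennreal ((1/2) powr u * W) \<le> iter_int unit_int ss (\<lambda>x. ennreal (norm (F x) powr u)) (vupd x s y)"
    and y': "\<bar>y' - y\<bar> \<le> 1 / (8 * A * 2 ^ a)"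
  shows "ennreal ((1/4) powr u * W) \<le> iter_int unit_int ss (\<lambda>x. ennreal (norm (F x) powr u)) (vupd x s y')"
proof -
  have [measurable]: "F \<in> borel_measurable borel" using F by (rule rep_measurable)
  let ?J = "\<lambda>y. iter_int unit_int ss (\<lambda>x. ennreal (norm (F x) powr u)) (vupd x s y)"
  have J: "?J y = iter_int unit_int ss (\<lambda>x. ennreal (norm (F (vupd x s y)) powr u)) x" for y
    by (rule iter_int_vupd[OF s])
  let ?c = "ennreal (2 powr (u - 1))"
  let ?E = "iter_int unit_int ss (\<lambda>x. ennreal (norm (F (vupd x s y) - F (vupd x s y')) powr u)) x"
  have "A * 2 ^ a * \<bar>y - y'\<bar> \<le> 1 / 8"
    using y' A_pos by (simp add: field_simps abs_minus_commute)
  then have "(A * 2 ^ a * \<bar>y - y'\<bar>) powr u \<le> (1 / 8) powr u"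
    using u A_pos by (intro powr_mono2) auto
  then have E: "?E \<le> ennreal ((1 / 8) powr u * W)"
    using iter_shift_bound[OF F s _ W, of y y'] u W(2)
    by (meson ennreal_leI less_imp_le mult_right_mono order_trans)
  have pw: "norm (F (vupd x s y)) powr u \<le> 2 powr (u - 1) * (norm (F (vupd x s y')) powr u + norm (F (vupd x s y) - F (vupd x s y')) powr u)" for x
  proof -
    have "norm (F (vupd x s y)) \<le> norm (F (vupd x s y')) + norm (F (vupd x s y) - F (vupd x s y'))"
      using norm_triangle_ineq[of "F (vupd x s y')" "F (vupd x s y) - F (vupd x s y')"] by simp
    then have "norm (F (vupd x s y)) powr u \<le> (norm (F (vupd x s y')) + norm (F (vupd x s y) - F (vupd x s y'))) powr u"
      using u by (intro powr_mono2) auto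
    also have "\<dots> \<le> 2 powr (u - 1) * (norm (F (vupd x s y')) powr u + norm (F (vupd x s y) - F (vupd x s y')) powr u)"
      using u by (intro powr_add_le) auto
    finally show ?thesis .
  qed
  have "?J y \<le> iter_int unit_int ss (\<lambda>x. ?c * (ennreal (norm (F (vupd x s y')) powr u) + ennreal (norm (F (vupd x s y) - F (vupd x s y')) powr u))) x"
    unfolding J by (intro iter_int_mono)
      (use pw in \<open>simp add: ennreal_leI flip: ennreal_mult ennreal_plus\<close>)
  also have "\<dots> = ?c * (?J y' + ?E)"
    unfolding J by (subst iter_int_cmult) (auto simp: iter_int_add)
  also have "\<dots> \<le> ?c * (?J y' + ennreal ((1 / 8) powr u * W))"
    by (intro mult_left_mono add_left_mono E) auto
  finally have le: "ennreal ((1/2) powr u * W) \<le> ?c * (?J y' + ennreal ((1 / 8) powr u * W))"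
    using y by (rule order_trans[rotated])
  have "?J y' < top" using W(1)[of y'] ennreal_less_top le_less_trans by blast
  then obtain r where r: "?J y' = ennreal r" "r \<ge> 0" by (cases "?J y'") auto
  have "ennreal ((1/2) powr u * W) \<le> ennreal (2 powr (u - 1) * (r + (1 / 8) powr u * W))"
    using le r W(2) by (simp flip: ennreal_mult ennreal_plus)
  then have "(1/2) powr u * W \<le> 2 powr (u - 1) * (r + (1 / 8) powr u * W)"
    using r W(2) by (subst (asm) ennreal_le_iff) auto
  then have "2 powr (1 - u) * ((1/2) powr u * W) \<le> 2 powr (1 - u) * (2 powr (u - 1) * (r + (1 / 8) powr u * W))"
    by (intro mult_left_mono) auto
  moreover have "2 powr (1 - u) * (2 powr (u - 1) * (r + (1 / 8) powr u * W)) = r + (1 / 8) powr u * W"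
    by (simp add: mult.assoc[symmetric] flip: powr_add)
  moreover have "2 powr (1 - u) * ((1/2) powr u * W) = 2 * ((1/4) powr u * W)"
  proof -
    have "(1/4::real) powr u = (1/2) powr u * (1/2) powr u" by (simp flip: powr_mult)
    moreover have "2 powr (1 - u) = 2 * (1/2) powr u" by (simp add: powr_diff powr_divide)
    ultimately show ?thesis by simp
  qed
  moreover have "(1/8) powr u * W \<le> (1/4) powr u * W"
    using u W(2) by (intro mult_right_mono powr_mono2) auto
  ultimately have "(1/4) powr u * W \<le> r" by linarith
  then show ?thesis by (simp add: r ennreal_leI)
qed

text \<open>The exponent records the coordinates that have not been sampled yet.\<close>

lemma jawerth_iter:
  fixes f :: "('d \<Rightarrow> nat) \<Rightarrow> real^'d \<Rightarrow> complex"
  assumes u: "1 < u" and "distinct ss" and f: "\<And>j s. rep (j s) s (f j)"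
    and Gm: "G \<in> borel_measurable borel"
    and G: "\<And>j x. ennreal (2 ^ (\<Sum>s\<in>UNIV. j s) * norm (f j x)) \<le> G x"
    and c: "c \<ge> 0" and le: "iter_int lborel ss G x \<le> ennreal c"
  shows "iter_int unit_int ss (\<lambda>x. ennreal (norm (difs k ss (partial_box_sum M ss f j) x) powr u)) x
    \<le> ennreal (((Cs u powr (1 / u) * CJ A u) ^ length ss / 2 ^ (\<Sum>s\<in>- set ss. j s) * c) powr u / 2 ^ (\<Sum>s\<in>set ss. k s))"
  using \<open>distinct ss\<close> c le
proof (induction ss arbitrary: j x c)
  case Nil
  have "ennreal (2 ^ (\<Sum>s\<in>UNIV. j s) * norm (f j x)) \<le> ennreal c"
    by (rule order_trans[OF G]) (use Nil in simp)
  then have "norm (f j x) \<le> 1 / 2 ^ (\<Sum>s\<in>UNIV. j s) * c"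
    using Nil by (subst (asm) ennreal_le_iff) (auto simp: field_simps)
  then show ?case using u by (auto intro!: ennreal_leI powr_mono2)
next
  case (Cons s ss)
  define D where "D = Cs u powr (1 / u) * CJ A u"
  have D: "D > 0" unfolding D_def using Cs_pos[of u] CJ_pos[OF A_pos u] by simp
  have sss: "s \<notin> set ss" "distinct ss" using Cons.prems by auto
  define F where "F a = difs k ss (partial_box_sum M ss f (fun_upd j s a))" for a
  have F: "rep a s (F a)" for a
    unfolding F_def using rep_partial_box_sum[OF f sss(1), of "fun_upd j s a" M] rep_difs[OF _ sss(1)] by simp
  have fm: "f j \<in> borel_measurable borel" for j using f rep_measurable by blast
  have Fm[measurable]: "F a \<in> borel_measurable borel" for a by (rule rep_measurable[OF F])
  define J where "J a = iter_int unit_int ss (\<lambda>x. ennreal (norm (F a x) powr u))" for a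
  have Jm[measurable]: "J a \<in> borel_measurable borel" for a unfolding J_def by (intro iter_int_measurable) auto
  define \<kappa> where "\<kappa> = D ^ length ss / 2 ^ (\<Sum>s\<in>- set (s # ss). j s)"
  have \<kappa>: "\<kappa> > 0" using D by (simp add: \<kappa>_def)
  define lam where "lam = 1 / (2::real) ^ (\<Sum>s\<in>set ss. k s)"
  have lam: "lam > 0" by (simp add: lam_def)
  \<comment> \<open>The majorant for \<open>jawerth_scalar\<close>: the other coordinates are
    integrated, the coordinate \<open>s\<close> is frozen at \<open>y\<close>.\<close>
  define g where "g y = iter_int lborel ss G (vupd x s y)" for y
  have gm: "g \<in> borel_measurable borel"
    unfolding g_def using iter_int_measurable[OF _ Gm, of lborel ss] by measurable
  have sum_j: "(\<Sum>r\<in>- set ss. fun_upd j s a r) = a + (\<Sum>s\<in>- set (s # ss). j s)" for a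
  proof -
    have "- set ss = insert s (- set (s # ss))" using sss by auto
    then show ?thesis by (simp add: sum.insert)
  qed
  \<comment> \<open>The bound \<open>c'\<close> may depend on \<open>y\<close>. The factor 2^-a
    appears because \<open>s\<close>, with frequency \<open>a\<close>, now counts among the
    coordinates not yet sampled.\<close>
  have IH: "J a (vupd x s y) \<le> ennreal ((\<kappa> * c' / 2 ^ a) powr u * lam)" if "c' \<ge> 0" "g y \<le> ennreal c'" for a y c'
    using Cons.IH[OF sss(2) that(1), of "vupd x s y" "fun_upd j s a"] that(2)
    unfolding g_def J_def F_def sum_j D_def[symmetric]
    by (simp add: lam_def \<kappa>_def power_add mult_ac divide_simps del: fun_upd_apply)
  \<comment> \<open>Dividing by \<open>\<rho>\<close> normalizes the induction hypothesis: where
    \<open>g y\<close> is at most \<open>c'\<close>, the u-th root of \<open>v a y\<close> is at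
    most c'/2^a.\<close>
  define \<rho> where "\<rho> = \<kappa> powr u * lam"
  have \<rho>: "\<rho> > 0" using \<kappa> lam by (simp add: \<rho>_def)
  define v where "v a y = ennreal (1 / \<rho>) * J a (vupd x s y)" for a y
  have vm: "v a \<in> borel_measurable borel" for a unfolding v_def by measurable
  have vJ: "J a (vupd x s y) = ennreal \<rho> * v a y" for a y
    unfolding v_def using \<rho> by (simp add: mult.assoc[symmetric] flip: ennreal_mult)
  have vle: "v a y \<le> ennreal w \<longleftrightarrow> J a (vupd x s y) \<le> ennreal (\<rho> * w)" if "w \<ge> 0" for a y w
  proof
    assume "v a y \<le> ennreal w"
    then show "J a (vupd x s y) \<le> ennreal (\<rho> * w)" unfolding vJ using \<rho> that by (simp add: ennreal_mult mult_left_mono)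
  next
    assume "J a (vupd x s y) \<le> ennreal (\<rho> * w)"
    then have "v a y \<le> ennreal (1 / \<rho>) * ennreal (\<rho> * w)" unfolding v_def by (intro mult_left_mono) auto
    then show "v a y \<le> ennreal w" using \<rho> that by (simp flip: ennreal_mult)
  qed
  have lev: "ennreal w \<le> v a y \<longleftrightarrow> ennreal (\<rho> * w) \<le> J a (vupd x s y)" if "w \<ge> 0" for a y w
  proof
    assume "ennreal w \<le> v a y"
    then show "ennreal (\<rho> * w) \<le> J a (vupd x s y)" unfolding vJ using \<rho> that by (simp add: ennreal_mult mult_left_mono)
  next
    assume "ennreal (\<rho> * w) \<le> J a (vupd x s y)"
    then have "ennreal (1 / \<rho>) * ennreal (\<rho> * w) \<le> v a y" unfolding v_def by (intro mult_left_mono) auto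
    then show "ennreal w \<le> v a y" using \<rho> that by (simp flip: ennreal_mult)
  qed
  have "\<exists>X. (\<forall>a. X a \<ge> 0) \<and> (\<forall>a\<le>M. (\<integral>\<^sup>+y. v a y \<partial>lborel) \<le> ennreal (X a powr u)) \<and>
     (\<Sum>a\<le>M. 2 powr (real a / u) * X a) \<le> CJ A u * c"
  proof (rule jawerth_scalar[where g=g, OF _ gm A_pos u])
    show "v a \<in> borel_measurable borel" for a by (rule vm)
  next
    fix a m y y' assume m: "m \<ge> 0" and b: "\<And>z. v a z \<le> ennreal (m powr u)"
      and h: "ennreal ((m / 2) powr u) \<le> v a y" and d: "\<bar>y' - y\<bar> \<le> 1 / (8 * A * 2 ^ a)"
    have "ennreal ((1/4) powr u * (\<rho> * m powr u)) \<le> J a (vupd x s y')"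
      unfolding J_def
    proof (rule iter_flat[OF F sss(1) u _ _ _ d])
      show "iter_int unit_int ss (\<lambda>x. ennreal (norm (F a x) powr u)) (vupd x s z) \<le> ennreal (\<rho> * m powr u)" for z
        using b[of z] vle[of "m powr u" a z] by (simp add: J_def)
      show "0 \<le> \<rho> * m powr u" using \<rho> by simp
      show "ennreal ((1/2) powr u * (\<rho> * m powr u)) \<le> iter_int unit_int ss (\<lambda>x. ennreal (norm (F a x) powr u)) (vupd x s y)"
      proof -
        have "\<rho> * (m / 2) powr u = (1/2) powr u * (\<rho> * m powr u)"
          using m powr_mult[of "1/2" m u] by simp
        then show ?thesis using h lev[of "(m / 2) powr u" a y] by (simp only: J_def powr_ge_zero)
      qed
    qed
    moreover have "\<rho> * (m / 4) powr u = (1/4) powr u * (\<rho> * m powr u)"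
      using m powr_mult[of "1/4" m u] by simp
    ultimately show "ennreal ((m / 4) powr u) \<le> v a y'"
      by (simp only: lev powr_ge_zero)
  next
    fix a t y assume t: "t > 0" and h: "ennreal (t powr u) < v a y"
    \<comment> \<open>The contrapositive of \<open>IH\<close> with
      \<open>c' = 2 ^ a * t\<close>.\<close>
    show "ennreal (2 ^ a * t) < g y"
    proof (rule ccontr)
      assume "\<not> ennreal (2 ^ a * t) < g y"
      then have "J a (vupd x s y) \<le> ennreal ((\<kappa> * (2 ^ a * t) / 2 ^ a) powr u * lam)"
        using t by (intro IH) auto
      also have "(\<kappa> * (2 ^ a * t) / 2 ^ a) powr u * lam = \<rho> * t powr u"
        using \<kappa> t by (simp add: \<rho>_def powr_mult)
      finally have "v a y \<le> ennreal (t powr u)" using vle by simp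
      then show False using h by simp
    qed
  next
    fix a
    obtain B where B: "B > 0" "\<And>x. norm (F a x) \<le> B" using rep_bounded[OF F] by blast
    have "J a (vupd x s y) \<le> ennreal (B powr u)" for y
    proof -
      have "J a (vupd x s y) \<le> iter_int unit_int ss (\<lambda>x. ennreal (B powr u)) (vupd x s y)"
        unfolding J_def using B u by (intro iter_int_mono ennreal_leI powr_mono2) auto
      then show ?thesis by (simp add: iter_unit_int_const)
    qed
    then have "\<forall>y. v a y \<le> ennreal (B powr u / \<rho>)" using \<rho> by (subst vle) auto
    then show "\<exists>B. \<forall>y. v a y \<le> ennreal B" by blast
  next
    show "(\<integral>\<^sup>+y. g y \<partial>lborel) \<le> ennreal c" using Cons.prems by (simp add: g_def coord_int_def)
  qed (use Cons.prems in auto)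
  then obtain X where X0: "\<And>a. X a \<ge> 0" and Xint: "\<And>a. a \<le> M \<Longrightarrow> (\<integral>\<^sup>+y. v a y \<partial>lborel) \<le> ennreal (X a powr u)"
    and Xsum: "(\<Sum>a\<le>M. 2 powr (real a / u) * X a) \<le> CJ A u * c" by blast
  \<comment> \<open>Schur's test in the coordinate \<open>s\<close> costs
    \<open>Cs u * 2 ^ a\<close> in the u-th power, hence the weight 2^(a/u), precisely the one that
    \<open>jawerth_scalar\<close> can sum.\<close>
  define Y where "Y a = Cs u powr (1 / u) * \<kappa> * (2 powr (real a / u) * X a)" for a
  have Y0: "Y a \<ge> 0" for a unfolding Y_def using \<kappa> X0 by simp
  have "iter_int unit_int (s # ss) (\<lambda>x. ennreal (norm (dif s (k s) (F a) x) powr u)) x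
      \<le> ennreal (Y a powr u * (lam / 2 ^ k s))" if "a \<le> M" for a
  proof -
    have "iter_int unit_int (s # ss) (\<lambda>x. ennreal (norm (dif s (k s) (F a) x) powr u)) x
      = iter_int unit_int ss (coord_int unit_int s (\<lambda>x. ennreal (norm (dif s (k s) (F a) x) powr u))) x"
      using sss by (simp add: coord_iter_commute)
    also have "\<dots> \<le> iter_int unit_int ss (\<lambda>x. ennreal (Cs u * 2 ^ a / 2 ^ k s) * coord_int lborel s (\<lambda>x. ennreal (norm (F a x) powr u)) x) x"
      using u by (intro iter_int_mono schur_dif F) auto
    also have "\<dots> = ennreal (Cs u * 2 ^ a / 2 ^ k s) * coord_int lborel s (J a) x"
      unfolding J_def using sss by (subst iter_int_cmult) (auto intro!: coord_int_measurable simp: coord_iter_commute)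
    also have "coord_int lborel s (J a) x = ennreal \<rho> * (\<integral>\<^sup>+y. v a y \<partial>lborel)"
      unfolding coord_int_def vJ using vm by (intro nn_integral_cmult) auto
    also have "\<dots> \<le> ennreal \<rho> * ennreal (X a powr u)"
      using that by (intro mult_left_mono Xint) auto
    also have "ennreal (Cs u * 2 ^ a / 2 ^ k s) * (ennreal \<rho> * ennreal (X a powr u)) = ennreal (Cs u * 2 ^ a / 2 ^ k s * (\<rho> * X a powr u))"
      using Cs_pos[of u] \<rho> by (simp flip: ennreal_mult)
    also have "Cs u * 2 ^ a / 2 ^ k s * (\<rho> * X a powr u) = Y a powr u * (lam / 2 ^ k s)"
      using Cs_pos[of u] \<kappa> X0[of a] u by (simp add: Y_def \<rho>_def powr_mult powr_powr powr_realpow)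
    finally show ?thesis by (simp add: mult_left_mono)
  qed
  then have "iter_int unit_int (s # ss) (\<lambda>x. ennreal (norm (\<Sum>a\<in>{..M}. dif s (k s) (F a) x) powr u)) x
      \<le> ennreal ((\<Sum>a\<in>{..M}. Y a) powr u * (lam / 2 ^ k s))"
    using u lam Y0 by (intro minkowski_iter) (auto intro!: dif_measurable)
  also have "\<dots> \<le> ennreal ((D * \<kappa> * c) powr u * (lam / 2 ^ k s))"
  proof (intro ennreal_leI mult_right_mono powr_mono2)
    have "(\<Sum>a\<in>{..M}. Y a) = Cs u powr (1 / u) * \<kappa> * (\<Sum>a\<le>M. 2 powr (real a / u) * X a)"
      by (simp add: Y_def sum_distrib_left)
    also have "\<dots> \<le> Cs u powr (1 / u) * \<kappa> * (CJ A u * c)"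
      using \<kappa> by (intro mult_left_mono Xsum) auto
    finally show "(\<Sum>a\<in>{..M}. Y a) \<le> D * \<kappa> * c" by (simp add: D_def mult_ac)
  qed (use u lam Y0 in \<open>auto intro: sum_nonneg\<close>)
  also have "(D * \<kappa> * c) powr u * (lam / 2 ^ k s) = (D ^ length (s # ss) / 2 ^ (\<Sum>s\<in>- set (s # ss). j s) * c) powr u / 2 ^ (\<Sum>s\<in>set (s # ss). k s)"
    using sss by (simp add: \<kappa>_def lam_def power_add mult_ac)
  finally show ?case
    by (simp add: difs_sum F_def D_def dif_sum)
qed

end

section \<open>Sums of functions that are constant on dyadic cells\<close>

lemma dyad_le: "dyad a t \<le> t"
  unfolding dyad_def by (simp add: pos_divide_le_eq mult.commute)

lemma dyad_gt: "t < dyad a t + 1 / 2 ^ a"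
proof -
  have "2 ^ a * t < of_int \<lfloor>2 ^ a * t\<rfloor> + 1" by linarith
  then show ?thesis unfolding dyad_def by (simp add: field_simps)
qed

lemma dyad_nonneg: "t \<ge> 0 \<Longrightarrow> dyad a t \<ge> 0"
  unfolding dyad_def by simp

lemma dyad_upper: "t < 1 \<Longrightarrow> dyad a t + 1 / 2 ^ a \<le> 1"
proof -
  assume "t < 1"
  then have "2 ^ a * t < 2 ^ a" by simp
  then have "\<lfloor>2 ^ a * t\<rfloor> < 2 ^ a" by (simp add: floor_less_iff)
  then have "\<lfloor>2 ^ a * t\<rfloor> + 1 \<le> 2 ^ a" by linarith
  then have "of_int (\<lfloor>2 ^ a * t\<rfloor> + 1) \<le> (of_int (2 ^ a) :: real)" by (simp only: of_int_le_iff)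
  then have "of_int \<lfloor>2 ^ a * t\<rfloor> + 1 \<le> (2 ^ a :: real)" by simp
  then show ?thesis unfolding dyad_def by (simp add: field_simps)
qed

lemma dyad_cell: "dyad a t \<le> z \<Longrightarrow> z < dyad a t + 1 / 2 ^ a \<Longrightarrow> dyad a z = dyad a t"
proof -
  assume "dyad a t \<le> z" "z < dyad a t + 1 / 2 ^ a"
  then have "of_int \<lfloor>2 ^ a * t\<rfloor> \<le> 2 ^ a * z" "2 ^ a * z < of_int \<lfloor>2 ^ a * t\<rfloor> + 1"
    unfolding dyad_def by (auto simp: field_simps)
  then have "\<lfloor>2 ^ a * z\<rfloor> = \<lfloor>2 ^ a * t\<rfloor>" by (simp add: floor_eq_iff)
  then show ?thesis by (simp add: dyad_def)
qed

lemma dyad_dyad: "dyad a (dyad a t) = dyad a t"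
  by (rule dyad_cell) auto

lemma dyad_pred_dyad: "dyad (a - 1) (dyad a t) = dyad (a - 1) t"
proof (cases a)
  case (Suc b)
  have "\<lfloor>2 ^ b * dyad a t\<rfloor> = \<lfloor>2 ^ b * t\<rfloor>"
  proof -
    have 1: "2 ^ b * dyad a t = of_int \<lfloor>2 * (2 ^ b * t)\<rfloor> / 2"
      unfolding dyad_def Suc by (simp add: field_simps)
    have "2 * \<lfloor>2 ^ b * t\<rfloor> \<le> \<lfloor>2 * (2 ^ b * t)\<rfloor>" "\<lfloor>2 * (2 ^ b * t)\<rfloor> \<le> 2 * \<lfloor>2 ^ b * t\<rfloor> + 1"
      by linarith+
    then have "real_of_int (2 * \<lfloor>2 ^ b * t\<rfloor>) \<le> of_int \<lfloor>2 * (2 ^ b * t)\<rfloor>"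
      "of_int \<lfloor>2 * (2 ^ b * t)\<rfloor> \<le> real_of_int (2 * \<lfloor>2 ^ b * t\<rfloor> + 1)"
      by (simp_all only: of_int_le_iff)
    then show ?thesis unfolding 1 by (intro floor_unique) simp_all
  qed
  then show ?thesis by (simp add: dyad_def Suc)
qed (simp add: dyad_dyad)

text \<open>Moving the coordinate \<open>s\<close> to the left end of its cell changes nothing; the
  cells are thus half-open intervals.\<close>

definition cell_const :: "'d \<Rightarrow> nat \<Rightarrow> (real^'d \<Rightarrow> 'b) \<Rightarrow> bool" where
  "cell_const s a F \<longleftrightarrow> (\<forall>x. F (vupd x s (dyad a (x $ s))) = F x)"

lemma cell_const_dif: "cell_const s a (dif s a h)"
  by (simp add: cell_const_def dif_def dyad_dyad dyad_pred_dyad[simplified])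

lemma cell_const_dif_other:
  assumes F: "cell_const s a F" and "r \<noteq> s"
  shows "cell_const s a (dif r b F)"
proof -
  have "F (vupd (vupd x s (dyad a (x $ s))) r t) = F (vupd x r t)" for x t
  proof -
    have "F (vupd (vupd x r t) s (dyad a (vupd x r t $ s))) = F (vupd x r t)"
      using F unfolding cell_const_def by blast
    then show ?thesis using \<open>r \<noteq> s\<close> by (simp add: vupd_commute[of s r])
  qed
  then show ?thesis using \<open>r \<noteq> s\<close> by (simp add: cell_const_def dif_def)
qed

lemma cell_const_difs: "distinct ss \<Longrightarrow> s \<in> set ss \<Longrightarrow> cell_const s (k s) (difs k ss h)"
  by (induction ss) (auto intro: cell_const_dif cell_const_dif_other)

lemma cell_const_comp: "cell_const s a F \<Longrightarrow> cell_const s a (\<lambda>x. f (F x))"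
  by (simp add: cell_const_def)

lemma cell_const_coord_int:
  assumes F: "cell_const s a F" and "r \<noteq> s"
  shows "cell_const s a (coord_int N r F)"
proof -
  have "F (vupd (vupd x s (dyad a (x $ s))) r t) = F (vupd x r t)" for x t
  proof -
    have "F (vupd (vupd x r t) s (dyad a (vupd x r t $ s))) = F (vupd x r t)"
      using F unfolding cell_const_def by blast
    then show ?thesis using \<open>r \<noteq> s\<close> by (simp add: vupd_commute[of s r])
  qed
  then show ?thesis by (simp add: cell_const_def coord_int_def)
qed

lemma cell_const_iter_int: "cell_const s a F \<Longrightarrow> s \<notin> set ss \<Longrightarrow> cell_const s a (iter_int N ss F)"
  by (induction ss) (auto intro: cell_const_coord_int)

text \<open>The cell of \<open>x\<close> in the direction \<open>s\<close> lies inside [0,1), has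
  length 2^-a, and \<open>F\<close> equals \<open>F x\<close> throughout it, so the integral over
  this cell alone suffices.\<close>

lemma cell_const_le:
  assumes F: "cell_const s a F" and [measurable]: "F \<in> borel_measurable borel" and x: "0 \<le> x $ s" "x $ s < 1"
  shows "F x \<le> ennreal (2 ^ a) * coord_int unit_int s F x"
proof -
  define d where "d = dyad a (x $ s)"
  have "F (vupd x s t) = F x" if "t \<in> {d..<d + 1 / 2 ^ a}" for t
  proof -
    have "dyad a t = d" using that dyad_cell[of a "x $ s" t] by (simp add: d_def)
    moreover have "F (vupd (vupd x s t) s (dyad a (vupd x s t $ s))) = F (vupd x s t)"
      using F unfolding cell_const_def by blast
    moreover have "F (vupd x s (dyad a (x $ s))) = F x"
      using F unfolding cell_const_def by blast
    ultimately show ?thesis by (simp add: d_def)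
  qed
  moreover have "{d..<d + 1 / 2 ^ a} \<subseteq> {0..<1}"
    using dyad_nonneg[OF x(1), of a] dyad_upper[OF x(2), of a] by (auto simp: d_def)
  ultimately have le: "indicator {d..<d + 1 / 2 ^ a} t * F x \<le> indicator {0..<1} t * F (vupd x s t)" for t
    by (cases "t \<in> {d..<d + 1 / 2 ^ a}") (simp_all only: indicator_simps subsetD, simp_all)
  have "ennreal (1 / 2 ^ a) * F x = (\<integral>\<^sup>+t. indicator {d..<d + 1 / 2 ^ a} t * F x \<partial>lborel)"
    by (subst nn_integral_multc) auto
  also have "\<dots> \<le> coord_int unit_int s F x"
    by (subst coord_unit_int) (auto intro!: nn_integral_mono le)
  finally have "ennreal (2 ^ a) * (ennreal (1 / 2 ^ a) * F x) \<le> ennreal (2 ^ a) * coord_int unit_int s F x"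
    by (intro mult_left_mono) auto
  then show ?thesis by (simp add: mult.assoc[symmetric] flip: ennreal_mult)
qed

lemma coord_int_mult_le:
  assumes U: "cell_const s a U" "U \<in> borel_measurable borel" and W: "W \<in> borel_measurable borel"
  shows "coord_int unit_int s (\<lambda>x. U x * W x) x \<le> ennreal (2 ^ a) * (coord_int unit_int s U x * coord_int unit_int s W x)"
proof -
  note [measurable] = U(2) W
  have "coord_int unit_int s (\<lambda>x. U x * W x) x = (\<integral>\<^sup>+t. indicator {0..<1} t * (U (vupd x s t) * W (vupd x s t)) \<partial>lborel)"
    by (rule coord_unit_int) measurable
  also have "\<dots> \<le> (\<integral>\<^sup>+t. (ennreal (2 ^ a) * coord_int unit_int s U x) * (indicator {0..<1} t * W (vupd x s t)) \<partial>lborel)"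
  proof (intro nn_integral_mono)
    fix t
    have "U (vupd x s t) \<le> ennreal (2 ^ a) * coord_int unit_int s U x" if "t \<in> {0..<1}"
      using cell_const_le[OF U, of "vupd x s t"] that by (simp add: coord_int_def)
    then show "indicator {0..<1} t * (U (vupd x s t) * W (vupd x s t)) \<le> (ennreal (2 ^ a) * coord_int unit_int s U x) * (indicator {0..<1} t * W (vupd x s t))"
      by (auto simp: indicator_def intro!: mult_right_mono)
  qed
  also have "\<dots> = ennreal (2 ^ a) * coord_int unit_int s U x * coord_int unit_int s W x"
    by (subst nn_integral_cmult) (auto simp: coord_unit_int)
  finally show ?thesis by (simp add: mult.assoc)
qed

text \<open>In every coordinate the factor with the coarser cells is the one replaced by its mean,
  which costs only the minimum of the two levels. This minimum is the source of the decay away from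
  the diagonal.\<close>

lemma iter_int_mult_le:
  assumes U: "\<And>s. s \<in> set ss \<Longrightarrow> cell_const s (k s) U" "U \<in> borel_measurable borel"
    and W: "\<And>s. s \<in> set ss \<Longrightarrow> cell_const s (l s) W" "W \<in> borel_measurable borel"
    and "distinct ss"
  shows "iter_int unit_int ss (\<lambda>x. U x * W x) x
    \<le> ennreal (2 ^ (\<Sum>s\<in>set ss. min (k s) (l s))) * (iter_int unit_int ss U x * iter_int unit_int ss W x)"
  using assms(1,3,5)
proof (induction ss arbitrary: x)
  case (Cons s ss)
  let ?IU = "iter_int unit_int ss U" and ?IW = "iter_int unit_int ss W"
  let ?e = "\<Sum>s\<in>set ss. min (k s) (l s)"
  have [measurable]: "?IU \<in> borel_measurable borel" "?IW \<in> borel_measurable borel"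
    using U W by (auto intro: iter_int_measurable)
  have "coord_int unit_int s (iter_int unit_int ss (\<lambda>x. U x * W x)) x
     \<le> coord_int unit_int s (\<lambda>x. ennreal (2 ^ ?e) * (?IU x * ?IW x)) x"
    using Cons by (intro coord_int_mono) auto
  also have "\<dots> = ennreal (2 ^ ?e) * coord_int unit_int s (\<lambda>x. ?IU x * ?IW x) x"
    by (subst coord_int_cmult) auto
  also have "\<dots> \<le> ennreal (2 ^ ?e) * (ennreal (2 ^ min (k s) (l s)) * (coord_int unit_int s ?IU x * coord_int unit_int s ?IW x))"
  proof (intro mult_left_mono)
    have c: "cell_const s (k s) ?IU" "cell_const s (l s) ?IW"
      using Cons.prems by (auto intro!: cell_const_iter_int)
    show "coord_int unit_int s (\<lambda>x. ?IU x * ?IW x) x \<le> ennreal (2 ^ min (k s) (l s)) * (coord_int unit_int s ?IU x * coord_int unit_int s ?IW x)"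
      using coord_int_mult_le[OF c(1), of ?IW x] coord_int_mult_le[OF c(2), of ?IU x]
      by (cases "k s \<le> l s") (simp_all add: mult.commute min_def)
  qed simp
  also have "\<dots> = ennreal (2 ^ (\<Sum>s\<in>set (s # ss). min (k s) (l s))) * (coord_int unit_int s ?IU x * coord_int unit_int s ?IW x)"
  proof -
    have "ennreal (2 ^ ?e) * ennreal (2 ^ min (k s) (l s)) = ennreal (2 ^ (\<Sum>s\<in>set (s # ss). min (k s) (l s)))"
      using Cons.prems by (simp add: power_add mult.commute flip: ennreal_mult)
    then show ?thesis by (simp only: mult.assoc[symmetric])
  qed
  finally show ?case by simp
qed simp

section \<open>Distances of level vectors and the almost orthogonality of levels\<close>

definition idist :: "('d::finite \<Rightarrow> nat) \<Rightarrow> ('d \<Rightarrow> nat) \<Rightarrow> real" where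
  "idist k l = (\<Sum>s\<in>UNIV. \<bar>real (k s) - real (l s)\<bar>)"

lemma sum_exp_dist_1:
  fixes k :: nat assumes "\<epsilon> > 0"
  shows "(\<Sum>l\<le>M. 2 powr (- \<epsilon> * \<bar>real k - real l\<bar>)) \<le> 2 / (1 - 2 powr (- \<epsilon>))"
proof -
  define r where "r = (2::real) powr (- \<epsilon>)"
  have r: "0 < r" "r < 1" using two_powr_neg_less_1[OF assms] by (auto simp: r_def)
  have eq: "2 powr (- \<epsilon> * real n) = r ^ n" for n
    unfolding r_def by (simp add: powr_realpow[symmetric] powr_powr)
  have geo: "(\<Sum>n\<in>I. r ^ n) \<le> 1 / (1 - r)" if "finite I" for I
  proof -
    have "(\<Sum>n\<in>I. r ^ n) \<le> (\<Sum>n. r ^ n)"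
      using r that by (intro sum_le_suminf summable_geometric) auto
    then show ?thesis using r by (simp add: suminf_geometric)
  qed
  have "(\<Sum>l\<le>M. 2 powr (- \<epsilon> * \<bar>real k - real l\<bar>)) \<le>
     (\<Sum>l\<in>{l. l \<le> M \<and> l \<le> k}. 2 powr (- \<epsilon> * real (k - l))) + (\<Sum>l\<in>{l. l \<le> M \<and> k < l}. 2 powr (- \<epsilon> * real (l - k)))"
  proof -
    have "{..M} = {l. l \<le> M \<and> l \<le> k} \<union> {l. l \<le> M \<and> k < l}" by auto
    then have "(\<Sum>l\<le>M. 2 powr (- \<epsilon> * \<bar>real k - real l\<bar>)) =
      (\<Sum>l\<in>{l. l \<le> M \<and> l \<le> k}. 2 powr (- \<epsilon> * \<bar>real k - real l\<bar>)) + (\<Sum>l\<in>{l. l \<le> M \<and> k < l}. 2 powr (- \<epsilon> * \<bar>real k - real l\<bar>))"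
      by (simp only:) (rule sum.union_disjoint; auto)
    also have "(\<Sum>l\<in>{l. l \<le> M \<and> l \<le> k}. 2 powr (- \<epsilon> * \<bar>real k - real l\<bar>)) = (\<Sum>l\<in>{l. l \<le> M \<and> l \<le> k}. 2 powr (- \<epsilon> * real (k - l)))"
      by (intro sum.cong) (auto simp: of_nat_diff)
    also have "(\<Sum>l\<in>{l. l \<le> M \<and> k < l}. 2 powr (- \<epsilon> * \<bar>real k - real l\<bar>)) = (\<Sum>l\<in>{l. l \<le> M \<and> k < l}. 2 powr (- \<epsilon> * real (l - k)))"
      by (intro sum.cong) (auto simp: of_nat_diff)
    finally show ?thesis by simp
  qed
  also have "(\<Sum>l\<in>{l. l \<le> M \<and> l \<le> k}. 2 powr (- \<epsilon> * real (k - l))) = (\<Sum>n\<in>(\<lambda>l. k - l) ` {l. l \<le> M \<and> l \<le> k}. r ^ n)"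
    unfolding eq by (subst sum.reindex) (auto simp: inj_on_def)
  also have "(\<Sum>l\<in>{l. l \<le> M \<and> k < l}. 2 powr (- \<epsilon> * real (l - k))) = (\<Sum>n\<in>(\<lambda>l. l - k) ` {l. l \<le> M \<and> k < l}. r ^ n)"
    unfolding eq by (subst sum.reindex) (auto simp: inj_on_def)
  also have "(\<Sum>n\<in>(\<lambda>l. k - l) ` {l. l \<le> M \<and> l \<le> k}. r ^ n) + (\<Sum>n\<in>(\<lambda>l. l - k) ` {l. l \<le> M \<and> k < l}. r ^ n) \<le> 1 / (1 - r) + 1 / (1 - r)"
    by (intro add_mono geo) auto
  finally show ?thesis by (simp add: r_def)
qed

definition CB :: "nat \<Rightarrow> real \<Rightarrow> real" where "CB d \<epsilon> = (2 / (1 - 2 powr (- \<epsilon>))) ^ d"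

lemma CB_pos: "\<epsilon> > 0 \<Longrightarrow> CB d \<epsilon> > 0"
  unfolding CB_def using two_powr_neg_less_1[of \<epsilon>] by simp

text \<open>The finite set is enlarged to a box, where the sum factors into two-sided geometric sums
  whose bound does not depend on the centre \<open>k\<close>.\<close>

lemma sum_exp_idist:
  fixes k :: "'d::finite \<Rightarrow> nat"
  assumes "\<epsilon> > 0" "finite L"
  shows "(\<Sum>l\<in>L. 2 powr (- \<epsilon> * idist k l)) \<le> CB CARD('d) \<epsilon>"
proof -
  define M where "M = Max (insert 0 ((\<lambda>(l, s). l s) ` (L \<times> UNIV)))"
  have "l s \<le> M" if "l \<in> L" for l s
    unfolding M_def using that assms(2) by (intro Max_ge) auto
  then have "L \<subseteq> Pi\<^sub>E UNIV (\<lambda>_. {..M})" by (auto simp: PiE_def Pi_def)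
  then have "(\<Sum>l\<in>L. 2 powr (- \<epsilon> * idist k l)) \<le> (\<Sum>l\<in>Pi\<^sub>E UNIV (\<lambda>_. {..M}). 2 powr (- \<epsilon> * idist k l))"
    by (intro sum_mono2) (auto intro: finite_PiE)
  also have "\<dots> = (\<Sum>l\<in>Pi\<^sub>E UNIV (\<lambda>_. {..M}). \<Prod>s\<in>UNIV. 2 powr (- \<epsilon> * \<bar>real (k s) - real (l s)\<bar>))"
    by (simp add: idist_def sum_distrib_left powr_sum)
  also have "\<dots> = (\<Prod>s\<in>UNIV. \<Sum>l\<le>M. 2 powr (- \<epsilon> * \<bar>real (k s) - real l\<bar>))"
    by (rule prod_sum_PiE[symmetric]) auto
  also have "\<dots> \<le> (\<Prod>s\<in>(UNIV::'d set). 2 / (1 - 2 powr (- \<epsilon>)))"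
    using sum_exp_dist_1[OF assms(1)] by (intro prod_mono) (auto intro: sum_nonneg)
  finally show ?thesis by (simp add: CB_def)
qed

lemma idist_sym: "idist k l = idist l k"
  unfolding idist_def by (intro sum.cong) auto

text \<open>Turns the exponent with the minimum, as produced by \<open>iter_int_mult_le\<close>,
  into decay in the distance of the levels.\<close>

lemma idist_min: "idist k l = real (\<Sum>s\<in>UNIV. k s) + real (\<Sum>s\<in>UNIV. l s) - 2 * real (\<Sum>s\<in>UNIV. min (k s) (l s))"
  unfolding idist_def by (simp add: sum.distrib[symmetric] sum_subtractf[symmetric] sum_distrib_left)
    (intro sum.cong; auto simp: min_def)

lemma powr_convex_comb_le:
  fixes a b t :: real
  assumes "0 \<le> t" "t \<le> 1"
  shows "2 powr (- (t * a + (1 - t) * b)) \<le> 2 powr (- a) + 2 powr (- b)"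
proof -
  have "min a b \<le> t * a + (1 - t) * b"
  proof -
    have "t * min a b + (1 - t) * min a b \<le> t * a + (1 - t) * b"
      using assms by (intro add_mono mult_left_mono) auto
    then show ?thesis by (simp add: algebra_simps)
  qed
  then have "2 powr (- (t * a + (1 - t) * b)) \<le> (2::real) powr (- min a b)" by simp
  also have "\<dots> \<le> 2 powr (- a) + 2 powr (- b)" by (auto simp: min_def)
  finally show ?thesis .
qed

lemma powr_sum_subadd:
  fixes z :: "'i \<Rightarrow> real"
  assumes "finite I" "\<And>i. i \<in> I \<Longrightarrow> z i \<ge> 0" "0 < \<beta>" "\<beta> \<le> 1"
  shows "(\<Sum>i\<in>I. z i) powr \<beta> \<le> (\<Sum>i\<in>I. z i powr \<beta>)"
proof (cases "(\<Sum>i\<in>I. z i) = 0")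
  case False
  define S where "S = sum z I"
  have S: "S > 0" unfolding S_def using False assms(2) by (simp add: order_less_le sum_nonneg)
  have "z i * S powr (\<beta> - 1) \<le> z i powr \<beta>" if i: "i \<in> I" for i
  proof (cases "z i = 0")
    case False
    then have zi: "z i > 0" using assms(2)[OF i] by simp
    have "z i \<le> S" unfolding S_def using i assms(1,2) by (intro member_le_sum) auto
    then have "S powr (\<beta> - 1) \<le> z i powr (\<beta> - 1)"
      using zi assms(4) by (intro powr_mono2') auto
    then have "z i * S powr (\<beta> - 1) \<le> z i * z i powr (\<beta> - 1)" using zi by (intro mult_left_mono) auto
    then show ?thesis using zi by (simp add: powr_diff)
  qed simp
  then have "(\<Sum>i\<in>I. z i * S powr (\<beta> - 1)) \<le> (\<Sum>i\<in>I. z i powr \<beta>)" by (rule sum_mono)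
  then have "S * S powr (\<beta> - 1) \<le> (\<Sum>i\<in>I. z i powr \<beta>)" by (simp add: S_def sum_distrib_right)
  then show ?thesis using S by (simp add: S_def[symmetric] powr_diff)
qed (simp add: sum_nonneg)

text \<open>The factor 4 is 2 from the two terms in the estimate of a pair, times 2 from the
  symmetric roles of \<open>k\<close> and \<open>l\<close>. One power of \<open>CB\<close> sums over
  the second level, the other \<open>u - 1\<close> come from the convexity weights.\<close>

definition CT :: "nat \<Rightarrow> real \<Rightarrow> real \<Rightarrow> real \<Rightarrow> real" where
  "CT d u q K = 4 * CB d ((q - u) / u / (4 * u)) powr u * K powr (q / u)"

lemma CT_pos: "K > 0 \<Longrightarrow> 1 \<le> u \<Longrightarrow> u < q \<Longrightarrow> CT d u q K > 0"
  unfolding CT_def using CB_pos[of "(q - u) / u / (4 * u)" d] by simp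

text \<open>The product \<open>T\<^bsup>q\<^esup> = T\<^bsup>q-u\<^esup> T\<^bsup>u\<^esup>\<close> is expanded into pairs; cell-constancy makes the levels
  \<open>k\<close> and \<open>l\<close> almost orthogonal, with a gain exponential in \<^term>\<open>idist k l\<close>.\<close>

lemma sum_levels_le:
  fixes D :: "('d \<Rightarrow> nat) \<Rightarrow> real^'d \<Rightarrow> complex"
  assumes u: "1 \<le> u" "u < q" "q - u \<le> 1" "q \<le> 2 * u" and K: "K > 0" and ss: "distinct ss" "set ss = UNIV"
    and Dm: "\<And>k. D k \<in> borel_measurable borel" and Dc: "\<And>k s. cell_const s (k s) (D k)"
    and D: "\<And>k. iter_int unit_int ss (\<lambda>x. ennreal (norm (D k x) powr u)) x \<le> ennreal (K / 2 ^ (\<Sum>s\<in>UNIV. k s))"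
    and "finite I"
  shows "iter_int unit_int ss (\<lambda>x. ennreal (norm (\<Sum>k\<in>I. D k x) powr q)) x
    \<le> ennreal (CT CARD('d) u q K * (\<Sum>k\<in>I. 1 / 2 ^ (\<Sum>s\<in>UNIV. k s)))"
proof -
  note [measurable] = Dm
  define \<zeta> where "\<zeta> = (q - u) / u"
  have \<zeta>: "\<zeta> > 0" "\<zeta> \<le> 1" using u by (auto simp: \<zeta>_def field_simps)
  \<comment> \<open>A pair of levels gains 2^(-(\<zeta>/2) idist). The convexity weights may consume
    half of the exponent, and the other half must still dominate the rate \<epsilon> at which the
    sum over the levels is taken.\<close>
  define \<epsilon> where "\<epsilon> = \<zeta> / (4 * u)"
  have \<epsilon>: "\<epsilon> > 0" "\<epsilon> \<le> \<zeta> / 4" "\<epsilon> * (u - 1) \<le> \<zeta> / 4"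
    using u \<zeta> by (auto simp: \<epsilon>_def field_simps)
  define B where "B = CB CARD('d) \<epsilon>"
  have B: "B > 0" unfolding B_def by (rule CB_pos[OF \<epsilon>(1)])
  let ?n = "\<lambda>k::'d \<Rightarrow> nat. (\<Sum>s\<in>UNIV. k s)"
  define a where "a k x = norm (D k x)" for k x
  have a0: "a k x \<ge> 0" for k x by (simp add: a_def)
  have am[measurable]: "a k \<in> borel_measurable borel" for k unfolding a_def by measurable
  have pair: "iter_int unit_int ss (\<lambda>x. ennreal (a k x powr (q - u)) * ennreal (a l x powr u)) x
     \<le> ennreal (2 * K powr (q / u) * 2 powr (- (\<zeta> / 2) * idist k l) * (1 / 2 ^ ?n k + 1 / 2 ^ ?n l))" for k l
  proof -
    define v where "v = (\<Sum>s\<in>UNIV. min (k s) (l s))"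
    \<comment> \<open>The power \<open>q - u\<close> is linearized by t^\<zeta> \<le> t + 1 at the
      threshold \<open>c\<close>. This choice balances the two resulting terms: both are bounded by
      K 2^-|l|.\<close>
    define c where "c = 2 ^ v * (K / 2 ^ ?n k)"
    have c: "c > 0" using K by (simp add: c_def)
    have "a k x powr (q - u) \<le> c powr \<zeta> * (a k x powr u / c + 1)" for x
    proof -
      have "a k x powr (q - u) = (a k x powr u) powr \<zeta>" using u by (simp add: \<zeta>_def powr_powr)
      also have "\<dots> = c powr \<zeta> * (a k x powr u / c) powr \<zeta>" using c by (simp add: powr_divide)
      also have "\<dots> \<le> c powr \<zeta> * (a k x powr u / c + 1)"
      proof (intro mult_left_mono)
        show "(a k x powr u / c) powr \<zeta> \<le> a k x powr u / c + 1"
        proof (cases "a k x powr u / c \<le> 1")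
          case True
          then have "(a k x powr u / c) powr \<zeta> \<le> 1" using c \<zeta> powr_mono2[of \<zeta> "a k x powr u / c" 1] by simp
          then show ?thesis using c by (simp add: add_increasing)
        next
          case False
          then have "(a k x powr u / c) powr \<zeta> \<le> (a k x powr u / c) powr 1" using \<zeta> by (intro powr_mono) auto
          then show ?thesis using c by simp
        qed
      qed simp
      finally show ?thesis .
    qed
    then have "iter_int unit_int ss (\<lambda>x. ennreal (a k x powr (q - u)) * ennreal (a l x powr u)) x
      \<le> iter_int unit_int ss (\<lambda>x. ennreal (c powr \<zeta>) * (ennreal (1 / c) * (ennreal (a k x powr u) * ennreal (a l x powr u)) + ennreal (a l x powr u))) x"
    proof (intro iter_int_mono)
      fix x assume *: "\<And>x. a k x powr (q - u) \<le> c powr \<zeta> * (a k x powr u / c + 1)"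
      have "a k x powr (q - u) * a l x powr u \<le> c powr \<zeta> * (a k x powr u / c + 1) * a l x powr u"
        by (intro mult_right_mono *) simp
      also have "\<dots> = c powr \<zeta> * (1 / c * (a k x powr u * a l x powr u) + a l x powr u)"
        by (simp add: algebra_simps)
      finally show "ennreal (a k x powr (q - u)) * ennreal (a l x powr u) \<le> ennreal (c powr \<zeta>) * (ennreal (1 / c) * (ennreal (a k x powr u) * ennreal (a l x powr u)) + ennreal (a l x powr u))"
        using c by (simp add: ennreal_leI flip: ennreal_mult ennreal_plus)
    qed
    also have "\<dots> = ennreal (c powr \<zeta>) * (ennreal (1 / c) * iter_int unit_int ss (\<lambda>x. ennreal (a k x powr u) * ennreal (a l x powr u)) x + iter_int unit_int ss (\<lambda>x. ennreal (a l x powr u)) x)"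
      by (simp add: iter_int_cmult iter_int_add)
    also have "\<dots> \<le> ennreal (c powr \<zeta>) * (ennreal (1 / c) * (ennreal (2 ^ v) * (ennreal (K / 2 ^ ?n k) * ennreal (K / 2 ^ ?n l))) + ennreal (K / 2 ^ ?n l))"
    proof (intro mult_left_mono add_mono)
      have "iter_int unit_int ss (\<lambda>x. ennreal (a k x powr u) * ennreal (a l x powr u)) x
        \<le> ennreal (2 ^ (\<Sum>s\<in>set ss. min (k s) (l s))) * (iter_int unit_int ss (\<lambda>x. ennreal (a k x powr u)) x * iter_int unit_int ss (\<lambda>x. ennreal (a l x powr u)) x)"
        unfolding a_def by (rule iter_int_mult_le) (use Dc ss in \<open>auto intro: cell_const_comp\<close>)
      also have "\<dots> \<le> ennreal (2 ^ v) * (ennreal (K / 2 ^ ?n k) * ennreal (K / 2 ^ ?n l))"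
        unfolding v_def ss a_def by (intro mult_left_mono mult_mono D) auto
      finally show "iter_int unit_int ss (\<lambda>x. ennreal (a k x powr u) * ennreal (a l x powr u)) x \<le> ennreal (2 ^ v) * (ennreal (K / 2 ^ ?n k) * ennreal (K / 2 ^ ?n l))" .
      show "iter_int unit_int ss (\<lambda>x. ennreal (a l x powr u)) x \<le> ennreal (K / 2 ^ ?n l)"
        unfolding a_def by (rule D)
    qed auto
    also have "\<dots> = ennreal (c powr \<zeta> * (1 / c * (2 ^ v * (K / 2 ^ ?n k * (K / 2 ^ ?n l))) + K / 2 ^ ?n l))"
    proof -
      have "ennreal x1 * (ennreal x2 * (ennreal x3 * (ennreal x4 * ennreal x5)) + ennreal x5) = ennreal (x1 * (x2 * (x3 * (x4 * x5)) + x5))"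
        if "x1 \<ge> 0" "x2 \<ge> 0" "x3 \<ge> 0" "x4 \<ge> 0" "x5 \<ge> 0" for x1 x2 x3 x4 x5
        using that by (simp flip: ennreal_mult ennreal_plus)
      then show ?thesis using c K by auto
    qed
    also have "\<dots> \<le> ennreal (2 * K powr (q / u) * 2 powr (- (\<zeta> / 2) * idist k l) * (1 / 2 ^ ?n k + 1 / 2 ^ ?n l))"
    proof (intro ennreal_leI)
      have "1 / c * (2 ^ v * (K / 2 ^ ?n k * (K / 2 ^ ?n l))) = K / 2 ^ ?n l"
        using K by (simp add: c_def)
      then have 1: "c powr \<zeta> * (1 / c * (2 ^ v * (K / 2 ^ ?n k * (K / 2 ^ ?n l))) + K / 2 ^ ?n l) = 2 * (c powr \<zeta> * (K / 2 ^ ?n l))"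
        by simp
      have 2: "c powr \<zeta> = K powr \<zeta> * 2 powr (\<zeta> * (real v - real (?n k)))"
      proof -
        have "c = K * 2 powr (real v - real (?n k))" by (simp add: c_def powr_diff powr_realpow del: of_nat_sum)
        then show ?thesis using K by (simp add: powr_mult powr_powr mult.commute)
      qed
      have 3: "K powr \<zeta> * 2 powr (\<zeta> * (real v - real (?n k))) * (K / 2 ^ ?n l)
         = K powr (q / u) * 2 powr (\<zeta> * (real v - real (?n k)) - real (?n l))"
      proof -
        have "q / u = \<zeta> + 1" using u by (simp add: \<zeta>_def field_simps)
        then show ?thesis using K by (simp add: powr_add powr_diff powr_realpow del: of_nat_sum)
      qed
      \<comment> \<open>The exponent splits into a gain in the distance and a convex combination of
        the two level sums; the latter is then bounded by the larger of the two powers, hence by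
        their sum.\<close>
      have 4: "\<zeta> * (real v - real (?n k)) - real (?n l) = - (\<zeta> / 2) * idist k l + - (\<zeta> / 2 * real (?n k) + (1 - \<zeta> / 2) * real (?n l))"
        unfolding idist_min v_def[symmetric] by (simp add: algebra_simps)
      have "c powr \<zeta> * (1 / c * (2 ^ v * (K / 2 ^ ?n k * (K / 2 ^ ?n l))) + K / 2 ^ ?n l)
         = 2 * K powr (q / u) * 2 powr (- (\<zeta> / 2) * idist k l) * 2 powr (- (\<zeta> / 2 * real (?n k) + (1 - \<zeta> / 2) * real (?n l)))"
        unfolding 1 unfolding 2 unfolding 3 unfolding 4 unfolding powr_add by (simp only: mult.assoc)
      also have "\<dots> \<le> 2 * K powr (q / u) * 2 powr (- (\<zeta> / 2) * idist k l) * (2 powr (- real (?n k)) + 2 powr (- real (?n l)))"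
        using \<zeta> by (intro mult_left_mono powr_convex_comb_le) auto
      also have "2 powr (- real (?n k)) + 2 powr (- real (?n l)) = 1 / 2 ^ ?n k + 1 / 2 ^ ?n l"
        by (simp add: powr_minus_divide powr_realpow del: of_nat_sum)
      finally show "c powr \<zeta> * (1 / c * (2 ^ v * (K / 2 ^ ?n k * (K / 2 ^ ?n l))) + K / 2 ^ ?n l) \<le> 2 * K powr (q / u) * 2 powr (- (\<zeta> / 2) * idist k l) * (1 / 2 ^ ?n k + 1 / 2 ^ ?n l)" .
    qed
    finally show ?thesis .
  qed
  define T where "T x = (\<Sum>k\<in>I. a k x)" for x
  have T0: "T x \<ge> 0" for x unfolding T_def using a0 by (intro sum_nonneg) auto
  \<comment> \<open>The weights of the convexity inequality are centred at \<open>k\<close>, for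
    each \<open>k\<close> separately, so that the loss grows only with the distance from
    \<open>k\<close> to \<open>l\<close>.\<close>
  have Tu: "T x powr u \<le> (\<Sum>l\<in>I. B powr (u - 1) * 2 powr (\<zeta> / 4 * idist k l) * a l x powr u)" for k x
  proof -
    have "T x powr u \<le> (\<Sum>l\<in>I. (2 powr (- \<epsilon> * idist k l) / B) powr (1 - u) * a l x powr u)"
      unfolding T_def
    proof (rule powr_sum_weighted)
      show "(\<Sum>l\<in>I. 2 powr (- \<epsilon> * idist k l) / B) \<le> 1"
        using sum_exp_idist[OF \<epsilon>(1) \<open>finite I\<close>, of k] B by (simp add: B_def sum_divide_distrib[symmetric])
    qed (use u a0 B \<open>finite I\<close> in auto)
    also have "\<dots> \<le> (\<Sum>l\<in>I. B powr (u - 1) * 2 powr (\<zeta> / 4 * idist k l) * a l x powr u)"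
    proof (intro sum_mono mult_right_mono)
      fix l
      have "(2 powr (- \<epsilon> * idist k l) / B) powr (1 - u) = B powr (u - 1) * 2 powr (\<epsilon> * (u - 1) * idist k l)"
      proof -
        have "(2 powr (- \<epsilon> * idist k l)) powr (1 - u) = 2 powr (\<epsilon> * (u - 1) * idist k l)"
          unfolding powr_powr by (simp add: algebra_simps)
        moreover have "1 / B powr (1 - u) = B powr (u - 1)"
          using powr_minus_divide[of B "1 - u"] by simp
        moreover have "(2 powr (- \<epsilon> * idist k l) / B) powr (1 - u) = (2 powr (- \<epsilon> * idist k l)) powr (1 - u) * (1 / B powr (1 - u))"
          using B by (simp only: powr_divide times_divide_eq_right mult_1_right)
        ultimately show ?thesis by (simp only: mult.commute)
      qed
      also have "\<dots> \<le> B powr (u - 1) * 2 powr (\<zeta> / 4 * idist k l)"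
        using \<epsilon>(3) by (intro mult_left_mono powr_mono mult_right_mono) (auto simp: idist_def sum_nonneg)
      finally show "(2 powr (- \<epsilon> * idist k l) / B) powr (1 - u) \<le> B powr (u - 1) * 2 powr (\<zeta> / 4 * idist k l)" .
    qed simp
    finally show ?thesis .
  qed
  have Tq: "norm (\<Sum>k\<in>I. D k x) powr q \<le> (\<Sum>k\<in>I. \<Sum>l\<in>I. B powr (u - 1) * 2 powr (\<zeta> / 4 * idist k l) * (a k x powr (q - u) * a l x powr u))" for x
  proof -
    have "norm (\<Sum>k\<in>I. D k x) powr q \<le> T x powr q"
      unfolding T_def a_def using u by (intro powr_mono2 norm_sum) auto
    also have "\<dots> = T x powr (q - u) * T x powr u" by (simp flip: powr_add)
    \<comment> \<open>Subadditivity of a power of exponent at most 1; this is where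
      \<open>q - u \<le> 1\<close> enters.\<close>
    also have "\<dots> \<le> (\<Sum>k\<in>I. a k x powr (q - u)) * T x powr u"
      unfolding T_def using u a0 \<open>finite I\<close> by (intro mult_right_mono powr_sum_subadd) auto
    also have "\<dots> = (\<Sum>k\<in>I. a k x powr (q - u) * T x powr u)" by (simp add: sum_distrib_right)
    also have "\<dots> \<le> (\<Sum>k\<in>I. a k x powr (q - u) * (\<Sum>l\<in>I. B powr (u - 1) * 2 powr (\<zeta> / 4 * idist k l) * a l x powr u))"
      by (intro sum_mono mult_left_mono Tu) auto
    also have "\<dots> = (\<Sum>k\<in>I. \<Sum>l\<in>I. B powr (u - 1) * 2 powr (\<zeta> / 4 * idist k l) * (a k x powr (q - u) * a l x powr u))"
      by (simp add: sum_distrib_left mult_ac)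
    finally show ?thesis .
  qed
  have "iter_int unit_int ss (\<lambda>x. ennreal (norm (\<Sum>k\<in>I. D k x) powr q)) x
    \<le> iter_int unit_int ss (\<lambda>x. \<Sum>k\<in>I. \<Sum>l\<in>I. ennreal (B powr (u - 1) * 2 powr (\<zeta> / 4 * idist k l)) * (ennreal (a k x powr (q - u)) * ennreal (a l x powr u))) x"
  proof (intro iter_int_mono)
    fix x
    have "(\<Sum>k\<in>I. \<Sum>l\<in>I. ennreal (B powr (u - 1) * 2 powr (\<zeta> / 4 * idist k l)) * (ennreal (a k x powr (q - u)) * ennreal (a l x powr u)))
      = ennreal (\<Sum>k\<in>I. \<Sum>l\<in>I. B powr (u - 1) * 2 powr (\<zeta> / 4 * idist k l) * (a k x powr (q - u) * a l x powr u))"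
      by (simp add: sum_nonneg flip: sum_ennreal ennreal_mult)
    then show "ennreal (norm (\<Sum>k\<in>I. D k x) powr q) \<le> (\<Sum>k\<in>I. \<Sum>l\<in>I. ennreal (B powr (u - 1) * 2 powr (\<zeta> / 4 * idist k l)) * (ennreal (a k x powr (q - u)) * ennreal (a l x powr u)))"
      using Tq[of x] by (simp add: ennreal_leI)
  qed
  also have "\<dots> = (\<Sum>k\<in>I. \<Sum>l\<in>I. ennreal (B powr (u - 1) * 2 powr (\<zeta> / 4 * idist k l)) * iter_int unit_int ss (\<lambda>x. ennreal (a k x powr (q - u)) * ennreal (a l x powr u)) x)"
    using \<open>finite I\<close> by (simp add: iter_int_sum iter_int_cmult)
  also have "\<dots> \<le> (\<Sum>k\<in>I. \<Sum>l\<in>I. ennreal (B powr (u - 1) * 2 powr (\<zeta> / 4 * idist k l)) * ennreal (2 * K powr (q / u) * 2 powr (- (\<zeta> / 2) * idist k l) * (1 / 2 ^ ?n k + 1 / 2 ^ ?n l)))"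
    by (intro sum_mono mult_left_mono pair) auto
  also have "\<dots> = ennreal (\<Sum>k\<in>I. \<Sum>l\<in>I. B powr (u - 1) * 2 powr (\<zeta> / 4 * idist k l) * (2 * K powr (q / u) * 2 powr (- (\<zeta> / 2) * idist k l) * (1 / 2 ^ ?n k + 1 / 2 ^ ?n l)))"
    by (simp add: sum_nonneg flip: sum_ennreal ennreal_mult)
  also have "\<dots> \<le> ennreal (CT CARD('d) u q K * (\<Sum>k\<in>I. 1 / 2 ^ ?n k))"
  proof (intro ennreal_leI)
    define E where "E k l = 2 powr (- \<epsilon> * idist k l)" for k l :: "'d \<Rightarrow> nat"
    have E0: "E k l \<ge> 0" and Esym: "E k l = E l k" for k l :: "'d \<Rightarrow> nat" by (auto simp: E_def idist_sym)
    have EB: "(\<Sum>l\<in>I. E k l) \<le> B" for k unfolding E_def B_def by (rule sum_exp_idist[OF \<epsilon>(1) \<open>finite I\<close>])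
    define C where "C = B powr (u - 1) * (2 * K powr (q / u))"
    have C0: "C \<ge> 0" by (simp add: C_def)
    have "(\<Sum>k\<in>I. \<Sum>l\<in>I. B powr (u - 1) * 2 powr (\<zeta> / 4 * idist k l) * (2 * K powr (q / u) * 2 powr (- (\<zeta> / 2) * idist k l) * (1 / 2 ^ ?n k + 1 / 2 ^ ?n l)))
      \<le> (\<Sum>k\<in>I. \<Sum>l\<in>I. C * (E k l * (1 / 2 ^ ?n k + 1 / 2 ^ ?n l)))"
    proof (intro sum_mono)
      fix k l :: "'d \<Rightarrow> nat"
      have "2 powr (\<zeta> / 4 * idist k l) * 2 powr (- (\<zeta> / 2) * idist k l) = 2 powr (- (\<zeta> / 4) * idist k l)"
        by (simp add: algebra_simps flip: powr_add)
      also have "\<dots> \<le> E k l" unfolding E_def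
        using \<epsilon>(2) by (intro powr_mono mult_right_mono) (auto simp: idist_def sum_nonneg)
      finally have "C * (1 / 2 ^ ?n k + 1 / 2 ^ ?n l) * (2 powr (\<zeta> / 4 * idist k l) * 2 powr (- (\<zeta> / 2) * idist k l)) \<le> C * (1 / 2 ^ ?n k + 1 / 2 ^ ?n l) * E k l"
        using C0 by (intro mult_left_mono) auto
      then show "B powr (u - 1) * 2 powr (\<zeta> / 4 * idist k l) * (2 * K powr (q / u) * 2 powr (- (\<zeta> / 2) * idist k l) * (1 / 2 ^ ?n k + 1 / 2 ^ ?n l)) \<le> C * (E k l * (1 / 2 ^ ?n k + 1 / 2 ^ ?n l))"
        unfolding C_def by (simp only: ac_simps)
    qed
    also have "\<dots> = C * ((\<Sum>k\<in>I. \<Sum>l\<in>I. E k l * (1 / 2 ^ ?n k)) + (\<Sum>k\<in>I. \<Sum>l\<in>I. E k l * (1 / 2 ^ ?n l)))"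
      by (simp only: sum_distrib_left[symmetric] distrib_left sum.distrib)
    also have "(\<Sum>k\<in>I. \<Sum>l\<in>I. E k l * (1 / 2 ^ ?n l)) = (\<Sum>k\<in>I. \<Sum>l\<in>I. E k l * (1 / 2 ^ ?n k))"
      by (subst sum.swap) (simp only: Esym)
    also have "C * ((\<Sum>k\<in>I. \<Sum>l\<in>I. E k l * (1 / 2 ^ ?n k)) + (\<Sum>k\<in>I. \<Sum>l\<in>I. E k l * (1 / 2 ^ ?n k))) \<le> C * (B * (\<Sum>k\<in>I. 1 / 2 ^ ?n k) + B * (\<Sum>k\<in>I. 1 / 2 ^ ?n k))"
    proof -
      have "(\<Sum>k\<in>I. \<Sum>l\<in>I. E k l * (1 / 2 ^ ?n k)) = (\<Sum>k\<in>I. (\<Sum>l\<in>I. E k l) * (1 / 2 ^ ?n k))"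
        by (simp only: sum_distrib_right)
      also have "\<dots> \<le> (\<Sum>k\<in>I. B * (1 / 2 ^ ?n k))" by (intro sum_mono mult_right_mono EB) auto
      finally have "(\<Sum>k\<in>I. \<Sum>l\<in>I. E k l * (1 / 2 ^ ?n k)) \<le> B * (\<Sum>k\<in>I. 1 / 2 ^ ?n k)"
        by (simp only: sum_distrib_left)
      then show ?thesis using C0 by (intro mult_left_mono add_mono)
    qed
    also have "\<dots> = (2 * C * B) * (\<Sum>k\<in>I. 1 / 2 ^ ?n k)" by (simp only: distrib_left[symmetric]) simp
    also have "2 * C * B = CT CARD('d) u q K"
      using B by (simp add: C_def CT_def B_def \<epsilon>_def \<zeta>_def powr_diff)
    finally show "(\<Sum>k\<in>I. \<Sum>l\<in>I. B powr (u - 1) * 2 powr (\<zeta> / 4 * idist k l) * (2 * K powr (q / u) * 2 powr (- (\<zeta> / 2) * idist k l) * (1 / 2 ^ ?n k + 1 / 2 ^ ?n l))) \<le> CT CARD('d) u q K * (\<Sum>k\<in>I. 1 / 2 ^ ?n k)" .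
  qed
  finally show ?thesis .
qed

section \<open>Sparse grids\<close>

lemma difs_cong: "(\<And>s. s \<in> set ss \<Longrightarrow> k s = k' s) \<Longrightarrow> difs k ss h = difs k' ss h"
  by (induction ss) auto

lemma sum_dif_telescope: "(\<Sum>a\<le>M. dif s a h x) = h (vupd x s (dyad M (x $ s)))"
  by (induction M) (auto simp: dif_def)

text \<open>Coordinates outside \<open>S\<close> are pinned to level 0, so that the box is a finite
  set of functions on all coordinates and each choice of levels in \<open>S\<close> is counted
  once.\<close>

definition lvl_box :: "'d set \<Rightarrow> nat \<Rightarrow> ('d \<Rightarrow> nat) set" where
  "lvl_box S M = {k. \<forall>s. if s \<in> S then k s \<le> M else k s = 0}"

lemma lvl_box_insert:
  assumes "s \<notin> S"
  shows "bij_betw (\<lambda>(a, k). fun_upd k s a) ({..M} \<times> lvl_box S M) (lvl_box (insert s S) M)"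
proof (rule bij_betwI[where g="\<lambda>k. (k s, fun_upd k s 0)"])
  show "(\<lambda>(a, k). fun_upd k s a) \<in> {..M} \<times> lvl_box S M \<rightarrow> lvl_box (insert s S) M"
    using assms by (auto simp: lvl_box_def)
  show "(\<lambda>k. (k s, fun_upd k s 0)) \<in> lvl_box (insert s S) M \<rightarrow> {..M} \<times> lvl_box S M"
    using assms unfolding lvl_box_def by (auto split: if_splits)
  show "\<And>x. x \<in> {..M} \<times> lvl_box S M \<Longrightarrow> (\<lambda>k. (k s, fun_upd k s 0)) ((\<lambda>(a, k). fun_upd k s a) x) = x"
    using assms by (auto simp: lvl_box_def fun_eq_iff)
  show "\<And>y. y \<in> lvl_box (insert s S) M \<Longrightarrow> (\<lambda>(a, k). fun_upd k s a) ((\<lambda>k. (k s, fun_upd k s 0)) y) = y"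
    by (auto simp: fun_eq_iff)
qed

lemma sum_difs_telescope:
  fixes h :: "real^'d \<Rightarrow> complex"
  assumes "distinct ss"
  shows "(\<Sum>k\<in>lvl_box (set ss) M. difs k ss h x) = h (\<chi> i. if i \<in> set ss then dyad M (x $ i) else x $ i)"
  using assms
proof (induction ss arbitrary: x)
  case Nil
  have "lvl_box {} M = {\<lambda>_::'d. 0}" by (auto simp: lvl_box_def)
  then show ?case by simp
next
  case (Cons s ss)
  let ?g = "\<lambda>x. h (\<chi> i. if i \<in> set ss then dyad M (x $ i) else x $ i)"
  have "(\<Sum>k\<in>lvl_box (set (s # ss)) M. difs k (s # ss) h x)
    = (\<Sum>(a, k)\<in>{..M} \<times> lvl_box (set ss) M. difs (fun_upd k s a) (s # ss) h x)"
    using Cons.prems sum.reindex_bij_betw[OF lvl_box_insert[of s "set ss" M], of "\<lambda>k. difs k (s # ss) h x"]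
    by (simp add: case_prod_unfold del: difs.simps)
  also have "\<dots> = (\<Sum>a\<le>M. \<Sum>k\<in>lvl_box (set ss) M. difs (fun_upd k s a) (s # ss) h x)"
    by (rule sum.cartesian_product[symmetric])
  also have "\<dots> = (\<Sum>a\<le>M. \<Sum>k\<in>lvl_box (set ss) M. dif s a (difs k ss h) x)"
  proof (intro sum.cong refl)
    fix a k
    have "difs (fun_upd k s a) ss h = difs k ss h" using Cons.prems by (intro difs_cong) auto
    then show "difs (fun_upd k s a) (s # ss) h x = dif s a (difs k ss h) x" by simp
  qed
  also have "\<dots> = (\<Sum>a\<le>M. dif s a (\<lambda>x. \<Sum>k\<in>lvl_box (set ss) M. difs k ss h x) x)"
    by (simp only: dif_sum)
  also have "\<dots> = (\<Sum>a\<le>M. dif s a ?g x)" using Cons by simp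
  also have "\<dots> = ?g (vupd x s (dyad M (x $ s)))" by (rule sum_dif_telescope)
  also have "\<dots> = h (\<chi> i. if i \<in> set (s # ss) then dyad M (x $ i) else x $ i)"
    using Cons.prems by (intro arg_cong[where f=h]) (auto simp: vec_eq_iff)
  finally show ?case .
qed

text \<open>\<open>difs k\<close> reads \<open>h\<close> only at points obtained by rounding the
  coordinates of \<open>x\<close> to levels not above those of \<open>k\<close>. Vanishing on the
  grid thus removes every level that the grid contains.\<close>

lemma difs_eq_0:
  assumes "distinct ss"
    and "\<And>k'. (\<And>i. i \<in> set ss \<Longrightarrow> k' i \<le> k i) \<Longrightarrow> h (\<chi> i. if i \<in> set ss then dyad (k' i) (x $ i) else x $ i) = 0"
  shows "difs k ss h x = 0"
  using assms
proof (induction ss arbitrary: x)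
  case Nil
  show ?case using Nil(2)[of k] by simp
next
  case (Cons s ss)
  have "difs k ss h (vupd x s (dyad a (x $ s))) = 0" if "a \<le> k s" for a
  proof (rule Cons.IH)
    fix k' assume k': "\<And>i. i \<in> set ss \<Longrightarrow> k' i \<le> k i"
    have "h (\<chi> i. if i \<in> set (s # ss) then dyad (fun_upd k' s a i) (x $ i) else x $ i) = 0"
      using that k' by (intro Cons.prems(2)) auto
    moreover have "(\<chi> i. if i \<in> set (s # ss) then dyad (fun_upd k' s a i) (x $ i) else x $ i) =
      (\<chi> i. if i \<in> set ss then dyad (k' i) (vupd x s (dyad a (x $ s)) $ i) else vupd x s (dyad a (x $ s)) $ i)"
      using Cons.prems(1) by (auto simp: vec_eq_iff)
    ultimately show "h (\<chi> i. if i \<in> set ss then dyad (k' i) (vupd x s (dyad a (x $ s)) $ i) else vupd x s (dyad a (x $ s)) $ i) = 0"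
      by simp
  qed (use Cons.prems in auto)
  then show ?case by (simp add: dif_def)
qed

text \<open>The Smolyak grid: the union of the anisotropic dyadic grids of total level at most
  \<open>n\<close>. Written as images of the half-open cube under rounding, it visibly contains the
  points at which \<open>difs\<close> evaluates.\<close>

definition sparse_grid :: "nat \<Rightarrow> (real^'d) set" where
  "sparse_grid n = (\<Union>k\<in>{k. (\<Sum>s\<in>UNIV. k s) \<le> n}. (\<lambda>x. \<chi> i. dyad (k i) (x $ i)) ` half_cube)"

section \<open>Counting grid points and summing the levels beyond the grid\<close>

lemma finite_lvl: "finite {k :: 'd::finite \<Rightarrow> nat. (\<Sum>s\<in>UNIV. k s) \<le> n}"
proof (rule finite_subset)
  show "{k :: 'd \<Rightarrow> nat. (\<Sum>s\<in>UNIV. k s) \<le> n} \<subseteq> Pi\<^sub>E UNIV (\<lambda>_. {..n})"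
  proof
    fix k :: "'d \<Rightarrow> nat" assume "k \<in> {k. (\<Sum>s\<in>UNIV. k s) \<le> n}"
    moreover have "k s \<le> (\<Sum>s\<in>UNIV. k s)" for s by (rule member_le_sum) auto
    ultimately show "k \<in> Pi\<^sub>E UNIV (\<lambda>_. {..n})" using order_trans by (auto simp: PiE_def Pi_def)
  qed
qed (auto intro: finite_PiE)

text \<open>A level vector with sum \<open>t\<close> is determined by its coordinates other than one
  fixed \<open>s0\<close>, and each of these is at most \<open>t\<close>.\<close>

lemma card_lvl: "card {k :: 'd::finite \<Rightarrow> nat. (\<Sum>s\<in>UNIV. k s) = t} \<le> (t + 1) ^ (CARD('d) - 1)"
proof -
  obtain s0 :: 'd where True by simp
  let ?S = "{k :: 'd \<Rightarrow> nat. (\<Sum>s\<in>UNIV. k s) = t}"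
  let ?T = "Pi\<^sub>E (UNIV - {s0}) (\<lambda>_. {..t})"
  have "inj_on (\<lambda>k. restrict k (UNIV - {s0})) ?S"
  proof (rule inj_onI)
    fix k l :: "'d \<Rightarrow> nat"
    assume k: "k \<in> ?S" and l: "l \<in> ?S" and eq: "restrict k (UNIV - {s0}) = restrict l (UNIV - {s0})"
    have o: "k s = l s" if "s \<noteq> s0" for s
      using fun_cong[OF eq, of s] that by simp
    have "(\<Sum>s\<in>UNIV. k s) = k s0 + (\<Sum>s\<in>UNIV - {s0}. k s)" "(\<Sum>s\<in>UNIV. l s) = l s0 + (\<Sum>s\<in>UNIV - {s0}. l s)"
      by (simp_all add: sum.remove)
    moreover have "(\<Sum>s\<in>UNIV - {s0}. k s) = (\<Sum>s\<in>UNIV - {s0}. l s)" using o by (intro sum.cong) auto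
    ultimately have "k s0 = l s0" using k l by simp
    then show "k = l" using o by (auto simp: fun_eq_iff) metis
  qed
  moreover have "(\<lambda>k. restrict k (UNIV - {s0})) ` ?S \<subseteq> ?T"
  proof -
    have "k s \<le> t" if "k \<in> ?S" for k s
      using that member_le_sum[of s UNIV k] by auto
    then show ?thesis by (intro image_subsetI) (simp only: restrict_PiE_iff atMost_iff, blast)
  qed
  moreover have "finite ?T" by (intro finite_PiE) auto
  ultimately have "card ?S \<le> card ?T" by (rule card_inj_on_le)
  also have "card ?T = (t + 1) ^ (CARD('d) - 1)"
    by (subst card_PiE) (auto simp: card_Diff_singleton)
  finally show ?thesis .
qed

lemma sparse_grid_level:
  fixes k :: "'d::finite \<Rightarrow> nat"
  defines "S \<equiv> (\<lambda>x::real^'d. \<chi> i. dyad (k i) (x $ i)) ` half_cube"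
  shows "finite S" "card S \<le> 2 ^ (\<Sum>s\<in>UNIV. k s)"
proof -
  let ?T = "Pi\<^sub>E UNIV (\<lambda>i. {0..<(2::int) ^ k i})"
  let ?f = "\<lambda>w::'d \<Rightarrow> int. (\<chi> i. of_int (w i) / 2 ^ k i) :: real^'d"
  have fin: "finite ?T" by (intro finite_PiE) auto
  have sub: "S \<subseteq> ?f ` ?T"
  proof
    fix y assume "y \<in> S"
    then obtain x :: "real^'d" where x: "x \<in> half_cube" "y = (\<chi> i. dyad (k i) (x $ i))" by (auto simp: S_def)
    have "\<lfloor>2 ^ k i * x $ i\<rfloor> \<in> {0..<2 ^ k i}" for i
      using x by (auto simp: half_cube_def floor_less_iff)
    then have 1: "(\<lambda>i. \<lfloor>2 ^ k i * x $ i\<rfloor>) \<in> ?T" by auto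
    have 2: "y = ?f (\<lambda>i. \<lfloor>2 ^ k i * x $ i\<rfloor>)" by (simp add: x dyad_def)
    show "y \<in> ?f ` ?T" by (rule image_eqI[where f="?f", OF 2 1])
  qed
  then show "finite S" using fin finite_surj by blast
  have "card S \<le> card ?T" using sub fin by (meson card_image_le card_mono finite_imageI order_trans)
  also have "card ?T = 2 ^ (\<Sum>s\<in>UNIV. k s)"
    by (subst card_PiE) (auto simp: power_sum nat_power_eq)
  finally show "card S \<le> 2 ^ (\<Sum>s\<in>UNIV. k s)" .
qed

lemma sparse_grid_finite: "finite (sparse_grid n)"
  unfolding sparse_grid_def using finite_lvl sparse_grid_level(1) by blast

lemma sparse_grid_card: "card (sparse_grid n :: (real^'d) set) \<le> (n + 1) ^ (CARD('d) - 1) * 2 ^ (n + 1)"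
proof -
  let ?I = "{k :: 'd \<Rightarrow> nat. (\<Sum>s\<in>UNIV. k s) \<le> n}"
  have "card (sparse_grid n :: (real^'d) set) \<le> (\<Sum>k\<in>?I. 2 ^ (\<Sum>s\<in>UNIV. k s))"
    unfolding sparse_grid_def
    by (rule order_trans[OF card_UN_le[OF finite_lvl]]) (intro sum_mono sparse_grid_level)
  also have "\<dots> = (\<Sum>t\<in>{..n}. \<Sum>k\<in>{k\<in>?I. (\<Sum>s\<in>UNIV. k s) = t}. 2 ^ (\<Sum>s\<in>UNIV. k s))"
    by (rule sum.group[symmetric]) (auto simp: finite_lvl)
  also have "\<dots> \<le> (\<Sum>t\<in>{..n}. (n + 1) ^ (CARD('d) - 1) * 2 ^ t)"
  proof (intro sum_mono)
    fix t assume t: "t \<in> {..n}"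
    have "(\<Sum>k\<in>{k\<in>?I. (\<Sum>s\<in>UNIV. k s) = t}. 2 ^ (\<Sum>s\<in>UNIV. k s)) = card {k\<in>?I. (\<Sum>s\<in>UNIV. k s) = t} * 2 ^ t"
      by simp
    also have "card {k\<in>?I. (\<Sum>s\<in>UNIV. k s) = t} = card {k :: 'd \<Rightarrow> nat. (\<Sum>s\<in>UNIV. k s) = t}"
      using t by (intro arg_cong[where f=card]) auto
    also have "\<dots> * 2 ^ t \<le> (t + 1) ^ (CARD('d) - 1) * 2 ^ t"
      by (intro mult_right_mono card_lvl) auto
    also have "\<dots> \<le> (n + 1) ^ (CARD('d) - 1) * 2 ^ t"
      using t by (intro mult_right_mono power_mono) auto
    finally show "(\<Sum>k\<in>{k\<in>?I. (\<Sum>s\<in>UNIV. k s) = t}. 2 ^ (\<Sum>s\<in>UNIV. k s)) \<le> (n + 1) ^ (CARD('d) - 1) * 2 ^ t" .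
  qed
  also have "\<dots> = (n + 1) ^ (CARD('d) - 1) * (\<Sum>t\<in>{..n}. 2 ^ t)" by (simp add: sum_distrib_left)
  also have "(\<Sum>t\<in>{..n}. (2::nat) ^ t) \<le> 2 ^ (n + 1)"
    by (induction n) auto
  finally show ?thesis by simp
qed

definition Ctail :: "nat \<Rightarrow> real" where "Ctail m = (\<Sum>i. (real i + 1) ^ m / 2 ^ i)"

lemma summable_Ctail: "summable (\<lambda>i. (real i + 1) ^ m / 2 ^ i)"
proof -
  have "(\<lambda>n. (1 + inverse (real (Suc n))) ^ m) \<longlonglongrightarrow> (1 + 0) ^ m"
    by (intro tendsto_power tendsto_add tendsto_const LIMSEQ_inverse_real_of_nat)
  then have "eventually (\<lambda>n. (1 + inverse (real (Suc n))) ^ m < 3 / 2) sequentially"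
    by (rule order_tendstoD) simp
  then obtain N where N: "\<And>n. n \<ge> N \<Longrightarrow> (1 + inverse (real (Suc n))) ^ m < 3 / 2"
    by (auto simp: eventually_sequentially)
  show ?thesis
  proof (rule summable_ratio_test[of "3/4" N])
    fix n assume "N \<le> n"
    then have *: "(1 + inverse (real (Suc n))) ^ m \<le> 3 / 2" using N less_imp_le by blast
    have "(real (Suc n) + 1) = (1 + inverse (real (Suc n))) * (real n + 1)"
      by (simp add: field_simps)
    then have "(real (Suc n) + 1) ^ m / 2 ^ Suc n = (1 + inverse (real (Suc n))) ^ m * ((real n + 1) ^ m / 2 ^ Suc n)"
      by (simp add: power_mult_distrib)
    also have "\<dots> \<le> 3 / 2 * ((real n + 1) ^ m / 2 ^ Suc n)"
      using * by (intro mult_right_mono) auto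
    finally show "norm ((real (Suc n) + 1) ^ m / 2 ^ Suc n) \<le> 3 / 4 * norm ((real n + 1) ^ m / 2 ^ n)"
      by simp
  qed simp
qed

lemma Ctail_pos: "Ctail m > 0"
  unfolding Ctail_def by (rule suminf_pos[OF summable_Ctail]) simp

text \<open>Level vectors are grouped by their sum t = i + n, at most (t+1)^(d-1) of them for each.
  The inequality i + n + 1 \<le> (n + 1)(i + 1) separates the dependence on \<open>n\<close> from a
  convergent series in \<open>i\<close>.\<close>

lemma sum_tail_le:
  assumes "finite I" and I: "\<And>k. k \<in> I \<Longrightarrow> n < (\<Sum>s\<in>UNIV. k s)"
  shows "(\<Sum>k\<in>I. 1 / 2 ^ (\<Sum>s\<in>(UNIV::'d::finite set). k s)) \<le> Ctail (CARD('d) - 1) * (real n + 1) ^ (CARD('d) - 1) / 2 ^ n"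
proof -
  let ?m = "CARD('d) - 1"
  let ?n = "\<lambda>k::'d \<Rightarrow> nat. (\<Sum>s\<in>UNIV. k s)"
  have "(\<Sum>k\<in>I. 1 / 2 ^ ?n k) = (\<Sum>t\<in>?n ` I. \<Sum>k\<in>{k\<in>I. ?n k = t}. 1 / 2 ^ ?n k :: real)"
    using \<open>finite I\<close> by (intro sum.group[symmetric]) auto
  also have "\<dots> \<le> (\<Sum>t\<in>?n ` I. (real t + 1) ^ ?m / 2 ^ t)"
  proof (intro sum_mono)
    fix t
    have "finite {k :: 'd \<Rightarrow> nat. ?n k = t}" by (rule finite_subset[OF _ finite_lvl[of t]]) auto
    then have "card {k\<in>I. ?n k = t} \<le> card {k :: 'd \<Rightarrow> nat. ?n k = t}" by (intro card_mono) auto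
    also have "\<dots> \<le> (t + 1) ^ ?m" by (rule card_lvl)
    finally have "real (card {k\<in>I. ?n k = t}) \<le> (real t + 1) ^ ?m" by (simp flip: of_nat_le_iff of_nat_Suc add: add.commute)
    then show "(\<Sum>k\<in>{k\<in>I. ?n k = t}. 1 / 2 ^ ?n k :: real) \<le> (real t + 1) ^ ?m / 2 ^ t"
      by (simp add: divide_right_mono)
  qed
  also have "\<dots> = (\<Sum>i\<in>(\<lambda>t. t - n) ` ?n ` I. (real (i + n) + 1) ^ ?m / 2 ^ (i + n))"
  proof -
    have "inj_on (\<lambda>t. t - n) (?n ` I)" using I by (intro inj_onI) (auto dest!: I)
    then show ?thesis using I by (subst sum.reindex) (auto intro!: sum.cong dest!: I)
  qed
  also have "\<dots> \<le> (\<Sum>i\<in>(\<lambda>t. t - n) ` ?n ` I. (real n + 1) ^ ?m / 2 ^ n * ((real i + 1) ^ ?m / 2 ^ i))"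
  proof (intro sum_mono)
    fix i
    have "real (i + n) + 1 \<le> (real n + 1) * (real i + 1)" by (simp add: algebra_simps)
    then have "(real (i + n) + 1) ^ ?m \<le> ((real n + 1) * (real i + 1)) ^ ?m" by (intro power_mono) auto
    then have "(real (i + n) + 1) ^ ?m / 2 ^ (i + n) \<le> ((real n + 1) * (real i + 1)) ^ ?m / 2 ^ (i + n)"
      by (intro divide_right_mono) auto
    then show "(real (i + n) + 1) ^ ?m / 2 ^ (i + n) \<le> (real n + 1) ^ ?m / 2 ^ n * ((real i + 1) ^ ?m / 2 ^ i)"
      by (simp add: power_mult_distrib power_add mult.commute)
  qed
  also have "\<dots> = (real n + 1) ^ ?m / 2 ^ n * (\<Sum>i\<in>(\<lambda>t. t - n) ` ?n ` I. (real i + 1) ^ ?m / 2 ^ i)"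
    by (simp only: sum_distrib_left)
  also have "\<dots> \<le> (real n + 1) ^ ?m / 2 ^ n * Ctail ?m"
    unfolding Ctail_def using \<open>finite I\<close>
    by (intro mult_left_mono sum_le_suminf summable_Ctail) auto
  finally show ?thesis by (simp add: mult.commute)
qed

section \<open>The error of a function vanishing on the sparse grid\<close>

lemma nn_integral_lim_le:
  assumes "\<And>n. F n \<in> borel_measurable M" and "\<And>x. (\<lambda>n. F n x) \<longlonglongrightarrow> G x"
    and "\<And>n. (\<integral>\<^sup>+x. F n x \<partial>M) \<le> (c :: ennreal)"
  shows "(\<integral>\<^sup>+x. G x \<partial>M) \<le> c"
proof -
  have "G x = liminf (\<lambda>n. F n x)" for x
    using lim_imp_Liminf[OF _ assms(2)] by simp
  then have "(\<integral>\<^sup>+x. G x \<partial>M) \<le> liminf (\<lambda>n. \<integral>\<^sup>+x. F n x \<partial>M)"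
    using nn_integral_liminf[of F M] assms(1) by simp
  also have "\<dots> \<le> liminf (\<lambda>n::nat. c)" using assms(3) by (intro Liminf_mono) auto
  finally show ?thesis by (simp add: Liminf_const)
qed

lemma dyad_tendsto: "(\<lambda>M. dyad M t) \<longlonglongrightarrow> t"
proof (rule tendsto_sandwich)
  show "\<forall>\<^sub>F n in sequentially. t - (1/2) ^ n \<le> dyad n t"
    using dyad_gt[of t] by (auto intro!: always_eventually simp: power_divide algebra_simps less_imp_le)
  show "\<forall>\<^sub>F n in sequentially. dyad n t \<le> t" using dyad_le by (auto intro!: always_eventually)
  have "(\<lambda>n. t - (1/2) ^ n) \<longlonglongrightarrow> t - 0" by (intro tendsto_diff tendsto_const LIMSEQ_power_zero) auto
  then show "(\<lambda>n. t - (1/2) ^ n) \<longlonglongrightarrow> t" by simp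
qed simp

lemma half_cube_subset: "half_cube \<subseteq> unit_cube"
  by (auto simp: half_cube_def unit_cube_def less_imp_le)

lemma dyad_half_cube: "x \<in> half_cube \<Longrightarrow> (\<chi> i. dyad (k i) (x $ i)) \<in> half_cube"
  by (auto simp: half_cube_def intro!: dyad_nonneg le_less_trans[OF dyad_le])

lemma sparse_grid_subset: "sparse_grid n \<subseteq> unit_cube"
  using dyad_half_cube half_cube_subset by (force simp: sparse_grid_def)

text \<open>The levels in a box telescope to \<open>h\<close> at rounded points, which tend to the
  original points inside the cube. The bound of \<open>sum_levels_le\<close> is uniform over the
  boxes, so it passes to the limit by continuity of \<open>h\<close> and Fatou's lemma.\<close>

lemma sampling_error:
  fixes h :: "real^'d \<Rightarrow> complex"
  assumes u: "1 \<le> u" "u < q" "q - u \<le> 1" "q \<le> 2 * u" and K: "K > 0" and ss: "distinct ss" "set ss = UNIV"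
    and hm: "h \<in> borel_measurable borel" and hc: "continuous_on unit_cube h"
    and h0: "\<And>x. x \<in> sparse_grid n \<Longrightarrow> h x = 0"
    and D: "\<And>k. (\<integral>\<^sup>+x\<in>half_cube. ennreal (norm (difs k ss h x) powr u) \<partial>lborel) \<le> ennreal (K / 2 ^ (\<Sum>s\<in>UNIV. k s))"
  shows "(\<integral>\<^sup>+x\<in>half_cube. ennreal (norm (h x) powr q) \<partial>lborel)
    \<le> ennreal (CT CARD('d) u q K * Ctail (CARD('d) - 1) * (real n + 1) ^ (CARD('d) - 1) / 2 ^ n)"
proof (rule nn_integral_lim_le)
  note [measurable] = hm
  let ?r = "\<lambda>M (x::real^'d). (\<chi> i. dyad M (x $ i)) :: real^'d"
  have dm: "difs k ss h \<in> borel_measurable borel" for k by (rule difs_measurable[OF hm])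
  have D': "iter_int unit_int ss (\<lambda>x. ennreal (norm (difs k ss h x) powr u)) x \<le> ennreal (K / 2 ^ (\<Sum>s\<in>UNIV. k s))" for k x
    using D[of k] dm[of k] by (subst nn_integral_half_cube[symmetric]) (use ss in auto)
  define I where "I M = {k \<in> lvl_box (UNIV :: 'd set) M. n < (\<Sum>s\<in>UNIV. k s)}" for M
  have "lvl_box (UNIV :: 'd set) M = Pi\<^sub>E UNIV (\<lambda>_. {..M})" for M by (auto simp: lvl_box_def)
  then have fin: "finite (lvl_box (UNIV :: 'd set) M)" for M by (auto intro: finite_PiE)
  have finI: "finite (I M)" for M using fin by (auto simp: I_def)
  have eq: "h (?r M x) = (\<Sum>k\<in>I M. difs k ss h x)" if x: "x \<in> half_cube" for x M
  proof -
    have "h (?r M x) = (\<Sum>k\<in>lvl_box UNIV M. difs k ss h x)"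
      using sum_difs_telescope[OF ss(1), where M=M and h=h and x=x] ss(2) by simp
    also have "\<dots> = (\<Sum>k\<in>I M. difs k ss h x)"
    proof (rule sum.mono_neutral_right[OF fin])
      show "\<forall>k\<in>lvl_box UNIV M - I M. difs k ss h x = 0"
      proof
        fix k assume "k \<in> lvl_box UNIV M - I M"
        then have k: "(\<Sum>s\<in>UNIV. k s) \<le> n" by (auto simp: I_def)
        show "difs k ss h x = 0"
        proof (rule difs_eq_0[OF ss(1)])
          fix k' assume "\<And>i. i \<in> set ss \<Longrightarrow> k' i \<le> k i"
          then have "(\<Sum>s\<in>UNIV. k' s) \<le> n" using k ss(2) by (intro order_trans[OF sum_mono k]) auto
          then have "(\<chi> i. dyad (k' i) (x $ i)) \<in> sparse_grid n" using x by (auto simp: sparse_grid_def)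
          then show "h (\<chi> i. if i \<in> set ss then dyad (k' i) (x $ i) else x $ i) = 0" using h0 ss(2) by simp
        qed
      qed
    qed (auto simp: I_def)
    finally show ?thesis .
  qed
  show "(\<lambda>x. ennreal (norm (\<Sum>k\<in>I M. difs k ss h x) powr q) * indicator half_cube x) \<in> borel_measurable lborel" for M
    using dm by simp
  show "(\<integral>\<^sup>+x\<in>half_cube. ennreal (norm (\<Sum>k\<in>I M. difs k ss h x) powr q) \<partial>lborel)
    \<le> ennreal (CT CARD('d) u q K * Ctail (CARD('d) - 1) * (real n + 1) ^ (CARD('d) - 1) / 2 ^ n)" for M
  proof -
    have "(\<integral>\<^sup>+x\<in>half_cube. ennreal (norm (\<Sum>k\<in>I M. difs k ss h x) powr q) \<partial>lborel)
      = iter_int unit_int ss (\<lambda>x. ennreal (norm (\<Sum>k\<in>I M. difs k ss h x) powr q)) 0"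
      using dm ss by (intro nn_integral_half_cube) auto
    also have "\<dots> \<le> ennreal (CT CARD('d) u q K * (\<Sum>k\<in>I M. 1 / 2 ^ (\<Sum>s\<in>UNIV. k s)))"
      by (rule sum_levels_le[OF u K ss dm _ D' finI]) (use ss in \<open>auto intro: cell_const_difs\<close>)
    also have "\<dots> \<le> ennreal (CT CARD('d) u q K * (Ctail (CARD('d) - 1) * (real n + 1) ^ (CARD('d) - 1) / 2 ^ n))"
      using CT_pos[OF K u(1,2)] by (intro ennreal_leI mult_left_mono sum_tail_le finI) (auto simp: I_def less_imp_le)
    finally show ?thesis by (simp add: mult.assoc)
  qed
  show "(\<lambda>M. ennreal (norm (\<Sum>k\<in>I M. difs k ss h x) powr q) * indicator half_cube x) \<longlonglongrightarrow> ennreal (norm (h x) powr q) * indicator half_cube x" for x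
  proof (cases "x \<in> half_cube")
    case True
    have "(\<lambda>M. ?r M x) \<longlonglongrightarrow> (\<chi> i. x $ i)"
      by (intro tendsto_vec_lambda dyad_tendsto)
    then have "(\<lambda>M. ?r M x) \<longlonglongrightarrow> x" by simp
    moreover have "x \<in> unit_cube" "\<And>M. ?r M x \<in> unit_cube"
      using True half_cube_subset dyad_half_cube[OF True] by auto
    ultimately have "(\<lambda>M. h (?r M x)) \<longlonglongrightarrow> h x"
      by (intro continuous_on_tendsto_compose[OF hc]) (auto intro: always_eventually)
    then have "(\<lambda>M. norm (h (?r M x)) powr q) \<longlonglongrightarrow> norm (h x) powr q"
      using u by (intro tendsto_powr' tendsto_norm tendsto_const) auto
    then show ?thesis using True by (simp add: eq tendsto_ennrealI)
  qed simp
qed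

section \<open>One-dimensional Fourier transforms\<close>

lemma integrable_tensor:
  fixes f :: "'a::euclidean_space \<Rightarrow> complex" and g :: "'b::euclidean_space \<Rightarrow> complex"
  assumes f: "integrable lborel f" and g: "integrable lborel g"
    and [measurable]: "case_prod H \<in> borel_measurable (lborel \<Otimes>\<^sub>M lborel)" and H: "\<And>x y. norm (H x y) \<le> c"
  shows "integrable (lborel \<Otimes>\<^sub>M lborel) (\<lambda>(x, y). f x * g y * H x y)"
proof -
  have [measurable]: "f \<in> borel_measurable borel" "g \<in> borel_measurable borel" using f g by auto
  have c0: "c \<ge> 0" using H[of undefined undefined] norm_ge_zero order_trans by blast
  have "(\<integral>\<^sup>+z. norm (case z of (x, y) \<Rightarrow> f x * g y * H x y) \<partial>(lborel \<Otimes>\<^sub>M lborel))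
    = (\<integral>\<^sup>+x. \<integral>\<^sup>+y. norm (f x * g y * H x y) \<partial>lborel \<partial>lborel)"
    by (subst lborel.nn_integral_fst[symmetric]) auto
  also have "\<dots> \<le> (\<integral>\<^sup>+x. \<integral>\<^sup>+y. ennreal (norm (f x)) * (ennreal c * ennreal (norm (g y))) \<partial>lborel \<partial>lborel)"
  proof (intro nn_integral_mono)
    fix x y
    have "norm (f x * g y * H x y) \<le> norm (f x) * (c * norm (g y))"
      using mult_left_mono[OF H[of x y], of "norm (f x) * norm (g y)"] by (simp add: norm_mult mult_ac)
    then show "ennreal (norm (f x * g y * H x y)) \<le> ennreal (norm (f x)) * (ennreal c * ennreal (norm (g y)))"
      using c0 by (simp add: ennreal_leI flip: ennreal_mult)
  qed
  also have "\<dots> = (\<integral>\<^sup>+x. norm (f x) \<partial>lborel) * (ennreal c * (\<integral>\<^sup>+y. norm (g y) \<partial>lborel))"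
    by (simp add: nn_integral_cmult nn_integral_multc)
  also have "\<dots> < \<infinity>"
    using f g by (auto simp: integrable_iff_bounded ennreal_mult_less_top)
  finally show ?thesis by (intro integrableI_bounded) auto
qed

text \<open>All exchanges of oscillatory integrals below have this shape: two integrable factors in
  separate variables and a bounded coupling, which is an exponential or a kernel.\<close>

lemma Fubini_tensor:
  fixes f :: "'a::euclidean_space \<Rightarrow> complex" and g :: "'b::euclidean_space \<Rightarrow> complex"
  assumes "integrable lborel f" "integrable lborel g"
    and "case_prod H \<in> borel_measurable (lborel \<Otimes>\<^sub>M lborel)" "\<And>x y. norm (H x y) \<le> c"
  shows "(\<integral>y. \<integral>x. f x * g y * H x y \<partial>lborel \<partial>lborel) = (\<integral>x. \<integral>y. f x * g y * H x y \<partial>lborel \<partial>lborel)"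
  by (rule lborel_pair.Fubini_integral) (rule integrable_tensor[OF assms])

text \<open>The full factor 1/(2 pi) makes this the convolution kernel belonging to the multiplier
  \<open>g\<close>, in contrast to the symmetric normalization of
  \<open>inverse_fourier\<close>.\<close>

definition ift :: "(real \<Rightarrow> complex) \<Rightarrow> real \<Rightarrow> complex" where
  "ift g x = of_real (1 / (2 * pi)) * (\<integral>\<xi>. g \<xi> * iexp (\<xi> * x) \<partial>lborel)"

lemma integrable_mult_iexp:
  assumes "integrable M g" and [measurable]: "f \<in> borel_measurable M"
  shows "integrable M (\<lambda>x. g x * iexp (f x))"
proof -
  have [measurable]: "g \<in> borel_measurable M" using assms by auto
  show ?thesis
    by (rule Bochner_Integration.integrable_bound[OF assms(1)]) (auto simp: norm_mult)
qed

lemma ift_measurable [measurable]: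
  assumes [measurable]: "g \<in> borel_measurable borel"
  shows "ift g \<in> borel_measurable borel"
  unfolding ift_def[abs_def] by measurable

lemma nn_integral_restrict_support:
  fixes g :: "real \<Rightarrow> complex"
  assumes "\<And>x. norm (g x) \<le> b" and "\<And>x. \<bar>x\<bar> > R \<Longrightarrow> g x = 0" and "R \<ge> 0" and "b \<ge> 0"
  shows "(\<integral>\<^sup>+x. norm (g x) \<partial>lborel) \<le> ennreal (2 * R * b)"
proof -
  have "(\<integral>\<^sup>+x. norm (g x) \<partial>lborel) \<le> (\<integral>\<^sup>+x. ennreal b * indicator {- R..R} x \<partial>lborel)"
  proof (intro nn_integral_mono)
    fix x
    show "ennreal (norm (g x)) \<le> ennreal b * indicator {- R..R} x"
    proof (cases "x \<in> {- R..R}")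
      case False
      then have "g x = 0" using assms(2) by (auto simp: abs_real_def split: if_splits)
      then show ?thesis by simp
    qed (use assms(1) in \<open>auto intro: ennreal_leI\<close>)
  qed
  also have "\<dots> = ennreal (2 * R * b)"
    using assms by (subst nn_integral_cmult_indicator) (auto simp: ennreal_mult[symmetric] mult.commute)
  finally show ?thesis .
qed

lemma integrable_bounded_support:
  fixes g :: "real \<Rightarrow> complex"
  assumes [measurable]: "g \<in> borel_measurable borel"
    and "\<And>x. norm (g x) \<le> b" and "\<And>x. \<bar>x\<bar> > R \<Longrightarrow> g x = 0" and "R \<ge> 0" and "b \<ge> 0"
  shows "integrable lborel g" "(\<integral>x. norm (g x) \<partial>lborel) \<le> 2 * R * b"
proof -
  have le: "(\<integral>\<^sup>+x. norm (g x) \<partial>lborel) \<le> ennreal (2 * R * b)"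
    by (rule nn_integral_restrict_support) (use assms in auto)
  show i: "integrable lborel g"
    using le_less_trans[OF le ennreal_less_top] by (simp add: integrable_iff_bounded)
  show "(\<integral>x. norm (g x) \<partial>lborel) \<le> 2 * R * b"
  proof -
    have "ennreal (\<integral>x. norm (g x) \<partial>lborel) \<le> ennreal (2 * R * b)"
      using le i by (subst nn_integral_eq_integral[symmetric]) auto
    then show ?thesis using assms(4,5) by (subst (asm) ennreal_le_iff) auto
  qed
qed

lemma norm_ift_le:
  assumes "integrable lborel g"
  shows "norm (ift g x) \<le> (\<integral>\<xi>. norm (g \<xi>) \<partial>lborel) / (2 * pi)"
proof -
  have "norm (\<integral>\<xi>. g \<xi> * iexp (\<xi> * x) \<partial>lborel) \<le> (\<integral>\<xi>. norm (g \<xi>) \<partial>lborel)"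
    using integral_norm_bound[of lborel "\<lambda>\<xi>. g \<xi> * iexp (\<xi> * x)"] by (simp add: norm_mult)
  then have "1 / (2 * pi) * norm (\<integral>\<xi>. g \<xi> * iexp (\<xi> * x) \<partial>lborel) \<le> 1 / (2 * pi) * (\<integral>\<xi>. norm (g \<xi>) \<partial>lborel)"
    by (intro mult_left_mono) auto
  moreover have "\<bar>1 / (2 * pi)\<bar> = 1 / (2 * pi)" by simp
  ultimately show ?thesis unfolding ift_def norm_mult norm_of_real by simp
qed

text \<open>Two integrations by parts trade x^2 for the second derivative of \<open>g\<close>. The
  free scale \<open>T\<close>, later 2^M, balances this against the trivial bound.\<close>

lemma ift_decay:
  assumes g: "\<And>x. (g has_vector_derivative g1 x) (at x)" and g1: "\<And>x. (g1 has_vector_derivative g2 x) (at x)"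
    and g2: "continuous_on UNIV g2"
    and b: "\<And>x. norm (g x) \<le> b0" "\<And>x. norm (g2 x) \<le> b2" "b0 \<ge> 0" "b2 \<ge> 0"
    and R: "\<And>x. \<bar>x\<bar> > R \<Longrightarrow> g x = 0" "\<And>x. \<bar>x\<bar> > R \<Longrightarrow> g1 x = 0" "\<And>x. \<bar>x\<bar> > R \<Longrightarrow> g2 x = 0" "R > 0"
    and T: "T \<ge> 0"
  shows "(1 + (T * x)\<^sup>2) * norm (ift g x) \<le> R / pi * (b0 + T\<^sup>2 * b2)"
proof -
  have gc: "continuous_on UNIV g" "continuous_on UNIV g1"
    using g g1 by (auto intro!: continuous_at_imp_continuous_on has_vector_derivative_continuous)
  then have [measurable]: "g \<in> borel_measurable borel" "g1 \<in> borel_measurable borel" "g2 \<in> borel_measurable borel"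
    using g2 by (auto intro: borel_measurable_continuous_onI)
  have gi: "integrable lborel g" "(\<integral>x. norm (g x) \<partial>lborel) \<le> 2 * R * b0"
    using integrable_bounded_support[of g b0 R] b R by auto
  have g2i: "integrable lborel g2" "(\<integral>x. norm (g2 x) \<partial>lborel) \<le> 2 * R * b2"
    using integrable_bounded_support[of g2 b2 R] b R by auto
  have n0: "norm (ift g x) \<le> R / pi * b0"
    using order_trans[OF norm_ift_le[OF gi(1)] divide_right_mono[OF gi(2), of "2 * pi"]] by simp
  \<comment> \<open>A primitive of \<open>h\<close> that performs both integrations by parts at
    once.\<close>
  define H where "H = (\<lambda>\<xi>::real. iexp (\<xi> * x) * (\<i> * of_real x * g \<xi> - g1 \<xi>))"
  define h where "h = (\<lambda>\<xi>::real. iexp (\<xi> * x) * (- of_real (x\<^sup>2) * g \<xi> - g2 \<xi>))"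
  \<comment> \<open>The endpoints are put at 2R because vanishing is assumed only strictly beyond
    \<open>R\<close>.\<close>
  have "(\<integral>\<xi>. indicator {- (2 * R)..2 * R} \<xi> *\<^sub>R h \<xi> \<partial>lborel) = H (2 * R) - H (- (2 * R))"
  proof (rule integral_FTC_atLeastAtMost)
    show "- (2 * R) \<le> 2 * R" using R by simp
    show "continuous_on {- (2 * R)..2 * R} h"
      unfolding h_def using gc g2 by (intro continuous_intros) (auto intro: continuous_on_subset)
    fix \<xi>
    have "((\<lambda>\<xi>::real. iexp (\<xi> * x)) has_vector_derivative iexp (\<xi> * x) * (\<i> * of_real x)) (at \<xi>)"
    proof -
      have "((\<lambda>z. exp (\<i> * (z * of_real x))) has_field_derivative exp (\<i> * (of_real \<xi> * of_real x)) * (\<i> * of_real x)) (at (of_real \<xi>))"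
        by (auto intro!: derivative_eq_intros)
      from has_vector_derivative_real_field[OF this] show ?thesis by simp
    qed
    moreover have "((\<lambda>\<xi>. \<i> * of_real x * g \<xi> - g1 \<xi>) has_vector_derivative (\<i> * of_real x * g1 \<xi> - g2 \<xi>)) (at \<xi>)"
      by (intro has_vector_derivative_diff has_vector_derivative_mult_right g g1)
    ultimately have "(H has_vector_derivative iexp (\<xi> * x) * (\<i> * of_real x * g1 \<xi> - g2 \<xi>) + iexp (\<xi> * x) * (\<i> * of_real x) * (\<i> * of_real x * g \<xi> - g1 \<xi>)) (at \<xi>)"
      unfolding H_def by (rule has_vector_derivative_mult)
    moreover have "iexp (\<xi> * x) * (\<i> * of_real x * g1 \<xi> - g2 \<xi>) + iexp (\<xi> * x) * (\<i> * of_real x) * (\<i> * of_real x * g \<xi> - g1 \<xi>) = h \<xi>"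
    proof -
      have "\<i> * of_real x * (\<i> * of_real x * g \<xi>) = - of_real (x\<^sup>2) * g \<xi>"
      proof -
        have "\<i> * of_real x * (\<i> * of_real x * g \<xi>) = (\<i> * \<i>) * (of_real x * of_real x) * g \<xi>"
          by (simp only: mult_ac)
        then show ?thesis by (simp add: power2_eq_square)
      qed
      then show ?thesis unfolding h_def by (simp add: algebra_simps)
    qed
    ultimately show "(H has_vector_derivative h \<xi>) (at \<xi> within {- (2 * R)..2 * R})"
      by (simp add: has_vector_derivative_at_within)
  qed
  moreover have "H (2 * R) = 0" "H (- (2 * R)) = 0" using R by (auto simp: H_def)
  moreover have "indicator {- (2 * R)..2 * R} \<xi> *\<^sub>R h \<xi> = h \<xi>" for \<xi>
  proof (cases "\<xi> \<in> {- (2 * R)..2 * R}")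
    case False
    then have "\<bar>\<xi>\<bar> > R" using R by (auto simp: abs_real_def)
    then show ?thesis using R False by (simp add: h_def)
  qed simp
  ultimately have "(\<integral>\<xi>. h \<xi> \<partial>lborel) = 0" by simp
  moreover have "(\<integral>\<xi>. h \<xi> \<partial>lborel) = - of_real (x\<^sup>2) * (\<integral>\<xi>. g \<xi> * iexp (\<xi> * x) \<partial>lborel) - (\<integral>\<xi>. g2 \<xi> * iexp (\<xi> * x) \<partial>lborel)"
  proof -
    have "h \<xi> = - of_real (x\<^sup>2) * (g \<xi> * iexp (\<xi> * x)) - g2 \<xi> * iexp (\<xi> * x)" for \<xi>
      unfolding h_def by (simp add: algebra_simps)
    moreover have "integrable lborel (\<lambda>\<xi>. g \<xi> * iexp (\<xi> * x))" "integrable lborel (\<lambda>\<xi>. g2 \<xi> * iexp (\<xi> * x))"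
      by (intro integrable_mult_iexp gi g2i; simp)+
    ultimately show ?thesis by simp
  qed
  ultimately have "of_real (x\<^sup>2) * (\<integral>\<xi>. g \<xi> * iexp (\<xi> * x) \<partial>lborel) = - (\<integral>\<xi>. g2 \<xi> * iexp (\<xi> * x) \<partial>lborel)"
    by algebra
  then have "of_real (x\<^sup>2) * ift g x = - ift g2 x"
    unfolding ift_def by (simp add: mult.left_commute)
  then have "x\<^sup>2 * norm (ift g x) = norm (ift g2 x)"
    by (metis abs_power2 norm_minus_cancel norm_mult norm_of_real)
  also have "\<dots> \<le> R / pi * b2"
    using order_trans[OF norm_ift_le[OF g2i(1)] divide_right_mono[OF g2i(2), of "2 * pi"]] by simp
  finally have "T\<^sup>2 * (x\<^sup>2 * norm (ift g x)) \<le> T\<^sup>2 * (R / pi * b2)"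
    by (intro mult_left_mono) auto
  with n0 have "norm (ift g x) + T\<^sup>2 * (x\<^sup>2 * norm (ift g x)) \<le> R / pi * b0 + T\<^sup>2 * (R / pi * b2)"
    by (rule add_mono)
  then show ?thesis by (simp add: algebra_simps power_mult_distrib)
qed

text \<open>The Cauchy profile dilated to the scale 2^-M; its integral is pi at every scale.\<close>

definition kap :: "nat \<Rightarrow> real \<Rightarrow> real" where "kap M x = 2 ^ M / (1 + (2 ^ M * x)\<^sup>2)"

lemma kap_measurable [measurable]: "kap M \<in> borel_measurable borel"
  unfolding kap_def[abs_def] by measurable

lemma nn_integral_inverse_1_plus_square: "(\<integral>\<^sup>+x. ennreal (1 / (1 + x\<^sup>2)) \<partial>lborel) = ennreal pi"
proof -
  have i: "integrable lborel (\<lambda>x::real. inverse (1 + x\<^sup>2))"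
    using integrable_inverse_1_plus_square by (simp add: set_integrable_def einterval_def)
  have "(\<integral>x. inverse (1 + (x::real)\<^sup>2) \<partial>lborel) = pi"
    using LBINT_inverse_1_plus_square by (simp add: interval_lebesgue_integral_def set_lebesgue_integral_def einterval_def)
  then show ?thesis
    using nn_integral_eq_integral[OF i] by (simp add: divide_inverse)
qed

lemma nn_integral_kap: "(\<integral>\<^sup>+x. ennreal (kap M x) \<partial>lborel) = ennreal pi"
  using nn_integral_real_affine[of "\<lambda>x. ennreal (1 / (1 + x\<^sup>2))" "2 ^ M" 0]
  by (simp add: nn_integral_inverse_1_plus_square kap_def nn_integral_cmult[symmetric] flip: ennreal_mult)

text \<open>Gaussian summation. With a Gaussian factor inserted, Fubini turns the integral into an
  average of \<open>g\<close> against a narrow normal density around \<open>\<xi>\<close>. As the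
  width tends to 0, dominated convergence applies to both expressions.\<close>

lemma fourier_inversion_1d:
  fixes g :: "real \<Rightarrow> complex"
  assumes gc: "continuous_on UNIV g" and gb: "\<And>x. norm (g x) \<le> b" and gi: "integrable lborel g"
    and ki: "integrable lborel (ift g)"
  shows "(\<integral>y. ift g y * iexp (- (\<xi> * y)) \<partial>lborel) = g \<xi>"
proof -
  have [measurable]: "g \<in> borel_measurable borel" using gi by auto
  define e where "e n = inverse (real (Suc n))" for n
  have e0: "e n > 0" for n by (simp add: e_def)
  have e_lim: "e \<longlonglongrightarrow> 0" unfolding e_def[abs_def] by (rule LIMSEQ_inverse_real_of_nat)
  define J where "J n = (\<integral>y. ift g y * iexp (- (\<xi> * y)) * of_real (exp (- ((e n * y)\<^sup>2 / 2))) \<partial>lborel)" for n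
  have "J \<longlonglongrightarrow> (\<integral>y. ift g y * iexp (- (\<xi> * y)) * of_real (exp (- ((0 * y)\<^sup>2 / 2))) \<partial>lborel)"
    unfolding J_def
  proof (rule integral_dominated_convergence[where w="\<lambda>y. norm (ift g y)"])
    show "integrable lborel (\<lambda>y. norm (ift g y))" using ki by simp
    show "AE y in lborel. (\<lambda>n. ift g y * iexp (- (\<xi> * y)) * of_real (exp (- ((e n * y)\<^sup>2 / 2)))) \<longlonglongrightarrow> ift g y * iexp (- (\<xi> * y)) * of_real (exp (- ((0 * y)\<^sup>2 / 2)))"
      by (intro AE_I2 tendsto_intros e_lim) simp_all
    show "AE y in lborel. norm (ift g y * iexp (- (\<xi> * y)) * of_real (exp (- ((e n * y)\<^sup>2 / 2)))) \<le> norm (ift g y)" for n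
      by (intro AE_I2) (auto simp: norm_mult intro!: mult_left_le)
  qed measurable
  then have lim1: "J \<longlonglongrightarrow> (\<integral>y. ift g y * iexp (- (\<xi> * y)) \<partial>lborel)" by simp
  have J_eq: "J n = (\<integral>z. g (\<xi> + e n * z) * of_real (std_normal_density z) \<partial>lborel)" for n
  proof -
    define w where "w y = exp (- ((e n * y)\<^sup>2 / 2))" for y
    have [measurable]: "w \<in> borel_measurable borel" unfolding w_def by measurable
    have w_eq: "w y = sqrt (2 * pi) * std_normal_density (e n * y)" for y
      by (simp add: w_def std_normal_density_def)
    have wi: "integrable lborel w"
    proof -
      have "integrable lborel (\<lambda>y. std_normal_density (0 + e n * y))"
        using e0[of n] by (intro lborel_integrable_real_affine) auto
      then show ?thesis unfolding w_eq[abs_def] by simp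
    qed
    \<comment> \<open>The transform of a dilated Gaussian, read off from the characteristic function
      of the standard normal distribution.\<close>
    have char: "(\<integral>y. iexp (\<eta> * y - \<xi> * y) * of_real (w y) \<partial>lborel) = of_real (2 * pi / e n * std_normal_density ((\<eta> - \<xi>) / e n))" for \<eta>
    proof -
      have "(\<integral>y. iexp (\<eta> * y - \<xi> * y) * of_real (w y) \<partial>lborel)
        = (1 / e n) *\<^sub>R (\<integral>y. iexp ((\<eta> - \<xi>) / e n * y) * of_real (sqrt (2 * pi) * std_normal_density y) \<partial>lborel)"
      proof -
        have "(\<integral>y. iexp ((\<eta> - \<xi>) / e n * y) * of_real (sqrt (2 * pi) * std_normal_density y) \<partial>lborel)
          = \<bar>e n\<bar> *\<^sub>R (\<integral>y. iexp ((\<eta> - \<xi>) / e n * (0 + e n * y)) * of_real (sqrt (2 * pi) * std_normal_density (0 + e n * y)) \<partial>lborel)"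
          using e0[of n] by (intro lborel_integral_real_affine) auto
        also have "(\<lambda>y. iexp ((\<eta> - \<xi>) / e n * (0 + e n * y)) * of_real (sqrt (2 * pi) * std_normal_density (0 + e n * y)))
           = (\<lambda>y. iexp (\<eta> * y - \<xi> * y) * of_real (w y))"
        proof
          fix y
          have "(\<eta> - \<xi>) / e n * (0 + e n * y) = (\<eta> - \<xi>) * y"
            using e0[of n] by simp
          also have "\<dots> = \<eta> * y - \<xi> * y" by (rule left_diff_distrib)
          finally have "(\<eta> - \<xi>) / e n * (0 + e n * y) = \<eta> * y - \<xi> * y" .
          then show "iexp ((\<eta> - \<xi>) / e n * (0 + e n * y)) * of_real (sqrt (2 * pi) * std_normal_density (0 + e n * y)) = iexp (\<eta> * y - \<xi> * y) * of_real (w y)"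
            by (simp only: w_eq add_0)
        qed
        finally have 1: "(\<integral>y. iexp ((\<eta> - \<xi>) / e n * y) * of_real (sqrt (2 * pi) * std_normal_density y) \<partial>lborel)
          = \<bar>e n\<bar> *\<^sub>R (\<integral>y. iexp (\<eta> * y - \<xi> * y) * of_real (w y) \<partial>lborel)" .
        have "1 / e n * \<bar>e n\<bar> = 1" using e0[of n] by simp
        then show ?thesis unfolding 1 scaleR_scaleR by (simp only: scaleR_one)
      qed
      also have "(\<integral>y. iexp ((\<eta> - \<xi>) / e n * y) * of_real (sqrt (2 * pi) * std_normal_density y) \<partial>lborel)
        = of_real (sqrt (2 * pi)) * (\<integral>y. std_normal_density y *\<^sub>R iexp ((\<eta> - \<xi>) / e n * y) \<partial>lborel)"
        unfolding integral_mult_right_zero[symmetric]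
        by (intro Bochner_Integration.integral_cong refl) (simp only: scaleR_conv_of_real of_real_mult mult_ac)
      also have "(\<integral>y. std_normal_density y *\<^sub>R iexp ((\<eta> - \<xi>) / e n * y) \<partial>lborel) = char std_normal_distribution ((\<eta> - \<xi>) / e n)"
        unfolding char_def by (rule integral_density[symmetric]) (auto simp: normal_density_nonneg)
      also have "\<dots> = of_real (exp (- (((\<eta> - \<xi>) / e n)\<^sup>2) / 2))" by (simp add: char_std_normal_distribution)
      also have "exp (- (((\<eta> - \<xi>) / e n)\<^sup>2) / 2) = sqrt (2 * pi) * std_normal_density ((\<eta> - \<xi>) / e n)"
        by (simp add: std_normal_density_def)
      also have "(1 / e n) *\<^sub>R (of_real (sqrt (2 * pi)) * of_real (sqrt (2 * pi) * std_normal_density ((\<eta> - \<xi>) / e n)))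
         = (of_real (1 / e n * (sqrt (2 * pi) * (sqrt (2 * pi) * std_normal_density ((\<eta> - \<xi>) / e n)))) :: complex)"
        by (simp only: scaleR_conv_of_real of_real_mult)
      also have "1 / e n * (sqrt (2 * pi) * (sqrt (2 * pi) * std_normal_density ((\<eta> - \<xi>) / e n))) = 2 * pi / e n * std_normal_density ((\<eta> - \<xi>) / e n)"
      proof -
        have "sqrt (2 * pi) * (sqrt (2 * pi) * z) = 2 * pi * z" for z
          by (simp only: mult.assoc[symmetric] real_sqrt_mult_self) simp
        then show ?thesis by (simp only:) simp
      qed
      finally show ?thesis .
    qed
    have "J n = (\<integral>y. \<integral>\<eta>. g \<eta> * of_real (w y) * (of_real (1 / (2 * pi)) * iexp (\<eta> * y - \<xi> * y)) \<partial>lborel \<partial>lborel)"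
      unfolding J_def w_def[symmetric]
    proof (intro Bochner_Integration.integral_cong refl)
      fix y
      have eq: "g \<eta> * of_real (w y) * (of_real (1 / (2 * pi)) * iexp (\<eta> * y - \<xi> * y)) = of_real (1 / (2 * pi)) * iexp (- (\<xi> * y)) * of_real (w y) * (g \<eta> * iexp (\<eta> * y))" for \<eta>
      proof -
        have "iexp (\<eta> * y - \<xi> * y) = iexp (- (\<xi> * y)) * iexp (\<eta> * y)"
          by (simp add: algebra_simps flip: exp_add)
        then show ?thesis by (simp only: mult_ac)
      qed
      show "ift g y * iexp (- (\<xi> * y)) * of_real (w y) = (\<integral>\<eta>. g \<eta> * of_real (w y) * (of_real (1 / (2 * pi)) * iexp (\<eta> * y - \<xi> * y)) \<partial>lborel)"
        unfolding ift_def eq integral_mult_right_zero by (simp only: mult_ac)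
    qed
    also have "\<dots> = (\<integral>\<eta>. \<integral>y. g \<eta> * of_real (w y) * (of_real (1 / (2 * pi)) * iexp (\<eta> * y - \<xi> * y)) \<partial>lborel \<partial>lborel)"
    proof (rule Fubini_tensor[where f=g and g="\<lambda>y. of_real (w y)" and H="\<lambda>\<eta> y. of_real (1 / (2 * pi)) * iexp (\<eta> * y - \<xi> * y)" and c="1 / (2 * pi)"])
      show "integrable lborel (\<lambda>y. complex_of_real (w y))" using wi by (rule integrable_of_real)
      show "cmod (of_real (1 / (2 * pi)) * iexp (\<eta> * y - \<xi> * y)) \<le> 1 / (2 * pi)" for \<eta> y
        unfolding norm_mult norm_exp_i_times norm_of_real by simp
      show "(\<lambda>(\<eta>, y). of_real (1 / (2 * pi)) * iexp (\<eta> * y - \<xi> * y)) \<in> borel_measurable (lborel \<Otimes>\<^sub>M lborel)"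
        by measurable
    qed (rule gi)
    also have "\<dots> = (\<integral>\<eta>. g \<eta> * of_real (1 / e n * std_normal_density ((\<eta> - \<xi>) / e n)) \<partial>lborel)"
    proof (intro Bochner_Integration.integral_cong refl)
      fix \<eta>
      have "(\<integral>y. g \<eta> * of_real (w y) * (of_real (1 / (2 * pi)) * iexp (\<eta> * y - \<xi> * y)) \<partial>lborel)
        = g \<eta> * of_real (1 / (2 * pi)) * (\<integral>y. iexp (\<eta> * y - \<xi> * y) * of_real (w y) \<partial>lborel)"
        by (subst integral_mult_right_zero[symmetric]) (simp only: mult_ac)
      then show "(\<integral>y. g \<eta> * of_real (w y) * (of_real (1 / (2 * pi)) * iexp (\<eta> * y - \<xi> * y)) \<partial>lborel) = g \<eta> * of_real (1 / e n * std_normal_density ((\<eta> - \<xi>) / e n))"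
        unfolding char by (simp only: mult.assoc of_real_mult[symmetric]) simp
    qed
    also have "\<dots> = \<bar>e n\<bar> *\<^sub>R (\<integral>z. g (\<xi> + e n * z) * of_real (1 / e n * std_normal_density ((\<xi> + e n * z - \<xi>) / e n)) \<partial>lborel)"
      using e0[of n] by (intro lborel_integral_real_affine) auto
    also have "\<dots> = (\<integral>z. g (\<xi> + e n * z) * of_real (std_normal_density z) \<partial>lborel)"
    proof -
      have "g (\<xi> + e n * z) * of_real (1 / e n * std_normal_density ((\<xi> + e n * z - \<xi>) / e n)) = of_real (1 / e n) * (g (\<xi> + e n * z) * of_real (std_normal_density z))" for z
      proof -
        have "(\<xi> + e n * z - \<xi>) / e n = z" using e0[of n] by simp
        then show ?thesis by (simp only: of_real_mult mult_ac)
      qed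
      then show ?thesis using e0[of n]
        by (simp only: integral_mult_right_zero scaleR_conv_of_real mult.assoc[symmetric] of_real_mult[symmetric]) simp
    qed
    finally show ?thesis .
  qed
  have "(\<lambda>n. \<integral>z. g (\<xi> + e n * z) * of_real (std_normal_density z) \<partial>lborel) \<longlonglongrightarrow> (\<integral>z. g (\<xi> + 0 * z) * of_real (std_normal_density z) \<partial>lborel)"
  proof (rule integral_dominated_convergence[where w="\<lambda>z. b * std_normal_density z"])
    show "integrable lborel (\<lambda>z. b * std_normal_density z)" by simp
    show "AE z in lborel. (\<lambda>n. g (\<xi> + e n * z) * of_real (std_normal_density z)) \<longlonglongrightarrow> g (\<xi> + 0 * z) * of_real (std_normal_density z)"
    proof (intro AE_I2 tendsto_mult tendsto_const)
      fix z
      have "isCont g (\<xi> + 0 * z)" using gc by (simp add: continuous_on_eq_continuous_at)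
      then show "(\<lambda>n. g (\<xi> + e n * z)) \<longlonglongrightarrow> g (\<xi> + 0 * z)"
        by (rule isCont_tendsto_compose) (intro tendsto_intros e_lim)
    qed
    show "AE z in lborel. norm (g (\<xi> + e n * z) * of_real (std_normal_density z)) \<le> b * std_normal_density z" for n
      using gb by (intro AE_I2) (auto simp: norm_mult normal_density_nonneg intro!: mult_right_mono)
  qed measurable
  moreover have "(\<integral>z. g (\<xi> + 0 * z) * of_real (std_normal_density z) \<partial>lborel) = g \<xi>"
    by (simp add: integral_normal_density)
  ultimately have "J \<longlonglongrightarrow> g \<xi>" unfolding J_eq[abs_def] by simp
  with lim1 show ?thesis by (rule LIMSEQ_unique)
qed

section \<open>Kernels of the dyadic decomposition\<close>

locale dyadic =
  fixes \<phi> :: "nat \<Rightarrow> real \<Rightarrow> complex"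
  assumes dyadic: "dyadic_system \<phi>"
begin

section \<open>Partial sums of the dyadic system and their derivatives\<close>

lemma nvd_Suc: "nth_vderiv (Suc l) f = (\<lambda>x. vector_derivative (nth_vderiv l f) (at x))"
  by (simp add: nth_vderiv_def)

lemma nvd_has: "(nth_vderiv l (\<phi> n) has_vector_derivative nth_vderiv (Suc l) (\<phi> n) x) (at x)"
  using dyadic unfolding dyadic_system_def test_function_def nvd_Suc
  by (auto simp: vector_derivative_works[symmetric])

lemma nvd_zero: "x \<notin> tsupp (\<phi> n) \<Longrightarrow> nth_vderiv l (\<phi> n) x = 0"
proof (induction l arbitrary: x)
  case 0
  then show ?case using closure_subset[of "{x. \<phi> n x \<noteq> 0}"] by (auto simp: nth_vderiv_def tsupp_def)
next
  case (Suc l)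
  have "((\<lambda>_. 0 :: complex) has_vector_derivative 0) (at x)" by simp
  then have "(nth_vderiv l (\<phi> n) has_vector_derivative 0) (at x)"
    by (rule has_vector_derivative_transform_within_open[where S="- tsupp (\<phi> n)"])
       (use Suc in \<open>auto simp: tsupp_def\<close>)
  then show ?case unfolding nvd_Suc by (rule vector_derivative_at)
qed

lemma nvd_supp:
  assumes "nth_vderiv l (\<phi> n) x \<noteq> 0"
  shows "\<bar>x\<bar> \<le> 2 ^ (n + 1)" "n \<ge> 1 \<Longrightarrow> 2 ^ (n - 1) \<le> \<bar>x\<bar>"
proof -
  have x: "x \<in> tsupp (\<phi> n)" using assms nvd_zero by blast
  have d: "tsupp (\<phi> 0) \<subseteq> {x. \<bar>x\<bar> \<le> 2}" "\<And>n. n \<ge> 1 \<Longrightarrow> tsupp (\<phi> n) \<subseteq> {x. 2 ^ (n - 1) \<le> \<bar>x\<bar> \<and> \<bar>x\<bar> \<le> 2 ^ (n + 1)}"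
    using dyadic unfolding dyadic_system_def by auto
  show "\<bar>x\<bar> \<le> 2 ^ (n + 1)"
  proof (cases "n = 0")
    case True
    then show ?thesis using x d(1) by auto
  next
    case False
    then show ?thesis using x d(2)[of n] by auto
  qed
  show "n \<ge> 1 \<Longrightarrow> 2 ^ (n - 1) \<le> \<bar>x\<bar>" using x d(2)[of n] by auto
qed

lemma nvd_bound: "\<exists>B\<ge>0. \<forall>n x. norm (nth_vderiv l (\<phi> n) x) \<le> B / 2 ^ (n * l)"
proof -
  obtain B where B: "\<And>n x. 2 ^ (n * l) * norm (nth_vderiv l (\<phi> n) x) \<le> B"
    using dyadic unfolding dyadic_system_def by blast
  have "0 \<le> 2 ^ (0 * l) * norm (nth_vderiv l (\<phi> 0) 0)" by simp
  then have "B \<ge> 0" using B[of 0 0] by linarith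
  then show ?thesis using B by (intro exI[of _ B]) (auto simp: field_simps)
qed

text \<open>The derivatives of a low-pass multiplier, which equals 1 for |x| < 2^M and vanishes for
  |x| > 2^(M+1).\<close>

definition chi :: "nat \<Rightarrow> nat \<Rightarrow> real \<Rightarrow> complex" where
  "chi l M x = (\<Sum>n\<le>M. nth_vderiv l (\<phi> n) x)"

lemma chi_has: "(chi l M has_vector_derivative chi (Suc l) M x) (at x)"
  unfolding chi_def[abs_def] by (intro has_vector_derivative_sum nvd_has)

lemma chi_cont: "continuous_on UNIV (chi l M)"
  by (intro continuous_at_imp_continuous_on ballI has_vector_derivative_continuous[OF chi_has])

lemma chi_measurable [measurable]: "chi l M \<in> borel_measurable borel"
  by (rule borel_measurable_continuous_onI[OF chi_cont])

lemma chi_outside: "\<bar>x\<bar> > 2 ^ (M + 1) \<Longrightarrow> chi l M x = 0"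
proof -
  assume x: "\<bar>x\<bar> > 2 ^ (M + 1)"
  have "nth_vderiv l (\<phi> n) x = 0" if "n \<le> M" for n
  proof (rule ccontr)
    assume "nth_vderiv l (\<phi> n) x \<noteq> 0"
    then have "\<bar>x\<bar> \<le> 2 ^ (n + 1)" by (rule nvd_supp)
    also have "\<dots> \<le> 2 ^ (M + 1)" using that by (intro power_increasing) auto
    finally show False using x by simp
  qed
  then show ?thesis by (simp add: chi_def)
qed

lemma nvd0: "nth_vderiv 0 f = f" by (simp add: nth_vderiv_def)

lemma chi_inside: "\<bar>x\<bar> < 2 ^ M \<Longrightarrow> chi 0 M x = 1"
proof -
  assume x: "\<bar>x\<bar> < 2 ^ M"
  have "\<phi> n x = 0" if "n \<notin> {..M}" for n
  proof (rule ccontr)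
    assume "\<phi> n x \<noteq> 0"
    then have p: "2 ^ (n - 1) \<le> \<bar>x\<bar>" using nvd_supp(2)[of 0 n x] that by (simp add: nvd0)
    have "(2::real) ^ M \<le> 2 ^ (n - 1)" using that by (intro power_increasing) auto
    from order_trans[OF this p] show False using x by linarith
  qed
  then have "(\<lambda>n. \<phi> n x) sums (\<Sum>n\<in>{..M}. \<phi> n x)" by (intro sums_finite) auto
  moreover have "(\<lambda>n. \<phi> n x) sums 1" using dyadic by (auto simp: dyadic_system_def)
  ultimately show ?thesis using sums_unique2 by (auto simp: chi_def nvd0)
qed

lemma chi_inside_Suc: "\<bar>x\<bar> < 2 ^ M \<Longrightarrow> chi (Suc l) M x = 0"
proof (induction l arbitrary: x)
  case 0
  have "((\<lambda>_. 1 :: complex) has_vector_derivative 0) (at x)" by simp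
  then have "(chi 0 M has_vector_derivative 0) (at x)"
    by (rule has_vector_derivative_transform_within_open[where S="{- (2 ^ M)<..<2 ^ M}"])
       (use 0 in \<open>auto simp: chi_inside abs_less_iff\<close>)
  then show ?case using vector_derivative_unique_at chi_has by blast
next
  case (Suc l)
  have "((\<lambda>_. 0 :: complex) has_vector_derivative 0) (at x)" by simp
  then have "(chi (Suc l) M has_vector_derivative 0) (at x)"
    by (rule has_vector_derivative_transform_within_open[where S="{- (2 ^ M)<..<2 ^ M}"])
       (use Suc in \<open>auto simp: abs_less_iff\<close>)
  then show ?case using vector_derivative_unique_at chi_has by blast
qed

text \<open>For |x| < 2^M the multiplier is constant. Elsewhere only the summands with n = M - 1 and
  n = M can be nonzero, so the bounds do not accumulate over the sum; replacing n = M - 1 by M costs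
  the factor 2^l.\<close>

lemma chi_bound: "\<exists>C>0. \<forall>M x. norm (chi l M x) \<le> C / 2 ^ (M * l)"
proof -
  obtain B where B: "B \<ge> 0" "\<And>n x. norm (nth_vderiv l (\<phi> n) x) \<le> B / 2 ^ (n * l)" using nvd_bound by blast
  define C where "C = 1 + 2 * B * 2 ^ l"
  have C: "C \<ge> 1" using B by (simp add: C_def)
  have "norm (chi l M x) \<le> C / 2 ^ (M * l)" for M x
  proof (cases "\<bar>x\<bar> < 2 ^ M")
    case True
    have "norm (chi l M x) \<le> 1 / 2 ^ (M * l)"
      using True by (cases l) (auto simp: chi_inside chi_inside_Suc)
    also have "\<dots> \<le> C / 2 ^ (M * l)" using C by (intro divide_right_mono) auto
    finally show ?thesis .
  next
    case False
    have "nth_vderiv l (\<phi> n) x = 0" if "n + 1 < M" for n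
    proof (rule ccontr)
      assume "nth_vderiv l (\<phi> n) x \<noteq> 0"
      then have "\<bar>x\<bar> \<le> 2 ^ (n + 1)" by (rule nvd_supp)
      also have "\<dots> < 2 ^ M" using that by (intro power_strict_increasing) auto
      finally show False using False by simp
    qed
    then have "chi l M x = (\<Sum>n\<in>{M - 1..M}. nth_vderiv l (\<phi> n) x)"
      unfolding chi_def by (intro sum.mono_neutral_right) auto
    then have "norm (chi l M x) \<le> (\<Sum>n\<in>{M - 1..M}. B * 2 ^ l / 2 ^ (M * l))"
    proof (simp only:, intro sum_norm_le)
      fix n assume n: "n \<in> {M - 1..M}"
      have "(2::real) ^ (M * l) \<le> 2 ^ ((n + 1) * l)" using n by (intro power_increasing mult_right_mono) auto
      then have "1 / 2 ^ (n * l) \<le> 2 ^ l / (2::real) ^ (M * l)" by (simp add: field_simps power_add)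
      then have "B * (1 / 2 ^ (n * l)) \<le> B * (2 ^ l / 2 ^ (M * l))" using B by (intro mult_left_mono)
      then show "norm (nth_vderiv l (\<phi> n) x) \<le> B * 2 ^ l / 2 ^ (M * l)" using B(2)[of n x] by simp
    qed
    also have "\<dots> = real (card {M - 1..M}) * (B * 2 ^ l / 2 ^ (M * l))" by simp
    also have "\<dots> \<le> 2 * (B * 2 ^ l / 2 ^ (M * l))"
      using B by (intro mult_right_mono) auto
    also have "\<dots> \<le> C / 2 ^ (M * l)"
      using B by (simp add: C_def divide_right_mono)
    finally show ?thesis .
  qed
  then show ?thesis using C by (intro exI[of _ C]) auto
qed

text \<open>\<open>P M\<close> is the low-pass kernel, \<open>L M\<close> its derivative,
  \<open>K n\<close> the kernel of a single member of the system.\<close>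

definition P :: "nat \<Rightarrow> real \<Rightarrow> complex" where "P M = ift (chi 0 M)"
definition L :: "nat \<Rightarrow> real \<Rightarrow> complex" where "L M = ift (\<lambda>\<xi>. \<i> * of_real \<xi> * chi 0 M \<xi>)"
definition K :: "nat \<Rightarrow> real \<Rightarrow> complex" where "K n = ift (\<phi> n)"

lemma P_measurable [measurable]: "P M \<in> borel_measurable borel"
  unfolding P_def by measurable

lemma L_measurable [measurable]: "L M \<in> borel_measurable borel"
  unfolding L_def by measurable

lemma phi_cont: "continuous_on UNIV (\<phi> n)"
  using nvd_has[of 0 n] unfolding nvd0
  by (intro continuous_at_imp_continuous_on ballI has_vector_derivative_continuous)

lemma phi_measurable [measurable]: "\<phi> n \<in> borel_measurable borel"
  by (rule borel_measurable_continuous_onI[OF phi_cont])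

lemma K_measurable [measurable]: "K n \<in> borel_measurable borel"
  unfolding K_def by measurable

lemma phi_bounded: "\<exists>B\<ge>0. \<forall>n x. norm (\<phi> n x) \<le> B"
  using nvd_bound[of 0] by (simp add: nvd0)

lemma phi_outside: "\<bar>x\<bar> > 2 ^ (n + 1) \<Longrightarrow> \<phi> n x = 0"
  using nvd_supp(1)[of 0 n x] by (auto simp: nvd0)

lemma phi_integrable: "integrable lborel (\<phi> n)"
proof -
  obtain B where "B \<ge> 0" "\<And>x. norm (\<phi> n x) \<le> B" using phi_bounded by blast
  then show ?thesis
    by (intro integrable_bounded_support[of "\<phi> n" B "2 ^ (n + 1)"] phi_outside) auto
qed

lemma chi_integrable: "integrable lborel (chi 0 M)"
proof -
  obtain B where "B > 0" "\<And>x. norm (chi 0 M x) \<le> B" using chi_bound[of 0] by auto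
  then show ?thesis
    by (intro integrable_bounded_support[of "chi 0 M" B "2 ^ (M + 1)"] chi_outside) auto
qed

lemma P_sum_K: "P M x = (\<Sum>n\<le>M. K n x)"
proof -
  have "(\<integral>\<xi>. chi 0 M \<xi> * iexp (\<xi> * x) \<partial>lborel) = (\<Sum>n\<le>M. \<integral>\<xi>. \<phi> n \<xi> * iexp (\<xi> * x) \<partial>lborel)"
    unfolding chi_def nvd0 sum_distrib_right
    by (intro Bochner_Integration.integral_sum integrable_mult_iexp phi_integrable) auto
  then show ?thesis by (simp add: P_def K_def ift_def sum_distrib_left)
qed

text \<open>\<open>ift_decay\<close> with T = 2^M and a support of size 2^(M+1): each derivative of
  the multiplier gains 2^-M, and the factor \<xi> in the multiplier of \<open>L M\<close> loses one
  power of 2^M.\<close>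

lemma kernel_bounds: "\<exists>A>0. \<forall>M x. norm (P M x) \<le> A * kap M x \<and> norm (L M x) \<le> A * 2 ^ M * kap M x"
proof -
  obtain C0 where C0: "C0 > 0" "\<And>M x. norm (chi 0 M x) \<le> C0" using chi_bound[of 0] by auto
  obtain C1 where C1: "C1 > 0" "\<And>M x. norm (chi 1 M x) \<le> C1 / 2 ^ M" using chi_bound[of 1] by auto
  obtain C2 where C2: "C2 > 0" "\<And>M x. norm (chi 2 M x) \<le> C2 / 2 ^ (M * 2)" using chi_bound[of 2] by auto
  have has: "(chi 0 M has_vector_derivative chi 1 M x) (at x)" "(chi 1 M has_vector_derivative chi 2 M x) (at x)" for M x
    using chi_has[of 0 M x] chi_has[of 1 M x] by (simp_all add: numeral_2_eq_2)
  define A where "A = 4 / pi * (C0 + C1 + C2)"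
  have A: "A > 0" using C0(1) C1(1) C2(1) by (simp add: A_def)
  have T: "((2::real) ^ M)\<^sup>2 = 2 ^ (M * 2)" for M by (simp add: power_mult)
  have pk: "(1 + (2 ^ M * x)\<^sup>2) * z \<le> c * 2 ^ M \<Longrightarrow> z \<le> c * kap M x" for M x z c
  proof -
    assume *: "(1 + (2 ^ M * x)\<^sup>2) * z \<le> c * 2 ^ M"
    have "1 + (2 ^ M * x)\<^sup>2 > 0" by (simp add: add_pos_nonneg)
    then show ?thesis using * by (simp add: kap_def pos_le_divide_eq mult.commute)
  qed
  have "norm (P M x) \<le> A * kap M x" for M x
  proof -
    have "(1 + (2 ^ M * x)\<^sup>2) * norm (ift (chi 0 M) x) \<le> 2 ^ (M + 1) / pi * (C0 + (2 ^ M)\<^sup>2 * (C2 / 2 ^ (M * 2)))"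
      by (rule ift_decay[OF has chi_cont]) (use C0 C2 chi_outside in auto)
    also have "\<dots> = 2 / pi * (C0 + C2) * 2 ^ M" by (simp add: T)
    also have "\<dots> \<le> A * 2 ^ M"
      using C0(1) C1(1) C2(1) by (intro mult_right_mono) (auto simp: A_def field_simps)
    finally show ?thesis by (simp only: P_def) (rule pk)
  qed
  moreover have "norm (L M x) \<le> A * 2 ^ M * kap M x" for M x
  proof -
    define g where "g = (\<lambda>\<xi>::real. \<i> * of_real \<xi> * chi 0 M \<xi>)"
    define g1 where "g1 = (\<lambda>\<xi>::real. \<i> * of_real \<xi> * chi 1 M \<xi> + \<i> * chi 0 M \<xi>)"
    define g2 where "g2 = (\<lambda>\<xi>::real. (\<i> * of_real \<xi> * chi 2 M \<xi> + \<i> * chi 1 M \<xi>) + \<i> * chi 1 M \<xi>)"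
    have lin: "((\<lambda>\<xi>::real. \<i> * of_real \<xi>) has_vector_derivative \<i>) (at \<xi>)" for \<xi>
      using has_vector_derivative_mult_right[OF has_vector_derivative_of_real[OF DERIV_ident], of \<i>] by simp
    have h1: "(g has_vector_derivative g1 \<xi>) (at \<xi>)" for \<xi>
      unfolding g_def g1_def by (intro has_vector_derivative_mult lin has)
    have h2: "(g1 has_vector_derivative g2 \<xi>) (at \<xi>)" for \<xi>
      unfolding g1_def g2_def
      by (intro has_vector_derivative_add has_vector_derivative_mult has_vector_derivative_mult_right lin has)
    have c2: "continuous_on UNIV g2" unfolding g2_def by (intro continuous_intros chi_cont)
    have inx: "norm (chi l M \<xi>) * \<bar>\<xi>\<bar> \<le> b * 2 ^ (M + 1)" if "\<And>x. norm (chi l M x) \<le> b" for l \<xi> b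
    proof (cases "\<bar>\<xi>\<bar> \<le> 2 ^ (M + 1)")
      case True
      have "b \<ge> 0" using that[of \<xi>] norm_ge_zero order_trans by blast
      then show ?thesis using True that by (intro mult_mono) auto
    next
      case False
      have "b \<ge> 0" using that[of \<xi>] norm_ge_zero order_trans by blast
      then show ?thesis using False by (simp add: chi_outside)
    qed
    have "(1 + (2 ^ M * x)\<^sup>2) * norm (ift g x) \<le> 2 ^ (M + 1) / pi * (C0 * 2 ^ (M + 1) + (2 ^ M)\<^sup>2 * (2 * (C1 + C2) / 2 ^ M))"
    proof (rule ift_decay[OF h1 h2 c2])
      show "norm (g \<xi>) \<le> C0 * 2 ^ (M + 1)" for \<xi>
        using inx[of 0 C0 \<xi>] C0 by (simp add: g_def norm_mult mult.commute)
      show "norm (g2 \<xi>) \<le> 2 * (C1 + C2) / 2 ^ M" for \<xi>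
      proof -
        have "norm (g2 \<xi>) \<le> norm (\<i> * of_real \<xi> * chi 2 M \<xi>) + norm (\<i> * chi 1 M \<xi>) + norm (\<i> * chi 1 M \<xi>)"
          unfolding g2_def by (intro norm_triangle_mono order_refl)
        also have "\<dots> = norm (chi 2 M \<xi>) * \<bar>\<xi>\<bar> + 2 * norm (chi 1 M \<xi>)" by (simp add: norm_mult)
        also have "\<dots> \<le> C2 / 2 ^ (M * 2) * 2 ^ (M + 1) + 2 * (C1 / 2 ^ M)"
          using C1(2) C2(2) by (intro add_mono mult_left_mono inx) auto
        also have "\<dots> = 2 * (C1 + C2) / 2 ^ M" by (simp add: power_mult power2_eq_square field_simps)
        finally show ?thesis .
      qed
    qed (use C0 C1 C2 chi_outside in \<open>auto simp: g_def g1_def g2_def\<close>)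
    also have "\<dots> = A * 2 ^ M * 2 ^ M" by (simp add: A_def power2_eq_square field_simps)
    finally show ?thesis by (simp only: L_def g_def) (rule pk)
  qed
  ultimately show ?thesis using A by blast
qed

definition A0 :: real where
  "A0 = (SOME A. A > 0 \<and> (\<forall>M x. norm (P M x) \<le> A * kap M x \<and> norm (L M x) \<le> A * 2 ^ M * kap M x))"

lemma A0: "A0 > 0" "norm (P M x) \<le> A0 * kap M x" "norm (L M x) \<le> A0 * 2 ^ M * kap M x"
proof -
  have "A0 > 0 \<and> (\<forall>M x. norm (P M x) \<le> A0 * kap M x \<and> norm (L M x) \<le> A0 * 2 ^ M * kap M x)"
    unfolding A0_def by (rule someI_ex[OF kernel_bounds])
  then show "A0 > 0" "norm (P M x) \<le> A0 * kap M x" "norm (L M x) \<le> A0 * 2 ^ M * kap M x" by auto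
qed

lemma kap_nonneg: "kap M x \<ge> 0"
  by (simp add: kap_def)

lemma kap_le: "kap M x \<le> 2 ^ M"
  unfolding kap_def by (auto simp: divide_le_eq add_pos_nonneg mult_le_cancel_left1)

lemma P_norm_int: "(\<integral>\<^sup>+x. norm (P M x) \<partial>lborel) \<le> ennreal (A0 * pi)"
proof -
  have "(\<integral>\<^sup>+x. norm (P M x) \<partial>lborel) \<le> (\<integral>\<^sup>+x. ennreal A0 * ennreal (kap M x) \<partial>lborel)"
    using A0 kap_nonneg by (intro nn_integral_mono) (simp add: ennreal_leI less_imp_le flip: ennreal_mult)
  also have "\<dots> = ennreal (A0 * pi)"
    using A0(1) by (simp add: nn_integral_cmult nn_integral_kap less_imp_le flip: ennreal_mult)
  finally show ?thesis .
qed

lemma L_norm_int: "(\<integral>\<^sup>+x. norm (L M x) \<partial>lborel) \<le> ennreal (A0 * 2 ^ M * pi)"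
proof -
  have "(\<integral>\<^sup>+x. norm (L M x) \<partial>lborel) \<le> (\<integral>\<^sup>+x. ennreal (A0 * 2 ^ M) * ennreal (kap M x) \<partial>lborel)"
    using A0 kap_nonneg by (intro nn_integral_mono) (simp add: ennreal_leI less_imp_le flip: ennreal_mult)
  also have "\<dots> = ennreal (A0 * 2 ^ M * pi)"
    using A0(1) by (simp add: nn_integral_cmult nn_integral_kap less_imp_le flip: ennreal_mult)
  finally show ?thesis .
qed

lemma P_integrable: "integrable lborel (P M)"
  using P_norm_int[of M] by (auto simp: integrable_iff_bounded intro: le_less_trans)

lemma K_integrable: "integrable lborel (K n)"
proof (cases n)
  case 0
  have "K 0 = P 0" by (auto simp: P_sum_K fun_eq_iff)
  then show ?thesis using 0 P_integrable by simp
next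
  case (Suc m)
  have "K n = (\<lambda>x. P n x - P m x)" by (auto simp: P_sum_K Suc fun_eq_iff)
  then show ?thesis using P_integrable by simp
qed

lemma K_bounded: "\<exists>B>0. \<forall>x. norm (K n x) \<le> B"
proof -
  have "norm (K n x) \<le> (\<integral>\<xi>. norm (\<phi> n \<xi>) \<partial>lborel) / (2 * pi) + 1" for x
    unfolding K_def using norm_ift_le[OF phi_integrable[of n], of x] by simp
  moreover have "(\<integral>\<xi>. norm (\<phi> n \<xi>) \<partial>lborel) / (2 * pi) + 1 > 0"
    by (intro add_nonneg_pos divide_nonneg_nonneg integral_nonneg_AE) auto
  ultimately show ?thesis by blast
qed

text \<open>Fourier inversion at frequency 0, where the low-pass multiplier is 1.\<close>

lemma P_integral: "(\<integral>x. P M x \<partial>lborel) = 1"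
proof -
  obtain B where "B > 0" "\<And>x. norm (chi 0 M x) \<le> B" using chi_bound[of 0] by auto
  then have "(\<integral>y. ift (chi 0 M) y * iexp (- (0 * y)) \<partial>lborel) = chi 0 M 0"
    using P_integrable[of M] unfolding P_def by (intro fourier_inversion_1d chi_cont chi_integrable) auto
  then show ?thesis by (simp add: P_def chi_inside)
qed

text \<open>The multipliers satisfy chi * phi = phi. The support of \<open>\<phi> n\<close> reaches
  up to 2^(n+1) inclusively, while the multiplier of \<open>P M\<close> is known to be 1 only for
  |\<xi>| < 2^M; so M = n + 2 is taken.\<close>

lemma K_conv: "(\<integral>y. K n y * P (n + 2) (x - y) \<partial>lborel) = K n x"
proof -
  obtain B where B: "B \<ge> 0" "\<And>x. norm (\<phi> n x) \<le> B" using phi_bounded by blast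
  have inv: "(\<integral>y. K n y * iexp (- (\<xi> * y)) \<partial>lborel) = \<phi> n \<xi>" for \<xi>
    unfolding K_def using K_integrable[of n] B by (intro fourier_inversion_1d phi_cont phi_integrable) (auto simp: K_def)
  let ?c = "of_real (1 / (2 * pi)) :: complex"
  have "(\<integral>y. K n y * P (n + 2) (x - y) \<partial>lborel) = (\<integral>y. \<integral>\<xi>. chi 0 (n + 2) \<xi> * K n y * (?c * iexp (\<xi> * x - \<xi> * y)) \<partial>lborel \<partial>lborel)"
  proof (intro Bochner_Integration.integral_cong refl)
    fix y
    have "chi 0 (n + 2) \<xi> * K n y * (?c * iexp (\<xi> * x - \<xi> * y)) = ?c * K n y * (chi 0 (n + 2) \<xi> * iexp (\<xi> * (x - y)))" for \<xi>
      by (simp only: right_diff_distrib mult_ac)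
    then show "K n y * P (n + 2) (x - y) = (\<integral>\<xi>. chi 0 (n + 2) \<xi> * K n y * (?c * iexp (\<xi> * x - \<xi> * y)) \<partial>lborel)"
      unfolding P_def ift_def by (simp only: integral_mult_right_zero mult_ac)
  qed
  also have "\<dots> = (\<integral>\<xi>. \<integral>y. chi 0 (n + 2) \<xi> * K n y * (?c * iexp (\<xi> * x - \<xi> * y)) \<partial>lborel \<partial>lborel)"
  proof (rule Fubini_tensor[where f="chi 0 (n + 2)" and g="K n" and H="\<lambda>\<xi> y. ?c * iexp (\<xi> * x - \<xi> * y)" and c="1 / (2 * pi)"])
    show "cmod (?c * iexp (\<xi> * x - \<xi> * y)) \<le> 1 / (2 * pi)" for \<xi> y
      unfolding norm_mult norm_exp_i_times norm_of_real by simp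
    show "(\<lambda>(\<xi>, y). ?c * iexp (\<xi> * x - \<xi> * y)) \<in> borel_measurable (lborel \<Otimes>\<^sub>M lborel)"
      by measurable
  qed (rule chi_integrable K_integrable)+
  also have "\<dots> = (\<integral>\<xi>. ?c * (\<phi> n \<xi> * iexp (\<xi> * x)) \<partial>lborel)"
  proof (intro Bochner_Integration.integral_cong refl)
    fix \<xi>
    have "chi 0 (n + 2) \<xi> * K n y * (?c * iexp (\<xi> * x - \<xi> * y)) = ?c * chi 0 (n + 2) \<xi> * iexp (\<xi> * x) * (K n y * iexp (- (\<xi> * y)))" for y
    proof -
      have "iexp (\<xi> * x - \<xi> * y) = iexp (\<xi> * x) * iexp (- (\<xi> * y))"
        by (simp add: algebra_simps flip: exp_add)
      then show ?thesis by (simp only: mult_ac)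
    qed
    then have "(\<integral>y. chi 0 (n + 2) \<xi> * K n y * (?c * iexp (\<xi> * x - \<xi> * y)) \<partial>lborel) = ?c * chi 0 (n + 2) \<xi> * iexp (\<xi> * x) * \<phi> n \<xi>"
      by (simp only: integral_mult_right_zero inv)
    moreover have "chi 0 (n + 2) \<xi> * \<phi> n \<xi> = \<phi> n \<xi>"
    proof (cases "\<bar>\<xi>\<bar> \<le> 2 ^ (n + 1)")
      case True
      also have "(2::real) ^ (n + 1) < 2 ^ (n + 2)" by (intro power_strict_increasing) auto
      finally show ?thesis by (simp add: chi_inside)
    qed (simp add: phi_outside)
    ultimately show "(\<integral>y. chi 0 (n + 2) \<xi> * K n y * (?c * iexp (\<xi> * x - \<xi> * y)) \<partial>lborel) = ?c * (\<phi> n \<xi> * iexp (\<xi> * x))"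
      by (metis (no_types, lifting) mult.assoc mult.commute)
  qed
  also have "\<dots> = K n x" unfolding K_def ift_def by (simp only: integral_mult_right_zero)
  finally show ?thesis .
qed

text \<open>The increment of the exponential is the integral of its derivative, and Fubini moves
  that integral outside, leaving \<open>L M\<close>. The right endpoint is dropped as a null
  set.\<close>

lemma P_increment:
  assumes "x \<le> y"
  shows "ennreal (norm (P M y - P M x)) \<le> (\<integral>\<^sup>+t. indicator {x..<y} t * ennreal (norm (L M t)) \<partial>lborel)"
proof -
  let ?c = "of_real (1 / (2 * pi)) :: complex"
  define w where "w = (\<lambda>\<xi>::real. \<i> * of_real \<xi> * chi 0 M \<xi>)"
  define I where "I = (\<lambda>t::real. complex_of_real (indicator {x..y} t))"
  have [measurable]: "w \<in> borel_measurable borel" "I \<in> borel_measurable borel"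
    unfolding w_def I_def by measurable
  obtain B where B: "B > 0" "\<And>x. norm (chi 0 M x) \<le> B" using chi_bound[of 0] by auto
  have wi: "integrable lborel w"
  proof (rule integrable_bounded_support(1)[where b="2 ^ (M + 1) * B" and R="2 ^ (M + 1)"])
    fix \<xi> :: real
    show "norm (w \<xi>) \<le> 2 ^ (M + 1) * B"
    proof (cases "\<bar>\<xi>\<bar> \<le> 2 ^ (M + 1)")
      case True
      then show ?thesis using B unfolding w_def norm_mult by (intro mult_mono) auto
    qed (use B in \<open>simp add: w_def chi_outside\<close>)
    show "\<bar>\<xi>\<bar> > 2 ^ (M + 1) \<Longrightarrow> w \<xi> = 0" by (simp add: w_def chi_outside)
  qed (use B in auto)
  have Ii: "integrable lborel I"
    unfolding I_def by (intro integrable_of_real integrable_real_indicator) (auto simp: emeasure_lborel_Icc_eq)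
  have ftc: "iexp (\<xi> * y) - iexp (\<xi> * x) = (\<integral>t. I t * (\<i> * of_real \<xi> * iexp (\<xi> * t)) \<partial>lborel)" for \<xi>
  proof -
    have "(\<integral>t. indicator {x..y} t *\<^sub>R (\<i> * of_real \<xi> * iexp (\<xi> * t)) \<partial>lborel) = iexp (\<xi> * y) - iexp (\<xi> * x)"
    proof (rule integral_FTC_atLeastAtMost[OF assms])
      fix t
      have "((\<lambda>z. exp (\<i> * (of_real \<xi> * z))) has_field_derivative \<i> * of_real \<xi> * exp (\<i> * (of_real \<xi> * of_real t))) (at (of_real t))"
        by (auto intro!: derivative_eq_intros)
      from has_vector_derivative_real_field[OF this]
      show "((\<lambda>t. iexp (\<xi> * t)) has_vector_derivative \<i> * of_real \<xi> * iexp (\<xi> * t)) (at t within {x..y})"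
        by (simp add: has_vector_derivative_at_within)
    qed (intro continuous_intros)
    then show ?thesis by (simp add: I_def scaleR_conv_of_real)
  qed
  have "P M y - P M x = ?c * ((\<integral>\<xi>. chi 0 M \<xi> * iexp (\<xi> * y) \<partial>lborel) - (\<integral>\<xi>. chi 0 M \<xi> * iexp (\<xi> * x) \<partial>lborel))"
    unfolding P_def ift_def by (rule right_diff_distrib[symmetric])
  also have "(\<integral>\<xi>. chi 0 M \<xi> * iexp (\<xi> * y) \<partial>lborel) - (\<integral>\<xi>. chi 0 M \<xi> * iexp (\<xi> * x) \<partial>lborel)
      = (\<integral>\<xi>. chi 0 M \<xi> * iexp (\<xi> * y) - chi 0 M \<xi> * iexp (\<xi> * x) \<partial>lborel)"
    by (rule Bochner_Integration.integral_diff[symmetric]; rule integrable_mult_iexp[OF chi_integrable]; measurable)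
  also have "?c * \<dots> = (\<integral>\<xi>. ?c * (chi 0 M \<xi> * (iexp (\<xi> * y) - iexp (\<xi> * x))) \<partial>lborel)"
    unfolding right_diff_distrib[symmetric] by (rule integral_mult_right_zero[symmetric])
  also have "\<dots> = (\<integral>\<xi>. \<integral>t. w \<xi> * I t * (?c * iexp (\<xi> * t)) \<partial>lborel \<partial>lborel)"
  proof (intro Bochner_Integration.integral_cong refl)
    fix \<xi>
    have "w \<xi> * I t * (?c * iexp (\<xi> * t)) = ?c * chi 0 M \<xi> * (I t * (\<i> * of_real \<xi> * iexp (\<xi> * t)))" for t
      unfolding w_def by (simp only: mult_ac)
    then show "?c * (chi 0 M \<xi> * (iexp (\<xi> * y) - iexp (\<xi> * x))) = (\<integral>t. w \<xi> * I t * (?c * iexp (\<xi> * t)) \<partial>lborel)"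
      unfolding ftc by (simp only: integral_mult_right_zero mult.assoc)
  qed
  also have "\<dots> = (\<integral>t. \<integral>\<xi>. w \<xi> * I t * (?c * iexp (\<xi> * t)) \<partial>lborel \<partial>lborel)"
  proof (rule Fubini_tensor[where f=w and g=I and H="\<lambda>\<xi> t. ?c * iexp (\<xi> * t)" and c="1 / (2 * pi)", symmetric])
    show "cmod (?c * iexp (\<xi> * t)) \<le> 1 / (2 * pi)" for \<xi> t
      unfolding norm_mult norm_exp_i_times norm_of_real by simp
    show "(\<lambda>(\<xi>, t). ?c * iexp (\<xi> * t)) \<in> borel_measurable (lborel \<Otimes>\<^sub>M lborel)"
      by measurable
  qed (rule wi Ii)+
  also have "\<dots> = (\<integral>t. I t * L M t \<partial>lborel)"
  proof (intro Bochner_Integration.integral_cong refl)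
    fix t
    have eq: "w \<xi> * I t * (?c * iexp (\<xi> * t)) = ?c * I t * (w \<xi> * iexp (\<xi> * t))" for \<xi>
      by (simp only: mult_ac)
    show "(\<integral>\<xi>. w \<xi> * I t * (?c * iexp (\<xi> * t)) \<partial>lborel) = I t * L M t"
      unfolding eq integral_mult_right_zero L_def ift_def w_def[symmetric] by (simp only: mult_ac)
  qed
  finally have eq: "P M y - P M x = (\<integral>t. I t * L M t \<partial>lborel)" .
  have "integrable lborel (\<lambda>t. I t * L M t)"
  proof (rule Bochner_Integration.integrable_bound)
    show "integrable lborel (L M)" using L_norm_int[of M] by (auto simp: integrable_iff_bounded intro: le_less_trans)
  qed (auto simp: I_def norm_mult indicator_def)
  then have "ennreal (norm (P M y - P M x)) \<le> (\<integral>\<^sup>+t. norm (I t * L M t) \<partial>lborel)"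
    unfolding eq by (rule integral_norm_bound_ennreal)
  also have "\<dots> = (\<integral>\<^sup>+t. indicator {x..<y} t * ennreal (norm (L M t)) \<partial>lborel)"
  proof (rule nn_integral_cong_AE)
    have "AE t in lborel. t \<noteq> y" by (rule AE_lborel_singleton)
    then show "AE t in lborel. ennreal (norm (I t * L M t)) = indicator {x..<y} t * ennreal (norm (L M t))"
      by eventually_elim (auto simp: I_def norm_mult indicator_def)
  qed
  finally show ?thesis .
qed

text \<open>4 = 2^2 pays for the shift of the index by 2, and pi is the integral of
  \<open>kap\<close>.\<close>

definition A1 :: real where "A1 = 4 * A0 * pi"

text \<open>The shift by 2: the multiplier of \<^term>\<open>P (a + 2)\<close> equals 1 on the support of \<^term>\<open>\<phi> a\<close>, so
  \<^term>\<open>P (a + 2)\<close> reproduces the blocks of level \<^term>\<open>a\<close>.\<close>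

sublocale kernels "\<lambda>a. P (a + 2)" "\<lambda>a. L (a + 2)" A1
proof (unfold_locales, goal_cases)
  case (1 a) show ?case by measurable
next
  case (2 a) show ?case by measurable
next
  case 3 show ?case using A0(1) by (simp add: A1_def)
next
  case (4 a) show ?case
    using A0(1) by (intro order_trans[OF P_norm_int] ennreal_leI) (simp add: A1_def)
next
  case (5 a x)
  have pi1: "pi \<ge> 1" using pi_gt3 by simp
  have "norm (P (a + 2) x) \<le> A0 * kap (a + 2) x" by (rule A0)
  also have "\<dots> \<le> A0 * 2 ^ (a + 2)" using A0(1) by (intro mult_left_mono kap_le) auto
  also have "\<dots> = 4 * A0 * 2 ^ a * 1" by simp
  also have "\<dots> \<le> 4 * A0 * 2 ^ a * pi" using A0(1) pi1 by (intro mult_left_mono) auto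
  finally show ?case by (simp add: A1_def mult_ac)
next
  case (6 a) show ?case
    by (rule order_trans[OF L_norm_int]) (simp add: A1_def mult_ac)
next
  case (7 x y a)
  then show ?case
    using P_increment[of x y "a + 2"] by (simp add: ennreal_mult' ennreal_indicator)
qed

section \<open>Averages of the low-pass kernel over intervals\<close>

definition box_avg :: "nat \<Rightarrow> real \<Rightarrow> real \<Rightarrow> real \<Rightarrow> complex" where
  "box_avg M a b y = (\<integral>x. of_real (indicator {a..b} x) * P M (x - y) \<partial>lborel)"

text \<open>Away from the origin \<open>kap M\<close> is of order 2^-M / x^2. This is compared with
  1/(1 + x^2), whose integral is known, at the price of a factor depending on
  \<open>\<delta>\<close>.\<close>

lemma P_tail:
  assumes "\<delta> > 0"
  shows "(\<integral>\<^sup>+x. ennreal (norm (P M x)) * indicator {x. \<bar>x\<bar> \<ge> \<delta>} x \<partial>lborel) \<le> ennreal (A0 * (1 / \<delta>\<^sup>2 + 1) * pi / 2 ^ M)"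
proof -
  have "(\<integral>\<^sup>+x. ennreal (norm (P M x)) * indicator {x. \<bar>x\<bar> \<ge> \<delta>} x \<partial>lborel)
     \<le> (\<integral>\<^sup>+x. ennreal (A0 * (1 / \<delta>\<^sup>2 + 1) / 2 ^ M) * ennreal (1 / (1 + x\<^sup>2)) \<partial>lborel)"
  proof (intro nn_integral_mono)
    fix x :: real
    have "norm (P M x) \<le> A0 * (1 / \<delta>\<^sup>2 + 1) / 2 ^ M * (1 / (1 + x\<^sup>2))" if "\<bar>x\<bar> \<ge> \<delta>"
    proof -
      have x0: "x\<^sup>2 > 0" and xd: "\<delta>\<^sup>2 \<le> x\<^sup>2" using that assms by (auto simp: abs_le_square_iff[symmetric])
      have "kap M x \<le> 2 ^ M / (2 ^ M * x)\<^sup>2"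
        unfolding kap_def using x0 by (intro divide_left_mono) (auto simp: add_pos_nonneg)
      also have "\<dots> = (1 + 1 / x\<^sup>2) / 2 ^ M * (1 / (1 + x\<^sup>2))"
      proof -
        have "1 + x\<^sup>2 \<noteq> 0" using x0 by linarith
        moreover have "1 + 1 / x\<^sup>2 = (1 + x\<^sup>2) / x\<^sup>2" using x0 by (simp add: add_divide_distrib)
        moreover have "2 ^ M / (2 ^ M * x)\<^sup>2 = 1 / (2 ^ M * x\<^sup>2)"
          using x0 by (simp add: power_mult_distrib power2_eq_square)
        ultimately show ?thesis by simp
      qed
      also have "\<dots> \<le> (1 + 1 / \<delta>\<^sup>2) / 2 ^ M * (1 / (1 + x\<^sup>2))"
        using xd x0 assms by (intro mult_right_mono divide_right_mono add_left_mono divide_left_mono mult_pos_pos) auto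
      finally have "A0 * kap M x \<le> A0 * ((1 + 1 / \<delta>\<^sup>2) / 2 ^ M * (1 / (1 + x\<^sup>2)))"
        using A0(1) by (intro mult_left_mono) auto
      then show ?thesis using A0(2)[of M x] by (simp add: add.commute)
    qed
    then show "ennreal (norm (P M x)) * indicator {x. \<bar>x\<bar> \<ge> \<delta>} x \<le> ennreal (A0 * (1 / \<delta>\<^sup>2 + 1) / 2 ^ M) * ennreal (1 / (1 + x\<^sup>2))"
      using A0(1) by (auto simp: indicator_def ennreal_leI simp flip: ennreal_mult)
  qed
  also have "\<dots> = ennreal (A0 * (1 / \<delta>\<^sup>2 + 1) / 2 ^ M) * ennreal pi"
    by (subst nn_integral_cmult) (auto simp: nn_integral_inverse_1_plus_square)
  also have "\<dots> = ennreal (A0 * (1 / \<delta>\<^sup>2 + 1) * pi / 2 ^ M)"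
    using A0(1) by (simp add: field_simps flip: ennreal_mult)
  finally show ?thesis .
qed

lemma box_avg_eq: "box_avg M a b y = (\<integral>x. of_real (indicator {a - y..b - y} x) * P M x \<partial>lborel)"
proof -
  have "(\<integral>x. of_real (indicator {a..b} x) * P M (x - y) \<partial>lborel) = \<bar>1\<bar> *\<^sub>R (\<integral>x. of_real (indicator {a..b} (y + 1 * x)) * P M (y + 1 * x - y) \<partial>lborel)"
    by (rule lborel_integral_real_affine) simp
  also have "\<dots> = (\<integral>x. of_real (indicator {a - y..b - y} x) * P M x \<partial>lborel)"
    by (auto intro!: Bochner_Integration.integral_cong simp: indicator_def)
  finally show ?thesis by (simp add: box_avg_def)
qed

lemma ind_P_integrable:
  assumes [measurable]: "S \<in> sets borel"
  shows "integrable lborel (\<lambda>x. of_real (indicator S x) * P M x)"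
  by (rule Bochner_Integration.integrable_bound[OF P_integrable[of M]]) (auto simp: norm_mult indicator_def)

lemma ind_P_bound:
  assumes [measurable]: "S \<in> sets borel"
  shows "ennreal (norm (\<integral>x. of_real (indicator S x) * P M x \<partial>lborel)) \<le> (\<integral>\<^sup>+x. ennreal (norm (P M x)) * indicator S x \<partial>lborel)"
proof -
  have "ennreal (norm (\<integral>x. of_real (indicator S x) * P M x \<partial>lborel)) \<le> (\<integral>\<^sup>+x. norm (of_real (indicator S x) * P M x) \<partial>lborel)"
    by (rule integral_norm_bound_ennreal[OF ind_P_integrable]) simp
  also have "\<dots> = (\<integral>\<^sup>+x. ennreal (norm (P M x)) * indicator S x \<partial>lborel)"
    by (intro nn_integral_cong) (auto simp: norm_mult indicator_def)
  finally show ?thesis .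
qed

lemma box_avg_bound: "norm (box_avg M a b y) \<le> A1"
proof -
  have "ennreal (norm (box_avg M a b y)) \<le> (\<integral>\<^sup>+x. ennreal (norm (P M x)) * indicator {a - y..b - y} x \<partial>lborel)"
    unfolding box_avg_eq by (rule ind_P_bound) simp
  also have "\<dots> \<le> (\<integral>\<^sup>+x. ennreal (norm (P M x)) \<partial>lborel)"
    by (intro nn_integral_mono) (auto simp: indicator_def)
  also have "\<dots> \<le> ennreal (A0 * pi)" by (rule P_norm_int)
  also have "\<dots> \<le> ennreal A1" using A0(1) by (intro ennreal_leI) (simp add: A1_def)
  finally show ?thesis using A0(1) by (simp add: ennreal_le_iff A1_def)
qed

text \<open>\<open>P M\<close> has integral 1, so for \<open>y\<close> inside the interval the error
  is its mass over the complement of the shifted interval, and for \<open>y\<close> outside its mass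
  over the interval. Either set keeps the distance \<open>\<delta>\<close> from 0, where
  \<open>P_tail\<close> applies.\<close>

lemma box_avg_tendsto:
  assumes "y \<noteq> a" "y \<noteq> b"
  shows "(\<lambda>M. box_avg M a b y) \<longlonglongrightarrow> of_real (indicator {a..b} y)"
proof -
  define \<delta> where "\<delta> = min \<bar>a - y\<bar> \<bar>b - y\<bar>"
  have \<delta>: "\<delta> > 0" using assms by (simp add: \<delta>_def)
  define C where "C = A0 * (1 / \<delta>\<^sup>2 + 1) * pi"
  have C: "C \<ge> 0" using A0(1) by (simp add: C_def)
  have "norm (box_avg M a b y - of_real (indicator {a..b} y)) \<le> C / 2 ^ M" for M
  proof -
    define S where "S = (if y \<in> {a..b} then - {a - y..b - y} else {a - y..b - y})"
    have Sm[measurable]: "S \<in> sets borel" by (auto simp: S_def)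
    have "norm (box_avg M a b y - of_real (indicator {a..b} y)) = norm (\<integral>x. of_real (indicator S x) * P M x \<partial>lborel)"
    proof (cases "y \<in> {a..b}")
      case True
      have "(\<integral>x. of_real (indicator {a - y..b - y} x) * P M x \<partial>lborel) + (\<integral>x. of_real (indicator S x) * P M x \<partial>lborel)
        = (\<integral>x. of_real (indicator {a - y..b - y} x) * P M x + of_real (indicator S x) * P M x \<partial>lborel)"
        by (rule Bochner_Integration.integral_add[symmetric]) (auto intro!: ind_P_integrable)
      also have "\<dots> = (\<integral>x. P M x \<partial>lborel)"
        using True by (intro Bochner_Integration.integral_cong) (auto simp: S_def indicator_def)
      finally have "box_avg M a b y + (\<integral>x. of_real (indicator S x) * P M x \<partial>lborel) = 1"
        unfolding box_avg_eq P_integral .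
      then have "box_avg M a b y - 1 = - (\<integral>x. of_real (indicator S x) * P M x \<partial>lborel)" by algebra
      moreover have "indicator {a..b} y = (1 :: real)" using True by simp
      ultimately show ?thesis by (simp only: of_real_1 norm_minus_cancel)
    next
      case False
      then have "S = {a - y..b - y}" unfolding S_def by (simp only: if_False)
      moreover have "indicator {a..b} y = (0 :: real)" using False by simp
      ultimately show ?thesis by (simp only: box_avg_eq of_real_0 diff_0_right)
    qed
    moreover have "ennreal (norm (\<integral>x. of_real (indicator S x) * P M x \<partial>lborel)) \<le> ennreal (C / 2 ^ M)"
    proof -
      have "S \<subseteq> {x. \<bar>x\<bar> \<ge> \<delta>}"
      proof
        fix x assume "x \<in> S"
        then have "(a \<le> y \<and> y \<le> b \<and> \<not> (a - y \<le> x \<and> x \<le> b - y)) \<or> (\<not> (a \<le> y \<and> y \<le> b) \<and> a - y \<le> x \<and> x \<le> b - y)"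
          unfolding S_def by (cases "y \<in> {a..b}") auto
        then have "\<bar>a - y\<bar> \<le> \<bar>x\<bar> \<or> \<bar>b - y\<bar> \<le> \<bar>x\<bar>" by (smt (verit))
        then show "x \<in> {x. \<bar>x\<bar> \<ge> \<delta>}" by (simp add: \<delta>_def min_le_iff_disj)
      qed
      then have "(\<integral>\<^sup>+x. ennreal (norm (P M x)) * indicator S x \<partial>lborel) \<le> (\<integral>\<^sup>+x. ennreal (norm (P M x)) * indicator {x. \<bar>x\<bar> \<ge> \<delta>} x \<partial>lborel)"
        by (intro nn_integral_mono mult_left_mono indicator_leI) (blast, simp)
      also have "\<dots> \<le> ennreal (C / 2 ^ M)" unfolding C_def by (rule P_tail[OF \<delta>])
      finally show ?thesis by (rule order_trans[OF ind_P_bound[OF Sm]])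
    qed
    then have "norm (\<integral>x. of_real (indicator S x) * P M x \<partial>lborel) \<le> C / 2 ^ M"
      using C by (subst (asm) ennreal_le_iff) auto
    ultimately show ?thesis by (simp only:)
  qed
  then have "\<forall>\<^sub>F M in sequentially. norm (box_avg M a b y - of_real (indicator {a..b} y)) \<le> C / 2 ^ M"
    by simp
  moreover have "(\<lambda>M. C / 2 ^ M) \<longlonglongrightarrow> 0"
    by (rule LIMSEQ_divide_realpow_zero) simp
  ultimately have "(\<lambda>M. box_avg M a b y - of_real (indicator {a..b} y)) \<longlonglongrightarrow> 0"
    by (rule Lim_null_comparison)
  then show ?thesis by (rule LIM_zero_cancel)
qed

end

section \<open>Frequency blocks as convolutions\<close>

lemma
  fixes g :: "'d::finite \<Rightarrow> real \<Rightarrow> complex"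
  assumes g: "\<And>s. integrable lborel (g s)"
  shows tensor_integral: "(\<integral>x. (\<Prod>s\<in>UNIV. g s ((x::real^'d) $ s)) \<partial>lborel) = (\<Prod>s\<in>UNIV. \<integral>t. g s t \<partial>lborel)"
    and tensor_integrable: "integrable lborel (\<lambda>x::real^'d. \<Prod>s\<in>UNIV. g s (x $ s))"
proof -
  interpret product_sigma_finite "\<lambda>_::'d. lborel :: real measure" ..
  have [measurable]: "g s \<in> borel_measurable borel" for s using g[of s] by auto
  have m: "(\<lambda>x::real^'d. \<Prod>s\<in>UNIV. g s (x $ s)) \<in> borel_measurable borel" by measurable
  show "(\<integral>x. (\<Prod>s\<in>UNIV. g s ((x::real^'d) $ s)) \<partial>lborel) = (\<Prod>s\<in>UNIV. \<integral>t. g s t \<partial>lborel)"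
    using product_integral_prod[OF finite g] m
    by (subst lborel_eq_PiM) (simp add: integral_distr)
  show "integrable lborel (\<lambda>x::real^'d. \<Prod>s\<in>UNIV. g s (x $ s))"
    using product_integrable_prod[OF finite g] m
    by (subst lborel_eq_PiM) (simp add: integrable_distr_eq)
qed

lemma integrable_mult_bounded:
  fixes f H :: "'a \<Rightarrow> complex"
  assumes f: "integrable M f" and [measurable]: "H \<in> borel_measurable M" and H: "\<And>x. norm (H x) \<le> B"
  shows "integrable M (\<lambda>x. f x * H x)"
proof -
  have [measurable]: "f \<in> borel_measurable M" using f by auto
  have B0: "B \<ge> 0" using H[of undefined] norm_ge_zero order_trans by blast
  show ?thesis
  proof (rule Bochner_Integration.integrable_bound)
    show "integrable M (\<lambda>x. B * norm (f x))" using f by simp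
    show "AE x in M. norm (f x * H x) \<le> norm (B * norm (f x))"
    proof (rule AE_I2)
      fix x
      have "norm (f x) * norm (H x) \<le> norm (f x) * B" by (intro mult_left_mono H norm_ge_zero)
      then show "norm (f x * H x) \<le> norm (B * norm (f x))" using B0 by (simp add: norm_mult mult.commute)
    qed
  qed measurable
qed

context dyadic
begin

text \<open>Indexed by functions instead of vectors, so that a single frequency can be changed by
  \<open>fun_upd\<close>.\<close>

definition blk :: "(real^'d \<Rightarrow> complex) \<Rightarrow> ('d \<Rightarrow> nat) \<Rightarrow> real^'d \<Rightarrow> complex" where
  "blk f j = freq_block \<phi> (\<chi> s. j s) f"

lemma blk_conv:
  fixes f :: "real^'d \<Rightarrow> complex"
  assumes f: "integrable lborel f"
  shows "blk f j x = (\<integral>y. f y * (\<Prod>s\<in>UNIV. K (j s) (x $ s - y $ s)) \<partial>lborel)"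
proof -
  let ?c = "of_real ((2 * pi) powr (- real CARD('d) / 2)) :: complex"
  define \<Phi> where "\<Phi> = (\<lambda>\<xi>::real^'d. \<Prod>s\<in>UNIV. \<phi> (j s) (\<xi> $ s))"
  have \<Phi>i: "integrable lborel \<Phi>" unfolding \<Phi>_def by (intro tensor_integrable phi_integrable)
  \<comment> \<open>The two d-dimensional transforms contribute (2 pi)^(-d/2) each, and writing the
    integrals through \<open>K\<close> gives back 2 pi for every coordinate.\<close>
  have cc: "?c * ?c * of_real (2 * pi) ^ CARD('d) = 1"
  proof -
    have "(2 * pi) powr (- real CARD('d) / 2) * (2 * pi) powr (- real CARD('d) / 2) * (2 * pi) powr (real CARD('d)) = 1"
      by (simp flip: powr_add)
    then have "(2 * pi) powr (- real CARD('d) / 2) * (2 * pi) powr (- real CARD('d) / 2) * (2 * pi) ^ CARD('d) = 1"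
      by (simp only: powr_realpow pi_gt_zero zero_less_mult_iff zero_less_numeral simp_thms)
    then show ?thesis by (metis of_real_1 of_real_mult of_real_power)
  qed
  have "blk f j x = (\<integral>\<xi>. \<integral>y. \<Phi> \<xi> * f y * (?c * ?c * exp (\<i> * of_real (\<xi> \<bullet> x - \<xi> \<bullet> y))) \<partial>lborel \<partial>lborel)"
    unfolding blk_def freq_block_def inverse_fourier_def fourier_def integral_mult_right_zero[symmetric] integral_mult_left_zero[symmetric]
  proof (intro Bochner_Integration.integral_cong refl)
    fix \<xi> y :: "real^'d"
    have "exp (\<i> * of_real (\<xi> \<bullet> x - \<xi> \<bullet> y)) = exp (\<i> * of_real (\<xi> \<bullet> x)) * exp (- \<i> * of_real (\<xi> \<bullet> y))"
      by (simp add: algebra_simps flip: exp_add)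
    then show "?c * ((\<Prod>i\<in>UNIV. \<phi> ((\<chi> s. j s) $ i) (\<xi> $ i)) * (?c * (f y * exp (- \<i> * of_real (\<xi> \<bullet> y)))) * exp (\<i> * of_real (\<xi> \<bullet> x)))
      = \<Phi> \<xi> * f y * (?c * ?c * exp (\<i> * of_real (\<xi> \<bullet> x - \<xi> \<bullet> y)))"
      by (simp only: \<Phi>_def vec_lambda_beta mult_ac)
  qed
  also have "\<dots> = (\<integral>y. \<integral>\<xi>. \<Phi> \<xi> * f y * (?c * ?c * exp (\<i> * of_real (\<xi> \<bullet> x - \<xi> \<bullet> y))) \<partial>lborel \<partial>lborel)"
  proof (rule Fubini_tensor[where f=\<Phi> and g=f and H="\<lambda>\<xi> y. ?c * ?c * exp (\<i> * of_real (\<xi> \<bullet> x - \<xi> \<bullet> y))" and c="norm (?c * ?c)", symmetric])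
    show "cmod (?c * ?c * exp (\<i> * of_real (\<xi> \<bullet> x - \<xi> \<bullet> y))) \<le> norm (?c * ?c)" for \<xi> y
      unfolding norm_mult[of _ "exp _"] norm_exp_i_times by simp
    show "(\<lambda>(\<xi>, y). ?c * ?c * exp (\<i> * of_real (\<xi> \<bullet> x - \<xi> \<bullet> y))) \<in> borel_measurable (lborel \<Otimes>\<^sub>M lborel)"
      by measurable
  qed (rule \<Phi>i f)+
  also have "\<dots> = (\<integral>y. f y * (\<Prod>s\<in>UNIV. K (j s) (x $ s - y $ s)) \<partial>lborel)"
  proof (intro Bochner_Integration.integral_cong refl)
    fix y :: "real^'d"
    have eq: "\<Phi> \<xi> * f y * (?c * ?c * exp (\<i> * of_real (\<xi> \<bullet> x - \<xi> \<bullet> y))) = f y * (?c * ?c) * (\<Prod>s\<in>UNIV. \<phi> (j s) (\<xi> $ s) * iexp (\<xi> $ s * (x $ s - y $ s)))" for \<xi>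
    proof -
      have "\<xi> \<bullet> x - \<xi> \<bullet> y = (\<Sum>s\<in>UNIV. \<xi> $ s * (x $ s - y $ s))"
        by (simp add: inner_vec_def sum_subtractf right_diff_distrib)
      then have "exp (\<i> * of_real (\<xi> \<bullet> x - \<xi> \<bullet> y)) = (\<Prod>s\<in>UNIV. iexp (\<xi> $ s * (x $ s - y $ s)))"
        by (simp only: of_real_sum sum_distrib_left exp_sum[OF finite])
      then show ?thesis by (simp only: \<Phi>_def prod.distrib mult_ac)
    qed
    have Keq: "(\<integral>t. \<phi> n t * iexp (t * z) \<partial>lborel) = of_real (2 * pi) * K n z" for n z
      unfolding K_def ift_def by simp
    have "(\<integral>\<xi>. (\<Prod>s\<in>UNIV. \<phi> (j s) ((\<xi>::real^'d) $ s) * iexp (\<xi> $ s * (x $ s - y $ s))) \<partial>lborel)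
       = (\<Prod>s\<in>UNIV. \<integral>t. \<phi> (j s) t * iexp (t * (x $ s - y $ s)) \<partial>lborel)"
      by (rule tensor_integral[where g="\<lambda>s t. \<phi> (j s) t * iexp (t * (x $ s - y $ s))"])
         (intro integrable_mult_iexp phi_integrable; measurable)
    also have "\<dots> = of_real (2 * pi) ^ CARD('d) * (\<Prod>s\<in>UNIV. K (j s) (x $ s - y $ s))"
      unfolding Keq by (simp add: prod.distrib)
    finally have "(\<integral>\<xi>. \<Phi> \<xi> * f y * (?c * ?c * exp (\<i> * of_real (\<xi> \<bullet> x - \<xi> \<bullet> y))) \<partial>lborel)
      = f y * (?c * ?c) * (of_real (2 * pi) ^ CARD('d) * (\<Prod>s\<in>UNIV. K (j s) (x $ s - y $ s)))"
      unfolding eq integral_mult_right_zero by (simp only:)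
    also have "\<dots> = f y * (?c * ?c * of_real (2 * pi) ^ CARD('d)) * (\<Prod>s\<in>UNIV. K (j s) (x $ s - y $ s))"
      by (simp only: mult_ac)
    also have "\<dots> = f y * (\<Prod>s\<in>UNIV. K (j s) (x $ s - y $ s))" unfolding cc by simp
    finally show "(\<integral>\<xi>. \<Phi> \<xi> * f y * (?c * ?c * exp (\<i> * of_real (\<xi> \<bullet> x - \<xi> \<bullet> y))) \<partial>lborel) = f y * (\<Prod>s\<in>UNIV. K (j s) (x $ s - y $ s))" .
  qed
  finally show ?thesis .
qed

lemma P_bounded: "\<exists>B>0. \<forall>x. norm (P M x) \<le> B"
proof -
  have "norm (P M x) \<le> A0 * 2 ^ M" for x
    using A0(2)[of M x] mult_left_mono[OF kap_le[of M x] less_imp_le[OF A0(1)]] by linarith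
  then show ?thesis using A0(1) by (intro exI[of _ "A0 * 2 ^ M"]) auto
qed

lemma tensor_bounded:
  fixes H :: "'d::finite \<Rightarrow> real \<Rightarrow> complex"
  assumes "\<And>s. \<exists>B>0. \<forall>x. norm (H s x) \<le> B"
  shows "\<exists>B>0. \<forall>x. norm (\<Prod>s\<in>S. H s (x s)) \<le> B"
proof -
  obtain B where B: "\<And>s. B s > 0" "\<And>s x. norm (H s x) \<le> B s" using assms by metis
  show ?thesis
    by (rule exI[of _ "prod B S"]) (auto simp: prod_norm[symmetric] intro!: prod_mono prod_pos B)
qed

text \<open>Kernel of a box sum in which only the coordinates in \<open>S\<close> have been summed:
  low-pass there, a single band in the others.\<close>

definition mixed_ker :: "nat \<Rightarrow> 'd set \<Rightarrow> ('d \<Rightarrow> nat) \<Rightarrow> 'd \<Rightarrow> real \<Rightarrow> complex" where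
  "mixed_ker M S j s = (if s \<in> S then P M else K (j s))"

lemma mixed_ker_measurable [measurable]: "mixed_ker M S j s \<in> borel_measurable borel"
  by (simp add: mixed_ker_def)

lemma mixed_ker_bounded: "\<exists>B>0. \<forall>x. norm (mixed_ker M S j s x) \<le> B"
  using P_bounded K_bounded by (simp add: mixed_ker_def)

lemma mixed_integrable:
  fixes f :: "real^'d \<Rightarrow> complex"
  assumes "integrable lborel f"
  shows "integrable lborel (\<lambda>y. f y * (\<Prod>s\<in>T. mixed_ker M S j s (x s - y $ s)))"
proof -
  obtain B where "\<And>x. norm (\<Prod>s\<in>T. mixed_ker M S j s (x s)) \<le> B"
    using tensor_bounded[of "mixed_ker M S j" T, OF mixed_ker_bounded] by blast
  then show ?thesis using assms by (intro integrable_mult_bounded) auto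
qed

lemma partial_box_sum_blk:
  fixes f :: "real^'d \<Rightarrow> complex"
  assumes f: "integrable lborel f" and "distinct ss"
  shows "partial_box_sum M ss (blk f) j x = (\<integral>y. f y * (\<Prod>s\<in>UNIV. mixed_ker M (set ss) j s (x $ s - y $ s)) \<partial>lborel)"
  using \<open>distinct ss\<close>
proof (induction ss arbitrary: j)
  case Nil
  then show ?case by (simp add: blk_conv[OF f] mixed_ker_def)
next
  case (Cons s ss)
  let ?R = "\<lambda>y. \<Prod>r\<in>UNIV - {s}. mixed_ker M (set (s # ss)) j r (x $ r - y $ r)"
  have split: "(\<Prod>r\<in>UNIV. mixed_ker M (set ss) (fun_upd j s a) r (x $ r - y $ r)) = K a (x $ s - y $ s) * ?R y" for a y
  proof -
    have "(\<Prod>r\<in>UNIV. mixed_ker M (set ss) (fun_upd j s a) r (x $ r - y $ r)) = mixed_ker M (set ss) (fun_upd j s a) s (x $ s - y $ s) * (\<Prod>r\<in>UNIV - {s}. mixed_ker M (set ss) (fun_upd j s a) r (x $ r - y $ r))"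
      by (rule prod.remove) auto
    also have "mixed_ker M (set ss) (fun_upd j s a) s = K a" using Cons.prems by (simp add: mixed_ker_def)
    also have "(\<Prod>r\<in>UNIV - {s}. mixed_ker M (set ss) (fun_upd j s a) r (x $ r - y $ r)) = ?R y"
      by (intro prod.cong) (auto simp: mixed_ker_def)
    finally show ?thesis .
  qed
  have split': "(\<Prod>r\<in>UNIV. mixed_ker M (set (s # ss)) j r (x $ r - y $ r)) = P M (x $ s - y $ s) * ?R y" for y
    by (subst prod.remove[of _ s]) (auto simp: mixed_ker_def)
  have "partial_box_sum M (s # ss) (blk f) j x = (\<Sum>a\<le>M. \<integral>y. f y * (\<Prod>r\<in>UNIV. mixed_ker M (set ss) (fun_upd j s a) r (x $ r - y $ r)) \<partial>lborel)"
    using Cons by simp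
  also have "\<dots> = (\<integral>y. (\<Sum>a\<le>M. f y * (\<Prod>r\<in>UNIV. mixed_ker M (set ss) (fun_upd j s a) r (x $ r - y $ r))) \<partial>lborel)"
    by (rule Bochner_Integration.integral_sum[symmetric]) (rule mixed_integrable[OF f])
  also have "\<dots> = (\<integral>y. f y * (\<Prod>r\<in>UNIV. mixed_ker M (set (s # ss)) j r (x $ r - y $ r)) \<partial>lborel)"
  proof (intro Bochner_Integration.integral_cong refl)
    fix y :: "real^'d"
    have "(\<Sum>a\<le>M. f y * (\<Prod>r\<in>UNIV. mixed_ker M (set ss) (fun_upd j s a) r (x $ r - y $ r))) = (\<Sum>a\<le>M. f y * (K a (x $ s - y $ s) * ?R y))"
      by (simp only: split)
    also have "\<dots> = f y * (P M (x $ s - y $ s) * ?R y)"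
      unfolding P_sum_K by (simp only: sum_distrib_left sum_distrib_right)
    finally show "(\<Sum>a\<le>M. f y * (\<Prod>r\<in>UNIV. mixed_ker M (set ss) (fun_upd j s a) r (x $ r - y $ r))) = f y * (\<Prod>r\<in>UNIV. mixed_ker M (set (s # ss)) j r (x $ r - y $ r))"
      by (simp only: split')
  qed
  finally show ?case .
qed

lemma blk_bounded:
  fixes f :: "real^'d \<Rightarrow> complex"
  assumes f: "integrable lborel f"
  shows "\<exists>B. \<forall>x. norm (blk f j x) \<le> B"
proof -
  obtain B where B: "B > 0" "\<And>x. norm (\<Prod>s\<in>UNIV. K (j s) (x s)) \<le> B"
    using tensor_bounded[of "\<lambda>s. K (j s)" UNIV, OF K_bounded] by blast
  have "norm (blk f j x) \<le> (\<integral>y. B * norm (f y) \<partial>lborel)" for x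
  proof -
    have "norm (blk f j x) \<le> (\<integral>y. norm (f y * (\<Prod>s\<in>UNIV. K (j s) (x $ s - y $ s))) \<partial>lborel)"
      unfolding blk_conv[OF f] by (rule integral_norm_bound)
    also have "\<dots> \<le> (\<integral>y. B * norm (f y) \<partial>lborel)"
    proof (rule integral_mono)
      show "integrable lborel (\<lambda>y. norm (f y * (\<Prod>s\<in>UNIV. K (j s) (x $ s - y $ s))))"
        using mixed_integrable[OF f, where T=UNIV and M=0 and S="{}" and j=j and x="\<lambda>s. x $ s"] by (intro integrable_norm) (simp add: mixed_ker_def)
      show "norm (f y * (\<Prod>s\<in>UNIV. K (j s) (x $ s - y $ s))) \<le> B * norm (f y)" for y
        using B(2)[of "\<lambda>s. x $ s - y $ s"] unfolding norm_mult
        by (subst mult.commute) (intro mult_right_mono, auto)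
    qed (use f in auto)
    finally show ?thesis .
  qed
  then show ?thesis by blast
qed

lemma blk_measurable:
  fixes f :: "real^'d \<Rightarrow> complex"
  assumes f: "integrable lborel f"
  shows "blk f j \<in> borel_measurable borel"
proof -
  have [measurable]: "f \<in> borel_measurable borel" using f by auto
  have "(\<lambda>x. \<integral>y. f y * (\<Prod>s\<in>UNIV. K (j s) (x $ s - y $ s)) \<partial>lborel) \<in> borel_measurable borel"
    by measurable
  then show ?thesis by (simp add: blk_conv[OF f, abs_def] blk_conv[OF f])
qed

text \<open>A block is a convolution with a product kernel, so \<open>K_conv\<close> in the
  coordinate \<open>s\<close>, after Fubini, leaves it unchanged.\<close>

lemma rep_blk:
  fixes f :: "real^'d \<Rightarrow> complex"
  assumes f: "integrable lborel f"
  shows "rep (j s) s (blk f j)"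
  unfolding rep_def
proof (intro conjI allI)
  show "blk f j \<in> borel_measurable borel" by (rule blk_measurable[OF f])
  show "\<exists>B. \<forall>x. norm (blk f j x) \<le> B" by (rule blk_bounded[OF f])
  fix x :: "real^'d"
  let ?R = "\<lambda>z::real^'d. \<Prod>r\<in>UNIV - {s}. K (j r) (x $ r - z $ r)"
  have Ri: "integrable lborel (\<lambda>z. f z * ?R z)"
    using mixed_integrable[OF f, where T="UNIV - {s}" and M=0 and S="{}" and j=j and x="\<lambda>s. x $ s"] by (simp add: mixed_ker_def)
  obtain B where B: "B > 0" "\<And>t. norm (K (j s) t) \<le> B" using K_bounded by blast
  have "(\<integral>y. blk f j (vupd x s y) * P (j s + 2) (x $ s - y) \<partial>lborel)
     = (\<integral>y. \<integral>z. f z * ?R z * P (j s + 2) (x $ s - y) * K (j s) (y - z $ s) \<partial>lborel \<partial>lborel)"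
  proof (intro Bochner_Integration.integral_cong refl)
    fix y
    have pr: "(\<Prod>r\<in>UNIV. K (j r) (vupd x s y $ r - z $ r)) = K (j s) (y - z $ s) * ?R z" for z :: "real^'d"
    proof -
      have "(\<Prod>r\<in>UNIV. K (j r) (vupd x s y $ r - z $ r)) = K (j s) (vupd x s y $ s - z $ s) * (\<Prod>r\<in>UNIV - {s}. K (j r) (vupd x s y $ r - z $ r))"
        by (rule prod.remove) auto
      also have "(\<Prod>r\<in>UNIV - {s}. K (j r) (vupd x s y $ r - z $ r)) = ?R z" by (intro prod.cong) auto
      finally show ?thesis by simp
    qed
    have "blk f j (vupd x s y) * P (j s + 2) (x $ s - y) = (\<integral>z. f z * (K (j s) (y - z $ s) * ?R z) \<partial>lborel) * P (j s + 2) (x $ s - y)"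
      unfolding blk_conv[OF f] pr ..
    also have "\<dots> = (\<integral>z. f z * (K (j s) (y - z $ s) * ?R z) * P (j s + 2) (x $ s - y) \<partial>lborel)"
      by (rule integral_mult_left_zero[symmetric])
    finally show "blk f j (vupd x s y) * P (j s + 2) (x $ s - y) = (\<integral>z. f z * ?R z * P (j s + 2) (x $ s - y) * K (j s) (y - z $ s) \<partial>lborel)"
      by (simp only: mult_ac)
  qed
  also have "\<dots> = (\<integral>z. \<integral>y. f z * ?R z * P (j s + 2) (x $ s - y) * K (j s) (y - z $ s) \<partial>lborel \<partial>lborel)"
  proof (rule Fubini_tensor[where f="\<lambda>z. f z * ?R z" and g="\<lambda>y. P (j s + 2) (x $ s - y)" and H="\<lambda>z y. K (j s) (y - z $ s)" and c=B])
    show "integrable lborel (\<lambda>y. P (j s + 2) (x $ s - y))" by (rule P_shift_integrable)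
    show "(\<lambda>(z :: real^'d, y). K (j s) (y - z $ s)) \<in> borel_measurable (lborel \<Otimes>\<^sub>M lborel)"
      by measurable
  qed (use Ri B in auto)
  also have "\<dots> = (\<integral>z. f z * (\<Prod>r\<in>UNIV. K (j r) (x $ r - z $ r)) \<partial>lborel)"
  proof (intro Bochner_Integration.integral_cong refl)
    fix z :: "real^'d"
    have "(\<integral>y. K (j s) (y - z $ s) * P (j s + 2) (x $ s - y) \<partial>lborel) = \<bar>1\<bar> *\<^sub>R (\<integral>y. K (j s) (z $ s + 1 * y - z $ s) * P (j s + 2) (x $ s - (z $ s + 1 * y)) \<partial>lborel)"
      by (rule lborel_integral_real_affine) simp
    also have "\<dots> = (\<integral>y. K (j s) y * P (j s + 2) ((x $ s - z $ s) - y) \<partial>lborel)"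
      by (simp add: algebra_simps)
    also have "\<dots> = K (j s) (x $ s - z $ s)" by (rule K_conv)
    finally have k: "(\<integral>y. K (j s) (y - z $ s) * P (j s + 2) (x $ s - y) \<partial>lborel) = K (j s) (x $ s - z $ s)" .
    have "(\<integral>y. f z * ?R z * P (j s + 2) (x $ s - y) * K (j s) (y - z $ s) \<partial>lborel)
      = (\<integral>y. f z * ?R z * (K (j s) (y - z $ s) * P (j s + 2) (x $ s - y)) \<partial>lborel)"
      by (simp only: mult_ac)
    also have "\<dots> = f z * ?R z * K (j s) (x $ s - z $ s)"
      unfolding integral_mult_right_zero k ..
    also have "\<dots> = f z * (K (j s) (x $ s - z $ s) * ?R z)" by (simp only: mult_ac)
    also have "K (j s) (x $ s - z $ s) * ?R z = (\<Prod>r\<in>UNIV. K (j r) (x $ r - z $ r))"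
      by (rule prod.remove[symmetric]) auto
    finally show "(\<integral>y. f z * ?R z * P (j s + 2) (x $ s - y) * K (j s) (y - z $ s) \<partial>lborel) = f z * (\<Prod>r\<in>UNIV. K (j r) (x $ r - z $ r))" .
  qed
  finally show "blk f j x = (\<integral>y. blk f j (vupd x s y) * P (j s + 2) (x $ s - y) \<partial>lborel)"
    unfolding blk_conv[OF f, of j x] by simp
qed

text \<open>Convolution commutes with translation. Translates are needed because the final estimates
  are averaged over them.\<close>

lemma rep_translate:
  assumes F: "rep a s F"
  shows "rep a s (\<lambda>x. F (x + t))"
  unfolding rep_def
proof (intro conjI allI)
  have [measurable]: "F \<in> borel_measurable borel" by (rule rep_measurable[OF F])
  show "(\<lambda>x. F (x + t)) \<in> borel_measurable borel" by measurable
  show "\<exists>B. \<forall>x. norm (F (x + t)) \<le> B" using rep_bounded[OF F] by blast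
  fix x
  have "F (x + t) = (\<integral>y. F (vupd (x + t) s y) * P (a + 2) ((x + t) $ s - y) \<partial>lborel)"
    using rep_eq[OF F, of "x + t" "(x + t) $ s"] by (simp only: vupd_triv)
  also have "\<dots> = \<bar>1\<bar> *\<^sub>R (\<integral>y. F (vupd (x + t) s (t $ s + 1 * y)) * P (a + 2) ((x + t) $ s - (t $ s + 1 * y)) \<partial>lborel)"
    by (rule lborel_integral_real_affine) simp
  also have "\<dots> = (\<integral>y. F (vupd x s y + t) * P (a + 2) (x $ s - y) \<partial>lborel)"
  proof -
    have "vupd (x + t) s (t $ s + 1 * y) = vupd x s y + t" for y by (simp add: vec_eq_iff)
    moreover have "(x + t) $ s - (t $ s + 1 * y) = x $ s - y" for y by simp
    ultimately show ?thesis by (simp only: abs_one scaleR_one)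
  qed
  finally show "F (x + t) = (\<integral>y. F (vupd x s y + t) * P (a + 2) (x $ s - y) \<partial>lborel)" .
qed

lemma partial_box_sum_translate:
  "partial_box_sum M ss (\<lambda>j x. f j (x + t)) j = (\<lambda>x. partial_box_sum M ss f j (x + t))"
  by (induction ss arbitrary: j) auto

end

section \<open>Translation invariance and change of exponent\<close>

lemma nn_integral_translate:
  fixes G :: "real^'d \<Rightarrow> ennreal"
  assumes [measurable]: "G \<in> borel_measurable borel"
  shows "(\<integral>\<^sup>+x. G (x + t) \<partial>lborel) = (\<integral>\<^sup>+x. G x \<partial>lborel)"
proof -
  have "(\<integral>\<^sup>+x. G x \<partial>lborel) = (\<integral>\<^sup>+x. G x \<partial>distr lborel borel ((+) t))"
    by (simp add: lborel_distr_plus)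
  also have "\<dots> = (\<integral>\<^sup>+x. G (x + t) \<partial>lborel)"
    by (subst nn_integral_distr) (auto simp: add.commute)
  finally show ?thesis by simp
qed

lemma enn_powr_1 [simp]: "enn_powr x 1 = x"
  by (cases x) (auto simp: enn_powr_def)

lemma enn_powr_ennreal: "x \<ge> 0 \<Longrightarrow> enn_powr (ennreal x) a = ennreal (x powr a)"
  by (simp add: enn_powr_def)

lemma cell_const_iter_le:
  fixes U :: "real^'d \<Rightarrow> ennreal"
  assumes "distinct ss" and U: "\<And>s. s \<in> set ss \<Longrightarrow> cell_const s (k s) U" and Um: "U \<in> borel_measurable borel"
    and x: "\<And>s. s \<in> set ss \<Longrightarrow> 0 \<le> x $ s \<and> x $ s < 1"
  shows "U x \<le> ennreal (2 ^ (\<Sum>s\<in>set ss. k s)) * iter_int unit_int ss U x"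
  using assms(1,2,4)
proof (induction ss)
  case (Cons s ss)
  have "U x \<le> ennreal (2 ^ (\<Sum>s\<in>set ss. k s)) * iter_int unit_int ss U x"
    using Cons by auto
  also have "iter_int unit_int ss U x \<le> ennreal (2 ^ k s) * coord_int unit_int s (iter_int unit_int ss U) x"
    using Cons.prems Um by (intro cell_const_le cell_const_iter_int iter_int_measurable) auto
  also have "ennreal (2 ^ (\<Sum>s\<in>set ss. k s)) * (ennreal (2 ^ k s) * coord_int unit_int s (iter_int unit_int ss U) x)
    = ennreal (2 ^ (\<Sum>s\<in>set (s # ss). k s)) * iter_int unit_int (s # ss) U x"
  proof -
    have "ennreal (2 ^ (\<Sum>s\<in>set (s # ss). k s)) = ennreal (2 ^ (\<Sum>s\<in>set ss. k s)) * ennreal (2 ^ k s)"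
      using Cons.prems by (simp add: power_add mult.commute flip: ennreal_mult)
    then show ?thesis by (simp only: mult.assoc iter_int_Cons)
  qed
  finally show ?case by (simp add: mult_left_mono)
qed simp

text \<open>On a cell of volume 2^-|k| the function \<open>D\<close> is constant, so the bound in
  L_p already forces |D| \<le> c pointwise, and surplus powers of |D| may be replaced by powers of
  \<open>c\<close>. The shape c^p / 2^|k| of the bound is kept under this change of
  exponent.\<close>

lemma cell_const_exponent_mono:
  fixes D :: "real^'d \<Rightarrow> complex" and ss :: "'d list"
  assumes ss: "distinct ss" "set ss = UNIV" and Dm: "D \<in> borel_measurable borel"
    and Dc: "\<And>s. cell_const s (k s) D" and pu: "1 \<le> p" "p \<le> u" and c: "c \<ge> 0"
    and le: "(\<integral>\<^sup>+x\<in>half_cube. ennreal (norm (D x) powr p) \<partial>lborel) \<le> ennreal (c powr p / 2 ^ (\<Sum>s\<in>UNIV. k s))"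
  shows "(\<integral>\<^sup>+x\<in>half_cube. ennreal (norm (D x) powr u) \<partial>lborel) \<le> ennreal (c powr u / 2 ^ (\<Sum>s\<in>UNIV. k s))"
proof -
  note [measurable] = Dm
  have I: "iter_int unit_int ss (\<lambda>x. ennreal (norm (D x) powr p)) x \<le> ennreal (c powr p / 2 ^ (\<Sum>s\<in>UNIV. k s))" for x
    using le ss by (subst nn_integral_half_cube[symmetric]) auto
  have Dle: "norm (D x) \<le> c" if x: "x \<in> half_cube" for x
  proof -
    have "ennreal (norm (D x) powr p) \<le> ennreal (2 ^ (\<Sum>s\<in>set ss. k s)) * iter_int unit_int ss (\<lambda>x. ennreal (norm (D x) powr p)) x"
      by (rule cell_const_iter_le[OF ss(1)]) (use x Dc in \<open>auto simp: half_cube_def intro: cell_const_comp\<close>)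
    also have "\<dots> \<le> ennreal (2 ^ (\<Sum>s\<in>UNIV. k s)) * ennreal (c powr p / 2 ^ (\<Sum>s\<in>UNIV. k s))"
      unfolding ss(2) by (intro mult_left_mono I) auto
    also have "\<dots> = ennreal (c powr p)" by (simp flip: ennreal_mult)
    finally have "norm (D x) powr p \<le> c powr p" by (subst (asm) ennreal_le_iff) auto
    then show ?thesis using pu c powr_less_mono2[of p c "norm (D x)"] by (auto simp: not_le[symmetric])
  qed
  have "(\<integral>\<^sup>+x\<in>half_cube. ennreal (norm (D x) powr u) \<partial>lborel)
     \<le> (\<integral>\<^sup>+x. ennreal (c powr (u - p)) * (ennreal (norm (D x) powr p) * indicator half_cube x) \<partial>lborel)"
  proof (intro nn_integral_mono)
    fix x
    have "norm (D x) powr u \<le> c powr (u - p) * norm (D x) powr p" if "x \<in> half_cube"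
    proof -
      have "norm (D x) powr u = norm (D x) powr (u - p) * norm (D x) powr p" by (simp flip: powr_add)
      also have "\<dots> \<le> c powr (u - p) * norm (D x) powr p"
        using Dle[OF that] pu by (intro mult_right_mono powr_mono2) auto
      finally show ?thesis .
    qed
    then show "ennreal (norm (D x) powr u) * indicator half_cube x \<le> ennreal (c powr (u - p)) * (ennreal (norm (D x) powr p) * indicator half_cube x)"
      by (auto simp: indicator_def ennreal_leI simp flip: ennreal_mult)
  qed
  also have "\<dots> = ennreal (c powr (u - p)) * (\<integral>\<^sup>+x\<in>half_cube. ennreal (norm (D x) powr p) \<partial>lborel)"
    by (rule nn_integral_cmult) measurable
  also have "\<dots> \<le> ennreal (c powr (u - p)) * ennreal (c powr p / 2 ^ (\<Sum>s\<in>UNIV. k s))"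
    by (intro mult_left_mono le) auto
  also have "\<dots> = ennreal (c powr u / 2 ^ (\<Sum>s\<in>UNIV. k s))"
    by (simp flip: ennreal_mult powr_add)
  finally show ?thesis .
qed

lemma partial_box_sum_eq_sum:
  fixes f :: "('d \<Rightarrow> nat) \<Rightarrow> real^'d \<Rightarrow> complex"
  assumes "distinct ss"
  shows "partial_box_sum M ss f j x = (\<Sum>k\<in>lvl_box (set ss) M. f (\<lambda>s. if s \<in> set ss then k s else j s) x)"
  using assms
proof (induction ss arbitrary: j)
  case Nil
  have "lvl_box {} M = {\<lambda>_::'d. 0}" by (auto simp: lvl_box_def)
  then show ?case by simp
next
  case (Cons s ss)
  have "(\<Sum>k\<in>lvl_box (set (s # ss)) M. f (\<lambda>r. if r \<in> set (s # ss) then k r else j r) x)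
    = (\<Sum>(a, k)\<in>{..M} \<times> lvl_box (set ss) M. f (\<lambda>r. if r \<in> set (s # ss) then (fun_upd k s a) r else j r) x)"
  proof -
    define h where "h = (\<lambda>k. f (\<lambda>r. if r \<in> set (s # ss) then k r else j r) x)"
    have "sum h (lvl_box (insert s (set ss)) M) = (\<Sum>z\<in>{..M} \<times> lvl_box (set ss) M. h ((\<lambda>(a, k). fun_upd k s a) z))"
      using Cons.prems by (intro sum.reindex_bij_betw[symmetric] lvl_box_insert) auto
    also have "\<dots> = (\<Sum>(a, k)\<in>{..M} \<times> lvl_box (set ss) M. h (fun_upd k s a))"
      by (intro sum.cong) auto
    finally show ?thesis by (simp only: h_def list.set)
  qed
  also have "\<dots> = (\<Sum>a\<le>M. \<Sum>k\<in>lvl_box (set ss) M. f (\<lambda>r. if r \<in> set (s # ss) then (fun_upd k s a) r else j r) x)"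
    by (rule sum.cartesian_product[symmetric])
  also have "\<dots> = (\<Sum>a\<le>M. \<Sum>k\<in>lvl_box (set ss) M. f (\<lambda>r. if r \<in> set ss then k r else (fun_upd j s a) r) x)"
  proof (intro sum.cong refl)
    fix a k
    have "(\<lambda>r. if r \<in> set (s # ss) then (fun_upd k s a) r else j r) = (\<lambda>r. if r \<in> set ss then k r else (fun_upd j s a) r)"
      using Cons.prems by (auto simp: fun_eq_iff)
    then show "f (\<lambda>r. if r \<in> set (s # ss) then (fun_upd k s a) r else j r) x = f (\<lambda>r. if r \<in> set ss then k r else (fun_upd j s a) r) x"
      by simp
  qed
  also have "\<dots> = partial_box_sum M (s # ss) f j x"
    using Cons by simp
  finally show ?case by simp
qed

section \<open>Uniform bounds for the differences of all translated box sums\<close>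

context dyadic
begin

definition part_sum :: "'d list \<Rightarrow> nat \<Rightarrow> (real^'d \<Rightarrow> complex) \<Rightarrow> real^'d \<Rightarrow> complex" where
  "part_sum ss M f = partial_box_sum M ss (blk f) (\<lambda>_. 0)"

text \<open>\<open>jawerth_iter\<close> over all coordinates, with the pointwise supremum of the
  weighted blocks as majorant \<open>G\<close>. Its integral is the norm of \<open>f\<close>, which
  translation does not change.\<close>

lemma key_F:
  fixes f :: "real^'d \<Rightarrow> complex"
  assumes ss: "distinct ss" "set ss = UNIV" and u: "1 < u" and f: "integrable lborel f"
    and N: "SF_norm \<phi> 1 1 \<infinity> f \<le> ennreal c" and c: "c \<ge> 0"
  shows "(\<integral>\<^sup>+x\<in>half_cube. ennreal (norm (difs k ss (\<lambda>x. part_sum ss M f (x + t)) x) powr u) \<partial>lborel)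
    \<le> ennreal ((((Cs u powr (1 / u) * CJ A1 u) ^ CARD('d)) * c) powr u / 2 ^ (\<Sum>s\<in>UNIV. k s))"
proof -
  have bm[measurable]: "blk f j \<in> borel_measurable borel" for j by (rule blk_measurable[OF f])
  define G where "G x = (SUP j. dyadic_weight 1 j * ennreal (norm (blk f (\<lambda>s. j $ s) x)))" for x
  have Gm[measurable]: "G \<in> borel_measurable borel" unfolding G_def by measurable
  have "(\<integral>\<^sup>+x. G x \<partial>lborel) = SF_norm \<phi> 1 1 \<infinity> f"
    unfolding SF_norm_def Lp_enn_def lq_norm_def G_def blk_def by simp
  then have Gi: "(\<integral>\<^sup>+x. G x \<partial>lborel) \<le> ennreal c" using N by simp
  have G: "ennreal (2 ^ (\<Sum>s\<in>UNIV. j s) * norm (blk f j x)) \<le> G x" for j x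
  proof -
    have "dyadic_weight 1 (\<chi> s. j s) * ennreal (norm (blk f (\<lambda>s. (\<chi> s. j s) $ s) x)) \<le> G x"
      unfolding G_def by (rule SUP_upper) simp
    moreover have "dyadic_weight 1 (\<chi> s. j s) = ennreal (2 ^ (\<Sum>s\<in>UNIV. j s))"
      unfolding dyadic_weight_def by (simp add: powr_realpow del: of_nat_sum)
    ultimately show ?thesis by (simp add: ennreal_mult)
  qed
  have rm: "difs k ss (\<lambda>x. part_sum ss M f (x + t)) \<in> borel_measurable borel"
  proof (rule difs_measurable)
    have [measurable]: "part_sum ss M f \<in> borel_measurable borel"
      unfolding part_sum_def by (rule partial_box_sum_measurable) (rule bm)
    show "(\<lambda>x. part_sum ss M f (x + t)) \<in> borel_measurable borel" by measurable
  qed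
  have eq: "(\<lambda>x. part_sum ss M f (x + t)) = partial_box_sum M ss (\<lambda>j x. blk f j (x + t)) (\<lambda>_. 0)"
    unfolding part_sum_def by (rule partial_box_sum_translate[symmetric])
  have "(\<integral>\<^sup>+x\<in>half_cube. ennreal (norm (difs k ss (\<lambda>x. part_sum ss M f (x + t)) x) powr u) \<partial>lborel)
    = iter_int unit_int ss (\<lambda>x. ennreal (norm (difs k ss (\<lambda>x. part_sum ss M f (x + t)) x) powr u)) 0"
    using rm ss by (intro nn_integral_half_cube) auto
  also have "\<dots> = iter_int unit_int ss (\<lambda>x. ennreal (norm (difs k ss (partial_box_sum M ss (\<lambda>j x. blk f j (x + t)) (\<lambda>_. 0)) x) powr u)) 0"
    by (simp only: eq)
  also have "iter_int unit_int ss (\<lambda>x. ennreal (norm (difs k ss (partial_box_sum M ss (\<lambda>j x. blk f j (x + t)) (\<lambda>_. 0)) x) powr u)) 0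
    \<le> ennreal (((Cs u powr (1 / u) * CJ A1 u) ^ length ss / 2 ^ (\<Sum>s\<in>- set ss. 0) * c) powr u / 2 ^ (\<Sum>s\<in>set ss. k s))"
  proof (rule jawerth_iter[where G="\<lambda>x. G (x + t)", OF u ss(1)])
    show "rep (j s) s (\<lambda>x. blk f j (x + t))" for j s by (intro rep_translate rep_blk f)
    have "iter_int lborel ss (\<lambda>x. G (x + t)) 0 = (\<integral>\<^sup>+x. G (x + t) \<partial>lborel)"
      by (rule nn_integral_iter_int[symmetric]) (use ss in auto)
    then show "iter_int lborel ss (\<lambda>x. G (x + t)) 0 \<le> ennreal c"
      using Gi by (simp add: nn_integral_translate)
  qed (use G c in auto)
  also have "length ss = CARD('d)" using ss by (metis distinct_card)
  also have "(\<Sum>s\<in>- set ss. 0 :: nat) = 0" by simp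
  also have "(Cs u powr (1 / u) * CJ A1 u) ^ CARD('d) / 2 ^ 0 = (Cs u powr (1 / u) * CJ A1 u) ^ CARD('d)" by simp
  finally show ?thesis by (simp only: ss(2))
qed

text \<open>Each block contributes 2^(|j| - |k|) times the p-th power of its L_p norm. After taking
  roots the weight 2^(|j|/p) is that of the norm, and Minkowski's inequality sums the blocks in l_1,
  as the third index 1 of the space allows.\<close>

lemma key_B:
  fixes f :: "real^'d \<Rightarrow> complex"
  assumes ss: "distinct ss" "set ss = UNIV" and p: "1 \<le> p" and f: "integrable lborel f"
    and N: "SB_norm \<phi> (1 / p) (ennreal p) 1 f \<le> ennreal c" and c: "c \<ge> 0"
  shows "(\<integral>\<^sup>+x\<in>half_cube. ennreal (norm (difs k ss (\<lambda>x. part_sum ss M f (x + t)) x) powr p) \<partial>lborel)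
    \<le> ennreal (((Cs p powr (1 / p)) ^ CARD('d) * c) powr p / 2 ^ (\<Sum>s\<in>UNIV. k s))"
proof -
  have bm[measurable]: "blk f j \<in> borel_measurable borel" for j by (rule blk_measurable[OF f])
  let ?n = "\<lambda>j::'d \<Rightarrow> nat. \<Sum>s\<in>UNIV. j s"
  define Q where "Q j = Lp_norm lborel (ennreal p) (blk f j)" for j
  have Qp: "Q j = enn_powr (\<integral>\<^sup>+x. ennreal (norm (blk f j x) powr p) \<partial>lborel) (1 / p)" for j
    unfolding Q_def Lp_norm_def Lp_enn_def using p by (simp add: enn_powr_ennreal)
  define J where "J = lvl_box (UNIV :: 'd set) M"
  have "J = Pi\<^sub>E UNIV (\<lambda>_. {..M})" by (auto simp: J_def lvl_box_def)
  then have fin: "finite J" by (auto intro: finite_PiE)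
  define w where "w j = ennreal (2 powr (real (?n j) / p)) * Q j" for j
  have sumw: "(\<Sum>j\<in>J. w j) \<le> ennreal c"
  proof -
    have "(\<Sum>j\<in>J. w j) = (\<Sum>j\<in>vec_lambda ` J. dyadic_weight (1 / p) j * Lp_norm lborel (ennreal p) (freq_block \<phi> j f))"
      by (subst sum.reindex) (auto simp: inj_on_def vec_lambda_inject w_def Q_def blk_def dyadic_weight_def)
    also have "\<dots> \<le> (\<Sum>\<^sub>\<infinity>j. dyadic_weight (1 / p) j * Lp_norm lborel (ennreal p) (freq_block \<phi> j f))"
      by (subst nonneg_infsum_complete, simp, rule SUP_upper) (use fin in auto)
    also have "\<dots> = SB_norm \<phi> (1 / p) (ennreal p) 1 f"
      unfolding SB_norm_def lq_norm_def by simp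
    finally show ?thesis using N by simp
  qed
  have Qfin: "Q j < top" if "j \<in> J" for j
  proof -
    have "w j \<le> (\<Sum>j\<in>J. w j)" using that fin by (intro member_le_sum) auto
    then have "w j < top" using sumw ennreal_less_top le_less_trans order_trans by metis
    then show ?thesis by (auto simp: w_def ennreal_mult_less_top)
  qed
  define q where "q j = enn2real (Q j)" for j
  have q0: "q j \<ge> 0" for j by (simp add: q_def)
  have Qq: "Q j = ennreal (q j)" if "j \<in> J" for j using Qfin[OF that] by (simp add: q_def)
  have sumq: "(\<Sum>j\<in>J. 2 powr (real (?n j) / p) * q j) \<le> c"
  proof -
    have "ennreal (\<Sum>j\<in>J. 2 powr (real (?n j) / p) * q j) = (\<Sum>j\<in>J. w j)"
      using q0 by (subst sum_ennreal[symmetric]) (auto simp: w_def Qq ennreal_mult intro!: sum.cong)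
    then have "ennreal (\<Sum>j\<in>J. 2 powr (real (?n j) / p) * q j) \<le> ennreal c" using sumw by simp
    then show ?thesis using c by (subst (asm) ennreal_le_iff) auto
  qed
  have int: "(\<integral>\<^sup>+x. ennreal (norm (blk f j x) powr p) \<partial>lborel) \<le> ennreal (q j powr p)" if "j \<in> J" for j
  proof -
    let ?I = "\<integral>\<^sup>+x. ennreal (norm (blk f j x) powr p) \<partial>lborel"
    have "?I < top"
      using Qfin[OF that] unfolding Qp enn_powr_def by (auto simp: top.not_eq_extremum split: if_splits)
    then obtain r where r: "?I = ennreal r" "r \<ge> 0" by (cases ?I) auto
    then have "ennreal (q j) = ennreal (r powr (1 / p))"
      using Qq[OF that] unfolding Qp by (simp add: enn_powr_ennreal)
    then have "q j = r powr (1 / p)" using q0 by (simp add: ennreal_inj)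
    then have "q j powr p = r" using p r by (simp add: powr_powr)
    then show ?thesis using r by simp
  qed
  define D where "D j = difs k ss (\<lambda>x. blk f j (x + t))" for j
  have Dm[measurable]: "D j \<in> borel_measurable borel" for j
    unfolding D_def by (rule difs_measurable) measurable
  define Y where "Y j = (Cs p powr (1 / p)) ^ CARD('d) * (2 powr (real (?n j) / p) * q j)" for j
  have Dle: "iter_int unit_int ss (\<lambda>x. ennreal (norm (D j x) powr p)) x \<le> ennreal (Y j powr p * (1 / 2 ^ ?n k))" if j: "j \<in> J" for j x
  proof -
    have "iter_int unit_int ss (\<lambda>x. ennreal (norm (D j x) powr p)) x
      \<le> ennreal (\<Prod>s\<in>set ss. Cs p * 2 ^ j s / 2 ^ k s) * iter_int lborel ss (\<lambda>x. ennreal (norm (blk f j (x + t)) powr p)) x"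
      unfolding D_def by (rule difs_bound[OF p ss(1)]) (rule rep_translate, rule rep_blk[OF f], measurable)
    also have "iter_int lborel ss (\<lambda>x. ennreal (norm (blk f j (x + t)) powr p)) x = (\<integral>\<^sup>+x. ennreal (norm (blk f j (x + t)) powr p) \<partial>lborel)"
      by (rule nn_integral_iter_int[symmetric]) (use ss in auto)
    also have "\<dots> = (\<integral>\<^sup>+x. ennreal (norm (blk f j x) powr p) \<partial>lborel)"
      by (rule nn_integral_translate) measurable
    also have "ennreal (\<Prod>s\<in>set ss. Cs p * 2 ^ j s / 2 ^ k s) * \<dots> \<le> ennreal (\<Prod>s\<in>set ss. Cs p * 2 ^ j s / 2 ^ k s) * ennreal (q j powr p)"
      by (intro mult_left_mono int j) auto
    also have "\<dots> = ennreal ((\<Prod>s\<in>set ss. Cs p * 2 ^ j s / 2 ^ k s) * q j powr p)"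
      using Cs_pos[of p] by (intro ennreal_mult[symmetric] prod_nonneg) auto
    also have "(\<Prod>s\<in>set ss. Cs p * 2 ^ j s / 2 ^ k s) * q j powr p = Y j powr p * (1 / 2 ^ ?n k)"
    proof -
      have "(\<Prod>s\<in>set ss. Cs p * 2 ^ j s / 2 ^ k s) = Cs p ^ CARD('d) * 2 ^ ?n j / 2 ^ ?n k"
        unfolding ss(2) by (simp add: prod_dividef prod.distrib power_sum)
      moreover have "((Cs p powr (1 / p)) ^ CARD('d)) powr p = Cs p ^ CARD('d)"
      proof -
        have "((Cs p powr (1 / p)) ^ CARD('d)) powr p = ((Cs p powr (1 / p)) powr p) ^ CARD('d)"
          using Cs_pos[of p] by (simp add: powr_realpow[symmetric] powr_powr mult.commute)
        then show ?thesis using p Cs_pos[of p] by (simp add: powr_powr)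
      qed
      moreover have "(2 powr (real (?n j) / p)) powr p = 2 ^ ?n j"
      proof -
        have "real (?n j) / p * p = real (?n j)" using p by simp
        then show ?thesis unfolding powr_powr by (simp only:) (rule powr_realpow, simp)
      qed
      moreover have "Y j powr p = ((Cs p powr (1 / p)) ^ CARD('d)) powr p * ((2 powr (real (?n j) / p)) powr p * q j powr p)"
        using q0[of j] unfolding Y_def by (subst powr_mult | simp)+
      ultimately show ?thesis by simp
    qed
    finally show ?thesis .
  qed
  have eq: "difs k ss (\<lambda>x. part_sum ss M f (x + t)) = (\<lambda>x. \<Sum>j\<in>J. D j x)"
  proof -
    have "part_sum ss M f = (\<lambda>x. \<Sum>j\<in>J. blk f j x)"
      unfolding part_sum_def J_def using ss by (auto simp: partial_box_sum_eq_sum[OF ss(1)])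
    then show ?thesis unfolding D_def by (simp only: difs_sum)
  qed
  have "(\<integral>\<^sup>+x\<in>half_cube. ennreal (norm (\<Sum>j\<in>J. D j x) powr p) \<partial>lborel)
    = iter_int unit_int ss (\<lambda>x. ennreal (norm (\<Sum>j\<in>J. D j x) powr p)) 0"
    using ss by (intro nn_integral_half_cube) auto
  also have "\<dots> \<le> ennreal ((\<Sum>j\<in>J. Y j) powr p * (1 / 2 ^ ?n k))"
    using fin p q0 Cs_pos[of p] by (intro minkowski_iter Dle) (auto simp: Y_def)
  also have "\<dots> \<le> ennreal (((Cs p powr (1 / p)) ^ CARD('d) * c) powr p / 2 ^ ?n k)"
  proof (intro ennreal_leI)
    have "(\<Sum>j\<in>J. Y j) = (Cs p powr (1 / p)) ^ CARD('d) * (\<Sum>j\<in>J. 2 powr (real (?n j) / p) * q j)"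
      by (simp add: Y_def sum_distrib_left)
    also have "\<dots> \<le> (Cs p powr (1 / p)) ^ CARD('d) * c" using sumq by (intro mult_left_mono) auto
    finally have "(\<Sum>j\<in>J. Y j) powr p \<le> ((Cs p powr (1 / p)) ^ CARD('d) * c) powr p"
      using p q0 by (intro powr_mono2 sum_nonneg) (auto simp: Y_def)
    then show "(\<Sum>j\<in>J. Y j) powr p * (1 / 2 ^ ?n k) \<le> ((Cs p powr (1 / p)) ^ CARD('d) * c) powr p / 2 ^ ?n k"
      by (simp add: divide_right_mono)
  qed
  finally show ?thesis unfolding eq .
qed

end

section \<open>Passing from the dyadic partial sums to the continuous representative\<close>

lemma difs_mult_right: "difs k ss (\<lambda>y. h y * c) = (\<lambda>x. difs k ss h x * c)"
proof (induction ss)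
  case (Cons s ss)
  show ?case by (rule ext) (simp add: Cons dif_def left_diff_distrib)
qed simp

lemma difs_bounded:
  assumes "\<And>x. norm (h x) \<le> B"
  shows "norm (difs k ss h x) \<le> 2 ^ length ss * B"
proof (induction ss arbitrary: x)
  case (Cons s ss)
  then show ?case using dif_bounded[of "difs k ss h" "2 ^ length ss * B" s "k s" x] by simp
qed (simp add: assms)

lemma difs_integral:
  assumes "\<And>y. integrable M (\<lambda>t. g t y)"
  shows "integrable M (\<lambda>t. difs k ss (g t) x)" "difs k ss (\<lambda>y. \<integral>t. g t y \<partial>M) x = (\<integral>t. difs k ss (g t) x \<partial>M)"
proof (induction ss arbitrary: x)
  case Nil
  {
    case 1
    show ?case using assms by simp
  next
    case 2
    show ?case by simp
  }
next
  case (Cons s ss)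
  {
    case 1
    show ?case using Cons(1) by (cases "k s = 0") (simp_all add: dif_def)
  next
    case 2
    show ?case using Cons by (cases "k s = 0") (simp_all add: dif_def)
  }
qed

lemma difs_measurable_param:
  assumes "(\<lambda>(t, y). g t y) \<in> borel_measurable (M \<Otimes>\<^sub>M borel)"
  shows "(\<lambda>(t, y). difs k ss (g t) y) \<in> borel_measurable (M \<Otimes>\<^sub>M borel)"
proof (induction ss)
  case (Cons s ss)
  note [measurable] = Cons
  have "(\<lambda>(t, y). difs k ss (g t) (vupd y s (dyad a (y $ s)))) \<in> borel_measurable (M \<Otimes>\<^sub>M borel)" for a
    using measurable_compose[OF _ Cons, of "\<lambda>(t, y). (t, vupd y s (dyad a (y $ s)))" "M \<Otimes>\<^sub>M borel"]
    by (simp add: case_prod_unfold)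
  then show ?case
    by (cases "k s = 0") (simp_all add: dif_def case_prod_unfold)
qed (use assms in simp)

text \<open>\<open>difs\<close> is a finite combination of values at rounded points, so convergence
  at these points is all that matters.\<close>

lemma difs_tendsto:
  assumes "distinct ss"
    and "\<And>k'. (\<And>i. i \<in> set ss \<Longrightarrow> k' i \<le> k i) \<Longrightarrow>
      ((\<lambda>n. g n (\<chi> i. if i \<in> set ss then dyad (k' i) (x $ i) else x $ i)) \<longlongrightarrow> h (\<chi> i. if i \<in> set ss then dyad (k' i) (x $ i) else x $ i)) F"
  shows "((\<lambda>n. difs k ss (g n) x) \<longlongrightarrow> difs k ss h x) F"
  using assms
proof (induction ss arbitrary: x)
  case Nil
  show ?case using Nil(2)[of k] by simp
next
  case (Cons s ss)
  have "((\<lambda>n. difs k ss (g n) (vupd x s (dyad a (x $ s)))) \<longlongrightarrow> difs k ss h (vupd x s (dyad a (x $ s)))) F" if "a \<le> k s" for a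
  proof (rule Cons.IH)
    fix k' assume k': "\<And>i. i \<in> set ss \<Longrightarrow> k' i \<le> k i"
    have eq: "(\<chi> i. if i \<in> set (s # ss) then dyad (fun_upd k' s a i) (x $ i) else x $ i) =
      (\<chi> i. if i \<in> set ss then dyad (k' i) (vupd x s (dyad a (x $ s)) $ i) else vupd x s (dyad a (x $ s)) $ i)"
      using Cons.prems(1) by (auto simp: vec_eq_iff)
    have "((\<lambda>n. g n (\<chi> i. if i \<in> set (s # ss) then dyad (fun_upd k' s a i) (x $ i) else x $ i)) \<longlongrightarrow> h (\<chi> i. if i \<in> set (s # ss) then dyad (fun_upd k' s a i) (x $ i) else x $ i)) F"
      using that k' by (intro Cons.prems(2)) auto
    then show "((\<lambda>n. g n (\<chi> i. if i \<in> set ss then dyad (k' i) (vupd x s (dyad a (x $ s)) $ i) else vupd x s (dyad a (x $ s)) $ i)) \<longlongrightarrow> h (\<chi> i. if i \<in> set ss then dyad (k' i) (vupd x s (dyad a (x $ s)) $ i) else vupd x s (dyad a (x $ s)) $ i)) F"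
      unfolding eq .
  qed (use Cons.prems in auto)
  then show ?case by (auto simp: dif_def intro!: tendsto_diff)
qed

text \<open>The uniform probability density on the box with lower corner \<open>x\<close> and side
  \<open>e\<close>; one-sided, to suit the sampling at lower corners.\<close>

definition rbox :: "real \<Rightarrow> real^'d \<Rightarrow> real^'d \<Rightarrow> real" where
  "rbox e x z = (\<Prod>s\<in>UNIV. if x $ s \<le> z $ s \<and> z $ s \<le> x $ s + e then 1 / e else 0)"

lemma rbox_nonneg: "e > 0 \<Longrightarrow> rbox e x z \<ge> 0"
  unfolding rbox_def by (intro prod_nonneg) auto

lemma rbox_measurable [measurable]:
  assumes [measurable]: "f \<in> borel_measurable M" "g \<in> borel_measurable M"
  shows "(\<lambda>w. rbox e (f w) (g w)) \<in> borel_measurable M"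
  unfolding rbox_def by measurable

lemma rbox_nonzero: "rbox e x z \<noteq> 0 \<Longrightarrow> x $ s \<le> z $ s \<and> z $ s \<le> x $ s + e"
  unfolding rbox_def by (auto split: if_splits)

lemma of_real_rbox: "of_real (rbox e x z) = (\<Prod>s\<in>UNIV. complex_of_real (1 / e) * of_real (indicator {x $ s..x $ s + e} (z $ s)))"
  unfolding rbox_def of_real_prod by (intro prod.cong) (auto simp: indicator_def)

lemma rbox_int:
  assumes "e > 0"
  shows "integrable lborel (\<lambda>z. complex_of_real (rbox e x z))" "(\<integral>z. complex_of_real (rbox e x z) \<partial>lborel) = 1"
    "(\<integral>z. rbox e x z \<partial>lborel) = 1" "integrable lborel (rbox e x)"
proof -
  have i: "integrable lborel (\<lambda>t. complex_of_real (1 / e) * of_real (indicator {x $ s..x $ s + e} t))" for s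
    by (intro integrable_mult_right integrable_of_real integrable_real_indicator) (auto simp: emeasure_lborel_Icc_eq)
  show 0: "integrable lborel (\<lambda>z. complex_of_real (rbox e x z))"
    unfolding of_real_rbox by (rule tensor_integrable) (rule i)
  show "integrable lborel (rbox e x)" using integrable_Re[OF 0] by simp
  have "(\<integral>t. complex_of_real (1 / e) * of_real (indicator {x $ s..x $ s + e} t) \<partial>lborel) = 1" for s
    using assms by simp
  then show 1: "(\<integral>z. complex_of_real (rbox e x z) \<partial>lborel) = 1"
    unfolding of_real_rbox by (subst tensor_integral[OF i]) simp
  then have "complex_of_real (\<integral>z. rbox e x z \<partial>lborel) = 1" by simp
  then show "(\<integral>z. rbox e x z \<partial>lborel) = 1" by (simp only: of_real_eq_1_iff)
qed

lemma AE_coord_neq: "AE y in lborel. (y::real^'d) $ s \<noteq> c"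
proof -
  have "negligible {x::real^'d. x $ s = c}" by (simp add: cart_eq_inner_axis negligible_standard_hyperplane)
  moreover have "{x::real^'d. x $ s = c} \<in> sets lborel"
  proof -
    have "{x\<in>space borel. (x::real^'d) $ s = c} \<in> sets borel" by measurable
    then show ?thesis by simp
  qed
  ultimately have "{x::real^'d. x $ s = c} \<in> null_sets lborel"
    by (simp add: negligible_iff_null_sets null_sets_completion_iff)
  then show ?thesis by (rule AE_I'[of _ _ "\<lambda>y. y $ s \<noteq> c"]) auto
qed

text \<open>Averaging over translates commutes with \<open>difs\<close>. Jensen's inequality for the
  density \<open>rbox\<close> and Tonelli then carry over any bound that is uniform in the
  translate.\<close>

lemma averaged_difs_le:
  fixes S :: "real^'d \<Rightarrow> complex"
  assumes [measurable]: "S \<in> borel_measurable borel" and B: "\<And>x. norm (S x) \<le> B" and w: "1 \<le> w" and e: "e > 0"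
    and le: "\<And>t. (\<integral>\<^sup>+x\<in>half_cube. ennreal (norm (difs k ss (\<lambda>x. S (x + t)) x) powr w) \<partial>lborel) \<le> C"
  shows "(\<integral>\<^sup>+x\<in>half_cube. ennreal (norm (difs k ss (\<lambda>x. \<integral>t. S (x + t) * of_real (rbox e 0 t) \<partial>lborel) x) powr w) \<partial>lborel) \<le> C"
proof -
  let ?W = "\<lambda>t. complex_of_real (rbox e (0::real^'d) t)"
  let ?D = "\<lambda>t. difs k ss (\<lambda>x. S (x + t))"
  have Dm: "(\<lambda>(t, y). ?D t y) \<in> borel_measurable (borel \<Otimes>\<^sub>M borel)"
    by (rule difs_measurable_param) measurable
  have Dm1[measurable]: "(\<lambda>t. ?D t x) \<in> borel_measurable borel" for x
    using measurable_compose[OF _ Dm, of "\<lambda>t. (t, x)" borel] by simp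
  have Dm2[measurable]: "(\<lambda>z. ?D (snd z) (fst z)) \<in> borel_measurable (borel \<Otimes>\<^sub>M borel)"
    using measurable_compose[OF _ Dm, of "\<lambda>z. (snd z, fst z)" "borel \<Otimes>\<^sub>M borel"] by simp
  have DB: "norm (?D t x) \<le> 2 ^ length ss * B" for t x by (rule difs_bounded) (rule B)
  have Si: "integrable lborel (\<lambda>t. S (x + t) * ?W t)" for x
    using integrable_mult_bounded[OF rbox_int(1)[OF e, of 0], of "\<lambda>t. S (x + t)" B] B by (simp add: mult.commute)
  have eq: "difs k ss (\<lambda>x. \<integral>t. S (x + t) * ?W t \<partial>lborel) x = (\<integral>t. ?D t x * ?W t \<partial>lborel)" for x
    using difs_integral(2)[of lborel "\<lambda>t x. S (x + t) * ?W t", OF Si] by (simp add: difs_mult_right)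
  have nW: "norm (?W t) = rbox e 0 t" for t using rbox_nonneg[OF e, of 0 t] by simp
  have pt: "ennreal (norm (difs k ss (\<lambda>x. \<integral>t. S (x + t) * ?W t \<partial>lborel) x) powr w)
     \<le> (\<integral>\<^sup>+t. ennreal (norm (?D t x) powr w) * ennreal (rbox e 0 t) \<partial>lborel)" for x
  proof -
    have "ennreal (norm (\<integral>t. ?D t x * ?W t \<partial>lborel) powr w)
       \<le> ennreal (1 powr (w - 1)) * (\<integral>\<^sup>+t. ennreal (norm (?D t x) powr w) * ennreal (norm (?W t)) \<partial>lborel)"
      by (rule jensen_powr[OF _ rbox_int(1)[OF e] _ _ DB w]) (simp_all only: nW rbox_int(3)[OF e], measurable)
    then show ?thesis unfolding eq nW by simp
  qed
  have "(\<integral>\<^sup>+x\<in>half_cube. ennreal (norm (difs k ss (\<lambda>x. \<integral>t. S (x + t) * ?W t \<partial>lborel) x) powr w) \<partial>lborel)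
    \<le> (\<integral>\<^sup>+x. \<integral>\<^sup>+t. ennreal (rbox e 0 t) * (ennreal (norm (?D t x) powr w) * indicator half_cube x) \<partial>lborel \<partial>lborel)"
  proof (intro nn_integral_mono)
    fix x :: "real^'d"
    have "ennreal (norm (difs k ss (\<lambda>x. \<integral>t. S (x + t) * ?W t \<partial>lborel) x) powr w) * indicator half_cube x
      \<le> (\<integral>\<^sup>+t. ennreal (norm (?D t x) powr w) * ennreal (rbox e 0 t) \<partial>lborel) * indicator half_cube x"
      by (intro mult_right_mono pt) auto
    also have "\<dots> = (\<integral>\<^sup>+t. ennreal (rbox e 0 t) * (ennreal (norm (?D t x) powr w) * indicator half_cube x) \<partial>lborel)"
      by (subst nn_integral_multc[symmetric]) (auto simp: mult_ac)
    finally show "ennreal (norm (difs k ss (\<lambda>x. \<integral>t. S (x + t) * ?W t \<partial>lborel) x) powr w) * indicator half_cube x \<le> (\<integral>\<^sup>+t. ennreal (rbox e 0 t) * (ennreal (norm (?D t x) powr w) * indicator half_cube x) \<partial>lborel)" .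
  qed
  also have "\<dots> = (\<integral>\<^sup>+t. \<integral>\<^sup>+x. ennreal (rbox e 0 t) * (ennreal (norm (?D t x) powr w) * indicator half_cube x) \<partial>lborel \<partial>lborel)"
  proof (rule lborel_pair.Fubini'[symmetric])
    have "(\<lambda>z. ennreal (rbox e 0 (snd z)) * (ennreal (norm (?D (snd z) (fst z)) powr w) * indicator half_cube (fst z))) \<in> borel_measurable (borel \<Otimes>\<^sub>M borel)"
      by measurable
    then show "(\<lambda>(x, t). ennreal (rbox e 0 t) * (ennreal (norm (?D t x) powr w) * indicator half_cube x)) \<in> borel_measurable (lborel \<Otimes>\<^sub>M lborel)"
      by (simp add: case_prod_unfold)
  qed
  also have "\<dots> \<le> (\<integral>\<^sup>+t. ennreal (rbox e (0::real^'d) t) * C \<partial>lborel)"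
  proof (intro nn_integral_mono)
    fix t :: "real^'d"
    have [measurable]: "?D t \<in> borel_measurable borel" by (rule difs_measurable) measurable
    have "(\<integral>\<^sup>+x. ennreal (rbox e 0 t) * (ennreal (norm (?D t x) powr w) * indicator half_cube x) \<partial>lborel)
      = ennreal (rbox e 0 t) * (\<integral>\<^sup>+x\<in>half_cube. ennreal (norm (?D t x) powr w) \<partial>lborel)"
      by (rule nn_integral_cmult) measurable
    also have "\<dots> \<le> ennreal (rbox e 0 t) * C" by (intro mult_left_mono le) auto
    finally show "(\<integral>\<^sup>+x. ennreal (rbox e 0 t) * (ennreal (norm (?D t x) powr w) * indicator half_cube x) \<partial>lborel) \<le> ennreal (rbox e 0 t) * C" .
  qed
  also have "\<dots> = (\<integral>\<^sup>+t. ennreal (rbox e (0::real^'d) t) \<partial>lborel) * C"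
    by (rule nn_integral_multc) measurable
  also have "(\<integral>\<^sup>+t. ennreal (rbox e (0::real^'d) t) \<partial>lborel) = 1"
  proof -
    have "integrable lborel (rbox e (0::real^'d))"
      by (rule rbox_int(4)[OF e])
    then show ?thesis using rbox_nonneg[OF e] rbox_int(3)[OF e, of "0::real^'d"] by (subst nn_integral_eq_integral) auto
  qed
  finally show ?thesis by simp
qed

lemma unit_cube_sets [measurable]: "(unit_cube :: (real^'d) set) \<in> sets borel"
proof -
  have "{x\<in>space borel. \<forall>i\<in>UNIV. 0 \<le> (x::real^'d) $ i \<and> x $ i \<le> 1} \<in> sets borel"
    by measurable
  then show ?thesis by (simp add: unit_cube_def)
qed

text \<open>The boxes over \<open>y\<close> lie in the cube as soon as their side is below
  \<open>\<delta>\<close>. There \<open>f\<close> may be replaced by \<open>h\<close>, whose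
  continuity relative to the cube is enough.\<close>

lemma rbox_average_tendsto:
  fixes f h :: "real^'d \<Rightarrow> complex"
  assumes f: "integrable lborel f" and hc: "continuous_on unit_cube h"
    and AE: "AE x in cube_measure. h x = f x" and y: "\<And>i. 0 \<le> y $ i" "\<And>i. y $ i + \<delta> \<le> 1" and \<delta>: "\<delta> > 0"
    and e: "e \<longlonglongrightarrow> 0" "\<And>n. e n > 0"
  shows "(\<lambda>n. \<integral>z. f z * of_real (rbox (e n) y z) \<partial>lborel) \<longlonglongrightarrow> h y"
proof (rule LIMSEQ_I)
  fix \<eta> :: real assume \<eta>: "\<eta> > 0"
  have [measurable]: "f \<in> borel_measurable borel" using f by auto
  have "y $ i \<le> 1" for i using y(2)[of i] \<delta> by linarith
  then have ycube: "y \<in> unit_cube" using y(1) by (simp add: unit_cube_def)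
  obtain d where d: "d > 0" "\<And>z. z \<in> unit_cube \<Longrightarrow> dist z y < d \<Longrightarrow> dist (h z) (h y) < \<eta> / 2"
    using hc ycube \<eta> unfolding continuous_on_iff by (meson half_gt_zero)
  have "eventually (\<lambda>n. e n < min \<delta> (d / real CARD('d))) sequentially"
    using e(1) by (rule order_tendstoD) (use \<delta> d in auto)
  \<comment> \<open>The bound \<open>\<delta>\<close> keeps the box inside the cube; the bound
    \<open>d / real CARD('d)\<close> keeps its points within distance \<open>d\<close> of
    \<open>y\<close>, as the distance is estimated by the sum over the coordinates.\<close>
  then obtain N where N: "\<And>n. n \<ge> N \<Longrightarrow> e n < min \<delta> (d / real CARD('d))" by (auto simp: eventually_sequentially)
  have AE': "AE z in lborel. z \<in> unit_cube \<longrightarrow> h z = f z"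
    using AE unfolding cube_measure_def by (subst (asm) AE_restrict_space_iff) auto
  show "\<exists>N. \<forall>n\<ge>N. norm ((\<integral>z. f z * of_real (rbox (e n) y z) \<partial>lborel) - h y) < \<eta>"
  proof (intro exI allI impI)
    fix n assume "n \<ge> N"
    note en = N[OF this]
    let ?W = "\<lambda>z. complex_of_real (rbox (e n) y z)"
    have Wr: "integrable lborel (rbox (e n) y)"
      by (rule rbox_int(4)[OF e(2)])
    have Wb: "norm (?W z) \<le> (1 / e n) ^ CARD('d)" for z
    proof -
      have "rbox (e n) y z \<le> (\<Prod>s\<in>(UNIV::'d set). 1 / e n)"
        unfolding rbox_def using e(2)[of n] by (intro prod_mono) auto
      then show ?thesis using rbox_nonneg[OF e(2), of n y z] by simp
    qed
    have fW: "integrable lborel (\<lambda>z. f z * ?W z)"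
      by (rule integrable_mult_bounded[OF f _ Wb]) measurable
    have hW: "integrable lborel (\<lambda>z. h y * ?W z)"
      using rbox_int(1)[OF e(2), of n y] by simp
    have "(\<integral>z. f z * ?W z \<partial>lborel) - h y = (\<integral>z. f z * ?W z \<partial>lborel) - (\<integral>z. h y * ?W z \<partial>lborel)"
      using rbox_int(2)[OF e(2), of n y] by simp
    also have "\<dots> = (\<integral>z. f z * ?W z - h y * ?W z \<partial>lborel)"
      by (rule Bochner_Integration.integral_diff[symmetric, OF fW hW])
    also have "norm \<dots> \<le> (\<integral>z. norm (f z * ?W z - h y * ?W z) \<partial>lborel)" by (rule integral_norm_bound)
    also have "\<dots> \<le> (\<integral>z. \<eta> / 2 * rbox (e n) y z \<partial>lborel)"
    proof (rule integral_mono_AE)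
      show "integrable lborel (\<lambda>z. norm (f z * ?W z - h y * ?W z))" using fW hW by auto
      show "integrable lborel (\<lambda>z. \<eta> / 2 * rbox (e n) y z)" using Wr by simp
      show "AE z in lborel. norm (f z * ?W z - h y * ?W z) \<le> \<eta> / 2 * rbox (e n) y z"
        using AE'
      proof eventually_elim
        case (elim z)
        show ?case
        proof (cases "rbox (e n) y z = 0")
          case False
          have b: "y $ s \<le> z $ s \<and> z $ s \<le> y $ s + e n" for s by (rule rbox_nonzero[OF False])
          have zc: "z \<in> unit_cube"
          proof -
            have "0 \<le> z $ i \<and> z $ i \<le> 1" for i using b[of i] y(1)[of i] y(2)[of i] en by auto
            then show ?thesis by (simp add: unit_cube_def)
          qed
          have "dist z y \<le> (\<Sum>i\<in>UNIV. \<bar>(z - y) $ i\<bar>)" unfolding dist_norm by (rule norm_le_l1_cart)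
          also have "\<dots> \<le> (\<Sum>i\<in>(UNIV::'d set). e n)" using b by (intro sum_mono) (auto simp: abs_le_iff algebra_simps)
          also have "\<dots> = real CARD('d) * e n" by simp
          also have "\<dots> < d" using en by (simp add: field_simps)
          finally have "norm (f z - h y) < \<eta> / 2" using d(2)[OF zc] elim zc by (simp add: dist_norm)
          then have "norm (f z - h y) * rbox (e n) y z \<le> \<eta> / 2 * rbox (e n) y z"
            using rbox_nonneg[OF e(2)] by (intro mult_right_mono) auto
          then show ?thesis using rbox_nonneg[OF e(2), of n y z] by (simp add: norm_mult flip: left_diff_distrib)
        qed simp
      qed
    qed
    also have "\<dots> = \<eta> / 2" using rbox_int(3)[OF e(2), of n y] by simp
    also have "\<dots> < \<eta>" using \<eta> by simp
    finally show "norm ((\<integral>z. f z * ?W z \<partial>lborel) - h y) < \<eta>" .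
  qed
qed

section \<open>Limits of averaged box sums\<close>

context dyadic
begin

lemma part_sum_eq:
  fixes f :: "real^'d \<Rightarrow> complex"
  assumes "integrable lborel f" "distinct ss" "set ss = UNIV"
  shows "part_sum ss M f x = (\<integral>y. f y * (\<Prod>s\<in>UNIV. P M (x $ s - y $ s)) \<partial>lborel)"
  unfolding part_sum_def using assms by (simp add: partial_box_sum_blk mixed_ker_def)

lemma part_sum_measurable:
  fixes f :: "real^'d \<Rightarrow> complex"
  assumes "integrable lborel f"
  shows "part_sum ss M f \<in> borel_measurable borel"
  unfolding part_sum_def by (rule partial_box_sum_measurable) (rule blk_measurable[OF assms])

lemma part_sum_bounded:
  fixes f :: "real^'d \<Rightarrow> complex"
  assumes f: "integrable lborel f" and ss: "distinct ss"
  shows "\<exists>B. \<forall>x. norm (part_sum ss M f x) \<le> B"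
proof -
  have "\<forall>j. \<exists>B. \<forall>x. norm (blk f j x) \<le> B" using blk_bounded[OF f] by blast
  then obtain B where B: "\<And>j x. norm (blk f j x) \<le> B j" by metis
  show ?thesis unfolding part_sum_def partial_box_sum_eq_sum[OF ss]
    by (intro exI[of _ "\<Sum>k\<in>lvl_box (set ss) M. B (\<lambda>s. if s \<in> set ss then k s else 0)"] allI sum_norm_le) (rule B)
qed

text \<open>By Fubini the average falls on the product kernel, where it acts on each coordinate
  separately and yields \<open>box_avg\<close>.\<close>

lemma averaged_part_sum:
  fixes f :: "real^'d \<Rightarrow> complex"
  assumes f: "integrable lborel f" and ss: "distinct ss" "set ss = UNIV" and e: "e > 0"
  shows "(\<integral>t. part_sum ss M f (x + t) * of_real (rbox e 0 t) \<partial>lborel)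
    = (\<integral>y. f y * (\<Prod>s\<in>UNIV. of_real (1 / e) * box_avg M (x $ s) (x $ s + e) (y $ s)) \<partial>lborel)"
proof -
  let ?W = "\<lambda>t. complex_of_real (rbox e (0::real^'d) t)"
  obtain B where B: "B > 0" "\<And>z. norm (\<Prod>s\<in>(UNIV::'d set). P M (z s)) \<le> B"
    using tensor_bounded[of "\<lambda>s::'d. P M" UNIV, OF P_bounded] by blast
  have "(\<integral>t. part_sum ss M f (x + t) * ?W t \<partial>lborel)
    = (\<integral>t. \<integral>y. f y * ?W t * (\<Prod>s\<in>UNIV. P M ((x + t) $ s - y $ s)) \<partial>lborel \<partial>lborel)"
  proof (intro Bochner_Integration.integral_cong refl)
    fix t :: "real^'d"
    have "part_sum ss M f (x + t) * ?W t = (\<integral>y. f y * (\<Prod>s\<in>UNIV. P M ((x + t) $ s - y $ s)) * ?W t \<partial>lborel)"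
      unfolding part_sum_eq[OF f ss] by (rule integral_mult_left_zero[symmetric])
    then show "part_sum ss M f (x + t) * ?W t = (\<integral>y. f y * ?W t * (\<Prod>s\<in>UNIV. P M ((x + t) $ s - y $ s)) \<partial>lborel)"
      by (simp only: mult_ac)
  qed
  also have "\<dots> = (\<integral>y. \<integral>t. f y * ?W t * (\<Prod>s\<in>UNIV. P M ((x + t) $ s - y $ s)) \<partial>lborel \<partial>lborel)"
  proof (rule Fubini_tensor[where f=f and g="?W" and H="\<lambda>y t. \<Prod>s\<in>UNIV. P M ((x + t) $ s - y $ s)" and c=B])
    show "(\<lambda>(y::real^'d, t). \<Prod>s\<in>UNIV. P M ((x + t) $ s - y $ s)) \<in> borel_measurable (lborel \<Otimes>\<^sub>M lborel)"
      by measurable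
    show "norm (\<Prod>s\<in>UNIV. P M ((x + t) $ s - y $ s)) \<le> B" for y t by (rule B(2))
  qed (use f rbox_int(1)[OF e, of 0] in auto)
  also have "\<dots> = (\<integral>y. f y * (\<Prod>s\<in>UNIV. of_real (1 / e) * box_avg M (x $ s) (x $ s + e) (y $ s)) \<partial>lborel)"
  proof (intro Bochner_Integration.integral_cong refl)
    fix y :: "real^'d"
    let ?g = "\<lambda>s t. of_real (1 / e) * (of_real (indicator {0..e} t) * P M (x $ s + t - y $ s))"
    have gi: "integrable lborel (?g s)" for s
    proof -
      have "integrable lborel (\<lambda>t. P M ((x $ s - y $ s) + 1 * t))"
        by (rule lborel_integrable_real_affine[OF P_integrable]) simp
      then have "integrable lborel (\<lambda>t. P M (x $ s + t - y $ s))" by (simp add: algebra_simps)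
      then have "integrable lborel (\<lambda>t. P M (x $ s + t - y $ s) * of_real (indicator {0..e} t))"
        by (rule integrable_mult_bounded[where B=1]) (auto simp: indicator_def)
      then show ?thesis by (simp add: mult.commute)
    qed
    have g: "(\<integral>t. ?g s t \<partial>lborel) = of_real (1 / e) * box_avg M (x $ s) (x $ s + e) (y $ s)" for s
    proof -
      have "box_avg M (x $ s) (x $ s + e) (y $ s) = \<bar>1\<bar> *\<^sub>R (\<integral>t. of_real (indicator {x $ s..x $ s + e} (x $ s + 1 * t)) * P M (x $ s + 1 * t - y $ s) \<partial>lborel)"
        unfolding box_avg_def by (rule lborel_integral_real_affine) simp
      also have "\<dots> = (\<integral>t. of_real (indicator {0..e} t) * P M (x $ s + t - y $ s) \<partial>lborel)"
        by (auto intro!: Bochner_Integration.integral_cong simp: indicator_def)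
      finally show ?thesis by (simp only: integral_mult_right_zero)
    qed
    have "f y * ?W t * (\<Prod>s\<in>UNIV. P M ((x + t) $ s - y $ s)) = f y * (\<Prod>s\<in>UNIV. ?g s (t $ s))" for t
      unfolding of_real_rbox prod.distrib[symmetric] mult.assoc by (simp add: prod.distrib)
    then have "(\<integral>t. f y * ?W t * (\<Prod>s\<in>UNIV. P M ((x + t) $ s - y $ s)) \<partial>lborel) = f y * (\<integral>t. (\<Prod>s\<in>UNIV. ?g s ((t::real^'d) $ s)) \<partial>lborel)"
      by (simp only: integral_mult_right_zero)
    also have "(\<integral>t. (\<Prod>s\<in>UNIV. ?g s ((t::real^'d) $ s)) \<partial>lborel) = (\<Prod>s\<in>UNIV. of_real (1 / e) * box_avg M (x $ s) (x $ s + e) (y $ s))"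
      unfolding g[symmetric] by (rule tensor_integral[OF gi])
    finally show "(\<integral>t. f y * ?W t * (\<Prod>s\<in>UNIV. P M ((x + t) $ s - y $ s)) \<partial>lborel) = f y * (\<Prod>s\<in>UNIV. of_real (1 / e) * box_avg M (x $ s) (x $ s + e) (y $ s))" .
  qed
  finally show ?thesis .
qed

lemma box_avg_measurable [measurable]: "box_avg M a b \<in> borel_measurable borel"
  unfolding box_avg_def[abs_def] by measurable

text \<open>At a given point the box sums of a merely integrable function need not converge, but
  their averages do: \<open>box_avg\<close> is bounded by \<open>A1\<close> and converges off the
  two end points, so that |f| dominates up to a factor and only finitely many hyperplanes are
  excluded.\<close>

lemma averaged_part_sum_tendsto:
  fixes f :: "real^'d \<Rightarrow> complex"
  assumes f: "integrable lborel f" and ss: "distinct ss" "set ss = UNIV" and e: "e > 0"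
  shows "(\<lambda>M. \<integral>t. part_sum ss M f (x + t) * of_real (rbox e 0 t) \<partial>lborel) \<longlonglongrightarrow> (\<integral>y. f y * of_real (rbox e x y) \<partial>lborel)"
  unfolding averaged_part_sum[OF f ss e] unfolding of_real_rbox
proof (rule integral_dominated_convergence[where w="\<lambda>y. norm (f y) * (1 / e * A1) ^ CARD('d)"])
  have [measurable]: "f \<in> borel_measurable borel" using f by auto
  show "(\<lambda>y. f y * (\<Prod>s\<in>UNIV. complex_of_real (1 / e) * complex_of_real (indicator {x $ s..x $ s + e} (y $ s)))) \<in> borel_measurable lborel"
    unfolding of_real_rbox[symmetric] by measurable
  show "(\<lambda>y. f y * (\<Prod>s\<in>UNIV. complex_of_real (1 / e) * box_avg M (x $ s) (x $ s + e) (y $ s))) \<in> borel_measurable lborel" for M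
    by measurable
  show "integrable lborel (\<lambda>y. norm (f y) * (1 / e * A1) ^ CARD('d))" using f by simp
  have "AE y in lborel. \<forall>s. y $ s \<noteq> x $ s \<and> y $ s \<noteq> x $ s + e"
    unfolding AE_all_countable using AE_coord_neq by (auto intro: AE_conjI)
  then show "AE y in lborel. (\<lambda>M. f y * (\<Prod>s\<in>UNIV. complex_of_real (1 / e) * box_avg M (x $ s) (x $ s + e) (y $ s))) \<longlonglongrightarrow> f y * (\<Prod>s\<in>UNIV. complex_of_real (1 / e) * complex_of_real (indicator {x $ s..x $ s + e} (y $ s)))"
  proof eventually_elim
    case (elim y)
    show ?case
      using elim e by (intro tendsto_mult tendsto_const tendsto_prod box_avg_tendsto) auto
  qed
  show "AE y in lborel. norm (f y * (\<Prod>s\<in>UNIV. complex_of_real (1 / e) * box_avg M (x $ s) (x $ s + e) (y $ s))) \<le> norm (f y) * (1 / e * A1) ^ CARD('d)" for M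
  proof (rule AE_I2)
    fix y :: "real^'d"
    have "norm (\<Prod>s\<in>UNIV. complex_of_real (1 / e) * box_avg M (x $ s) (x $ s + e) (y $ s)) \<le> (\<Prod>s\<in>(UNIV::'d set). 1 / e * A1)"
      unfolding prod_norm[symmetric]
    proof (intro prod_mono conjI norm_ge_zero)
      fix s
      have "norm (complex_of_real (1 / e) * box_avg M (x $ s) (x $ s + e) (y $ s)) = 1 / e * norm (box_avg M (x $ s) (x $ s + e) (y $ s))"
        using e by (simp add: norm_mult norm_divide)
      also have "\<dots> \<le> 1 / e * A1" using e by (intro mult_left_mono box_avg_bound) auto
      finally show "norm (complex_of_real (1 / e) * box_avg M (x $ s) (x $ s + e) (y $ s)) \<le> 1 / e * A1" .
    qed
    then show "norm (f y * (\<Prod>s\<in>UNIV. complex_of_real (1 / e) * box_avg M (x $ s) (x $ s + e) (y $ s))) \<le> norm (f y) * (1 / e * A1) ^ CARD('d)"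
      unfolding norm_mult by (intro mult_left_mono) (simp_all del: mult_eq_0_iff)
  qed
qed

text \<open>Two limits, each by Fatou's lemma: the box sums grow while the averaging box is fixed,
  then the averaging box shrinks. Only the second uses continuity, at the rounded points
  alone.\<close>

lemma limit_bound:
  fixes f h :: "real^'d \<Rightarrow> complex"
  assumes f: "integrable lborel f" and ss: "distinct ss" "set ss = UNIV" and w: "1 \<le> w"
    and hc: "continuous_on unit_cube h" and AE: "AE x in cube_measure. h x = f x"
    and le: "\<And>M t. (\<integral>\<^sup>+x\<in>half_cube. ennreal (norm (difs k ss (\<lambda>x. part_sum ss M f (x + t)) x) powr w) \<partial>lborel) \<le> C"
  shows "(\<integral>\<^sup>+x\<in>half_cube. ennreal (norm (difs k ss h x) powr w) \<partial>lborel) \<le> C"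
proof -
  have [measurable]: "f \<in> borel_measurable borel" using f by auto
  define e where "e n = inverse (real (Suc n))" for n
  have e0: "e n > 0" for n by (simp add: e_def)
  have e_lim: "e \<longlonglongrightarrow> 0" unfolding e_def[abs_def] by (rule LIMSEQ_inverse_real_of_nat)
  define av where "av n x = (\<integral>y. f y * of_real (rbox (e n) x y) \<partial>lborel)" for n x
  have avm: "av n \<in> borel_measurable borel" for n unfolding av_def[abs_def] by measurable
  have av_le: "(\<integral>\<^sup>+x\<in>half_cube. ennreal (norm (difs k ss (av n) x) powr w) \<partial>lborel) \<le> C" for n
  proof (rule nn_integral_lim_le)
    define S where "S M x = (\<integral>t. part_sum ss M f (x + t) * of_real (rbox (e n) 0 t) \<partial>lborel)" for M x
    have pm[measurable]: "part_sum ss M f \<in> borel_measurable borel" for M by (rule part_sum_measurable[OF f])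
    have Sm: "S M \<in> borel_measurable borel" for M unfolding S_def[abs_def] by measurable
    have [measurable]: "difs k ss (S M) \<in> borel_measurable borel" for M by (rule difs_measurable[OF Sm])
    show "(\<lambda>x. ennreal (norm (difs k ss (S M) x) powr w) * indicator half_cube x) \<in> borel_measurable lborel" for M
      by measurable
    show "(\<integral>\<^sup>+x\<in>half_cube. ennreal (norm (difs k ss (S M) x) powr w) \<partial>lborel) \<le> C" for M
    proof -
      obtain B where B: "\<And>x. norm (part_sum ss M f x) \<le> B" using part_sum_bounded[OF f ss(1)] by blast
      show ?thesis unfolding S_def by (rule averaged_difs_le[where S="part_sum ss M f" and B=B, OF pm B w e0[of n] le])
    qed
    show "(\<lambda>M. ennreal (norm (difs k ss (S M) x) powr w) * indicator half_cube x) \<longlonglongrightarrow> ennreal (norm (difs k ss (av n) x) powr w) * indicator half_cube x" for x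
    proof (cases "x \<in> half_cube")
      case True
      have "(\<lambda>M. S M y) \<longlonglongrightarrow> av n y" for y
        unfolding S_def av_def by (rule averaged_part_sum_tendsto[OF f ss e0])
      then have "(\<lambda>M. difs k ss (S M) x) \<longlonglongrightarrow> difs k ss (av n) x"
        by (rule difs_tendsto[OF ss(1)])
      then have "(\<lambda>M. norm (difs k ss (S M) x) powr w) \<longlonglongrightarrow> norm (difs k ss (av n) x) powr w"
        using w by (intro tendsto_powr' tendsto_norm tendsto_const) auto
      then show ?thesis using True by (simp add: tendsto_ennrealI)
    qed simp
  qed
  have [measurable]: "difs k ss (av n) \<in> borel_measurable borel" for n by (rule difs_measurable[OF avm])
  show ?thesis
  proof (rule nn_integral_lim_le)
    show "(\<lambda>x. ennreal (norm (difs k ss (av n) x) powr w) * indicator half_cube x) \<in> borel_measurable lborel" for n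
      by measurable
    show "(\<integral>\<^sup>+x\<in>half_cube. ennreal (norm (difs k ss (av n) x) powr w) \<partial>lborel) \<le> C" for n by (rule av_le)
    show "(\<lambda>n. ennreal (norm (difs k ss (av n) x) powr w) * indicator half_cube x) \<longlonglongrightarrow> ennreal (norm (difs k ss h x) powr w) * indicator half_cube x" for x
    proof (cases "x \<in> half_cube")
      case True
      have "(\<lambda>n. difs k ss (av n) x) \<longlonglongrightarrow> difs k ss h x"
      proof (rule difs_tendsto[OF ss(1)])
        fix k' :: "'d \<Rightarrow> nat"
        define y where "y = (\<chi> i. dyad (k' i) (x $ i))"
        \<comment> \<open>The finest level used by \<open>k'\<close>. Every rounded coordinate keeps
          at least the length 2^-m of such a cell from the upper face, which serves as the common
          \<open>\<delta>\<close>.\<close>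
        define m where "m = Max (range k')"
        have km: "k' i \<le> m" for i unfolding m_def by (intro Max_ge) auto
        have "(\<lambda>n. av n y) \<longlonglongrightarrow> h y"
          unfolding av_def
        proof (rule rbox_average_tendsto[OF f hc AE _ _ _ e_lim e0, where \<delta>="1 / 2 ^ m"])
          fix i
          show "0 \<le> y $ i" using True by (simp add: y_def half_cube_def dyad_nonneg)
          have "(1::real) / 2 ^ m \<le> 1 / 2 ^ k' i" using km[of i] by (simp add: frac_le power_increasing)
          moreover have "dyad (k' i) (x $ i) + 1 / 2 ^ k' i \<le> 1" using True by (intro dyad_upper) (simp add: half_cube_def)
          ultimately show "y $ i + 1 / 2 ^ m \<le> 1" by (simp add: y_def)
        qed simp
        then show "(\<lambda>n. av n (\<chi> i. if i \<in> set ss then dyad (k' i) (x $ i) else x $ i)) \<longlonglongrightarrow> h (\<chi> i. if i \<in> set ss then dyad (k' i) (x $ i) else x $ i)"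
          using ss(2) by (simp add: y_def)
      qed
      then have "(\<lambda>n. norm (difs k ss (av n) x) powr w) \<longlonglongrightarrow> norm (difs k ss h x) powr w"
        using w by (intro tendsto_powr' tendsto_norm tendsto_const) auto
      then show ?thesis using True by (simp add: tendsto_ennrealI)
    qed simp
  qed
qed

end

section \<open>Recovery from sparse grid samples\<close>

lemma difs_diff: "difs k ss (\<lambda>y. h y - g y) = (\<lambda>x. difs k ss h x - difs k ss g x)"
proof (induction ss)
  case (Cons s ss)
  show ?case by (rule ext) (simp add: Cons dif_def)
qed simp

lemma difs_diff_bound:
  fixes h g :: "real^'d \<Rightarrow> complex"
  assumes u: "1 \<le> u" and c: "c \<ge> 0" and [measurable]: "h \<in> borel_measurable borel" "g \<in> borel_measurable borel"
    and h: "(\<integral>\<^sup>+x\<in>half_cube. ennreal (norm (difs k ss h x) powr u) \<partial>lborel) \<le> ennreal c"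
    and g: "(\<integral>\<^sup>+x\<in>half_cube. ennreal (norm (difs k ss g x) powr u) \<partial>lborel) \<le> ennreal c"
  shows "(\<integral>\<^sup>+x\<in>half_cube. ennreal (norm (difs k ss (\<lambda>y. h y - g y) x) powr u) \<partial>lborel) \<le> ennreal (2 powr u * c)"
proof -
  have [measurable]: "difs k ss h \<in> borel_measurable borel" "difs k ss g \<in> borel_measurable borel"
    by (intro difs_measurable; measurable)+
  let ?a = "\<lambda>x. ennreal (norm (difs k ss h x) powr u) * indicator half_cube x"
  let ?b = "\<lambda>x. ennreal (norm (difs k ss g x) powr u) * indicator half_cube x"
  have "(\<integral>\<^sup>+x\<in>half_cube. ennreal (norm (difs k ss (\<lambda>y. h y - g y) x) powr u) \<partial>lborel)
     \<le> (\<integral>\<^sup>+x. ennreal (2 powr (u - 1)) * (?a x + ?b x) \<partial>lborel)"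
  proof (intro nn_integral_mono)
    fix x :: "real^'d"
    have "norm (difs k ss h x - difs k ss g x) powr u \<le> (norm (difs k ss h x) + norm (difs k ss g x)) powr u"
      using u by (intro powr_mono2 norm_triangle_ineq4) auto
    also have "\<dots> \<le> 2 powr (u - 1) * (norm (difs k ss h x) powr u + norm (difs k ss g x) powr u)"
      using u by (intro powr_add_le) auto
    finally have "ennreal (norm (difs k ss h x - difs k ss g x) powr u)
        \<le> ennreal (2 powr (u - 1) * (norm (difs k ss h x) powr u + norm (difs k ss g x) powr u))"
      by (rule ennreal_leI)
    then show "ennreal (norm (difs k ss (\<lambda>y. h y - g y) x) powr u) * indicator half_cube x \<le> ennreal (2 powr (u - 1)) * (?a x + ?b x)"
      by (cases "x \<in> half_cube") (simp_all add: difs_diff ennreal_mult)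
  qed
  also have "\<dots> = ennreal (2 powr (u - 1)) * ((\<integral>\<^sup>+x. ?a x \<partial>lborel) + (\<integral>\<^sup>+x. ?b x \<partial>lborel))"
    by (subst nn_integral_cmult, measurable, subst nn_integral_add) auto
  also have "\<dots> \<le> ennreal (2 powr (u - 1)) * (ennreal c + ennreal c)"
    by (intro mult_left_mono add_mono h g) auto
  also have "\<dots> = ennreal (2 powr (u - 1) * (c + c))"
    using c by (simp only: ennreal_plus[symmetric] ennreal_mult[symmetric] powr_ge_zero add_nonneg_nonneg)
  also have "2 powr (u - 1) * (c + c) = 2 powr u * c" by (simp add: powr_diff)
  finally show ?thesis .
qed

lemma unit_cube_eq_cbox: "(unit_cube :: (real^'d) set) = cbox 0 1"
  by (auto simp: unit_cube_def mem_box_cart)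

lemma nn_integral_cube_measure:
  fixes F G :: "real^'d \<Rightarrow> ennreal"
  assumes "\<And>x. x \<in> half_cube \<Longrightarrow> F x = G x"
  shows "(\<integral>\<^sup>+x. F x \<partial>cube_measure) = (\<integral>\<^sup>+x\<in>half_cube. G x \<partial>lborel)"
proof -
  have "(\<integral>\<^sup>+x. F x \<partial>cube_measure) = (\<integral>\<^sup>+x\<in>unit_cube. F x \<partial>lborel)"
    unfolding cube_measure_def by (rule nn_integral_restrict_space) simp
  also have "\<dots> = (\<integral>\<^sup>+x\<in>half_cube. G x \<partial>lborel)"
  proof (rule nn_integral_cong_AE)
    have "AE x in lborel. \<forall>s. (x::real^'d) $ s \<noteq> 1"
      unfolding AE_all_countable using AE_coord_neq by auto
    then show "AE x in lborel. F x * indicator unit_cube x = G x * indicator half_cube x"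
    proof eventually_elim
      case (elim x)
      then have "x \<in> unit_cube \<longleftrightarrow> x \<in> half_cube" by (simp add: unit_cube_def half_cube_def less_le)
      then show ?case using assms by (simp add: indicator_def)
    qed
  qed
  finally show ?thesis .
qed

lemma Lp_norm_cube_le:
  fixes g h :: "real^'d \<Rightarrow> complex"
  assumes q: "q > 0" and eq: "\<And>x. x \<in> half_cube \<Longrightarrow> g x = h x" and B: "B \<ge> 0"
    and le: "(\<integral>\<^sup>+x\<in>half_cube. ennreal (norm (h x) powr q) \<partial>lborel) \<le> ennreal B"
  shows "Lp_norm cube_measure (ennreal q) g \<le> ennreal (B powr (1 / q))"
proof -
  let ?I = "\<integral>\<^sup>+x. ennreal (norm (g x) powr q) \<partial>cube_measure"
  have I: "?I \<le> ennreal B"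
    using le by (subst nn_integral_cube_measure[where G="\<lambda>x. ennreal (norm (h x) powr q)"]) (auto simp: eq)
  then obtain r where r: "?I = ennreal r" "0 \<le> r" by (cases ?I) (auto simp: top_unique)
  have "Lp_norm cube_measure (ennreal q) g = enn_powr ?I (1 / q)"
    unfolding Lp_norm_def Lp_enn_def using q by (simp add: enn_powr_ennreal)
  also have "\<dots> = ennreal (r powr (1 / q))" unfolding r(1) by (rule enn_powr_ennreal[OF r(2)])
  also have "\<dots> \<le> ennreal (B powr (1 / q))"
    using I q r B by (intro ennreal_leI powr_mono2) auto
  finally show ?thesis .
qed

text \<open>Needed for the admissibility of the recovery map, whose values are continuous functions
  on the compact cube.\<close>

lemma Lp_space_cube_continuous:
  fixes f :: "real^'d \<Rightarrow> complex"
  assumes q: "q > 0" and f: "continuous_on unit_cube f" "f \<in> borel_measurable cube_measure"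
  shows "f \<in> Lp_space cube_measure (ennreal q)"
proof -
  have "compact (f ` (unit_cube :: (real^'d) set))"
    using f(1) by (intro compact_continuous_image) (simp_all add: unit_cube_eq_cbox)
  then have "bounded (f ` (unit_cube :: (real^'d) set))" by (rule compact_imp_bounded)
  then obtain B where B: "\<And>x. x \<in> unit_cube \<Longrightarrow> norm (f x) \<le> B" by (auto simp: bounded_iff)
  have "bounded (half_cube :: (real^'d) set)"
    using half_cube_subset unfolding unit_cube_eq_cbox by (rule bounded_subset[OF bounded_cbox])
  then have "emeasure lborel (half_cube :: (real^'d) set) < \<infinity>" by (rule emeasure_bounded_finite)
  then obtain V where V: "emeasure lborel (half_cube :: (real^'d) set) = ennreal V" "V \<ge> 0"
    by (cases "emeasure lborel (half_cube :: (real^'d) set)") auto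
  have "(\<integral>\<^sup>+x\<in>half_cube. ennreal (norm (f x) powr q) \<partial>lborel) \<le> (\<integral>\<^sup>+x. ennreal (B powr q) * indicator (half_cube :: (real^'d) set) x \<partial>lborel)"
    using B half_cube_subset q by (intro nn_integral_mono) (auto simp: indicator_def intro!: ennreal_leI powr_mono2)
  also have "\<dots> = ennreal (B powr q * V)"
    using V by (simp add: nn_integral_cmult_indicator ennreal_mult)
  finally have "Lp_norm cube_measure (ennreal q) f \<le> ennreal ((B powr q * V) powr (1 / q))"
    using q V by (intro Lp_norm_cube_le[where h=f]) auto
  then have "Lp_norm cube_measure (ennreal q) f < \<infinity>" by (rule le_less_trans) simp
  then show ?thesis using f(2) by (simp add: Lp_space_def)
qed

text \<open>The width asks for exactly \<open>m\<close> distinct points, so the grid is padded with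
  arbitrary points of the cube, of which the diagonal already provides infinitely many.\<close>

lemma sampling_points:
  assumes "card (sparse_grid n :: (real^'d) set) \<le> m"
  obtains X where "length X = m" "distinct X" "set X \<subseteq> (unit_cube :: (real^'d) set)" "sparse_grid n \<subseteq> set X"
proof -
  let ?G = "sparse_grid n :: (real^'d) set"
  have "inj_on (\<lambda>t::real. (\<chi> i. t) :: real^'d) {0..1}" by (auto simp: inj_on_def vec_eq_iff)
  then have "infinite ((\<lambda>t::real. (\<chi> i. t) :: real^'d) ` {0..1})"
    by (simp add: finite_image_iff infinite_Icc)
  moreover have "(\<lambda>t::real. (\<chi> i. t) :: real^'d) ` {0..1} \<subseteq> unit_cube" by (auto simp: unit_cube_def)
  ultimately have "infinite (unit_cube :: (real^'d) set)" using infinite_super by blast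
  then have "infinite (unit_cube - ?G)" using sparse_grid_finite Diff_infinite_finite by blast
  then obtain R where R: "finite R" "card R = m - card ?G" "R \<subseteq> unit_cube - ?G"
    using infinite_arbitrarily_large by metis
  obtain X where X: "set X = ?G \<union> R" "distinct X"
    using finite_distinct_list[of "?G \<union> R"] R(1) sparse_grid_finite by auto
  have "length X = card (?G \<union> R)" using X distinct_card by metis
  also have "\<dots> = m" using R assms sparse_grid_finite by (subst card_Un_disjoint) auto
  finally show ?thesis using X R sparse_grid_subset by (intro that[of X]) auto
qed

text \<open>The level \<open>n\<close> is the largest one whose sparse grid has at most \<open>m\<close> points.\<close>

lemma sparse_grid_level_choice:
  fixes D m :: nat
  assumes m: "m \<ge> 2"
  obtains n where "(n + 1) ^ D * 2 ^ (n + 1) \<le> m"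
    "(real n + 1) ^ D / 2 ^ n \<le> 4 * (2 / (ln 2)\<^sup>2) ^ D * (ln (real m) ^ D)\<^sup>2 / real m"
proof -
  let ?P = "\<lambda>n. (n + 1) ^ D * 2 ^ (n + 1) \<le> m"
  have bd: "n \<le> m" if "?P n" for n
  proof -
    have "n \<le> 2 ^ (n + 1)" using less_exp[of "n + 1"] by simp
    also have "\<dots> \<le> (n + 1) ^ D * 2 ^ (n + 1)" by simp
    finally show ?thesis using that by linarith
  qed
  have P0: "?P 0" using m by simp
  define n where "n = Greatest ?P"
  have n: "?P n" unfolding n_def by (rule GreatestI_nat[of ?P, OF P0 bd])
  have "\<not> ?P (n + 1)"
  proof
    assume "?P (n + 1)"
    then have "n + 1 \<le> n" unfolding n_def by (rule Greatest_le_nat[of ?P]) (rule bd)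
    then show False by simp
  qed
  then have "m < (n + 2) ^ D * 2 ^ (n + 2)" by (simp add: not_le)
  then have "real m \<le> real ((n + 2) ^ D * 2 ^ (n + 2))" by linarith
  then have up: "real m \<le> 4 * (real n + 2) ^ D * 2 ^ n" by (simp add: algebra_simps)
  have "2 ^ (n + 1) \<le> (n + 1) ^ D * 2 ^ (n + 1)" by simp
  then have "2 ^ (n + 1) \<le> m" using n by linarith
  then have "real (2 ^ (n + 1)) \<le> real m" by linarith
  then have "ln ((2::real) ^ (n + 1)) \<le> ln (real m)" using m by (subst ln_le_cancel_iff) auto
  then have "(real n + 1) * ln 2 \<le> ln (real m)" by (subst (asm) ln_realpow) (simp_all add: add.commute)
  then have L: "real n + 1 \<le> ln (real m) / ln 2" by (simp add: field_simps)
  have lm: "ln (real m) > 0" using m by simp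
  \<comment> \<open>One factor of order n^D is that of the error, the other comes from bounding
    \<open>m\<close> by the maximality of \<open>n\<close>; both turn into powers of log m.\<close>
  have "real m * ((real n + 1) ^ D / 2 ^ n) \<le> 4 * (real n + 2) ^ D * 2 ^ n * ((real n + 1) ^ D / 2 ^ n)"
    by (intro mult_right_mono up) auto
  also have "\<dots> = 4 * ((real n + 2) ^ D * (real n + 1) ^ D)" by simp
  also have "\<dots> \<le> 4 * ((2 * (ln (real m) / ln 2)) ^ D * (ln (real m) / ln 2) ^ D)"
    using L by (intro mult_left_mono mult_mono power_mono) auto
  also have "\<dots> = 4 * (2 / (ln 2)\<^sup>2) ^ D * (ln (real m) ^ D)\<^sup>2"
    by (simp add: power_mult_distrib power_divide power_mult[symmetric] power2_eq_square mult.commute field_simps)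
  finally have "(real n + 1) ^ D / 2 ^ n \<le> 4 * (2 / (ln 2)\<^sup>2) ^ D * (ln (real m) ^ D)\<^sup>2 / real m"
    using m by (simp add: pos_le_divide_eq mult.commute)
  then show ?thesis using n that by blast
qed

text \<open>Both \<open>f\<close> and the chosen interpolant obey the bound on the differences, so
  their difference obeys it with the additional factor 2^u and vanishes on the grid. No linear
  structure of \<open>Y\<close> is involved.\<close>

lemma sampling_width_le:
  fixes Y :: "(real^'d \<Rightarrow> complex) set"
  assumes u: "1 \<le> u" "u < q" "q - u \<le> 1" "q \<le> 2 * u" and K: "K > 0" and ss: "distinct ss" "set ss = (UNIV :: 'd set)"
    and Yc: "\<And>f. f \<in> Y \<Longrightarrow> N f \<le> 1 \<Longrightarrow> continuous_on unit_cube f"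
    and Ym: "\<And>f. f \<in> Y \<Longrightarrow> N f \<le> 1 \<Longrightarrow> f \<in> borel_measurable cube_measure"
    and D: "\<And>f k. f \<in> Y \<Longrightarrow> N f \<le> 1 \<Longrightarrow>
      (\<integral>\<^sup>+x\<in>half_cube. ennreal (norm (difs k ss (\<lambda>y. if y \<in> unit_cube then f y else 0) x) powr u) \<partial>lborel)
        \<le> ennreal (K / 2 ^ (\<Sum>s\<in>UNIV. k s))"
  shows "\<exists>C>0. \<forall>m\<ge>2. sampling_width Y N (ennreal q) m
    \<le> ennreal (C * real m powr (- 1 / q) * (ln (real m) ^ (CARD('d) - 1)) powr (2 / q))"
proof -
  let ?D = "CARD('d) - 1"
  define K' where "K' = 2 powr u * K"
  have K': "K' > 0" using K by (simp add: K'_def)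
  have q: "q > 0" using u by simp
  define c where "c = CT CARD('d) u q K' * Ctail ?D * (4 * (2 / (ln 2)\<^sup>2) ^ ?D)"
  have c: "c > 0" using CT_pos[OF K' u(1,2), of "CARD('d)"] Ctail_pos[of ?D] by (simp add: c_def)
  \<comment> \<open>Members of \<open>Y\<close> are measurable on the cube only; cut off by 0 they
    become Borel functions on the whole space, to which \<open>difs\<close> can be applied.\<close>
  let ?t = "\<lambda>f y. if y \<in> unit_cube then f y else (0::complex)"
  have "sampling_width Y N (ennreal q) m \<le> ennreal (c powr (1 / q) * real m powr (- 1 / q) * (ln (real m) ^ ?D) powr (2 / q))"
    if m: "m \<ge> 2" for m
  proof -
    obtain n where n: "(n + 1) ^ ?D * 2 ^ (n + 1) \<le> m"
      "(real n + 1) ^ ?D / 2 ^ n \<le> 4 * (2 / (ln 2)\<^sup>2) ^ ?D * (ln (real m) ^ ?D)\<^sup>2 / real m"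
      using sparse_grid_level_choice[OF m] by blast
    have "card (sparse_grid n :: (real^'d) set) \<le> m" using sparse_grid_card n(1) by (rule order_trans)
    then obtain X :: "(real^'d) list" where X: "length X = m" "distinct X" "set X \<subseteq> unit_cube" "sparse_grid n \<subseteq> set X"
      by (rule sampling_points)
    let ?S = "\<lambda>v f. f \<in> Y \<and> N f \<le> 1 \<and> map f X = v"
    \<comment> \<open>For data that no function of the unit ball attains, the value 0 keeps
      \<open>\<psi>\<close> inside L_q.\<close>
    define \<psi> where "\<psi> v = (if \<exists>f. ?S v f then SOME f. ?S v f else (\<lambda>_. 0))" for v
    have \<psi>: "?S (map f X) (\<psi> (map f X))" if "f \<in> Y" "N f \<le> 1" for f
    proof -
      have ex: "\<exists>g. ?S (map f X) g" using that by blast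
      show ?thesis unfolding \<psi>_def if_P[OF ex] by (rule someI_ex[OF ex])
    qed
    have "\<psi> v \<in> Lp_space cube_measure (ennreal q)" for v
    proof (cases "\<exists>f. ?S v f")
      case True
      have "?S v (\<psi> v)" unfolding \<psi>_def if_P[OF True] by (rule someI_ex[OF True])
      then show ?thesis using q Yc Ym by (intro Lp_space_cube_continuous) auto
    next
      case False
      then show ?thesis unfolding \<psi>_def using q by (simp only: if_False) (intro Lp_space_cube_continuous; simp)
    qed
    then have adm: "(X, \<psi>) \<in> {(X :: (real^'d) list, \<psi> :: complex list \<Rightarrow> real^'d \<Rightarrow> complex).
           length X = m \<and> distinct X \<and> set X \<subseteq> unit_cube \<and>
           (\<forall>v. length v = m \<longrightarrow> \<psi> v \<in> Lp_space cube_measure (ennreal q))}"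
      using X by simp
    have err: "Lp_norm cube_measure (ennreal q) (\<lambda>x. f x - \<psi> (map f X) x)
      \<le> ennreal (c powr (1 / q) * real m powr (- 1 / q) * (ln (real m) ^ ?D) powr (2 / q))" if f: "f \<in> Y" "N f \<le> 1" for f
    proof -
      let ?g = "\<psi> (map f X)"
      have g: "?g \<in> Y" "N ?g \<le> 1" "map ?g X = map f X" using \<psi>[OF f] by auto
      have tm: "?t h \<in> borel_measurable borel" if "h \<in> Y" "N h \<le> 1" for h
      proof -
        have "(\<lambda>x. if x \<in> unit_cube then h x else 0) \<in> borel_measurable lborel"
          using Ym[OF that] unfolding cube_measure_def by (subst (asm) measurable_restrict_space_iff) auto
        then show ?thesis by simp
      qed
      define h where "h y = ?t f y - ?t ?g y" for y
      have "(\<integral>\<^sup>+x\<in>half_cube. ennreal (norm (h x) powr q) \<partial>lborel)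
        \<le> ennreal (CT CARD('d) u q K' * Ctail ?D * (real n + 1) ^ ?D / 2 ^ n)"
      proof (rule sampling_error[OF u K' ss])
        show "h \<in> borel_measurable borel" unfolding h_def[abs_def] using tm[OF f] tm[OF g(1,2)] by simp
        have "continuous_on unit_cube (\<lambda>y. f y - ?g y)" by (intro continuous_on_diff Yc f g)
        then show "continuous_on unit_cube h" by (rule continuous_on_cong[THEN iffD1, rotated 2]) (auto simp: h_def)
        show "h x = 0" if "x \<in> sparse_grid n" for x
        proof -
          have "x \<in> set X" using that X(4) by blast
          then have "?g x = f x" using g(3) by simp
          then show ?thesis by (simp add: h_def)
        qed
        show "(\<integral>\<^sup>+x\<in>half_cube. ennreal (norm (difs k ss h x) powr u) \<partial>lborel) \<le> ennreal (K' / 2 ^ (\<Sum>s\<in>UNIV. k s))" for k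
          unfolding h_def[abs_def] K'_def times_divide_eq_right[symmetric]
          by (rule difs_diff_bound[OF u(1) _ tm[OF f] tm[OF g(1,2)] D[OF f] D[OF g(1,2)]]) (use K in simp)
      qed
      also have "\<dots> \<le> ennreal (c * (ln (real m) ^ ?D)\<^sup>2 / real m)"
      proof (rule ennreal_leI)
        have "CT CARD('d) u q K' * Ctail ?D * ((real n + 1) ^ ?D / 2 ^ n)
          \<le> CT CARD('d) u q K' * Ctail ?D * (4 * (2 / (ln 2)\<^sup>2) ^ ?D * (ln (real m) ^ ?D)\<^sup>2 / real m)"
          using CT_pos[OF K' u(1,2), of "CARD('d)"] Ctail_pos[of ?D] by (intro mult_left_mono n(2)) (simp add: less_imp_le)
        then show "CT CARD('d) u q K' * Ctail ?D * (real n + 1) ^ ?D / 2 ^ n \<le> c * (ln (real m) ^ ?D)\<^sup>2 / real m"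
          by (simp add: c_def mult.assoc)
      qed
      finally have "Lp_norm cube_measure (ennreal q) (\<lambda>x. f x - ?g x) \<le> ennreal ((c * (ln (real m) ^ ?D)\<^sup>2 / real m) powr (1 / q))"
        using q c half_cube_subset by (intro Lp_norm_cube_le[where h=h]) (auto simp: h_def)
      also have "(c * (ln (real m) ^ ?D)\<^sup>2 / real m) powr (1 / q) = c powr (1 / q) * real m powr (- 1 / q) * (ln (real m) ^ ?D) powr (2 / q)"
      proof -
        define l where "l = ln (real m) ^ ?D"
        have l: "l > 0" using m by (simp add: l_def)
        have "(l\<^sup>2) powr (1 / q) = l powr (2 / q)" using l by (simp add: powr_powr flip: powr_numeral)
        then show ?thesis unfolding l_def[symmetric] using c l m
          by (simp add: powr_mult powr_divide powr_minus_divide)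
      qed
      finally show ?thesis .
    qed
    show ?thesis unfolding sampling_width_def
    proof (rule INF_lower2[OF adm])
      show "(case (X, \<psi>) of (X, \<psi>) \<Rightarrow> SUP f\<in>{f \<in> Y. N f \<le> 1}. Lp_norm cube_measure (ennreal q) (\<lambda>x. f x - \<psi> (map f X) x))
        \<le> ennreal (c powr (1 / q) * real m powr (- 1 / q) * (ln (real m) ^ ?D) powr (2 / q))"
        unfolding prod.case by (rule SUP_least) (use err in auto)
    qed
  qed
  moreover have "c powr (1 / q) > 0" using c by simp
  ultimately show ?thesis by blast
qed

text \<open>The infimum over the extensions need not be attained, hence the bound 2 in place of
  1.\<close>

lemma cube_norm_extension:
  assumes "f \<in> cont_cube_space N" "cube_norm N f \<le> 1"
  obtains g where "integrable lborel g" "N g \<le> ennreal 2" "AE x in cube_measure. f x = g x"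
proof -
  have "cube_norm N f < 2" using assms(2) by (rule le_less_trans) simp
  then obtain g where "g \<in> extensions N f" "N g < 2" unfolding cube_norm_def by (auto simp: INF_less_iff)
  then show ?thesis by (intro that[of g]) (auto simp: extensions_def space_of_norm_def less_imp_le)
qed

text \<open>Common end of both cases: a bound with exponent \<open>w\<close> for the box sums of an
  extension passes to the continuous function on the cube by \<open>limit_bound\<close> and is
  raised to the exponent \<open>u\<close> by cell-constancy. The \<open>B\<close>-case has w = p,
  the \<open>F\<close>-case w = u.\<close>

lemma (in dyadic) sampling_width_cube_space:
  fixes N :: "(real^'d \<Rightarrow> complex) \<Rightarrow> ennreal"
  assumes u: "1 \<le> u" "u < q" "q - u \<le> 1" "q \<le> 2 * u" and w: "1 \<le> w" "w \<le> u" and ss: "distinct ss" "set ss = (UNIV :: 'd set)"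
    and c: "c > 0"
    and key: "\<And>g k M t. integrable lborel g \<Longrightarrow> N g \<le> ennreal 2 \<Longrightarrow>
      (\<integral>\<^sup>+x\<in>half_cube. ennreal (norm (difs k ss (\<lambda>x. part_sum ss M g (x + t)) x) powr w) \<partial>lborel)
        \<le> ennreal (c powr w / 2 ^ (\<Sum>s\<in>UNIV. k s))"
  shows "\<exists>C>0. \<forall>m\<ge>2. sampling_width (cont_cube_space N) (cube_norm N) (ennreal q) m
    \<le> ennreal (C * real m powr (- 1 / q) * (ln (real m) ^ (CARD('d) - 1)) powr (2 / q))"
proof (rule sampling_width_le[OF u _ ss])
  show "c powr u > 0" using c by simp
  fix f assume f: "f \<in> cont_cube_space N" "cube_norm N f \<le> 1"
  show fc: "continuous_on unit_cube f" using f by (simp add: cont_cube_space_def)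
  show fm: "f \<in> borel_measurable cube_measure" using f by (auto simp: cont_cube_space_def cube_space_def)
  fix k
  let ?h = "\<lambda>y. if y \<in> unit_cube then f y else 0"
  have "?h \<in> borel_measurable lborel"
    using fm unfolding cube_measure_def by (subst (asm) measurable_restrict_space_iff) auto
  then have hm: "?h \<in> borel_measurable borel" by simp
  obtain g where g: "integrable lborel g" "N g \<le> ennreal 2" "AE x in cube_measure. f x = g x"
    using cube_norm_extension[OF f] by blast
  have hc: "continuous_on unit_cube ?h" using fc by (rule continuous_on_cong[THEN iffD1, rotated 2]) auto
  have "AE x in cube_measure. ?h x = g x"
    using g(3) AE_space by eventually_elim (auto simp: cube_measure_def space_restrict_space)
  then have "(\<integral>\<^sup>+x\<in>half_cube. ennreal (norm (difs k ss ?h x) powr w) \<partial>lborel) \<le> ennreal (c powr w / 2 ^ (\<Sum>s\<in>UNIV. k s))"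
    by (rule limit_bound[OF g(1) ss w(1) hc]) (rule key[OF g(1,2)])
  then show "(\<integral>\<^sup>+x\<in>half_cube. ennreal (norm (difs k ss ?h x) powr u) \<partial>lborel) \<le> ennreal (c powr u / 2 ^ (\<Sum>s\<in>UNIV. k s))"
    using c ss by (intro cell_const_exponent_mono[OF ss difs_measurable[OF hm] _ w]) (auto intro: cell_const_difs)
qed

theorem theorem6p5:
  fixes \<phi> :: "nat \<Rightarrow> real \<Rightarrow> complex" and p q :: real
  assumes "dyadic_system \<phi>" and "1 \<le> p" and "p < q"
  shows "let B = (SB_norm \<phi> (1 / p) (ennreal p) 1 :: (real^'d \<Rightarrow> complex) \<Rightarrow> ennreal);
             F = (SF_norm \<phi> 1 1 \<infinity> :: (real^'d \<Rightarrow> complex) \<Rightarrow> ennreal)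
    in \<exists>C>0. \<forall>m\<ge>2.
      sampling_width (cont_cube_space B) (cube_norm B) (ennreal q) m
        \<le> ennreal (C * real m powr (- 1 / q) * (ln (real m) ^ (CARD('d) - 1)) powr (2 / q)) \<and>
      sampling_width (cont_cube_space F) (cube_norm F) (ennreal q) m
        \<le> ennreal (C * real m powr (- 1 / q) * (ln (real m) ^ (CARD('d) - 1)) powr (2 / q))"
proof -
  interpret dyadic \<phi> by unfold_locales (rule assms(1))
  let ?B = "SB_norm \<phi> (1 / p) (ennreal p) 1 :: (real^'d \<Rightarrow> complex) \<Rightarrow> ennreal"
  let ?F = "SF_norm \<phi> 1 1 \<infinity> :: (real^'d \<Rightarrow> complex) \<Rightarrow> ennreal"
  let ?bd = "\<lambda>C m. ennreal (C * real m powr (- 1 / q) * (ln (real m) ^ (CARD('d) - 1)) powr (2 / q))"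
  obtain ss where ss: "distinct ss" "set ss = (UNIV :: 'd set)" using finite_distinct_list[of "UNIV :: 'd set"] by auto
  \<comment> \<open>The term (1 + q)/2 ensures both u > 1, for the Jawerth argument, and q \<le> 2u;
    \<open>p\<close> allows the exponent to be raised from \<open>p\<close> to \<open>u\<close>; q -
    1 is for the subadditivity of the power q - u. All three are below \<open>q\<close>.\<close>
  define u where "u = max (max p (q - 1)) ((1 + q) / 2)"
  have "p \<le> u" "q - 1 \<le> u" "(1 + q) / 2 \<le> u" "u < q" using assms by (auto simp: u_def)
  then have u: "1 < u" "p \<le> u" "u < q" "q - u \<le> 1" "q \<le> 2 * u" using assms by auto
  have "\<exists>C>0. \<forall>m\<ge>2. sampling_width (cont_cube_space ?B) (cube_norm ?B) (ennreal q) m \<le> ?bd C m"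
    using key_B[OF ss assms(2), where c=2] Cs_pos[of p] assms u
    by (intro sampling_width_cube_space[OF _ u(3-5) assms(2) u(2) ss, where c="(Cs p powr (1 / p)) ^ CARD('d) * 2"]) auto
  then obtain C1 where C1: "C1 > 0" "\<And>m. m \<ge> 2 \<Longrightarrow> sampling_width (cont_cube_space ?B) (cube_norm ?B) (ennreal q) m \<le> ?bd C1 m"
    by blast
  have "\<exists>C>0. \<forall>m\<ge>2. sampling_width (cont_cube_space ?F) (cube_norm ?F) (ennreal q) m \<le> ?bd C m"
    using key_F[OF ss u(1), where c=2] Cs_pos[of u] CJ_pos[OF A_pos u(1)] u
    by (intro sampling_width_cube_space[OF _ u(3-5) _ order_refl ss, where c="(Cs u powr (1 / u) * CJ A1 u) ^ CARD('d) * 2"]) auto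
  then obtain C2 where C2: "C2 > 0" "\<And>m. m \<ge> 2 \<Longrightarrow> sampling_width (cont_cube_space ?F) (cube_norm ?F) (ennreal q) m \<le> ?bd C2 m"
    by blast
  have mono: "?bd a m \<le> ?bd (max C1 C2) m" if "a \<le> max C1 C2" for a m
    using that by (intro ennreal_leI mult_right_mono) auto
  have "sampling_width (cont_cube_space ?B) (cube_norm ?B) (ennreal q) m \<le> ?bd (max C1 C2) m \<and>
    sampling_width (cont_cube_space ?F) (cube_norm ?F) (ennreal q) m \<le> ?bd (max C1 C2) m" if "m \<ge> 2" for m
    using order_trans[OF C1(2)[OF that] mono] order_trans[OF C2(2)[OF that] mono] by simp
  then show ?thesis unfolding Let_def using C1(1) by (intro exI[of _ "max C1 C2"]) auto
qed

end
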